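(* Let $\mathcal K$ be an augmented virtual double category. Choose, for each horizontal morphism $j\colon A\nrightarrow B$ in $(Q\circ V)_*(\mathcal K)$, corresponding to a vertical morphism $j\colon A\to B$ of $\mathcal K$ that admits a companion, a cartesian cell $\varepsilon_j\colon j_*\Rightarrow (B)$ in $\mathcal K$, with vertical source $j$ and vertical target $\mathrm{id}_B$, that defines the companion of $j$. This choice induces an equivalence $(-)_*\colon (Q\circ V)_*(\mathcal K)\xrightarrow{\simeq}\mathrm{Rep}(\mathcal K)$ of augmented virtual double categories as follows. The functor $(-)_*$ restricts to the identity on objects and vertical morphisms, maps each horizontal morphism $j\colon A\nrightarrow B$ to its chosen companion $j_*$, and maps a cell $\phi$ of $(Q\circ V)_*(\mathcal K)$ with horizontal source $(j_1,\dots,j_n)$, vertical source $f\colon A_0\to C$ and vertical target $g\colon A_n\to D$ (that is, a vertical cell $\phi\colon \underline k\circ f\Rightarrow g\circ j_n\circ\dots\circ j_1$ of $\mathcal K$, where $\underline k=k$ if $\phi$ is unary with horizontal target $k\colon C\nrightarrow D$, and $\underline k=\mathrm{id}_C$ if $\phi$ is nullary) to the unique cell $\phi_*$ of $\mathcal K$, with horizontal source $(j_{1*},\dots,j_{n*})$, horizontal target $k_*$ (resp. $(C)$), and vertical source $f$ and target $g$, such that $$\phi\odot(g\circ j_n\circ\dots\circ j_2\circ\varepsilon_{j_1})\odot\dots\odot(g\circ\varepsilon_{j_n})=\underline{\varepsilon_k}\circ\phi_*,$$ where $\underline{\varepsilon_k}=\varepsilon_k$ if $\phi$ is unary and $\underline{\varepsilon_k}=\mathrm{id}_C$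 otherwise. Letting $\mathcal K$ vary, the functors $(-)_*$ combine to form a pseudonatural transformation $(-)_*\colon (Q\circ V)_*\Rightarrow\mathrm{Rep}$ of strict 2-endofunctors on $\mathrm{AugVirtDblCat}$. Analogously (horizontally dually), choosing cartesian cells $j^*\Rightarrow(B)$ in $\mathcal K$ that define the conjoints of the vertical morphisms $j\colon A\to B$ admitting conjoints induces an equivalence $(\mathrm{co}Q\circ V)^*(\mathcal K)\simeq\mathrm{opRep}(\mathcal K)$, whose underlying functors $(-)^*$ (for varying $\mathcal K$) combine to form a pseudonatural transformation $(-)^*\colon(\mathrm{co}Q\circ V)^*\Rightarrow\mathrm{opRep}$.
   Context: **Augmented virtual double categories.** An augmented virtual double category $\mathcal K$ consists of: a class of objects; a category $\mathcal K_{\mathrm v}$ with these objects, whose morphisms $f\colon A\to C$ are called vertical; a directed graph $\mathcal K_{\mathrm h}$ with these objects as vertices, whose edges $J\colon A\nrightarrow B$ are called horizontal morphisms; and a class of cells. Each cell $\phi$ has a horizontal source, which is a (possibly empty) path $\underline J=(J_1,\dots,J_n)\colon A_0\nrightarrow A_n$ of horizontal morphisms; a horizontal target, which is a path $\underline K\colon C\nrightarrow D$ of length $|\underline K|\le 1$; a vertical source $f\colon A_0\to C$; and a vertical target $g\colon A_n\to D$. We write $\phi\colon\underline J\Rightarrow\underline K$. The empty path at $A$ is written $(A)$ (so $\underline K=(C)$ forces $C=D$), and $\frown$ denotes concatenation of paths. For each $n\ge 1$, each path of cells $\phi_i\colon\underline J_i\Rightarrow\underline K_i$ ($1\le i\le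 n$) with vertical source $f_{i-1}$ and vertical target $f_i$, and each cell $\psi\colon\underline K_1\frown\dots\frown\underline K_n\Rightarrow\underline L$ with vertical source $h$ and target $k$, there is a vertical composite $\psi\circ(\phi_1,\dots,\phi_n)\colon\underline J_1\frown\dots\frown\underline J_n\Rightarrow\underline L$ with vertical source $h\circ f_0$ and target $k\circ f_n$. There are horizontal identity cells $\mathrm{id}_J\colon J\Rightarrow J$ (with identities as vertical source and target) and vertical identity cells $\mathrm{id}_f\colon (A)\Rightarrow(C)$ for $f\colon A\to C$ (with vertical source and target $f$), with $\mathrm{id}_h\circ(\mathrm{id}_f)=\mathrm{id}_{h\circ f}$; write $\mathrm{id}_A:=\mathrm{id}_{\mathrm{id}_A}$. Axioms, whenever they make sense (for associativity: whenever both sides make sense): $\chi\circ(\psi_1\circ(\phi_{11},\dots,\phi_{1m_1}),\dots,\psi_n\circ(\phi_{n1},\dots,\phi_{nm_n}))=(\chi\circ(\psi_1,\dots,\psi_n))\circ(\phi_{11},\dots,\phi_{nm_n})$; $\mathrm{id}_C\circ(\phi)=\phi$; $\mathrm{id}_K\circ(\phi)=\phi$; $\phi\circ(\mathrm{id}_A)=\phi$; $\phi\circ(\mathrm{id}_{J_1},\dots,\mathrm{id}_{J_n})=\phi$; and $\psi\circ(\phi_1,\dots,\phi_i,\mathrm{id}_{f_i},\phi_{i+1},\dots,\phi_n)=\psi\circ(\phi_1,\dots,\phi_n)$ for $0\le i\le n$. A cell is unary (resp. nullary) if its horizontal target has length 1 (resp. 0), vertical if both its horizontal source and target are empty, and horizontal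 if its vertical source and target are identities. Whiskering: $h\circ(\phi_1,\dots,\phi_n):=\mathrm{id}_h\circ(\phi_1,\dots,\phi_n)$ and $\psi\circ f:=\psi\circ(\mathrm{id}_f)$. Horizontal composition: if $\phi\colon\underline J\Rightarrow\underline K$ and $\psi\colon\underline H\Rightarrow\underline L$ are such that the vertical target of $\phi$ is the vertical source of $\psi$ and $|\underline K|+|\underline L|\le1$, then $\phi\odot\psi:=\mathrm{id}_{\underline K\frown\underline L}\circ(\phi,\psi)\colon\underline J\frown\underline H\Rightarrow\underline K\frown\underline L$, where $\mathrm{id}_{\underline K\frown\underline L}$ is the identity cell of the single horizontal morphism in $\underline K\frown\underline L$, or $\mathrm{id}_C$ if $\underline K\frown\underline L=(C)$; $\odot$ is associative. **Functors and transformations.** A functor $F\colon\mathcal K\to\mathcal L$ consists of a functor $F\colon\mathcal K_{\mathrm v}\to\mathcal L_{\mathrm v}$ and assignments sending $J\colon A\nrightarrow B$ to $FJ\colon FA\nrightarrow FB$ and each cell $\phi\colon(J_1,\dots,J_n)\Rightarrow\underline K$ with vertical source $f$ and target $g$ to a cell $F\phi\colon(FJ_1,\dots,FJ_n)\Rightarrow F\underline K$ with vertical source $Ff$ and target $Fg$, strictly preserving vertical composition and identity cells. A transformation $\xi\colon F\Rightarrow G$ consists of a natural transformation $\xi\colon F_{\mathrm v}\Rightarrow G_{\mathrm v}$ and, for each $J\colon A\nrightarrow B$, a cell $\xi_J\colon FJ\Rightarrow GJ$ with vertical source $\xi_A$ and target $\xi_B$, such that $G\phi\circ\xi_{\underline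 J}=\xi_{\underline K}\circ F\phi$ for all $\phi\colon\underline J\Rightarrow\underline K$, where $\xi_{\underline J}=(\xi_{J_1},\dots,\xi_{J_n})$ for non-empty paths and $\xi_{(A)}=\mathrm{id}_{\xi_A}$. These form a 2-category $\mathrm{AugVirtDblCat}$; equivalences are internal to it. **Cartesian cells, companions, conjoints.** A cell $\psi\colon\underline J\Rightarrow\underline K$ with $|\underline J|\le1$, $\underline J\colon A\nrightarrow B$, vertical source $f\colon A\to C$ and target $g\colon B\to D$, is cartesian if every cell $\chi\colon\underline H\Rightarrow\underline K$, with $\underline H\colon X_0\nrightarrow X_n$ and with vertical source $f\circ h$ and target $g\circ k$ (for any $h\colon X_0\to A$, $k\colon X_n\to B$), factors as $\chi=\psi\circ\phi$ for a unique $\phi\colon\underline H\Rightarrow\underline J$ with vertical source $h$ and target $k$. The companion of $j\colon A\to B$ is a horizontal morphism $j_*\colon A\nrightarrow B$ with a cartesian cell $j_*\Rightarrow(B)$ with vertical source $j$ and target $\mathrm{id}_B$. The conjoint of $j$ is a horizontal morphism $j^*\colon B\nrightarrow A$ with a cartesian cell $j^*\Rightarrow(B)$ with vertical source $\mathrm{id}_B$ and target $j$. **$\mathrm{Rep}$ and $\mathrm{opRep}$.** $J\colon A\nrightarrow B$ is representable if it is the companion of some $j\colon A\to B$, and oprepresentable if it is the conjoint of some $g\colon B\to A$. $\mathrm{Rep}(\mathcal K)\subseteq\mathcal K$ (resp. $\mathrm{opRep}(\mathcal K)$) consists of all objects, all vertical morphisms, only the representable (resp. oprepresentable) horizontal morphisms,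 and all cells between them. Since functors preserve companions and conjoints, these are strict 2-endofunctors on $\mathrm{AugVirtDblCat}$. **$V$, $Q$, $\mathrm{co}Q$.** $V(\mathcal K)$ is the 2-category of objects, vertical morphisms and vertical cells of $\mathcal K$ (a vertical cell with vertical source $f$ and target $g$ being a 2-cell $f\Rightarrow g$; composition of 2-cells along 1-cells is $\odot$). For a 2-category $\mathcal C$, the augmented virtual double category $Q(\mathcal C)$ of quintets has the objects of $\mathcal C$, and the morphisms of $\mathcal C$ both as vertical and as horizontal morphisms. A unary cell $(j_1,\dots,j_n)\Rightarrow k$ with vertical source $f\colon A_0\to C$ and target $g\colon A_n\to D$ is a 2-cell $k\circ f\Rightarrow g\circ j_n\circ\dots\circ j_1$ of $\mathcal C$; nullary cells are such 2-cells with $k=\mathrm{id}_C$; composition and identities are given by pasting in $\mathcal C$. The horizontal dual $\mathrm{co}\mathcal K$ of an augmented virtual double category $\mathcal K$ has the same objects and vertical morphisms, a horizontal morphism $\mathrm{co}J\colon A\nrightarrow B$ for each $J\colon B\nrightarrow A$, and a cell $\mathrm{co}\phi\colon(\mathrm{co}J_1,\dots,\mathrm{co}J_n)\Rightarrow\mathrm{co}\underline K$ with vertical source $f$ and target $g$ for each $\phi\colon(J_n,\dots,J_1)\Rightarrow\underline K$ with vertical source $g$ and target $f$, and $\mathrm{co}\psi\circ(\mathrm{co}\phi_1,\dots,\mathrm{co}\phi_n)=\mathrm{co}(\psi\circ(\phi_n,\dots,\phi_1))$. For a 2-category $\mathcal C$, $\mathrm{co}\mathcal C$ is obtained by reversing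 2-cells, and $\mathrm{co}Q(\mathcal C):=\mathrm{co}(Q(\mathrm{co}\mathcal C))$; thus each $j\colon A\to B$ in $\mathcal C$ gives a horizontal morphism $\mathrm{co}j\colon B\nrightarrow A$. $Q$, $\mathrm{co}Q$ and $V$ are strict 2-functors between $\mathrm{AugVirtDblCat}$ and the 2-category of 2-categories, strict 2-functors and 2-natural transformations. **$(Q\circ V)_*$ and $(\mathrm{co}Q\circ V)^*$.** $(Q\circ V)_*(\mathcal K)\subseteq(Q\circ V)(\mathcal K)$ consists of all objects and vertical morphisms, those horizontal morphisms $j\colon A\nrightarrow B$ whose corresponding $j\colon A\to B$ admits a companion in $\mathcal K$, and all quintets between them. $(\mathrm{co}Q\circ V)^*(\mathcal K)\subseteq(\mathrm{co}Q\circ V)(\mathcal K)$ is defined likewise with the horizontal morphisms $\mathrm{co}j\colon B\nrightarrow A$ for which $j\colon A\to B$ admits a conjoint in $\mathcal K$. These are strict sub-2-endofunctors of $Q\circ V$ and $\mathrm{co}Q\circ V$. The functor $(-)^*$ is the horizontal dual $\mathrm{co}(-)\circ(-)_*\circ\mathrm{co}(-)$ of $(-)_*$, using that conjoints in $\mathcal K$ are companions in $\mathrm{co}\mathcal K$; it is the identity on objects and vertical morphisms and maps $\mathrm{co}j$ to the chosen conjoint $j^*$. *)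

theory Defs
  imports Main "HOL-Library.FuncSet"
begin

section \<open>Augmented virtual double categories\<close>

text \<open>
  All composites are written in function order: \<open>vcomp K g f\<close> is \<open>g \<circ> f\<close> and \<open>ccomp K \<psi> \<phi>s\<close>
  is \<open>\<psi> \<circ> (\<phi>\<^sub>1, \<dots>, \<phi>\<^sub>n)\<close>.  Horizontal paths are lists.  The end points of the horizontal source
  of a cell are the domains of its vertical source and target, those of its horizontal target
  their codomains; in this way an empty list stands for the empty path \<open>(A)\<close> at a determined
  object \<open>A\<close>.  The operations are only meaningful on the carriers.
\<close>

record 'u avdc =
  Ob :: "'u set"
  Ver :: "'u set"
  vdom :: "'u \<Rightarrow> 'u"
  vcod :: "'u \<Rightarrow> 'u"
  vid :: "'u \<Rightarrow> 'u"
  vcomp :: "'u \<Rightarrow> 'u \<Rightarrow> 'u"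
  Hor :: "'u set"
  hdom :: "'u \<Rightarrow> 'u"
  hcod :: "'u \<Rightarrow> 'u"
  Cell :: "'u set"
  hsrc :: "'u \<Rightarrow> 'u list"
  htgt :: "'u \<Rightarrow> 'u list"
  vsrc :: "'u \<Rightarrow> 'u"
  vtgt :: "'u \<Rightarrow> 'u"
  ccomp :: "'u \<Rightarrow> 'u list \<Rightarrow> 'u"
  hidc :: "'u \<Rightarrow> 'u"
  vidc :: "'u \<Rightarrow> 'u"

primrec hpath :: "'u avdc \<Rightarrow> 'u \<Rightarrow> 'u list \<Rightarrow> 'u \<Rightarrow> bool" where
  "hpath K A [] B \<longleftrightarrow> A \<in> Ob K \<and> A = B"
| "hpath K A (J # Js) B \<longleftrightarrow> J \<in> Hor K \<and> hdom K J = A \<and> hpath K (hcod K J) Js B"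

primrec cpath :: "'u avdc \<Rightarrow> 'u \<Rightarrow> 'u list \<Rightarrow> 'u \<Rightarrow> bool" where
  "cpath K f [] g \<longleftrightarrow> f \<in> Ver K \<and> f = g"
| "cpath K f (\<phi> # \<phi>s) g \<longleftrightarrow> \<phi> \<in> Cell K \<and> vsrc K \<phi> = f \<and> cpath K (vtgt K \<phi>) \<phi>s g"

definition composable :: "'u avdc \<Rightarrow> 'u \<Rightarrow> 'u list \<Rightarrow> bool" where
  "composable K \<psi> \<phi>s \<longleftrightarrow>
     \<psi> \<in> Cell K \<and> \<phi>s \<noteq> [] \<and> cpath K (vsrc K (hd \<phi>s)) \<phi>s (vtgt K (last \<phi>s)) \<and>
     hsrc K \<psi> = concat (map (htgt K) \<phi>s) \<and> vdom K (vsrc K \<psi>) = vcod K (vsrc K (hd \<phi>s))"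

locale aug_virt_dbl_cat =
  fixes K :: "'u avdc"
  assumes vdom_in: "f \<in> Ver K \<Longrightarrow> vdom K f \<in> Ob K"
    and vcod_in: "f \<in> Ver K \<Longrightarrow> vcod K f \<in> Ob K"
    and vid_in: "A \<in> Ob K \<Longrightarrow> vid K A \<in> Ver K"
    and vdom_vid: "A \<in> Ob K \<Longrightarrow> vdom K (vid K A) = A"
    and vcod_vid: "A \<in> Ob K \<Longrightarrow> vcod K (vid K A) = A"
    and vcomp_in: "\<lbrakk>f \<in> Ver K; g \<in> Ver K; vcod K f = vdom K g\<rbrakk> \<Longrightarrow> vcomp K g f \<in> Ver K"
    and vdom_vcomp: "\<lbrakk>f \<in> Ver K; g \<in> Ver K; vcod K f = vdom K g\<rbrakk>
          \<Longrightarrow> vdom K (vcomp K g f) = vdom K f"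
    and vcod_vcomp: "\<lbrakk>f \<in> Ver K; g \<in> Ver K; vcod K f = vdom K g\<rbrakk>
          \<Longrightarrow> vcod K (vcomp K g f) = vcod K g"
    and vcomp_vid: "f \<in> Ver K \<Longrightarrow> vcomp K f (vid K (vdom K f)) = f"
    and vid_vcomp: "f \<in> Ver K \<Longrightarrow> vcomp K (vid K (vcod K f)) f = f"
    and vcomp_assoc: "\<lbrakk>f \<in> Ver K; g \<in> Ver K; h \<in> Ver K; vcod K f = vdom K g; vcod K g = vdom K h\<rbrakk>
          \<Longrightarrow> vcomp K h (vcomp K g f) = vcomp K (vcomp K h g) f"
    and hdom_in: "J \<in> Hor K \<Longrightarrow> hdom K J \<in> Ob K"
    and hcod_in: "J \<in> Hor K \<Longrightarrow> hcod K J \<in> Ob K"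
    and vsrc_in: "\<phi> \<in> Cell K \<Longrightarrow> vsrc K \<phi> \<in> Ver K"
    and vtgt_in: "\<phi> \<in> Cell K \<Longrightarrow> vtgt K \<phi> \<in> Ver K"
    and hsrc_path: "\<phi> \<in> Cell K \<Longrightarrow> hpath K (vdom K (vsrc K \<phi>)) (hsrc K \<phi>) (vdom K (vtgt K \<phi>))"
    and htgt_path: "\<phi> \<in> Cell K \<Longrightarrow> hpath K (vcod K (vsrc K \<phi>)) (htgt K \<phi>) (vcod K (vtgt K \<phi>))"
    and htgt_length: "\<phi> \<in> Cell K \<Longrightarrow> length (htgt K \<phi>) \<le> 1"
    and ccomp_in: "composable K \<psi> \<phi>s \<Longrightarrow> ccomp K \<psi> \<phi>s \<in> Cell K"
    and hsrc_ccomp: "composable K \<psi> \<phi>s \<Longrightarrow> hsrc K (ccomp K \<psi> \<phi>s) = concat (map (hsrc K) \<phi>s)"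
    and htgt_ccomp: "composable K \<psi> \<phi>s \<Longrightarrow> htgt K (ccomp K \<psi> \<phi>s) = htgt K \<psi>"
    and vsrc_ccomp: "composable K \<psi> \<phi>s
          \<Longrightarrow> vsrc K (ccomp K \<psi> \<phi>s) = vcomp K (vsrc K \<psi>) (vsrc K (hd \<phi>s))"
    and vtgt_ccomp: "composable K \<psi> \<phi>s
          \<Longrightarrow> vtgt K (ccomp K \<psi> \<phi>s) = vcomp K (vtgt K \<psi>) (vtgt K (last \<phi>s))"
    and hidc_in: "J \<in> Hor K \<Longrightarrow> hidc K J \<in> Cell K"
    and hsrc_hidc: "J \<in> Hor K \<Longrightarrow> hsrc K (hidc K J) = [J]"
    and htgt_hidc: "J \<in> Hor K \<Longrightarrow> htgt K (hidc K J) = [J]"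
    and vsrc_hidc: "J \<in> Hor K \<Longrightarrow> vsrc K (hidc K J) = vid K (hdom K J)"
    and vtgt_hidc: "J \<in> Hor K \<Longrightarrow> vtgt K (hidc K J) = vid K (hcod K J)"
    and vidc_in: "f \<in> Ver K \<Longrightarrow> vidc K f \<in> Cell K"
    and hsrc_vidc: "f \<in> Ver K \<Longrightarrow> hsrc K (vidc K f) = []"
    and htgt_vidc: "f \<in> Ver K \<Longrightarrow> htgt K (vidc K f) = []"
    and vsrc_vidc: "f \<in> Ver K \<Longrightarrow> vsrc K (vidc K f) = f"
    and vtgt_vidc: "f \<in> Ver K \<Longrightarrow> vtgt K (vidc K f) = f"
    and vidc_vidc: "\<lbrakk>f \<in> Ver K; h \<in> Ver K; vcod K f = vdom K h\<rbrakk>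
          \<Longrightarrow> ccomp K (vidc K h) [vidc K f] = vidc K (vcomp K h f)"
    and ccomp_assoc: "\<lbrakk>list_all2 (composable K) \<psi>s \<phi>ss; composable K \<chi> (map2 (ccomp K) \<psi>s \<phi>ss);
          composable K \<chi> \<psi>s; composable K (ccomp K \<chi> \<psi>s) (concat \<phi>ss)\<rbrakk>
          \<Longrightarrow> ccomp K \<chi> (map2 (ccomp K) \<psi>s \<phi>ss) = ccomp K (ccomp K \<chi> \<psi>s) (concat \<phi>ss)"
    and vidc_ccomp: "\<lbrakk>\<phi> \<in> Cell K; htgt K \<phi> = []\<rbrakk>
          \<Longrightarrow> ccomp K (vidc K (vid K (vcod K (vsrc K \<phi>)))) [\<phi>] = \<phi>"
    and hidc_ccomp: "\<lbrakk>\<phi> \<in> Cell K; htgt K \<phi> = [J]\<rbrakk> \<Longrightarrow> ccomp K (hidc K J) [\<phi>] = \<phi>"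
    and ccomp_vidc: "\<lbrakk>\<phi> \<in> Cell K; hsrc K \<phi> = []\<rbrakk>
          \<Longrightarrow> ccomp K \<phi> [vidc K (vid K (vdom K (vsrc K \<phi>)))] = \<phi>"
    and ccomp_hidc: "\<lbrakk>\<phi> \<in> Cell K; hsrc K \<phi> \<noteq> []\<rbrakk>
          \<Longrightarrow> ccomp K \<phi> (map (hidc K) (hsrc K \<phi>)) = \<phi>"
    and ccomp_insert_vidc: "\<lbrakk>composable K \<psi> (\<phi>s @ \<chi>s); cpath K f\<^sub>0 \<phi>s f; cpath K f \<chi>s f\<^sub>n\<rbrakk>
          \<Longrightarrow> ccomp K \<psi> (\<phi>s @ [vidc K f] @ \<chi>s) = ccomp K \<psi> (\<phi>s @ \<chi>s)"

text \<open>The identity cell of a path of length at most one, which starts at \<open>A\<close>.\<close>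

definition path_id :: "'u avdc \<Rightarrow> 'u \<Rightarrow> 'u list \<Rightarrow> 'u" where
  "path_id K A Js = (case Js of [] \<Rightarrow> vidc K (vid K A) | J # _ \<Rightarrow> hidc K J)"

definition hcomp :: "'u avdc \<Rightarrow> 'u \<Rightarrow> 'u \<Rightarrow> 'u" where
  "hcomp K \<phi> \<psi> =
     ccomp K (path_id K (vcod K (vsrc K \<phi>)) (htgt K \<phi> @ htgt K \<psi>)) [\<phi>, \<psi>]"

definition whisk :: "'u avdc \<Rightarrow> 'u \<Rightarrow> 'u \<Rightarrow> 'u" where
  "whisk K h \<phi> = ccomp K (vidc K h) [\<phi>]"

definition cartesian :: "'u avdc \<Rightarrow> 'u \<Rightarrow> bool" where
  "cartesian K \<psi> \<longleftrightarrow> \<psi> \<in> Cell K \<and> length (hsrc K \<psi>) \<le> 1 \<and>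
     (\<forall>\<chi>\<in>Cell K. \<forall>h\<in>Ver K. \<forall>k\<in>Ver K.
        vcod K h = vdom K (vsrc K \<psi>) \<and> vcod K k = vdom K (vtgt K \<psi>) \<and>
        htgt K \<chi> = htgt K \<psi> \<and>
        vsrc K \<chi> = vcomp K (vsrc K \<psi>) h \<and> vtgt K \<chi> = vcomp K (vtgt K \<psi>) k \<longrightarrow>
        (\<exists>!\<phi>. \<phi> \<in> Cell K \<and> hsrc K \<phi> = hsrc K \<chi> \<and> htgt K \<phi> = hsrc K \<psi> \<and>
              vsrc K \<phi> = h \<and> vtgt K \<phi> = k \<and> \<chi> = ccomp K \<psi> [\<phi>]))"

definition companion_cell :: "'u avdc \<Rightarrow> 'u \<Rightarrow> 'u \<Rightarrow> bool" where
  "companion_cell K j \<epsilon> \<longleftrightarrow> j \<in> Ver K \<and> cartesian K \<epsilon> \<and>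
     length (hsrc K \<epsilon>) = 1 \<and> htgt K \<epsilon> = [] \<and> vsrc K \<epsilon> = j \<and> vtgt K \<epsilon> = vid K (vcod K j)"

definition conjoint_cell :: "'u avdc \<Rightarrow> 'u \<Rightarrow> 'u \<Rightarrow> bool" where
  "conjoint_cell K j \<epsilon> \<longleftrightarrow> j \<in> Ver K \<and> cartesian K \<epsilon> \<and>
     length (hsrc K \<epsilon>) = 1 \<and> htgt K \<epsilon> = [] \<and> vsrc K \<epsilon> = vid K (vcod K j) \<and> vtgt K \<epsilon> = j"

definition has_companion :: "'u avdc \<Rightarrow> 'u \<Rightarrow> bool" where
  "has_companion K j \<longleftrightarrow> (\<exists>\<epsilon>. companion_cell K j \<epsilon>)"

definition has_conjoint :: "'u avdc \<Rightarrow> 'u \<Rightarrow> bool" where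
  "has_conjoint K j \<longleftrightarrow> (\<exists>\<epsilon>. conjoint_cell K j \<epsilon>)"

definition companion_choice :: "'u avdc \<Rightarrow> ('u \<Rightarrow> 'u) \<Rightarrow> bool" where
  "companion_choice K \<epsilon> \<longleftrightarrow> (\<forall>j. has_companion K j \<longrightarrow> companion_cell K j (\<epsilon> j))"

definition conjoint_choice :: "'u avdc \<Rightarrow> ('u \<Rightarrow> 'u) \<Rightarrow> bool" where
  "conjoint_choice K \<epsilon> \<longleftrightarrow> (\<forall>j. has_conjoint K j \<longrightarrow> conjoint_cell K j (\<epsilon> j))"

definition representable :: "'u avdc \<Rightarrow> 'u \<Rightarrow> bool" where
  "representable K J \<longleftrightarrow> (\<exists>j \<epsilon>. companion_cell K j \<epsilon> \<and> hsrc K \<epsilon> = [J])"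

definition oprepresentable :: "'u avdc \<Rightarrow> 'u \<Rightarrow> bool" where
  "oprepresentable K J \<longleftrightarrow> (\<exists>j \<epsilon>. conjoint_cell K j \<epsilon> \<and> hsrc K \<epsilon> = [J])"


section \<open>Functors and transformations\<close>

text \<open>
  Functors and transformations are made extensional, so that equality in HOL is equality of
  functors and of transformations.
\<close>

record 'u avfun =
  fdom :: "'u avdc"
  fcod :: "'u avdc"
  omap :: "'u \<Rightarrow> 'u"
  vmap :: "'u \<Rightarrow> 'u"
  hmap :: "'u \<Rightarrow> 'u"
  cmap :: "'u \<Rightarrow> 'u"

locale avdc_functor =
  fixes F :: "'u avfun"
  assumes fdom_avdc: "aug_virt_dbl_cat (fdom F)"
    and fcod_avdc: "aug_virt_dbl_cat (fcod F)"
    and omap_in: "omap F \<in> Ob (fdom F) \<rightarrow>\<^sub>E Ob (fcod F)"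
    and vmap_in: "vmap F \<in> Ver (fdom F) \<rightarrow>\<^sub>E Ver (fcod F)"
    and hmap_in: "hmap F \<in> Hor (fdom F) \<rightarrow>\<^sub>E Hor (fcod F)"
    and cmap_in: "cmap F \<in> Cell (fdom F) \<rightarrow>\<^sub>E Cell (fcod F)"
    and vdom_vmap: "f \<in> Ver (fdom F) \<Longrightarrow> vdom (fcod F) (vmap F f) = omap F (vdom (fdom F) f)"
    and vcod_vmap: "f \<in> Ver (fdom F) \<Longrightarrow> vcod (fcod F) (vmap F f) = omap F (vcod (fdom F) f)"
    and vmap_vid: "A \<in> Ob (fdom F) \<Longrightarrow> vmap F (vid (fdom F) A) = vid (fcod F) (omap F A)"
    and vmap_vcomp: "\<lbrakk>f \<in> Ver (fdom F); g \<in> Ver (fdom F); vcod (fdom F) f = vdom (fdom F) g\<rbrakk>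
          \<Longrightarrow> vmap F (vcomp (fdom F) g f) = vcomp (fcod F) (vmap F g) (vmap F f)"
    and hdom_hmap: "J \<in> Hor (fdom F) \<Longrightarrow> hdom (fcod F) (hmap F J) = omap F (hdom (fdom F) J)"
    and hcod_hmap: "J \<in> Hor (fdom F) \<Longrightarrow> hcod (fcod F) (hmap F J) = omap F (hcod (fdom F) J)"
    and hsrc_cmap: "\<phi> \<in> Cell (fdom F)
          \<Longrightarrow> hsrc (fcod F) (cmap F \<phi>) = map (hmap F) (hsrc (fdom F) \<phi>)"
    and htgt_cmap: "\<phi> \<in> Cell (fdom F)
          \<Longrightarrow> htgt (fcod F) (cmap F \<phi>) = map (hmap F) (htgt (fdom F) \<phi>)"
    and vsrc_cmap: "\<phi> \<in> Cell (fdom F) \<Longrightarrow> vsrc (fcod F) (cmap F \<phi>) = vmap F (vsrc (fdom F) \<phi>)"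
    and vtgt_cmap: "\<phi> \<in> Cell (fdom F) \<Longrightarrow> vtgt (fcod F) (cmap F \<phi>) = vmap F (vtgt (fdom F) \<phi>)"
    and cmap_ccomp: "composable (fdom F) \<psi> \<phi>s
          \<Longrightarrow> cmap F (ccomp (fdom F) \<psi> \<phi>s) = ccomp (fcod F) (cmap F \<psi>) (map (cmap F) \<phi>s)"
    and cmap_hidc: "J \<in> Hor (fdom F) \<Longrightarrow> cmap F (hidc (fdom F) J) = hidc (fcod F) (hmap F J)"
    and cmap_vidc: "f \<in> Ver (fdom F) \<Longrightarrow> cmap F (vidc (fdom F) f) = vidc (fcod F) (vmap F f)"

record 'u avtrans =
  tsrc :: "'u avfun"
  ttgt :: "'u avfun"
  tob :: "'u \<Rightarrow> 'u"
  thor :: "'u \<Rightarrow> 'u"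

text \<open>The path of cells \<open>\<xi>\<^bsub>(J\<^sub>1,\<dots>,J\<^sub>n)\<^esub>\<close>, which is \<open>id\<^bsub>\<xi>\<^sub>A\<^esub>\<close> for the empty path at \<open>A\<close>.\<close>

definition tpath :: "'u avtrans \<Rightarrow> 'u \<Rightarrow> 'u list \<Rightarrow> 'u list" where
  "tpath \<xi> A Js =
     (if Js = [] then [vidc (fcod (tsrc \<xi>)) (tob \<xi> A)] else map (thor \<xi>) Js)"

locale avdc_transformation =
  fixes \<xi> :: "'u avtrans" and F G K L
  defines "F \<equiv> tsrc \<xi>" and "G \<equiv> ttgt \<xi>" and "K \<equiv> fdom F" and "L \<equiv> fcod F"
  assumes src_functor: "avdc_functor F"
    and tgt_functor: "avdc_functor G"
    and fdom_eq: "fdom G = K"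
    and fcod_eq: "fcod G = L"
    and tob_in: "tob \<xi> \<in> Ob K \<rightarrow>\<^sub>E Ver L"
    and thor_in: "thor \<xi> \<in> Hor K \<rightarrow>\<^sub>E Cell L"
    and vdom_tob: "A \<in> Ob K \<Longrightarrow> vdom L (tob \<xi> A) = omap F A"
    and vcod_tob: "A \<in> Ob K \<Longrightarrow> vcod L (tob \<xi> A) = omap G A"
    and tob_natural: "f \<in> Ver K
          \<Longrightarrow> vcomp L (vmap G f) (tob \<xi> (vdom K f)) = vcomp L (tob \<xi> (vcod K f)) (vmap F f)"
    and hsrc_thor: "J \<in> Hor K \<Longrightarrow> hsrc L (thor \<xi> J) = [hmap F J]"
    and htgt_thor: "J \<in> Hor K \<Longrightarrow> htgt L (thor \<xi> J) = [hmap G J]"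
    and vsrc_thor: "J \<in> Hor K \<Longrightarrow> vsrc L (thor \<xi> J) = tob \<xi> (hdom K J)"
    and vtgt_thor: "J \<in> Hor K \<Longrightarrow> vtgt L (thor \<xi> J) = tob \<xi> (hcod K J)"
    and thor_natural: "\<phi> \<in> Cell K
          \<Longrightarrow> ccomp L (cmap G \<phi>) (tpath \<xi> (vdom K (vsrc K \<phi>)) (hsrc K \<phi>)) =
              ccomp L (hd (tpath \<xi> (vcod K (vsrc K \<phi>)) (htgt K \<phi>))) [cmap F \<phi>]"

definition avfun_id :: "'u avdc \<Rightarrow> 'u avfun" where
  "avfun_id K = \<lparr>fdom = K, fcod = K, omap = (\<lambda>A\<in>Ob K. A), vmap = (\<lambda>f\<in>Ver K. f),
     hmap = (\<lambda>J\<in>Hor K. J), cmap = (\<lambda>\<phi>\<in>Cell K. \<phi>)\<rparr>"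

definition avfun_comp :: "'u avfun \<Rightarrow> 'u avfun \<Rightarrow> 'u avfun" where
  "avfun_comp G F = \<lparr>fdom = fdom F, fcod = fcod G,
     omap = (\<lambda>A\<in>Ob (fdom F). omap G (omap F A)),
     vmap = (\<lambda>f\<in>Ver (fdom F). vmap G (vmap F f)),
     hmap = (\<lambda>J\<in>Hor (fdom F). hmap G (hmap F J)),
     cmap = (\<lambda>\<phi>\<in>Cell (fdom F). cmap G (cmap F \<phi>))\<rparr>"

definition avtrans_id :: "'u avfun \<Rightarrow> 'u avtrans" where
  "avtrans_id F = \<lparr>tsrc = F, ttgt = F,
     tob = (\<lambda>A\<in>Ob (fdom F). vid (fcod F) (omap F A)),
     thor = (\<lambda>J\<in>Hor (fdom F). hidc (fcod F) (hmap F J))\<rparr>"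

definition avtrans_vert :: "'u avtrans \<Rightarrow> 'u avtrans \<Rightarrow> 'u avtrans" where
  "avtrans_vert \<zeta> \<xi> = \<lparr>tsrc = tsrc \<xi>, ttgt = ttgt \<zeta>,
     tob = (\<lambda>A\<in>Ob (fdom (tsrc \<xi>)). vcomp (fcod (tsrc \<xi>)) (tob \<zeta> A) (tob \<xi> A)),
     thor = (\<lambda>J\<in>Hor (fdom (tsrc \<xi>)). ccomp (fcod (tsrc \<xi>)) (thor \<zeta> J) [thor \<xi> J])\<rparr>"

definition avtrans_horz :: "'u avtrans \<Rightarrow> 'u avtrans \<Rightarrow> 'u avtrans" where
  "avtrans_horz \<zeta> \<xi> =
     \<lparr>tsrc = avfun_comp (tsrc \<zeta>) (tsrc \<xi>), ttgt = avfun_comp (ttgt \<zeta>) (ttgt \<xi>),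
      tob = (\<lambda>A\<in>Ob (fdom (tsrc \<xi>)). vcomp (fcod (tsrc \<zeta>))
               (tob \<zeta> (omap (ttgt \<xi>) A)) (vmap (tsrc \<zeta>) (tob \<xi> A))),
      thor = (\<lambda>J\<in>Hor (fdom (tsrc \<xi>)). ccomp (fcod (tsrc \<zeta>))
               (thor \<zeta> (hmap (ttgt \<xi>) J)) [cmap (tsrc \<zeta>) (thor \<xi> J)])\<rparr>"


section \<open>2-categories\<close>

text \<open>
  \<open>vert C \<beta> \<alpha>\<close> is the composite of \<open>\<alpha> : f \<Rightarrow> g\<close> and \<open>\<beta> : g \<Rightarrow> h\<close> along the 1-cell \<open>g\<close>, and
  \<open>horz C \<beta> \<alpha>\<close> is the composite of \<open>\<alpha> : f \<Rightarrow> g : A \<rightarrow> B\<close> and \<open>\<beta> : h \<Rightarrow> k : B \<rightarrow> C\<close> along the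
  object \<open>B\<close>.
\<close>

record ('o, 'm, 'c) two_cat =
  Obj :: "'o set"
  Mor :: "'m set"
  mdom :: "'m \<Rightarrow> 'o"
  mcod :: "'m \<Rightarrow> 'o"
  mid :: "'o \<Rightarrow> 'm"
  mcomp :: "'m \<Rightarrow> 'm \<Rightarrow> 'm"
  Two :: "'c set"
  csrc :: "'c \<Rightarrow> 'm"
  ctgt :: "'c \<Rightarrow> 'm"
  cid :: "'m \<Rightarrow> 'c"
  vert :: "'c \<Rightarrow> 'c \<Rightarrow> 'c"
  horz :: "'c \<Rightarrow> 'c \<Rightarrow> 'c"

definition mor :: "('o, 'm, 'c) two_cat \<Rightarrow> 'o \<Rightarrow> 'o \<Rightarrow> 'm \<Rightarrow> bool" where
  "mor C A B f \<longleftrightarrow> f \<in> Mor C \<and> mdom C f = A \<and> mcod C f = B"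

definition two :: "('o, 'm, 'c) two_cat \<Rightarrow> 'm \<Rightarrow> 'm \<Rightarrow> 'c \<Rightarrow> bool" where
  "two C f g \<alpha> \<longleftrightarrow> \<alpha> \<in> Two C \<and> csrc C \<alpha> = f \<and> ctgt C \<alpha> = g"

locale two_category =
  fixes C :: "('o, 'm, 'c) two_cat"
  assumes mor_Obj: "mor C A B f \<Longrightarrow> A \<in> Obj C \<and> B \<in> Obj C"
    and mid: "A \<in> Obj C \<Longrightarrow> mor C A A (mid C A)"
    and mcomp: "\<lbrakk>mor C A B f; mor C B D g\<rbrakk> \<Longrightarrow> mor C A D (mcomp C g f)"
    and mcomp_mid: "mor C A B f \<Longrightarrow> mcomp C f (mid C A) = f"
    and mid_mcomp: "mor C A B f \<Longrightarrow> mcomp C (mid C B) f = f"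
    and mcomp_assoc: "\<lbrakk>mor C A B f; mor C B D g; mor C D E h\<rbrakk>
          \<Longrightarrow> mcomp C h (mcomp C g f) = mcomp C (mcomp C h g) f"
    and two_parallel: "two C f g \<alpha> \<Longrightarrow> \<exists>A B. mor C A B f \<and> mor C A B g"
    and cid: "f \<in> Mor C \<Longrightarrow> two C f f (cid C f)"
    and vert: "\<lbrakk>two C f g \<alpha>; two C g h \<beta>\<rbrakk> \<Longrightarrow> two C f h (vert C \<beta> \<alpha>)"
    and vert_cid: "two C f g \<alpha> \<Longrightarrow> vert C \<alpha> (cid C f) = \<alpha>"
    and cid_vert: "two C f g \<alpha> \<Longrightarrow> vert C (cid C g) \<alpha> = \<alpha>"
    and vert_assoc: "\<lbrakk>two C f g \<alpha>; two C g h \<beta>; two C h k \<gamma>\<rbrakk>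
          \<Longrightarrow> vert C \<gamma> (vert C \<beta> \<alpha>) = vert C (vert C \<gamma> \<beta>) \<alpha>"
    and horz: "\<lbrakk>two C f g \<alpha>; two C h k \<beta>; mcod C f = mdom C h\<rbrakk>
          \<Longrightarrow> two C (mcomp C h f) (mcomp C k g) (horz C \<beta> \<alpha>)"
    and horz_cid_mid: "\<lbrakk>two C f g \<alpha>; mdom C f = A\<rbrakk> \<Longrightarrow> horz C \<alpha> (cid C (mid C A)) = \<alpha>"
    and cid_mid_horz: "\<lbrakk>two C f g \<alpha>; mcod C f = B\<rbrakk> \<Longrightarrow> horz C (cid C (mid C B)) \<alpha> = \<alpha>"
    and horz_assoc: "\<lbrakk>two C f f' \<alpha>; two C g g' \<beta>; two C h h' \<gamma>; mcod C f = mdom C g;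
          mcod C g = mdom C h\<rbrakk> \<Longrightarrow> horz C \<gamma> (horz C \<beta> \<alpha>) = horz C (horz C \<gamma> \<beta>) \<alpha>"
    and horz_cid_cid: "\<lbrakk>mor C A B f; mor C B D g\<rbrakk>
          \<Longrightarrow> horz C (cid C g) (cid C f) = cid C (mcomp C g f)"
    and interchange: "\<lbrakk>two C f f' \<alpha>; two C f' f'' \<alpha>'; two C g g' \<beta>; two C g' g'' \<beta>';
          mcod C f = mdom C g\<rbrakk>
          \<Longrightarrow> horz C (vert C \<beta>' \<beta>) (vert C \<alpha>' \<alpha>) = vert C (horz C \<beta>' \<alpha>') (horz C \<beta> \<alpha>)"

definition invertible_two :: "('o, 'm, 'c) two_cat \<Rightarrow> 'm \<Rightarrow> 'm \<Rightarrow> 'c \<Rightarrow> bool" where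
  "invertible_two C f g \<alpha> \<longleftrightarrow>
     two C f g \<alpha> \<and> (\<exists>\<beta>. two C g f \<beta> \<and> vert C \<beta> \<alpha> = cid C f \<and> vert C \<alpha> \<beta> = cid C g)"

definition equivalence_in :: "('o, 'm, 'c) two_cat \<Rightarrow> 'o \<Rightarrow> 'o \<Rightarrow> 'm \<Rightarrow> bool" where
  "equivalence_in C A B f \<longleftrightarrow> mor C A B f \<and>
     (\<exists>g \<eta> \<epsilon>. mor C B A g \<and> invertible_two C (mid C A) (mcomp C g f) \<eta> \<and>
        invertible_two C (mcomp C f g) (mid C B) \<epsilon>)"

record ('o, 'm, 'c, 'p, 'n, 'd) two_fun =
  Tdom :: "('o, 'm, 'c) two_cat"
  Tcod :: "('p, 'n, 'd) two_cat"
  T0 :: "'o \<Rightarrow> 'p"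
  T1 :: "'m \<Rightarrow> 'n"
  T2 :: "'c \<Rightarrow> 'd"

locale strict_two_functor =
  C: two_category C + D: two_category D
  for C :: "('o, 'm, 'c) two_cat" and D :: "('p, 'n, 'd) two_cat" +
  fixes T :: "('o, 'm, 'c, 'p, 'n, 'd) two_fun"
  assumes Tdom: "Tdom T = C"
    and Tcod: "Tcod T = D"
    and T0_in: "A \<in> Obj C \<Longrightarrow> T0 T A \<in> Obj D"
    and T1_mor: "mor C A B f \<Longrightarrow> mor D (T0 T A) (T0 T B) (T1 T f)"
    and T2_two: "two C f g \<alpha> \<Longrightarrow> two D (T1 T f) (T1 T g) (T2 T \<alpha>)"
    and T1_mid: "A \<in> Obj C \<Longrightarrow> T1 T (mid C A) = mid D (T0 T A)"
    and T1_mcomp: "\<lbrakk>mor C A B f; mor C B E g\<rbrakk>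
          \<Longrightarrow> T1 T (mcomp C g f) = mcomp D (T1 T g) (T1 T f)"
    and T2_cid: "f \<in> Mor C \<Longrightarrow> T2 T (cid C f) = cid D (T1 T f)"
    and T2_vert: "\<lbrakk>two C f g \<alpha>; two C g h \<beta>\<rbrakk> \<Longrightarrow> T2 T (vert C \<beta> \<alpha>) = vert D (T2 T \<beta>) (T2 T \<alpha>)"
    and T2_horz: "\<lbrakk>two C f g \<alpha>; two C h k \<beta>; mcod C f = mdom C h\<rbrakk>
          \<Longrightarrow> T2 T (horz C \<beta> \<alpha>) = horz D (T2 T \<beta>) (T2 T \<alpha>)"

text \<open>Components \<open>p A : S A \<rightarrow> T A\<close> and invertible \<open>\<sigma> f : T f \<circ> p A \<Rightarrow> p B \<circ> S f\<close> for \<open>f : A \<rightarrow> B\<close>.\<close>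

locale pseudonatural =
  S: strict_two_functor C D S + T: strict_two_functor C D T
  for C :: "('o, 'm, 'c) two_cat" and D :: "('p, 'n, 'd) two_cat"
    and S T :: "('o, 'm, 'c, 'p, 'n, 'd) two_fun" +
  fixes p :: "'o \<Rightarrow> 'n" and \<sigma> :: "'m \<Rightarrow> 'd"
  assumes component: "A \<in> Obj C \<Longrightarrow> mor D (T0 S A) (T0 T A) (p A)"
    and structure_cell: "mor C A B f
          \<Longrightarrow> invertible_two D (mcomp D (T1 T f) (p A)) (mcomp D (p B) (T1 S f)) (\<sigma> f)"
    and natural: "\<lbrakk>mor C A B f; mor C A B g; two C f g \<alpha>\<rbrakk>
          \<Longrightarrow> vert D (\<sigma> g) (horz D (T2 T \<alpha>) (cid D (p A))) =
              vert D (horz D (cid D (p B)) (T2 S \<alpha>)) (\<sigma> f)"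
    and unit: "A \<in> Obj C \<Longrightarrow> \<sigma> (mid C A) = cid D (p A)"
    and composition: "\<lbrakk>mor C A B f; mor C B E g\<rbrakk>
          \<Longrightarrow> \<sigma> (mcomp C g f) =
              vert D (horz D (\<sigma> g) (cid D (T1 S f))) (horz D (cid D (T1 T g)) (\<sigma> f))"

text \<open>Only the data of a 2-natural transformation; naturality is not imposed.\<close>

record ('o, 'm, 'c, 'p, 'n, 'd) two_nat =
  nsrc :: "('o, 'm, 'c, 'p, 'n, 'd) two_fun"
  ntgt :: "('o, 'm, 'c, 'p, 'n, 'd) two_fun"
  ncomp :: "'o \<Rightarrow> 'n"

definition AugVirtDblCat :: "('u avdc, 'u avfun, 'u avtrans) two_cat" where
  "AugVirtDblCat = \<lparr>Obj = {K. aug_virt_dbl_cat K}, Mor = {F. avdc_functor F},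
     mdom = fdom, mcod = fcod, mid = avfun_id, mcomp = avfun_comp,
     Two = {\<xi>. avdc_transformation \<xi>}, csrc = tsrc, ctgt = ttgt, cid = avtrans_id,
     vert = avtrans_vert, horz = avtrans_horz\<rparr>"


section \<open>Sub-structures determined by horizontal morphisms\<close>

definition full_sub :: "'u avdc \<Rightarrow> ('u \<Rightarrow> bool) \<Rightarrow> 'u avdc" where
  "full_sub K P = K\<lparr>Hor := {J \<in> Hor K. P J},
     Cell := {\<phi> \<in> Cell K. (\<forall>J\<in>set (hsrc K \<phi>). P J) \<and> (\<forall>J\<in>set (htgt K \<phi>). P J)}\<rparr>"

definition avfun_restrict :: "'u avdc \<Rightarrow> 'u avdc \<Rightarrow> 'u avfun \<Rightarrow> 'u avfun" where
  "avfun_restrict K L F = \<lparr>fdom = K, fcod = L,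
     omap = restrict (omap F) (Ob K), vmap = restrict (vmap F) (Ver K),
     hmap = restrict (hmap F) (Hor K), cmap = restrict (cmap F) (Cell K)\<rparr>"

definition avtrans_restrict :: "'u avfun \<Rightarrow> 'u avfun \<Rightarrow> 'u avtrans \<Rightarrow> 'u avtrans" where
  "avtrans_restrict F G \<xi> = \<lparr>tsrc = F, ttgt = G,
     tob = restrict (tob \<xi>) (Ob (fdom F)), thor = restrict (thor \<xi>) (Hor (fdom F))\<rparr>"

definition sub_two_fun ::
  "('u avdc \<Rightarrow> 'u avdc) \<Rightarrow> ('u avfun \<Rightarrow> 'u avfun) \<Rightarrow> ('u avtrans \<Rightarrow> 'u avtrans) \<Rightarrow>
   ('u avdc, 'u avfun, 'u avtrans, 'u avdc, 'u avfun, 'u avtrans) two_fun" where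
  "sub_two_fun S0 S1 S2 =
     (let R1 = (\<lambda>F. avfun_restrict (S0 (fdom F)) (S0 (fcod F)) (S1 F))
      in \<lparr>Tdom = AugVirtDblCat, Tcod = AugVirtDblCat, T0 = S0, T1 = R1,
          T2 = (\<lambda>\<xi>. avtrans_restrict (R1 (tsrc \<xi>)) (R1 (ttgt \<xi>)) (S2 \<xi>))\<rparr>)"

definition Rep :: "'u avdc \<Rightarrow> 'u avdc" where
  "Rep K = full_sub K (representable K)"

definition opRep :: "'u avdc \<Rightarrow> 'u avdc" where
  "opRep K = full_sub K (oprepresentable K)"

definition Rep_two_fun where
  "Rep_two_fun = sub_two_fun Rep (\<lambda>F. F) (\<lambda>\<xi>. \<xi>)"

definition opRep_two_fun where
  "opRep_two_fun = sub_two_fun opRep (\<lambda>F. F) (\<lambda>\<xi>. \<xi>)"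


section \<open>Duals\<close>

text \<open>
  The horizontal dual.  No new names are needed for \<open>co J\<close> and \<open>co \<phi>\<close>: they are \<open>J\<close> and \<open>\<phi>\<close>
  with their boundaries reversed.
\<close>

definition co :: "'u avdc \<Rightarrow> 'u avdc" where
  "co K = K\<lparr>hdom := hcod K, hcod := hdom K, hsrc := (\<lambda>\<phi>. rev (hsrc K \<phi>)),
     vsrc := vtgt K, vtgt := vsrc K, ccomp := (\<lambda>\<psi> \<phi>s. ccomp K \<psi> (rev \<phi>s))\<rparr>"

definition co_fun :: "'u avfun \<Rightarrow> 'u avfun" where
  "co_fun F = F\<lparr>fdom := co (fdom F), fcod := co (fcod F)\<rparr>"

definition co_trans :: "'u avtrans \<Rightarrow> 'u avtrans" where
  "co_trans \<xi> = \<xi>\<lparr>tsrc := co_fun (tsrc \<xi>), ttgt := co_fun (ttgt \<xi>)\<rparr>"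

definition co2 :: "('o, 'm, 'c) two_cat \<Rightarrow> ('o, 'm, 'c) two_cat" where
  "co2 C = C\<lparr>csrc := ctgt C, ctgt := csrc C, vert := (\<lambda>\<beta> \<alpha>. vert C \<alpha> \<beta>)\<rparr>"

definition co2_fun ::
  "('o, 'm, 'c, 'p, 'n, 'd) two_fun \<Rightarrow> ('o, 'm, 'c, 'p, 'n, 'd) two_fun" where
  "co2_fun T = T\<lparr>Tdom := co2 (Tdom T), Tcod := co2 (Tcod T)\<rparr>"

definition co2_nat ::
  "('o, 'm, 'c, 'p, 'n, 'd) two_nat \<Rightarrow> ('o, 'm, 'c, 'p, 'n, 'd) two_nat" where
  "co2_nat \<tau> = \<tau>\<lparr>nsrc := co2_fun (nsrc \<tau>), ntgt := co2_fun (ntgt \<tau>)\<rparr>"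


section \<open>The 2-functor \<open>V\<close>\<close>

text \<open>
  The vertical composition of \<open>V K\<close> is left undefined on non-composable pairs so that
  \<open>V (co K) = co2 (V K)\<close> holds as an equality of records.
\<close>

definition V :: "'u avdc \<Rightarrow> ('u, 'u, 'u) two_cat" where
  "V K = (let Vc = {\<phi> \<in> Cell K. hsrc K \<phi> = [] \<and> htgt K \<phi> = []} in
     \<lparr>Obj = Ob K, Mor = Ver K, mdom = vdom K, mcod = vcod K, mid = vid K, mcomp = vcomp K,
      Two = Vc, csrc = vsrc K, ctgt = vtgt K, cid = vidc K,
      vert = (\<lambda>\<beta> \<alpha>. if \<alpha> \<in> Vc \<and> \<beta> \<in> Vc \<and> vtgt K \<alpha> = vsrc K \<beta> then hcomp K \<alpha> \<beta> else undefined),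
      horz = (\<lambda>\<beta> \<alpha>. ccomp K \<beta> [\<alpha>])\<rparr>)"

definition V_fun :: "'u avfun \<Rightarrow> ('u, 'u, 'u, 'u, 'u, 'u) two_fun" where
  "V_fun F = \<lparr>Tdom = V (fdom F), Tcod = V (fcod F), T0 = omap F, T1 = vmap F, T2 = cmap F\<rparr>"

definition V_nat :: "'u avtrans \<Rightarrow> ('u, 'u, 'u, 'u, 'u, 'u) two_nat" where
  "V_nat \<xi> = \<lparr>nsrc = V_fun (tsrc \<xi>), ntgt = V_fun (ttgt \<xi>), ncomp = tob \<xi>\<rparr>"


section \<open>Quintets\<close>

text \<open>
  For \<open>Q \<circ> V\<close> to be an endofunctor, objects, morphisms and cells are taken from a type that is
  closed under the formation of quintets.  The term \<open>Quint f js ks g \<alpha>\<close> is the quintet with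
  horizontal source \<open>js\<close>, horizontal target \<open>ks\<close>, vertical source \<open>f\<close> and vertical target \<open>g\<close>
  given by the 2-cell \<open>\<alpha>\<close>.
\<close>

datatype 'a univ =
    Atom 'a
  | Quint (qf: "'a univ") (qjs: "'a univ list") (qks: "'a univ list") (qg: "'a univ") (qc: "'a univ")

text \<open>\<open>mpath_comp C A (j\<^sub>1, \<dots>, j\<^sub>n)\<close> is \<open>j\<^sub>n \<circ> \<dots> \<circ> j\<^sub>1\<close> for a path that starts at \<open>A\<close>.\<close>

primrec mpath :: "('o, 'm, 'c) two_cat \<Rightarrow> 'o \<Rightarrow> 'm list \<Rightarrow> 'o \<Rightarrow> bool" where
  "mpath C A [] B \<longleftrightarrow> A \<in> Obj C \<and> A = B"
| "mpath C A (j # js) B \<longleftrightarrow> j \<in> Mor C \<and> mdom C j = A \<and> mpath C (mcod C j) js B"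

primrec mpath_comp :: "('o, 'm, 'c) two_cat \<Rightarrow> 'o \<Rightarrow> 'm list \<Rightarrow> 'm" where
  "mpath_comp C A [] = mid C A"
| "mpath_comp C A (j # js) = mcomp C (mpath_comp C (mcod C j) js) j"

definition quintets :: "('a univ, 'a univ, 'a univ) two_cat \<Rightarrow> 'a univ set" where
  "quintets C = {Quint f js ks g \<alpha> | f js ks g \<alpha>.
     f \<in> Mor C \<and> g \<in> Mor C \<and> mpath C (mdom C f) js (mdom C g) \<and>
     mpath C (mcod C f) ks (mcod C g) \<and> length ks \<le> 1 \<and>
     two C (mcomp C (mpath_comp C (mcod C f) ks) f) (mcomp C g (mpath_comp C (mdom C f) js)) \<alpha>}"

text \<open>
  Quintets \<open>\<phi>\<^sub>i : K\<^sub>i \<circ> f\<^bsub>i-1\<^esub> \<Rightarrow> f\<^sub>i \<circ> J\<^sub>i\<close>, where \<open>J\<^sub>i\<close> and \<open>K\<^sub>i\<close> denote the composites of their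
  horizontal sources and targets, are pasted into
  \<open>K\<^sub>n \<circ> \<dots> \<circ> K\<^sub>1 \<circ> f\<^sub>0 \<Rightarrow> f\<^sub>n \<circ> J\<^sub>n \<circ> \<dots> \<circ> J\<^sub>1\<close>, by first applying \<open>\<phi>\<^sub>1\<close> and next the pasting
  of \<open>\<phi>\<^sub>2, \<dots>, \<phi>\<^sub>n\<close>.
\<close>

primrec qpaste :: "('a univ, 'a univ, 'a univ) two_cat \<Rightarrow> 'a univ \<Rightarrow> 'a univ list \<Rightarrow> 'a univ" where
  "qpaste C f [] = cid C f"
| "qpaste C f (\<phi> # \<phi>s) = vert C
     (horz C (qpaste C (qg \<phi>) \<phi>s) (cid C (mpath_comp C (mdom C f) (qjs \<phi>))))
     (horz C (cid C (mpath_comp C (mcod C (qg \<phi>)) (concat (map qks \<phi>s)))) (qc \<phi>))"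

definition qcomp ::
  "('a univ, 'a univ, 'a univ) two_cat \<Rightarrow> 'a univ \<Rightarrow> 'a univ list \<Rightarrow> 'a univ" where
  "qcomp C \<psi> \<phi>s = (let f = qf (hd \<phi>s) in
     Quint (mcomp C (qf \<psi>) f) (concat (map qjs \<phi>s)) (qks \<psi>) (mcomp C (qg \<psi>) (qg (last \<phi>s)))
       (vert C (horz C (cid C (qg \<psi>)) (qpaste C f \<phi>s)) (horz C (qc \<psi>) (cid C f))))"

definition Q :: "('a univ, 'a univ, 'a univ) two_cat \<Rightarrow> 'a univ avdc" where
  "Q C = \<lparr>Ob = Obj C, Ver = Mor C, vdom = mdom C, vcod = mcod C, vid = mid C, vcomp = mcomp C,
     Hor = Mor C, hdom = mdom C, hcod = mcod C,
     Cell = quintets C, hsrc = qjs, htgt = qks, vsrc = qf, vtgt = qg, ccomp = qcomp C,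
     hidc = (\<lambda>j. Quint (mid C (mdom C j)) [j] [j] (mid C (mcod C j)) (cid C j)),
     vidc = (\<lambda>f. Quint f [] [] f (cid C f))\<rparr>"

definition Q_fun ::
  "('a univ, 'a univ, 'a univ, 'a univ, 'a univ, 'a univ) two_fun \<Rightarrow> 'a univ avfun" where
  "Q_fun T = \<lparr>fdom = Q (Tdom T), fcod = Q (Tcod T),
     omap = restrict (T0 T) (Obj (Tdom T)), vmap = restrict (T1 T) (Mor (Tdom T)),
     hmap = restrict (T1 T) (Mor (Tdom T)),
     cmap = (\<lambda>\<phi>\<in>quintets (Tdom T). Quint (T1 T (qf \<phi>)) (map (T1 T) (qjs \<phi>)) (map (T1 T) (qks \<phi>))
               (T1 T (qg \<phi>)) (T2 T (qc \<phi>)))\<rparr>"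

text \<open>
  At \<open>j : A \<rightarrow> B\<close> the transformation induced by a 2-natural \<open>\<tau> : S \<Rightarrow> T\<close> is the quintet given by
  the identity 2-cell of \<open>T j \<circ> \<tau>\<^sub>A = \<tau>\<^sub>B \<circ> S j\<close>.
\<close>

definition Q_trans ::
  "('a univ, 'a univ, 'a univ, 'a univ, 'a univ, 'a univ) two_nat \<Rightarrow> 'a univ avtrans" where
  "Q_trans \<tau> = (let C = Tdom (nsrc \<tau>); D = Tcod (nsrc \<tau>) in
     \<lparr>tsrc = Q_fun (nsrc \<tau>), ttgt = Q_fun (ntgt \<tau>), tob = restrict (ncomp \<tau>) (Obj C),
      thor = (\<lambda>j\<in>Mor C. Quint (ncomp \<tau> (mdom C j)) [T1 (nsrc \<tau>) j] [T1 (ntgt \<tau>) j]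
                (ncomp \<tau> (mcod C j)) (cid D (mcomp D (ncomp \<tau> (mcod C j)) (T1 (nsrc \<tau>) j))))\<rparr>)"

definition coQ where "coQ C = co (Q (co2 C))"
definition coQ_fun where "coQ_fun T = co_fun (Q_fun (co2_fun T))"
definition coQ_trans where "coQ_trans \<tau> = co_trans (Q_trans (co2_nat \<tau>))"

definition QV_lower :: "'a univ avdc \<Rightarrow> 'a univ avdc" where
  "QV_lower K = full_sub (Q (V K)) (has_companion K)"

definition coQV_upper :: "'a univ avdc \<Rightarrow> 'a univ avdc" where
  "coQV_upper K = full_sub (coQ (V K)) (has_conjoint K)"

definition QV_lower_two_fun where
  "QV_lower_two_fun = sub_two_fun QV_lower (\<lambda>F. Q_fun (V_fun F)) (\<lambda>\<xi>. Q_trans (V_nat \<xi>))"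

definition coQV_upper_two_fun where
  "coQV_upper_two_fun =
     sub_two_fun coQV_upper (\<lambda>F. coQ_fun (V_fun F)) (\<lambda>\<xi>. coQ_trans (V_nat \<xi>))"


section \<open>The functors induced by choices of companions and of conjoints\<close>

text \<open>The cells \<open>g \<circ> j\<^sub>n \<circ> \<dots> \<circ> j\<^bsub>i+1\<^esub> \<circ> \<epsilon>\<^bsub>j\<^sub>i\<^esub>\<close> for \<open>i = 1, \<dots>, n\<close>.\<close>

primrec whiskered :: "'u avdc \<Rightarrow> ('u \<Rightarrow> 'u) \<Rightarrow> 'u \<Rightarrow> 'u list \<Rightarrow> 'u list" where
  "whiskered K \<epsilon> g [] = []"
| "whiskered K \<epsilon> g (j # js) =
     whisk K (vcomp K g (mpath_comp (V K) (vcod K j) js)) (\<epsilon> j) # whiskered K \<epsilon> g js"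

definition chosen :: "'u avdc \<Rightarrow> ('u \<Rightarrow> 'u) \<Rightarrow> 'u \<Rightarrow> 'u" where
  "chosen K \<epsilon> j = hd (hsrc K (\<epsilon> j))"

definition is_lower_star_cell ::
  "'a univ avdc \<Rightarrow> ('a univ \<Rightarrow> 'a univ) \<Rightarrow> 'a univ \<Rightarrow> 'a univ \<Rightarrow> bool" where
  "is_lower_star_cell K \<epsilon> \<phi> \<phi>' \<longleftrightarrow>
     \<phi>' \<in> Cell K \<and> hsrc K \<phi>' = map (chosen K \<epsilon>) (qjs \<phi>) \<and> htgt K \<phi>' = map (chosen K \<epsilon>) (qks \<phi>) \<and>
     vsrc K \<phi>' = qf \<phi> \<and> vtgt K \<phi>' = qg \<phi> \<and>
     foldl (hcomp K) (qc \<phi>) (whiskered K \<epsilon> (qg \<phi>) (qjs \<phi>)) =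
       ccomp K (case qks \<phi> of [] \<Rightarrow> vidc K (vid K (vcod K (qf \<phi>))) | k # _ \<Rightarrow> \<epsilon> k) [\<phi>']"

definition lower_star :: "'a univ avdc \<Rightarrow> ('a univ \<Rightarrow> 'a univ) \<Rightarrow> 'a univ avfun" where
  "lower_star K \<epsilon> = \<lparr>fdom = QV_lower K, fcod = Rep K,
     omap = (\<lambda>A\<in>Ob K. A), vmap = (\<lambda>f\<in>Ver K. f),
     hmap = (\<lambda>j\<in>Hor (QV_lower K). chosen K \<epsilon> j),
     cmap = (\<lambda>\<phi>\<in>Cell (QV_lower K). THE \<phi>'. is_lower_star_cell K \<epsilon> \<phi> \<phi>')\<rparr>"

definition upper_star :: "'a univ avdc \<Rightarrow> ('a univ \<Rightarrow> 'a univ) \<Rightarrow> 'a univ avfun" where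
  "upper_star K \<epsilon> = co_fun (lower_star (co K) \<epsilon>)"

end

theory Submission
  imports Defs
begin

text \<open>
  Composing a vertical cell \<open>k \<circ> f \<Rightarrow> g \<circ> j\<^sub>n \<circ> \<dots> \<circ> j\<^sub>1\<close> with the whiskered cells \<open>\<epsilon>\<^bsub>j\<^sub>i\<^esub>\<close> is a
    bijection
  onto the nullary cells with horizontal source \<open>(j\<^sub>1\<^sub>*, \<dots>, j\<^sub>n\<^sub>*)\<close>, vertical source \<open>k \<circ> f\<close> and
    vertical
  target \<open>g\<close>: for one companion the inverse is composition with the unit \<open>\<eta>\<^sub>j\<close> of the companion, and
  one iterates from the right.  As \<open>\<epsilon>\<^sub>k\<close> is cartesian, \<open>\<phi> \<mapsto> \<phi>\<^sub>*\<close> is therefore a bijection between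
  quintets and cells of \<open>K\<close> with the corresponding boundary.  It preserves composition by the
  interchange law.

  Consequently the axioms for \<open>(Q \<circ> V)\<^sub>*(K)\<close>, in particular the associativity of pasting, are
  inherited from \<open>K\<close>, and \<open>(-)\<^sub>*\<close> is full, faithful and the identity on objects and vertical
  morphisms; every representable horizontal morphism is isomorphic to a chosen companion, whence the
  equivalence.  Functors preserve the companion identities, so the cartesian cells determine
  isomorphisms \<open>F (j\<^sub>*) \<rightarrow> (F j)\<^sub>*\<close>, which are the structure cells of the pseudonatural
    transformation.
  The statements on conjoints follow by conjugating with the strict 2-functor \<open>co\<close>.
\<close>


section \<open>Calculus of nullary cells\<close>

text \<open>A vertical composite needs a non-empty path of cells, whereas the horizontal source of a
  cell may be empty, and the path of counits or of comparison cells over it then vanishes. For this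
  reason the inductions carry a leading vertical identity cell, which the unit axioms allow to be
  inserted and removed.

  Inheriting the axioms is not circular: the map from quintets to cells and its injectivity are
  established inside K, before anything is known about the composition of quintets. It is injective
  only for a fixed horizontal boundary, since distinct vertical morphisms may share a chosen
  companion; so each transported equation comes with a separate comparison of the horizontal
  boundaries. Statements that mention no choice of companions are proved with an auxiliary one.

  Equality of functors and of transformations is literal equality of extensional records. Hence
  every 2-categorical equation is checked on components, and a comparison cell is recognized by what
  it becomes after composition with a counit.\<close>

definition is_cell :: "'u avdc \<Rightarrow> 'u \<Rightarrow> 'u list \<Rightarrow> 'u list \<Rightarrow> 'u \<Rightarrow> 'u \<Rightarrow> bool" where
  "is_cell K f Js Ks g \<phi> \<longleftrightarrow>
     \<phi> \<in> Cell K \<and> vsrc K \<phi> = f \<and> hsrc K \<phi> = Js \<and> htgt K \<phi> = Ks \<and> vtgt K \<phi> = g"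

lemma is_cellI:
  "\<phi> \<in> Cell K \<Longrightarrow> is_cell K (vsrc K \<phi>) (hsrc K \<phi>) (htgt K \<phi>) (vtgt K \<phi>) \<phi>"
  by (simp add: is_cell_def)

lemma is_cellD:
  assumes "is_cell K f Js Ks g \<phi>"
  shows "\<phi> \<in> Cell K" "vsrc K \<phi> = f" "hsrc K \<phi> = Js" "htgt K \<phi> = Ks" "vtgt K \<phi> = g"
  using assms by (auto simp: is_cell_def)

lemma cpath_hd_last:
  "cpath K f \<phi>s g \<Longrightarrow> \<phi>s \<noteq> [] \<Longrightarrow> vsrc K (hd \<phi>s) = f \<and> vtgt K (last \<phi>s) = g"
  by (induction \<phi>s arbitrary: f) auto

context aug_virt_dbl_cat
begin

lemmas vcomp_simps [simp] = vdom_in vcod_in vid_in vdom_vid vcod_vid vcomp_in vdom_vcomp vcod_vcomp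

lemma vcomp_vid' [simp]: "f \<in> Ver K \<Longrightarrow> vdom K f = A \<Longrightarrow> vcomp K f (vid K A) = f"
  using vcomp_vid by blast

lemma vid_vcomp' [simp]: "f \<in> Ver K \<Longrightarrow> vcod K f = A \<Longrightarrow> vcomp K (vid K A) f = f"
  using vid_vcomp by blast

lemma is_cell_Ver: "is_cell K f Js Ks g \<phi> \<Longrightarrow> f \<in> Ver K \<and> g \<in> Ver K"
  unfolding is_cell_def using vsrc_in vtgt_in by blast

lemma is_cell_hpath:
  "is_cell K f Js Ks g \<phi> \<Longrightarrow> hpath K (vdom K f) Js (vdom K g) \<and> hpath K (vcod K f) Ks (vcod K g)"
  unfolding is_cell_def using hsrc_path htgt_path by blast

lemma nullary_vcod: "is_cell K f Js [] g \<phi> \<Longrightarrow> vcod K g = vcod K f"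
  using is_cell_hpath by fastforce

lemma hsrc_Nil_vdom: "is_cell K f [] Ks g \<phi> \<Longrightarrow> vdom K g = vdom K f"
  using is_cell_hpath by fastforce

section \<open>Concatenation of paths and boundaries of composites\<close>

lemma hpath_append:
  "hpath K A (Js @ Js') B \<longleftrightarrow> (\<exists>C. hpath K A Js C \<and> hpath K C Js' B)"
  by (induction Js arbitrary: A) (auto dest: hdom_in hcod_in,
      (metis hpath.simps hdom_in list.exhaust)+)

lemma hpath_ends: "hpath K A Js B \<Longrightarrow> A \<in> Ob K \<and> B \<in> Ob K"
  by (induction Js arbitrary: A) (auto dest: hdom_in)

lemma cpath_ends: "cpath K f \<phi>s g \<Longrightarrow> f \<in> Ver K \<and> g \<in> Ver K"
  by (induction \<phi>s arbitrary: f) (auto dest: vsrc_in)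

lemma cpath_append:
  "cpath K f (\<phi>s @ \<chi>s) h \<longleftrightarrow> (\<exists>g. cpath K f \<phi>s g \<and> cpath K g \<chi>s h)"
  by (induction \<phi>s arbitrary: f) (auto dest: cpath_ends)

lemma composableI:
  assumes "\<psi> \<in> Cell K" "\<phi>s \<noteq> []" "cpath K f \<phi>s g" "hsrc K \<psi> = concat (map (htgt K) \<phi>s)"
    "vdom K (vsrc K \<psi>) = vcod K f"
  shows "composable K \<psi> \<phi>s"
  using assms cpath_hd_last[OF assms(3,2)] by (auto simp: composable_def)

lemma is_cell_ccomp:
  assumes "is_cell K p Ms Ls q \<psi>" "\<phi>s \<noteq> []" "cpath K f \<phi>s g" "Ms = concat (map (htgt K) \<phi>s)"
    "vdom K p = vcod K f"
  shows "is_cell K (vcomp K p f) (concat (map (hsrc K) \<phi>s)) Ls (vcomp K q g) (ccomp K \<psi> \<phi>s)"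
proof -
  have c: "composable K \<psi> \<phi>s"
    using assms by (intro composableI) (auto simp: is_cell_def)
  have "vsrc K (hd \<phi>s) = f" "vtgt K (last \<phi>s) = g"
    using cpath_hd_last[OF assms(3,2)] by auto
  then show ?thesis
    using c assms(1) ccomp_in hsrc_ccomp htgt_ccomp vsrc_ccomp vtgt_ccomp
    by (auto simp: is_cell_def)
qed

lemma composable_1:
  assumes "is_cell K p Ks Ls q \<psi>" "is_cell K f Js Ks g \<phi>" "vdom K p = vcod K f"
  shows "composable K \<psi> [\<phi>]"
  using assms is_cell_Ver[OF assms(2)] by (intro composableI[of _ _ f g]) (auto simp: is_cell_def)

lemma is_cell_ccomp_1:
  assumes "is_cell K p Ks Ls q \<psi>" "is_cell K f Js Ks g \<phi>" "vdom K p = vcod K f"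
  shows "is_cell K (vcomp K p f) Js Ls (vcomp K q g) (ccomp K \<psi> [\<phi>])"
  using is_cell_ccomp[OF assms(1), of "[\<phi>]" f g] assms is_cell_Ver[OF assms(2)]
  by (auto simp: is_cell_def)

lemma composable_2:
  assumes "is_cell K p (Ks @ Ks') Ls q \<psi>" "is_cell K f Js Ks g \<phi>" "is_cell K g Js' Ks' h \<phi>'"
    "vdom K p = vcod K f"
  shows "composable K \<psi> [\<phi>, \<phi>']"
  using assms is_cell_Ver[OF assms(3)] by (intro composableI[of _ _ f h]) (auto simp: is_cell_def)

lemma is_cell_ccomp_2:
  assumes "is_cell K p (Ks @ Ks') Ls q \<psi>" "is_cell K f Js Ks g \<phi>" "is_cell K g Js' Ks' h \<phi>'"
    "vdom K p = vcod K f"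
  shows "is_cell K (vcomp K p f) (Js @ Js') Ls (vcomp K q h) (ccomp K \<psi> [\<phi>, \<phi>'])"
  using is_cell_ccomp[OF assms(1), of "[\<phi>, \<phi>']" f h] assms is_cell_Ver[OF assms(3)]
  by (auto simp: is_cell_def)

section \<open>Identity cells, associativity and unit laws\<close>

lemma is_cell_vidc: "f \<in> Ver K \<Longrightarrow> is_cell K f [] [] f (vidc K f)"
  by (simp add: is_cell_def vidc_in hsrc_vidc htgt_vidc vsrc_vidc vtgt_vidc)

lemma is_cell_hidc: "J \<in> Hor K \<Longrightarrow> is_cell K (vid K (hdom K J)) [J] [J] (vid K (hcod K J)) (hidc K J)"
  by (simp add: is_cell_def hidc_in hsrc_hidc htgt_hidc vsrc_hidc vtgt_hidc)

text \<open>The associativity axiom asks that all composites on both sides make sense. For a single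
  inner cell, two of these four conditions follow from the other two by comparing boundaries, so
  that only those two have to be checked in later rewriting.\<close>

lemma ccomp_assoc_1:
  assumes "composable K \<chi> [\<psi>]" "composable K \<psi> \<phi>s"
  shows "ccomp K \<chi> [ccomp K \<psi> \<phi>s] = ccomp K (ccomp K \<chi> [\<psi>]) \<phi>s"
proof -
  note D = assms[unfolded composable_def]
  let ?f = "vsrc K (hd \<phi>s)" and ?g = "vtgt K (last \<phi>s)"
  have fg: "?f \<in> Ver K" "?g \<in> Ver K" using D cpath_ends by blast+
  have ps: "is_cell K (vsrc K \<psi>) (hsrc K \<psi>) (htgt K \<psi>) (vtgt K \<psi>) \<psi>" using D by
    (simp add: is_cell_def)
  have ch: "is_cell K (vsrc K \<chi>) (htgt K \<psi>) (htgt K \<chi>) (vtgt K \<chi>) \<chi>" using D by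
    (simp add: is_cell_def)
  have pp: "is_cell K (vcomp K (vsrc K \<psi>) ?f) (concat (map (hsrc K) \<phi>s)) (htgt K \<psi>)
       (vcomp K (vtgt K \<psi>) ?g) (ccomp K \<psi> \<phi>s)"
    by (rule is_cell_ccomp[OF ps]) (use D in auto)
  note cp = is_cell_ccomp_1[OF ch ps]
  have 1: "composable K \<chi> [ccomp K \<psi> \<phi>s]"
    using D fg is_cell_Ver[OF ps] by (intro composable_1[OF ch pp]) auto
  have cp': "is_cell K (vcomp K (vsrc K \<chi>) (vsrc K \<psi>)) (hsrc K \<psi>) (htgt K \<chi>)
      (vcomp K (vtgt K \<chi>) (vtgt K \<psi>)) (ccomp K \<chi> [\<psi>])"
    using D by (intro cp) auto
  have 2: "composable K (ccomp K \<chi> [\<psi>]) \<phi>s"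
    using D is_cellD[OF cp'] is_cell_Ver[OF ps] is_cell_Ver[OF ch]
    by (intro composableI[of _ _ ?f ?g]) auto
  show ?thesis using ccomp_assoc[of "[\<psi>]" "[\<phi>s]" \<chi>] assms 1 2 by simp
qed

text \<open>Composability of the outer cell ensures that \<psi> and \<psi>' meet, but it says
  nothing about the vertical morphisms at which \<phi>s ends and \<phi>s' starts. The condition
  \<open>m\<close> makes their concatenation a path of cells.\<close>

lemma ccomp_assoc_2:
  assumes c: "composable K \<chi> [\<psi>, \<psi>']" and d: "composable K \<psi> \<phi>s" "composable K \<psi>' \<phi>s'"
    and m: "vtgt K (last \<phi>s) = vsrc K (hd \<phi>s')"
  shows "ccomp K \<chi> [ccomp K \<psi> \<phi>s, ccomp K \<psi>' \<phi>s'] = ccomp K (ccomp K \<chi> [\<psi>, \<psi>']) (\<phi>s @ \<phi>s')"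
proof -
  note D = c[unfolded composable_def] d[unfolded composable_def]
  let ?f = "vsrc K (hd \<phi>s)" and ?g = "vtgt K (last \<phi>s)" and ?h = "vtgt K (last \<phi>s')"
  have fg: "?f \<in> Ver K" "?g \<in> Ver K" "?h \<in> Ver K" using D cpath_ends by blast+
  have ps: "is_cell K (vsrc K \<psi>) (hsrc K \<psi>) (htgt K \<psi>) (vtgt K \<psi>) \<psi>"
    and ps': "is_cell K (vtgt K \<psi>) (hsrc K \<psi>') (htgt K \<psi>') (vtgt K \<psi>') \<psi>'"
    using D by (simp_all add: is_cell_def)
  have ch: "is_cell K (vsrc K \<chi>) (htgt K \<psi> @ htgt K \<psi>') (htgt K \<chi>) (vtgt K \<chi>) \<chi>"
    using D by (simp add: is_cell_def)
  have pp: "is_cell K (vcomp K (vsrc K \<psi>) ?f) (concat (map (hsrc K) \<phi>s)) (htgt K \<psi>)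
       (vcomp K (vtgt K \<psi>) ?g) (ccomp K \<psi> \<phi>s)"
    using D by (intro is_cell_ccomp[OF ps]) simp_all
  have pp': "is_cell K (vcomp K (vtgt K \<psi>) ?g) (concat (map (hsrc K) \<phi>s')) (htgt K \<psi>')
       (vcomp K (vtgt K \<psi>') ?h) (ccomp K \<psi>' \<phi>s')"
    using D m by (intro is_cell_ccomp[OF ps']) auto
  have 1: "composable K \<chi> [ccomp K \<psi> \<phi>s, ccomp K \<psi>' \<phi>s']"
    using D ch fg is_cell_Ver[OF ps] by (intro composable_2[OF ch pp pp']) auto
  have cp: "is_cell K (vcomp K (vsrc K \<chi>) (vsrc K \<psi>)) (hsrc K \<psi> @ hsrc K \<psi>') (htgt K \<chi>)
      (vcomp K (vtgt K \<chi>) (vtgt K \<psi>')) (ccomp K \<chi> [\<psi>, \<psi>'])"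
    using D by (intro is_cell_ccomp_2[OF ch ps ps']) auto
  have 2: "composable K (ccomp K \<chi> [\<psi>, \<psi>']) (\<phi>s @ \<phi>s')"
    using D m is_cellD[OF cp] is_cell_Ver[OF ps] is_cell_Ver[OF ch]
    by (intro composableI[of _ _ ?f ?h]) (auto simp: cpath_append)
  show ?thesis using ccomp_assoc[of "[\<psi>, \<psi>']" "[\<phi>s, \<phi>s']" \<chi>] assms 1 2 by simp
qed

text \<open>The unit axiom at the front of the path, the case i = 0. It is the device by which empty
  paths of cells are made non-empty later on.\<close>

lemma ccomp_vidc_Cons:
  assumes "composable K \<psi> \<phi>s"
  shows "ccomp K \<psi> (vidc K (vsrc K (hd \<phi>s)) # \<phi>s) = ccomp K \<psi> \<phi>s"
  using ccomp_insert_vidc[of \<psi> "[]" \<phi>s] assms cpath_ends by (fastforce simp: composable_def)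

lemma ccomp_vidc_snoc:
  assumes "composable K \<psi> \<phi>s"
  shows "ccomp K \<psi> (\<phi>s @ [vidc K (vtgt K (last \<phi>s))]) = ccomp K \<psi> \<phi>s"
  using ccomp_insert_vidc[of \<psi> \<phi>s "[]"] assms cpath_ends by (fastforce simp: composable_def)

lemma vidc_is_cell_ccomp: "is_cell K f Js [] g \<phi> \<Longrightarrow> C = vcod K f \<Longrightarrow> ccomp K (vidc K (vid K C)) [\<phi>]
  = \<phi>"
  using vidc_ccomp by (auto simp: is_cell_def)

lemma hidc_is_cell_ccomp: "is_cell K f Js [J] g \<phi> \<Longrightarrow> ccomp K (hidc K J) [\<phi>] = \<phi>"
  using hidc_ccomp by (auto simp: is_cell_def)

lemma is_cell_ccomp_vidc:
  "is_cell K f [] Ks g \<phi> \<Longrightarrow> A = vdom K f \<Longrightarrow> ccomp K \<phi> [vidc K (vid K A)] = \<phi>"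
  using ccomp_vidc by (auto simp: is_cell_def)

lemma is_cell_ccomp_hidc:
  "is_cell K f [J] Ks g \<phi> \<Longrightarrow> ccomp K \<phi> [hidc K J] = \<phi>"
  using ccomp_hidc[of \<phi>] by (auto simp: is_cell_def)

section \<open>Horizontal composition of nullary cells and whiskering\<close>

lemma hcomp_nullary:
  "is_cell K f Js [] g \<alpha> \<Longrightarrow> is_cell K g Ls [] h \<beta> \<Longrightarrow>
    hcomp K \<alpha> \<beta> = ccomp K (vidc K (vid K (vcod K f))) [\<alpha>, \<beta>]"
  by (simp add: hcomp_def path_id_def is_cell_def)

lemma is_cell_hcomp:
  assumes a: "is_cell K f Js [] g \<alpha>" and b: "is_cell K g Ls [] h \<beta>"
  shows "is_cell K f (Js @ Ls) [] h (hcomp K \<alpha> \<beta>)"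
proof -
  have v: "f \<in> Ver K" "g \<in> Ver K" "h \<in> Ver K" "vcod K g = vcod K f" "vcod K h = vcod K f"
    using is_cell_Ver[OF a] is_cell_Ver[OF b] nullary_vcod[OF a] nullary_vcod[OF b] by auto
  have "is_cell K (vcomp K (vid K (vcod K f)) f) (Js @ Ls) [] (vcomp K (vid K (vcod K f)) h)
      (ccomp K (vidc K (vid K (vcod K f))) [\<alpha>, \<beta>])"
    by (rule is_cell_ccomp_2[OF _ a b]) (use v is_cell_vidc in auto)
  then show ?thesis using v hcomp_nullary[OF a b] by simp
qed

text \<open>The unit axiom deletes the identity from the pair of composed cells, and what remains is
  composition with id_C.\<close>

lemma hcomp_vidc_left:
  assumes a: "is_cell K f Js [] g \<alpha>"
  shows "hcomp K (vidc K f) \<alpha> = \<alpha>"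
proof -
  have v: "f \<in> Ver K" using is_cell_Ver[OF a] by auto
  have c: "composable K (vidc K (vid K (vcod K f))) [\<alpha>]"
    by (rule composable_1[OF is_cell_vidc a]) (use v in auto)
  show ?thesis
    using hcomp_nullary[OF is_cell_vidc[OF v] a] ccomp_vidc_Cons[OF c] vidc_is_cell_ccomp[OF a]
    by (simp add: is_cellD[OF a])
qed

lemma hcomp_vidc_right:
  assumes a: "is_cell K f Js [] g \<alpha>"
  shows "hcomp K \<alpha> (vidc K g) = \<alpha>"
proof -
  have v: "f \<in> Ver K" "g \<in> Ver K" using is_cell_Ver[OF a] by auto
  have c: "composable K (vidc K (vid K (vcod K f))) [\<alpha>]"
    by (rule composable_1[OF is_cell_vidc a]) (use v in auto)
  show ?thesis
    using hcomp_nullary[OF a is_cell_vidc[OF v(2)]] ccomp_vidc_snoc[OF c] vidc_is_cell_ccomp[OF a]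
    by (simp add: is_cellD[OF a])
qed

text \<open>Associativity with outer cell id_C, since \<alpha> \<odot> \<beta> is id_C \<circ>
  (\<alpha>, \<beta>). Associativity of \<odot>, the distributivity of whiskering and the
  interchange laws are all read off from this exchange of the two compositions.\<close>

lemma hcomp_ccomp:
  assumes a: "is_cell K f Js [] g \<alpha>" and b: "is_cell K g Ls [] h \<beta>"
    and c: "composable K \<alpha> \<phi>s" "composable K \<beta> \<psi>s"
    and m: "vtgt K (last \<phi>s) = vsrc K (hd \<psi>s)"
  shows "ccomp K (hcomp K \<alpha> \<beta>) (\<phi>s @ \<psi>s) = hcomp K (ccomp K \<alpha> \<phi>s) (ccomp K \<beta> \<psi>s)"
proof -
  note D = c[unfolded composable_def]
  have v: "f \<in> Ver K" "g \<in> Ver K" "h \<in> Ver K" "vcod K g = vcod K f" "vcod K h = vcod K f"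
    using is_cell_Ver[OF a] is_cell_Ver[OF b] nullary_vcod[OF a] nullary_vcod[OF b] by auto
  have w: "vsrc K (hd \<phi>s) \<in> Ver K" using D cpath_ends by blast
  have i: "is_cell K (vid K (vcod K f)) [] [] (vid K (vcod K f)) (vidc K (vid K (vcod K f)))"
    using v is_cell_vidc by simp
  have 1: "composable K (vidc K (vid K (vcod K f))) [\<alpha>, \<beta>]"
    by (rule composable_2[OF _ a b]) (use v i in auto)
  have 2: "hcomp K (ccomp K \<alpha> \<phi>s) (ccomp K \<beta> \<psi>s) =
     ccomp K (vidc K (vid K (vcod K f))) [ccomp K \<alpha> \<phi>s, ccomp K \<beta> \<psi>s]"
    using c a b v w D
    by (simp add: hcomp_def path_id_def is_cell_def htgt_ccomp vsrc_ccomp)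
  show ?thesis
    unfolding 2 hcomp_nullary[OF a b] using ccomp_assoc_2[OF 1 c m] by simp
qed

lemma hcomp_assoc:
  assumes a: "is_cell K f Js [] g \<alpha>" and b: "is_cell K g Ls [] h \<beta>" and d: "is_cell K h Ms [] k \<gamma>"
  shows "hcomp K (hcomp K \<alpha> \<beta>) \<gamma> = hcomp K \<alpha> (hcomp K \<beta> \<gamma>)"
proof -
  have v: "f \<in> Ver K" "g \<in> Ver K" "h \<in> Ver K" "vcod K g = vcod K f" "vcod K h = vcod K f"
    using is_cell_Ver[OF a] is_cell_Ver[OF b] nullary_vcod[OF a] nullary_vcod[OF b] by auto
  let ?i = "vidc K (vid K (vcod K f))"
  have i: "is_cell K (vid K (vcod K f)) [] [] (vid K (vcod K f)) ?i" using v is_cell_vidc by simp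
  have ic: "composable K ?i [\<alpha>]" "composable K ?i [\<gamma>]"
    "composable K ?i [\<alpha>, \<beta>]" "composable K ?i [\<beta>, \<gamma>]"
    using v i by (auto intro: composable_1[OF i a] composable_1[OF i d]
        composable_2[OF _ a b] composable_2[OF _ b d])
  have "hcomp K (hcomp K \<alpha> \<beta>) \<gamma> = hcomp K (ccomp K ?i [\<alpha>, \<beta>]) (ccomp K ?i [\<gamma>])"
    using hcomp_nullary[OF a b] vidc_is_cell_ccomp[OF d] v by simp
  \<comment> \<open>Both bracketings are id_C \<odot> id_C applied to the same path of three cells;
    only the place where that path is cut changes.\<close>
  also have "\<dots> = ccomp K (hcomp K ?i ?i) ([\<alpha>, \<beta>] @ [\<gamma>])"
    by (rule hcomp_ccomp[symmetric, OF i i]) (use ic is_cellD[OF b] is_cellD[OF d] in auto)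
  also have "\<dots> = ccomp K (hcomp K ?i ?i) ([\<alpha>] @ [\<beta>, \<gamma>])" by simp
  also have "\<dots> = hcomp K (ccomp K ?i [\<alpha>]) (ccomp K ?i [\<beta>, \<gamma>])"
    by (rule hcomp_ccomp[OF i i]) (use ic is_cellD[OF b] is_cellD[OF a] in auto)
  also have "\<dots> = hcomp K \<alpha> (hcomp K \<beta> \<gamma>)"
    using hcomp_nullary[OF b d] vidc_is_cell_ccomp[OF a] v by simp
  finally show ?thesis .
qed

lemma is_cell_whisk:
  assumes "is_cell K f Js [] g \<alpha>" "h \<in> Ver K" "vdom K h = vcod K f"
  shows "is_cell K (vcomp K h f) Js [] (vcomp K h g) (whisk K h \<alpha>)"
  unfolding whisk_def using assms by (intro is_cell_ccomp_1[OF is_cell_vidc]) auto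

lemma whisk_vidc:
  "f \<in> Ver K \<Longrightarrow> h \<in> Ver K \<Longrightarrow> vdom K h = vcod K f \<Longrightarrow> whisk K h (vidc K f) = vidc K (vcomp K h f)"
  by (simp add: whisk_def vidc_vidc)

lemma whisk_ccomp:
  assumes a: "is_cell K f Js [] g \<alpha>" and h: "h \<in> Ver K" "vdom K h = vcod K f"
    and c: "composable K \<alpha> \<phi>s"
  shows "whisk K h (ccomp K \<alpha> \<phi>s) = ccomp K (whisk K h \<alpha>) \<phi>s"
  unfolding whisk_def
  by (rule ccomp_assoc_1[OF composable_1[OF is_cell_vidc a]]) (use h c in auto)

lemma whisk_whisk:
  assumes a: "is_cell K f Js [] g \<alpha>" and h: "h \<in> Ver K" "vdom K h = vcod K f"
    "k \<in> Ver K" "vdom K k = vcod K h"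
  shows "whisk K k (whisk K h \<alpha>) = whisk K (vcomp K k h) \<alpha>"
proof -
  have "whisk K k (whisk K h \<alpha>) = ccomp K (whisk K k (vidc K h)) [\<alpha>]"
    unfolding whisk_def[of K h]
    by (rule whisk_ccomp[OF is_cell_vidc]) (use h in \<open>auto intro!: composable_1[OF is_cell_vidc a]\<close>)
  then show ?thesis using h by (simp add: whisk_vidc whisk_def[of K "vcomp K k h"])
qed

lemma whisk_vid: "is_cell K f Js [] g \<alpha> \<Longrightarrow> C = vcod K f \<Longrightarrow> whisk K (vid K C) \<alpha> = \<alpha>"
  unfolding whisk_def by (rule vidc_is_cell_ccomp)

lemma whisk_hcomp:
  assumes a: "is_cell K f Js [] g \<alpha>" and b: "is_cell K g Ls [] k \<beta>"
    and h: "h \<in> Ver K" "vdom K h = vcod K f"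
  shows "whisk K h (hcomp K \<alpha> \<beta>) = hcomp K (whisk K h \<alpha>) (whisk K h \<beta>)"
proof -
  have v: "f \<in> Ver K" "g \<in> Ver K" "vcod K g = vcod K f"
    using is_cell_Ver[OF a] nullary_vcod[OF a] by auto
  note iv = is_cell_vidc[OF h(1)]
  have i: "is_cell K (vid K (vcod K f)) [] [] (vid K (vcod K f)) (vidc K (vid K (vcod K f)))"
    using v is_cell_vidc by simp
  have "hcomp K (whisk K h \<alpha>) (whisk K h \<beta>) = ccomp K (hcomp K (vidc K h) (vidc K h)) ([\<alpha>] @ [\<beta>])"
    unfolding whisk_def
    by (rule hcomp_ccomp[symmetric, OF iv iv])
      (use v h is_cellD[OF a] is_cellD[OF b]
        in \<open>auto intro!: composable_1[OF iv a] composable_1[OF iv b]\<close>)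
  \<comment> \<open>By the unit laws id_h \<odot> id_h and id_h \<circ> id_C are both equal to
    id_h.\<close>
  also have "\<dots> = ccomp K (ccomp K (vidc K h) [vidc K (vid K (vcod K f))]) [\<alpha>, \<beta>]"
    using hcomp_vidc_left[OF iv] is_cell_ccomp_vidc[OF iv] h v by simp
  also have "\<dots> = whisk K h (hcomp K \<alpha> \<beta>)"
    unfolding whisk_def hcomp_nullary[OF a b]
    by (rule ccomp_assoc_1[symmetric])
      (use h v i in \<open>auto intro!: composable_1[OF iv i] composable_2[OF _ a b]\<close>)
  finally show ?thesis by simp
qed

text \<open>Write \<gamma> as \<gamma> \<odot> id_q and put id_f in front of \<alpha>. Exchanging
  the two compositions then applies \<gamma> at the vertical source of \<alpha> first, and \<alpha>
  whiskered with q afterwards.\<close>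

lemma interchange_left:
  assumes c: "is_cell K p [] [] q \<gamma>" and a: "is_cell K f Js [] g \<alpha>" and m: "vcod K f = vdom K p"
  shows "ccomp K \<gamma> [\<alpha>] = hcomp K (ccomp K \<gamma> [vidc K f]) (whisk K q \<alpha>)"
proof -
  have v: "f \<in> Ver K" "g \<in> Ver K" "p \<in> Ver K" "q \<in> Ver K" "vdom K q = vdom K p"
    using is_cell_Ver[OF a] is_cell_Ver[OF c] hsrc_Nil_vdom[OF c] by auto
  have ca: "composable K \<gamma> [\<alpha>]" using m by (intro composable_1[OF c a]) auto
  have "hcomp K (ccomp K \<gamma> [vidc K f]) (whisk K q \<alpha>)
    = ccomp K (hcomp K \<gamma> (vidc K q)) ([vidc K f] @ [\<alpha>])"
    unfolding whisk_def
    by (rule hcomp_ccomp[symmetric, OF c is_cell_vidc])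
      (use v m is_cellD[OF a] in \<open>auto simp: vtgt_vidc intro!: composable_1[OF c is_cell_vidc]
        composable_1[OF is_cell_vidc a]\<close>)
  also have "\<dots> = ccomp K \<gamma> [\<alpha>]"
    using hcomp_vidc_right[OF c] ccomp_vidc_Cons[OF ca] is_cellD[OF a] by simp
  finally show ?thesis by simp
qed

text \<open>The mirror image, with \<gamma> = id_p \<odot> \<gamma> and id_g behind \<alpha>.
  Together the two forms let a vertical cell be moved past a nullary one.\<close>

lemma interchange_right:
  assumes c: "is_cell K p [] [] q \<gamma>" and a: "is_cell K f Js [] g \<alpha>" and m: "vcod K f = vdom K p"
  shows "ccomp K \<gamma> [\<alpha>] = hcomp K (whisk K p \<alpha>) (ccomp K \<gamma> [vidc K g])"
proof -
  have v: "f \<in> Ver K" "g \<in> Ver K" "p \<in> Ver K" "q \<in> Ver K" "vdom K q = vdom K p" "vcod K g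
    = vcod K f"
    using is_cell_Ver[OF a] is_cell_Ver[OF c] hsrc_Nil_vdom[OF c] nullary_vcod[OF a] by auto
  have ca: "composable K \<gamma> [\<alpha>]" using m by (intro composable_1[OF c a]) auto
  have "hcomp K (whisk K p \<alpha>) (ccomp K \<gamma> [vidc K g])
    = ccomp K (hcomp K (vidc K p) \<gamma>) ([\<alpha>] @ [vidc K g])"
    unfolding whisk_def
    by (rule hcomp_ccomp[symmetric, OF is_cell_vidc c])
      (use v m is_cellD[OF a] in \<open>auto simp: vsrc_vidc intro!: composable_1[OF c is_cell_vidc]
        composable_1[OF is_cell_vidc a]\<close>)
  also have "\<dots> = ccomp K \<gamma> [\<alpha>]"
    using hcomp_vidc_left[OF c] ccomp_vidc_snoc[OF ca] is_cellD[OF a] by simp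
  finally show ?thesis by simp
qed

end


section \<open>Companions\<close>

text \<open>Companions in equational form: counit, unit and the two companion identities. Unlike the
  universal property of a cartesian cell these equations are visibly preserved by functors, and they
  give explicit formulas for factorizations.\<close>

definition companion_pair :: "'u avdc \<Rightarrow> 'u \<Rightarrow> 'u \<Rightarrow> 'u \<Rightarrow> 'u \<Rightarrow> bool" where
  "companion_pair K j J \<epsilon> \<eta> \<longleftrightarrow> j \<in> Ver K \<and> J \<in> Hor K \<and>
     is_cell K j [J] [] (vid K (vcod K j)) \<epsilon> \<and> is_cell K (vid K (vdom K j)) [] [J] j \<eta> \<and>
     ccomp K \<epsilon> [\<eta>] = vidc K j \<and> ccomp K (hidc K J) [\<eta>, \<epsilon>] = hidc K J"

context aug_virt_dbl_cat
begin

lemma companion_counit_ends: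
  assumes "is_cell K j [J] [] (vid K (vcod K j)) \<epsilon>"
  shows "j \<in> Ver K" "J \<in> Hor K" "hdom K J = vdom K j" "hcod K J = vcod K j"
  using assms is_cell_Ver[OF assms] is_cell_hpath[OF assms] by auto

text \<open>The factorization of \<chi> through \<epsilon> is id_J \<circ> (\<eta> \<circ> h,
  \<chi>). It rests on \<epsilon> \<circ> \<eta> = id_j alone, because
  \<open>companion_cell_pair\<close> uses it to derive the second companion identity.\<close>

lemma companion_unit_beta:
  assumes e: "is_cell K j [J] [] (vid K (vcod K j)) \<epsilon>"
    and u: "is_cell K (vid K (vdom K j)) [] [J] j \<eta>" "ccomp K \<epsilon> [\<eta>] = vidc K j"
    and x: "is_cell K (vcomp K j h) Hs [] k \<chi>" and h: "h \<in> Ver K" "vcod K h = vdom K j"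
  shows "is_cell K h Hs [J] k (ccomp K (hidc K J) [ccomp K \<eta> [vidc K h], \<chi>])"
    and "ccomp K \<epsilon> [ccomp K (hidc K J) [ccomp K \<eta> [vidc K h], \<chi>]] = \<chi>"
proof -
  note E = companion_counit_ends[OF e]
  have k: "k \<in> Ver K" "vcod K k = vcod K j"
    using is_cell_Ver[OF x] nullary_vcod[OF x] E h by auto
  have uh: "is_cell K h [] [J] (vcomp K j h) (ccomp K \<eta> [vidc K h])"
    using is_cell_ccomp_1[OF u(1) is_cell_vidc[OF h(1)]] E h by simp
  note i = is_cell_hidc[OF E(2)]
  have i': "is_cell K (vid K (hdom K J)) ([J] @ []) [J] (vid K (hcod K J)) (hidc K J)"
    using i by simp
  show c: "is_cell K h Hs [J] k (ccomp K (hidc K J) [ccomp K \<eta> [vidc K h], \<chi>])"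
    using is_cell_ccomp_2[OF i' uh x] E h k by simp
  have cc: "composable K (hidc K J) [ccomp K \<eta> [vidc K h], \<chi>]"
    by (rule composable_2[OF i' uh x]) (use E h in simp)
  have "ccomp K \<epsilon> [ccomp K (hidc K J) [ccomp K \<eta> [vidc K h], \<chi>]] =
      ccomp K (ccomp K \<epsilon> [hidc K J]) [ccomp K \<eta> [vidc K h], \<chi>]"
    by (rule ccomp_assoc_1[OF composable_1[OF e i] cc]) (use E in simp)
  \<comment> \<open>Writing \<epsilon> as \<epsilon> \<odot> id separates the two cells of the path:
    \<epsilon> meets \<eta> \<circ> h, and an identity meets \<chi>.\<close>
  also have "\<dots> = ccomp K (hcomp K \<epsilon> (vidc K (vid K (vcod K j)))) ([ccomp K \<eta> [vidc K h]] @ [\<chi>])"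
    using is_cell_ccomp_hidc[OF e] hcomp_vidc_right[OF e] by simp
  also have "\<dots> = hcomp K (ccomp K \<epsilon> [ccomp K \<eta> [vidc K h]]) (ccomp K (vidc K (vid K (vcod K j)))
    [\<chi>])"
    by (rule hcomp_ccomp[OF e is_cell_vidc])
      (use E h k is_cellD[OF uh] is_cellD[OF x] in
        \<open>auto intro!: composable_1[OF e uh] composable_1[OF is_cell_vidc x]\<close>)
  also have "ccomp K (vidc K (vid K (vcod K j))) [\<chi>] = \<chi>"
    using vidc_is_cell_ccomp[OF x] E h by simp
  also have "ccomp K \<epsilon> [ccomp K \<eta> [vidc K h]] = ccomp K (ccomp K \<epsilon> [\<eta>]) [vidc K h]"
    by (rule ccomp_assoc_1)
      (use E h in \<open>auto intro!: composable_1[OF e u(1)] composable_1[OF u(1) is_cell_vidc]\<close>)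
  also have "\<dots> = vidc K (vcomp K j h)"
    using E h u(2) by (simp add: vidc_vidc)
  also have "hcomp K (vidc K (vcomp K j h)) \<chi> = \<chi>" by (rule hcomp_vidc_left[OF x])
  finally show "ccomp K \<epsilon> [ccomp K (hidc K J) [ccomp K \<eta> [vidc K h], \<chi>]] = \<chi>" .
qed

lemma companion_factor:
  assumes cp: "companion_pair K j J \<epsilon> \<eta>"
    and x: "is_cell K (vcomp K j h) Hs [] k \<chi>" and h: "h \<in> Ver K" "vcod K h = vdom K j"
  shows "\<exists>!\<phi>. is_cell K h Hs [J] k \<phi> \<and> ccomp K \<epsilon> [\<phi>] = \<chi>"
proof -
  have e: "is_cell K j [J] [] (vid K (vcod K j)) \<epsilon>"
    and u: "is_cell K (vid K (vdom K j)) [] [J] j \<eta>" "ccomp K \<epsilon> [\<eta>] = vidc K j"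
    and ue: "ccomp K (hidc K J) [\<eta>, \<epsilon>] = hidc K J"
    using cp by (auto simp: companion_pair_def)
  note E = companion_counit_ends[OF e]
  note i = is_cell_hidc[OF E(2)]
  have i': "is_cell K (vid K (hdom K J)) ([J] @ []) [J] (vid K (hcod K J)) (hidc K J)"
    using i by simp
  have "\<phi> = ccomp K (hidc K J) [ccomp K \<eta> [vidc K h], \<chi>]"
    if f: "is_cell K h Hs [J] k \<phi>" and fx: "ccomp K \<epsilon> [\<phi>] = \<chi>" for \<phi>
  proof -
    have c: "composable K (hidc K J) [\<phi>]"
      by (rule composable_1[OF i f]) (use E h in simp)
    \<comment> \<open>Uniqueness: the second companion identity recovers \<phi> from \<epsilon>
      \<circ> \<phi>.\<close>
    have "\<phi> = ccomp K (ccomp K (hidc K J) [\<eta>, \<epsilon>]) [\<phi>]"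
      using hidc_is_cell_ccomp[OF f] ue by simp
    also have "\<dots> = ccomp K (ccomp K (hidc K J) [\<eta>, \<epsilon>]) ([vidc K h] @ [\<phi>])"
      using ccomp_vidc_Cons[OF c] is_cellD[OF f] ue by simp
    also have "\<dots> = ccomp K (hidc K J) [ccomp K \<eta> [vidc K h], ccomp K \<epsilon> [\<phi>]]"
      by (rule ccomp_assoc_2[symmetric])
        (use E h is_cellD[OF f] in \<open>auto simp: vtgt_vidc intro!: composable_2[OF i' u(1) e]
          composable_1[OF u(1) is_cell_vidc] composable_1[OF e f]\<close>)
    finally show ?thesis using fx by simp
  qed
  then show ?thesis using companion_unit_beta[OF e u x h] by metis
qed

lemma companion_pair_cell:
  assumes cp: "companion_pair K j J \<epsilon> \<eta>"
  shows "companion_cell K j \<epsilon>"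
proof -
  have e: "is_cell K j [J] [] (vid K (vcod K j)) \<epsilon>"
    using cp by (auto simp: companion_pair_def)
  note E = companion_counit_ends[OF e] is_cellD[OF e]
  have "\<exists>!\<phi>. \<phi> \<in> Cell K \<and> hsrc K \<phi> = hsrc K \<chi> \<and> htgt K \<phi> = hsrc K \<epsilon> \<and>
              vsrc K \<phi> = h \<and> vtgt K \<phi> = k \<and> \<chi> = ccomp K \<epsilon> [\<phi>]"
    if "\<chi> \<in> Cell K" "h \<in> Ver K" "k \<in> Ver K" "vcod K h = vdom K (vsrc K \<epsilon>)"
      "vcod K k = vdom K (vtgt K \<epsilon>)" "htgt K \<chi> = htgt K \<epsilon>"
      "vsrc K \<chi> = vcomp K (vsrc K \<epsilon>) h" "vtgt K \<chi> = vcomp K (vtgt K \<epsilon>) k" for \<chi> h k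
  proof -
    have x: "is_cell K (vcomp K j h) (hsrc K \<chi>) [] k \<chi>"
      using that E by (auto simp: is_cell_def)
    show ?thesis
      using companion_factor[OF cp x] that E unfolding is_cell_def by (simp add: conj_ac eq_commute)
  qed
  then show ?thesis using E by (auto simp: companion_cell_def cartesian_def)
qed

text \<open>The unit is the factorization of id_j through the cartesian cell \<epsilon>. The second
  identity is an instance of uniqueness, as id_J \<circ> (\<eta>, \<epsilon>) and id_J are both
  factorizations of \<epsilon> through itself.\<close>

lemma companion_cell_pair:
  assumes "companion_cell K j \<epsilon>"
  shows "\<exists>\<eta>. companion_pair K j (hd (hsrc K \<epsilon>)) \<epsilon> \<eta>"
proof -
  have j: "j \<in> Ver K" and cart: "cartesian K \<epsilon>" using assms by (auto simp: companion_cell_def)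
  define J where "J = hd (hsrc K \<epsilon>)"
  have "hsrc K \<epsilon> = [J]"
    using assms by (cases "hsrc K \<epsilon>") (auto simp: companion_cell_def J_def)
  then have e: "is_cell K j [J] [] (vid K (vcod K j)) \<epsilon>"
    using assms by (auto simp: companion_cell_def cartesian_def is_cell_def)
  note E = companion_counit_ends[OF e]
  have fac: "\<exists>!\<phi>. is_cell K h Hs [J] k \<phi> \<and> ccomp K \<epsilon> [\<phi>] = \<chi>"
    if x: "is_cell K (vcomp K j h) Hs [] k \<chi>" and h: "h \<in> Ver K" "vcod K h = vdom K j" for \<chi> h Hs k
  proof -
    have "k \<in> Ver K" "vcod K k = vcod K j"
      using is_cell_Ver[OF x] nullary_vcod[OF x] h E by auto
    then have "\<exists>!\<phi>. \<phi> \<in> Cell K \<and> hsrc K \<phi> = hsrc K \<chi> \<and> htgt K \<phi> = hsrc K \<epsilon> \<and>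
              vsrc K \<phi> = h \<and> vtgt K \<phi> = k \<and> \<chi> = ccomp K \<epsilon> [\<phi>]"
      using cart[unfolded cartesian_def, THEN conjunct2, THEN conjunct2, rule_format, of \<chi> h k]
        h E is_cellD[OF x] is_cellD[OF e] by simp
    then show ?thesis using is_cellD[OF x] is_cellD[OF e]
      unfolding is_cell_def by (simp add: conj_ac eq_commute)
  qed
  have "is_cell K (vcomp K j (vid K (vdom K j))) [] [] j (vidc K j)"
    using is_cell_vidc j by simp
  from fac[OF this] obtain \<eta> where u: "is_cell K (vid K (vdom K j)) [] [J] j \<eta>" "ccomp K \<epsilon> [\<eta>]
    = vidc K j"
    using j by auto
  have e': "is_cell K (vcomp K j (vid K (vdom K j))) [J] [] (vid K (vcod K j)) \<epsilon>"
    using e j by simp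
  note ub = companion_unit_beta[OF e u e']
  have eta: "ccomp K \<eta> [vidc K (vid K (vdom K j))] = \<eta>"
    using is_cell_ccomp_vidc[OF u(1)] j by simp
  have "is_cell K (vid K (vdom K j)) [J] [J] (vid K (vcod K j)) (hidc K J)"
    using is_cell_hidc[OF E(2)] E by simp
  with fac[OF e'] ub have "ccomp K (hidc K J) [\<eta>, \<epsilon>] = hidc K J"
    using j is_cell_ccomp_hidc[OF e] eta by auto
  then show ?thesis using e u E unfolding companion_pair_def J_def[symmetric] by blast
qed

section \<open>Transposition along a companion\<close>

lemma cpath_hidc:
  "hpath K A Hs B \<Longrightarrow> cpath K (vid K A) (map (hidc K) Hs) (vid K B)"
  by (induction Hs arbitrary: A) (auto simp: hidc_in vsrc_hidc vtgt_hidc)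

lemma concat_htgt_hidc: "set Hs \<subseteq> Hor K \<Longrightarrow> concat (map (htgt K) (map (hidc K) Hs)) = Hs"
  by (induction Hs) (auto simp: htgt_hidc)

lemma concat_hsrc_hidc: "set Hs \<subseteq> Hor K \<Longrightarrow> concat (map (hsrc K) (map (hidc K) Hs)) = Hs"
  by (induction Hs) (auto simp: hsrc_hidc)

lemma hpath_Hor: "hpath K A Hs B \<Longrightarrow> set Hs \<subseteq> Hor K"
  by (induction Hs arbitrary: A) auto

lemma composable_hidc:
  assumes "is_cell K f Js Ks g \<phi>" "Js \<noteq> []"
  shows "composable K \<phi> (map (hidc K) Js)"
proof (rule composableI)
  show "cpath K (vid K (vdom K f)) (map (hidc K) Js) (vid K (vdom K g))"
    using is_cell_hpath[OF assms(1)] cpath_hidc by blast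
qed (use assms is_cell_Ver[OF assms(1)] is_cell_hpath[OF assms(1)] in
    \<open>auto simp: is_cell_def concat_htgt_hidc[OF hpath_Hor, simplified]\<close>)

text \<open>Transposition along the companion of \<open>j\<close>, replacing the last horizontal morphism of the
  source by a factor \<open>j\<close> of the vertical target, is inverse to composing with \<open>g \<circ> \<epsilon>\<close>.\<close>

definition transpose_last :: "'u \<Rightarrow> 'u list \<Rightarrow> 'u \<Rightarrow> 'u" where
  "transpose_last \<eta> Hs \<chi> = ccomp K \<chi> (map (hidc K) Hs @ [\<eta>])"

lemma is_cell_transpose_last:
  assumes cp: "companion_pair K j J \<epsilon> \<eta>" and x: "is_cell K p (Hs @ [J]) [] g \<chi>"
  shows "composable K \<chi> (map (hidc K) Hs @ [\<eta>])"
    and "is_cell K p Hs [] (vcomp K g j) (transpose_last \<eta> Hs \<chi>)"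
proof -
  have j: "j \<in> Ver K" and u: "is_cell K (vid K (vdom K j)) [] [J] j \<eta>"
    and e: "is_cell K j [J] [] (vid K (vcod K j)) \<epsilon>"
    using cp by (auto simp: companion_pair_def)
  note E = companion_counit_ends[OF e]
  have p: "p \<in> Ver K" using is_cell_Ver[OF x] by simp
  have hp: "hpath K (vdom K p) Hs (vdom K j)"
    using is_cell_hpath[OF x] E by (auto simp: hpath_append)
  have c: "cpath K (vid K (vdom K p)) (map (hidc K) Hs @ [\<eta>]) j"
    using cpath_hidc[OF hp] u j by (auto simp: cpath_append is_cell_def)
  show "composable K \<chi> (map (hidc K) Hs @ [\<eta>])"
    by (rule composableI[OF _ _ c])
      (use is_cellD[OF x] is_cellD[OF u] p concat_htgt_hidc[OF hpath_Hor[OF hp]] in auto)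
  have "is_cell K (vcomp K p (vid K (vdom K p))) (concat (map (hsrc K) (map (hidc K) Hs @ [\<eta>]))) []
     (vcomp K g j) (transpose_last \<eta> Hs \<chi>)"
    unfolding transpose_last_def
    by (rule is_cell_ccomp[OF x _ c])
      (use is_cellD[OF u] p concat_htgt_hidc[OF hpath_Hor[OF hp]] in auto)
  then show "is_cell K p Hs [] (vcomp K g j) (transpose_last \<eta> Hs \<chi>)"
    using concat_hsrc_hidc[OF hpath_Hor[OF hp]] is_cellD[OF u] p by simp
qed

text \<open>For an empty \<open>Hs\<close> the leading identity is the whole path, and otherwise it
  is deleted again. The two unit axioms for the horizontal source of \<chi> thereby become
  one.\<close>

lemma ccomp_vidc_hidc:
  assumes "is_cell K p Hs Ks q \<chi>"
  shows "ccomp K \<chi> (vidc K (vid K (vdom K p)) # map (hidc K) Hs) = \<chi>"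
    and "composable K \<chi> (vidc K (vid K (vdom K p)) # map (hidc K) Hs)"
proof -
  have p: "p \<in> Ver K" using is_cell_Ver[OF assms] by simp
  note H = is_cell_hpath[OF assms]
  show "composable K \<chi> (vidc K (vid K (vdom K p)) # map (hidc K) Hs)"
    by (rule composableI[of _ _ "vid K (vdom K p)" "vid K (vdom K q)"])
      (use is_cellD[OF assms] p H cpath_hidc[of "vdom K p" Hs "vdom K q"]
          concat_htgt_hidc[OF hpath_Hor, of "vdom K p" Hs "vdom K q"] in
        \<open>auto simp: vidc_in vsrc_vidc vtgt_vidc htgt_vidc\<close>)
  show "ccomp K \<chi> (vidc K (vid K (vdom K p)) # map (hidc K) Hs) = \<chi>"
  proof (cases "Hs = []")
    case True
    then show ?thesis using is_cell_ccomp_vidc assms by simp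
  next
    case False
    have "vsrc K (hd (map (hidc K) Hs)) = vid K (vdom K p)"
      using False H by (cases Hs) (auto simp: vsrc_hidc)
    then show ?thesis
      using ccomp_vidc_Cons[OF composable_hidc[OF assms False]] ccomp_hidc[of \<chi>] False is_cellD[OF
        assms]
      by simp
  qed
qed

lemma transpose_last_hcomp:
  assumes cp: "companion_pair K j J \<epsilon> \<eta>" and x: "is_cell K p Hs [] (vcomp K g j) X"
    and g: "g \<in> Ver K" "vdom K g = vcod K j"
  shows "transpose_last \<eta> Hs (hcomp K X (whisk K g \<epsilon>)) = X"
proof -
  have j: "j \<in> Ver K" and u: "is_cell K (vid K (vdom K j)) [] [J] j \<eta>"
    and e: "is_cell K j [J] [] (vid K (vcod K j)) \<epsilon>" and ue: "ccomp K \<epsilon> [\<eta>] = vidc K j"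
    using cp by (auto simp: companion_pair_def)
  have p: "p \<in> Ver K" using is_cell_Ver[OF x] by simp
  have ge: "is_cell K (vcomp K g j) [J] [] g (whisk K g \<epsilon>)"
    using is_cell_whisk[OF e] g by simp
  note xe = is_cell_hcomp[OF x ge]
  \<comment> \<open>X needs a non-empty path of cells of its own, even when \<open>Hs\<close> is
    empty.\<close>
  let ?i = "vidc K (vid K (vdom K p)) # map (hidc K) Hs"
  note c = is_cell_transpose_last[OF cp xe]
  note d = ccomp_vidc_hidc[OF x]
  have l: "vtgt K (last ?i) = vid K (vdom K j)"
  proof -
    have "cpath K (vid K (vdom K p)) ?i (vid K (vdom K j))"
      using is_cell_hpath[OF x] g j p cpath_hidc[of "vdom K p" Hs "vdom K j"]
      by (auto simp: vidc_in vsrc_vidc vtgt_vidc)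
    from cpath_hd_last[OF this] show ?thesis by blast
  qed
  have "vsrc K (hd (map (hidc K) Hs @ [\<eta>])) = vid K (vdom K p)"
    using is_cell_hpath[OF x] is_cellD[OF u] g j
    by (cases Hs) (auto simp: vsrc_hidc)
  then have "transpose_last \<eta> Hs (hcomp K X (whisk K g \<epsilon>))
    = ccomp K (hcomp K X (whisk K g \<epsilon>)) (?i @ [\<eta>])"
    using ccomp_vidc_Cons[OF c(1)] unfolding transpose_last_def by simp
  also have "\<dots> = hcomp K (ccomp K X ?i) (ccomp K (whisk K g \<epsilon>) [\<eta>])"
    by (rule hcomp_ccomp[OF x ge d(2)])
      (use l is_cellD[OF u] g j in \<open>auto intro!: composable_1[OF ge u]\<close>)
  also have "ccomp K (whisk K g \<epsilon>) [\<eta>] = whisk K g (ccomp K \<epsilon> [\<eta>])"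
    by (rule whisk_ccomp[OF e, symmetric]) (use g j in \<open>auto intro!: composable_1[OF e u]\<close>)
  also have "\<dots> = vidc K (vcomp K g j)"
    unfolding ue using whisk_vidc g j by simp
  finally show ?thesis using d(1) hcomp_vidc_right[OF x] by simp
qed

lemma hcomp_transpose_last:
  assumes cp: "companion_pair K j J \<epsilon> \<eta>" and x: "is_cell K p (Hs @ [J]) [] g \<chi>"
  shows "hcomp K (transpose_last \<eta> Hs \<chi>) (whisk K g \<epsilon>) = \<chi>"
proof -
  have j: "j \<in> Ver K" and u: "is_cell K (vid K (vdom K j)) [] [J] j \<eta>"
    and e: "is_cell K j [J] [] (vid K (vcod K j)) \<epsilon>" and ue: "ccomp K (hidc K J) [\<eta>, \<epsilon>] = hidc K J"
    using cp by (auto simp: companion_pair_def)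
  note E = companion_counit_ends[OF e]
  have p: "p \<in> Ver K" and g: "g \<in> Ver K" using is_cell_Ver[OF x] by auto
  have hp: "hpath K (vdom K p) Hs (vdom K j)" and gd: "vdom K g = vcod K j"
    using is_cell_hpath[OF x] E by (auto simp: hpath_append)
  note c = is_cell_transpose_last[OF cp x]
  let ?h = "map (hidc K) Hs"
  have cp1: "cpath K (vid K (vdom K p)) (?h @ [\<eta>, \<epsilon>]) (vid K (vcod K j))"
    using cpath_hidc[OF hp] u e j by (auto simp: cpath_append is_cell_def)
  have cc: "composable K \<chi> (?h @ [\<eta>, \<epsilon>])"
    by (rule composableI[OF _ _ cp1])
      (use is_cellD[OF x] is_cellD[OF u] is_cellD[OF e] p concat_htgt_hidc[OF hpath_Hor[OF hp]]
        in auto)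
  have i': "is_cell K (vid K (hdom K J)) ([J] @ []) [J] (vid K (hcod K J)) (hidc K J)"
    using is_cell_hidc[OF E(2)] E by simp
  have HH: "H \<in> Hor K" if "H \<in> set Hs" for H using hpath_Hor[OF hp] that by blast
  \<comment> \<open>Associativity is applied below the identity cells of \<open>Hs\<close> and J:
    each identity of \<open>Hs\<close> is composed with itself and id_J with (\<eta>, \<epsilon>).
    By the second companion identity the latter composite is id_J again.\<close>
  have l2: "list_all2 (composable K) (?h @ [hidc K J]) (map (\<lambda>H. [hidc K H]) Hs @ [[\<eta>, \<epsilon>]])"
  proof (rule list_all2_appendI)
    show "list_all2 (composable K) ?h (map (\<lambda>H. [hidc K H]) Hs)"
      by (simp add: list_all2_map1 list_all2_map2 list_all2_same)
        (use HH in \<open>auto simp: hdom_in intro!: composable_1[OF is_cell_hidc is_cell_hidc]\<close>)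
    show "list_all2 (composable K) [hidc K J] [[\<eta>, \<epsilon>]]"
      using composable_2[OF i' u e] E by simp
  qed
  have m2: "map2 (ccomp K) (?h @ [hidc K J]) (map (\<lambda>H. [hidc K H]) Hs @ [[\<eta>, \<epsilon>]])
    = map (hidc K) (Hs @ [J])"
  proof -
    have "map2 (ccomp K) ?h (map (\<lambda>H. [hidc K H]) Hs) = ?h"
      using HH by (auto simp: map2_map_map hidc_is_cell_ccomp[OF is_cell_hidc])
    then show ?thesis using ue by simp
  qed
  have ch: "ccomp K \<chi> (?h @ [hidc K J]) = \<chi>" "composable K \<chi> (map (hidc K) (Hs @ [J]))"
    using ccomp_hidc[of \<chi>] is_cellD[OF x] composable_hidc[OF x] by auto
  have cn: "concat (map (\<lambda>H. [hidc K H]) Hs @ [[\<eta>, \<epsilon>]]) = ?h @ [\<eta>, \<epsilon>]" by simp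
  have "ccomp K \<chi> (map (hidc K) (Hs @ [J])) = ccomp K (ccomp K \<chi> (?h @ [hidc K J])) (?h @ [\<eta>, \<epsilon>])"
    using ccomp_assoc[OF l2, of \<chi>] m2 cn ch cc by simp
  then have 1: "ccomp K \<chi> (?h @ [\<eta>, \<epsilon>]) = \<chi>" using ch by simp
  have "hcomp K (transpose_last \<eta> Hs \<chi>) (whisk K g \<epsilon>) =
      ccomp K (hcomp K \<chi> (vidc K g)) ((?h @ [\<eta>]) @ [\<epsilon>])"
    unfolding transpose_last_def whisk_def
    by (rule hcomp_ccomp[OF x is_cell_vidc, symmetric])
      (use c g gd j is_cellD[OF u] is_cellD[OF e] in \<open>auto intro!: composable_1[OF is_cell_vidc e]\<close>)
  then show ?thesis using 1 hcomp_vidc_right[OF x] by simp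
qed

end


section \<open>Composites of companion cells\<close>

lemma V_simps [simp]:
  "Obj (V K) = Ob K" "Mor (V K) = Ver K" "mdom (V K) = vdom K" "mcod (V K) = vcod K"
  "mid (V K) = vid K" "mcomp (V K) = vcomp K" "csrc (V K) = vsrc K" "ctgt (V K) = vtgt K"
  "cid (V K) = vidc K" "horz (V K) \<beta> \<alpha> = ccomp K \<beta> [\<alpha>]"
  by (simp_all add: V_def Let_def)

lemma two_V: "two (V K) f g \<alpha> \<longleftrightarrow> is_cell K f [] [] g \<alpha>"
  by (auto simp: two_def V_def Let_def is_cell_def)

lemma vert_V:
  "is_cell K f [] [] g \<alpha> \<Longrightarrow> is_cell K g [] [] h \<beta> \<Longrightarrow> vert (V K) \<beta> \<alpha> = hcomp K \<alpha> \<beta>"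
  by (auto simp: V_def Let_def is_cell_def)

lemma QV_lower_simps [simp]:
  "Ob (QV_lower K) = Ob K" "Ver (QV_lower K) = Ver K" "vdom (QV_lower K) = vdom K"
  "vcod (QV_lower K) = vcod K" "vid (QV_lower K) = vid K" "vcomp (QV_lower K) = vcomp K"
  "Hor (QV_lower K) = {j \<in> Ver K. has_companion K j}"
  "hdom (QV_lower K) = vdom K" "hcod (QV_lower K) = vcod K"
  "hsrc (QV_lower K) = qjs" "htgt (QV_lower K) = qks" "vsrc (QV_lower K) = qf" "vtgt (QV_lower K)
    = qg"
  "ccomp (QV_lower K) = qcomp (V K)"
  "hidc (QV_lower K) j = Quint (vid K (vdom K j)) [j] [j] (vid K (vcod K j)) (vidc K j)"
  "vidc (QV_lower K) f = Quint f [] [] f (vidc K f)"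
  by (simp_all add: QV_lower_def full_sub_def Q_def)

lemma is_cell_QV:
  "is_cell (QV_lower K) f js ks g \<phi> \<longleftrightarrow> (\<exists>\<alpha>. \<phi> = Quint f js ks g \<alpha> \<and>
     f \<in> Ver K \<and> g \<in> Ver K \<and> mpath (V K) (vdom K f) js (vdom K g) \<and>
     mpath (V K) (vcod K f) ks (vcod K g) \<and> length ks \<le> 1 \<and>
     (\<forall>j\<in>set js. has_companion K j) \<and> (\<forall>k\<in>set ks. has_companion K k) \<and>
     is_cell K (vcomp K (mpath_comp (V K) (vcod K f) ks) f) [] []
       (vcomp K g (mpath_comp (V K) (vdom K f) js)) \<alpha>)"
  by (auto simp: is_cell_def[of "QV_lower K"])
    (auto simp: QV_lower_def full_sub_def Q_def quintets_def two_V)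

text \<open>The horizontal composite of the \<open>whiskered\<close> counits without the initial
  2-cell, nested to the right and ending in id_g. In this form it has a value on the empty path and
  splits along concatenation.\<close>

primrec counits :: "'u avdc \<Rightarrow> ('u \<Rightarrow> 'u) \<Rightarrow> 'u \<Rightarrow> 'u list \<Rightarrow> 'u" where
  "counits K \<epsilon> g [] = vidc K g"
| "counits K \<epsilon> g (j # js) =
     hcomp K (whisk K (vcomp K g (mpath_comp (V K) (vcod K j) js)) (\<epsilon> j)) (counits K \<epsilon> g js)"

context aug_virt_dbl_cat
begin

lemma mpath_comp_Ver:
  "mpath (V K) A js B \<Longrightarrow> mpath_comp (V K) A js \<in> Ver K \<and>
     vdom K (mpath_comp (V K) A js) = A \<and> vcod K (mpath_comp (V K) A js) = B"
  by (induction js arbitrary: A) auto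

lemma mpath_append:
  "mpath (V K) A (js @ ks) C \<longleftrightarrow> (\<exists>B. mpath (V K) A js B \<and> mpath (V K) B ks C)"
proof (induction js arbitrary: A)
  case Nil
  show ?case by (cases ks) auto
qed auto

lemma mpath_comp_append:
  "mpath (V K) A js B \<Longrightarrow> mpath (V K) B ks C \<Longrightarrow>
     mpath_comp (V K) A (js @ ks) = vcomp K (mpath_comp (V K) B ks) (mpath_comp (V K) A js)"
  by (induction js arbitrary: A) (auto simp: mpath_comp_Ver vcomp_assoc)

end

section \<open>Whiskered counits of the chosen companions\<close>

locale chosen_companions = aug_virt_dbl_cat K for K :: "'u avdc" +
  fixes \<epsilon> :: "'u \<Rightarrow> 'u"
  assumes choice: "companion_choice K \<epsilon>"
begin

abbreviation "mc \<equiv> mpath_comp (V K)"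
abbreviation "mp \<equiv> mpath (V K)"
abbreviation "ch \<equiv> chosen K \<epsilon>"

lemma has_companion_pair: "has_companion K j \<Longrightarrow> \<exists>\<eta>. companion_pair K j (ch j) (\<epsilon> j) \<eta>"
  using choice companion_cell_pair by (auto simp: companion_choice_def chosen_def)

lemma counit_cell:
  assumes "has_companion K j"
  shows "is_cell K j [ch j] [] (vid K (vcod K j)) (\<epsilon> j)" "j \<in> Ver K" "ch j \<in> Hor K"
    "hdom K (ch j) = vdom K j" "hcod K (ch j) = vcod K j"
proof -
  show 1: "is_cell K j [ch j] [] (vid K (vcod K j)) (\<epsilon> j)"
    using has_companion_pair[OF assms] by (auto simp: companion_pair_def)
  show "j \<in> Ver K" "ch j \<in> Hor K" "hdom K (ch j) = vdom K j" "hcod K (ch j) = vcod K j"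
    using companion_counit_ends[OF 1] by auto
qed

lemma is_cell_whisk_counit:
  assumes "has_companion K j" "g \<in> Ver K" "vdom K g = vcod K j"
  shows "is_cell K (vcomp K g j) [ch j] [] g (whisk K g (\<epsilon> j))"
  using is_cell_whisk[OF counit_cell(1)[OF assms(1)] assms(2)] counit_cell[OF assms(1)] assms
    by simp

lemma is_cell_counits:
  "mp A js B \<Longrightarrow> \<forall>j\<in>set js. has_companion K j \<Longrightarrow> g \<in> Ver K \<Longrightarrow> vdom K g = B \<Longrightarrow>
     is_cell K (vcomp K g (mc A js)) (map ch js) [] g (counits K \<epsilon> g js)"
proof (induction js arbitrary: A)
  case Nil
  then show ?case using is_cell_vidc by auto
next
  case (Cons j js)
  let ?g = "vcomp K g (mc (vcod K j) js)"
  have m: "mp (vcod K j) js B" using Cons.prems by simp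
  note M = mpath_comp_Ver[OF m]
  note j = counit_cell[of j]
  have ih: "is_cell K ?g (map ch js) [] g (counits K \<epsilon> g js)"
    using Cons.IH[OF m] Cons.prems by simp
  have e: "is_cell K (vcomp K ?g j) [ch j] [] ?g (whisk K ?g (\<epsilon> j))"
    by (rule is_cell_whisk_counit) (use Cons.prems M in auto)
  show ?case using is_cell_hcomp[OF e ih] M j Cons.prems by (simp add: vcomp_assoc)
qed

text \<open>Associativity of \<odot>. The composite nested to the left, which occurs in the
  definition of the image of a quintet, is split into its 2-cell and a factor that depends on g and
  the path only.\<close>

lemma foldl_hcomp_whiskered:
  "mp A js B \<Longrightarrow> \<forall>j\<in>set js. has_companion K j \<Longrightarrow> g \<in> Ver K \<Longrightarrow> vdom K g = B \<Longrightarrow>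
     is_cell K p Hs [] (vcomp K g (mc A js)) \<alpha> \<Longrightarrow>
     foldl (hcomp K) \<alpha> (whiskered K \<epsilon> g js) = hcomp K \<alpha> (counits K \<epsilon> g js)"
proof (induction js arbitrary: A \<alpha> Hs)
  case Nil
  then show ?case using hcomp_vidc_right by auto
next
  case (Cons j js)
  let ?g = "vcomp K g (mc (vcod K j) js)"
  have m: "mp (vcod K j) js B" using Cons.prems by simp
  note M = mpath_comp_Ver[OF m]
  note j = counit_cell[of j]
  have e: "is_cell K (vcomp K ?g j) [ch j] [] ?g (whisk K ?g (\<epsilon> j))"
    by (rule is_cell_whisk_counit) (use Cons.prems M in auto)
  have a: "is_cell K p Hs [] (vcomp K ?g j) \<alpha>" using Cons.prems M j by (simp add: vcomp_assoc)
  have w: "is_cell K ?g (map ch js) [] g (counits K \<epsilon> g js)"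
    by (rule is_cell_counits[OF m]) (use Cons.prems in auto)
  show ?case
    using Cons.IH[OF m _ _ _ is_cell_hcomp[OF a e]] Cons.prems hcomp_assoc[OF a e w] by simp
qed

text \<open>Whiskering distributes over \<odot>, and h is absorbed into each factor. Taking an
  identity for g exhibits \<open>counits K \<epsilon> h js\<close> as a whiskered cell, which is how
  the interchange laws are applied to it.\<close>

lemma whisk_counits:
  "mp A js B \<Longrightarrow> \<forall>j\<in>set js. has_companion K j \<Longrightarrow> g \<in> Ver K \<Longrightarrow> vdom K g = B \<Longrightarrow>
     h \<in> Ver K \<Longrightarrow> vdom K h = vcod K g \<Longrightarrow>
     whisk K h (counits K \<epsilon> g js) = counits K \<epsilon> (vcomp K h g) js"
proof (induction js arbitrary: A)
  case Nil
  then show ?case using whisk_vidc by auto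
next
  case (Cons j js)
  let ?g = "vcomp K g (mc (vcod K j) js)"
  have m: "mp (vcod K j) js B" using Cons.prems by simp
  note M = mpath_comp_Ver[OF m]
  note j = counit_cell[of j]
  have e: "is_cell K (vcomp K ?g j) [ch j] [] ?g (whisk K ?g (\<epsilon> j))"
    by (rule is_cell_whisk_counit) (use Cons.prems M in auto)
  have w: "is_cell K ?g (map ch js) [] g (counits K \<epsilon> g js)"
    by (rule is_cell_counits[OF m]) (use Cons.prems in auto)
  have "whisk K h (whisk K ?g (\<epsilon> j)) = whisk K (vcomp K h ?g) (\<epsilon> j)"
    by (rule whisk_whisk[OF j(1)]) (use Cons.prems M in auto)
  then show ?case
    using whisk_hcomp[OF e w] Cons.IH[OF m] Cons.prems M j by (simp add: vcomp_assoc)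
qed

lemma counits_append:
  "mp A js B \<Longrightarrow> mp B ks C \<Longrightarrow> \<forall>j\<in>set js. has_companion K j \<Longrightarrow> \<forall>k\<in>set ks. has_companion K k \<Longrightarrow>
     g \<in> Ver K \<Longrightarrow> vdom K g = C \<Longrightarrow>
     counits K \<epsilon> g (js @ ks) = hcomp K (counits K \<epsilon> (vcomp K g (mc B ks)) js) (counits K \<epsilon> g ks)"
proof (induction js arbitrary: A)
  case Nil
  then have "is_cell K (vcomp K g (mc B ks)) (map ch ks) [] g (counits K \<epsilon> g ks)"
    by (intro is_cell_counits[of _ _ C]) auto
  then show ?case using hcomp_vidc_left Nil by auto
next
  case (Cons j js)
  have m: "mp (vcod K j) js B" using Cons.prems by simp
  note M = mpath_comp_Ver[OF m] mpath_comp_Ver[OF Cons.prems(2)]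
  note j = counit_cell[of j]
  let ?h = "vcomp K g (mc B ks)"
  let ?g = "vcomp K ?h (mc (vcod K j) js)"
  have e: "is_cell K (vcomp K ?g j) [ch j] [] ?g (whisk K ?g (\<epsilon> j))"
    by (rule is_cell_whisk_counit) (use Cons.prems M in auto)
  have w: "is_cell K ?g (map ch js) [] ?h (counits K \<epsilon> ?h js)"
    by (rule is_cell_counits[OF m]) (use Cons.prems M in auto)
  have w': "is_cell K ?h (map ch ks) [] g (counits K \<epsilon> g ks)"
    by (rule is_cell_counits[OF Cons.prems(2)]) (use Cons.prems M in auto)
  have "vcomp K g (mc (vcod K j) (js @ ks)) = ?g"
    using M Cons.prems mpath_comp_append[OF m Cons.prems(2)] by (simp add: vcomp_assoc)
  then show ?case
    using hcomp_assoc[OF e w w'] Cons.IH[OF m] Cons.prems by simp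
qed

lemma counits_single:
  assumes "has_companion K j" "g \<in> Ver K" "vdom K g = vcod K j"
  shows "counits K \<epsilon> g [j] = whisk K g (\<epsilon> j)"
  using assms hcomp_vidc_right[OF is_cell_whisk_counit[OF assms]] counit_cell[OF assms(1)] by simp

lemma counits_snoc:
  assumes "mp A (js @ [j]) B" "\<forall>j\<in>set (js @ [j]). has_companion K j" "g \<in> Ver K" "vdom K g = B"
  shows "counits K \<epsilon> g (js @ [j]) = hcomp K (counits K \<epsilon> (vcomp K g j) js) (whisk K g (\<epsilon> j))"
  using assms counits_append[of A js "vdom K j" "[j]" B g] counits_single[of j g]
    counit_cell[of j] by (auto simp: mpath_append)

text \<open>The induction runs from the right because transposition acts on the last companion: it
  undoes the last factor g \<circ> \<epsilon>_j and leaves the same problem for a shorter path and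
  the vertical target g \<circ> j.\<close>

lemma hcomp_counits_inj:
  "mp A js B \<Longrightarrow> \<forall>j\<in>set js. has_companion K j \<Longrightarrow> g \<in> Ver K \<Longrightarrow> vdom K g = B \<Longrightarrow>
     is_cell K p [] [] (vcomp K g (mc A js)) \<alpha> \<Longrightarrow> is_cell K p [] [] (vcomp K g (mc A js)) \<alpha>' \<Longrightarrow>
     hcomp K \<alpha> (counits K \<epsilon> g js) = hcomp K \<alpha>' (counits K \<epsilon> g js) \<Longrightarrow> \<alpha> = \<alpha>'"
proof (induction js arbitrary: g B rule: rev_induct)
  case Nil
  then show ?case using hcomp_vidc_right[of p "[]" g] by auto
next
  case (snoc j js)
  have hj: "has_companion K j" using snoc.prems by simp
  note j = counit_cell[OF hj]
  have m: "mp A js (vdom K j)" and gj: "vdom K g = vcod K j" "g \<in> Ver K"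
    using snoc.prems by (auto simp: mpath_append)
  note M = mpath_comp_Ver[OF m]
  let ?g = "vcomp K g j"
  have eq: "vcomp K g (mc A (js @ [j])) = vcomp K ?g (mc A js)"
    using mpath_comp_append[OF m, of "[j]" "vcod K j"] M j gj by (auto simp: vcomp_assoc)
  have w: "is_cell K (vcomp K ?g (mc A js)) (map ch js) [] ?g (counits K \<epsilon> ?g js)"
    by (rule is_cell_counits[OF m]) (use snoc.prems gj j in auto)
  note e = is_cell_whisk_counit[OF hj gj(2) gj(1)]
  have a: "is_cell K p [] [] (vcomp K ?g (mc A js)) \<alpha>" "is_cell K p [] [] (vcomp K ?g (mc A js)) \<alpha>'"
    using snoc.prems eq by auto
  obtain \<eta> where cp: "companion_pair K j (ch j) (\<epsilon> j) \<eta>" using has_companion_pair hj by blast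
  have "hcomp K (hcomp K \<alpha> (counits K \<epsilon> ?g js)) (whisk K g (\<epsilon> j)) =
      hcomp K (hcomp K \<alpha>' (counits K \<epsilon> ?g js)) (whisk K g (\<epsilon> j))"
    using snoc.prems(7) counits_snoc[OF snoc.prems(1,2,3,4)] hcomp_assoc[OF _ w e] a by simp
  from arg_cong[OF this, of "transpose_last \<eta> (map ch js)"]
  have "hcomp K \<alpha> (counits K \<epsilon> ?g js) = hcomp K \<alpha>' (counits K \<epsilon> ?g js)"
    using transpose_last_hcomp[OF cp _ gj(2) gj(1)] is_cell_hcomp[OF a(1) w] is_cell_hcomp[OF a(2)
      w]
    by simp
  then show ?case using snoc.IH[OF m _ _ _ a] snoc.prems gj j by simp
qed

text \<open>Transpose \<chi> along the last companion, solve the problem for the shorter path with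
  vertical target g \<circ> j, and restore the last counit.\<close>

lemma hcomp_counits_surj:
  "mp A js B \<Longrightarrow> \<forall>j\<in>set js. has_companion K j \<Longrightarrow> g \<in> Ver K \<Longrightarrow> vdom K g = B \<Longrightarrow>
     is_cell K p (map ch js) [] g \<chi> \<Longrightarrow>
     \<exists>\<alpha>. is_cell K p [] [] (vcomp K g (mc A js)) \<alpha> \<and> hcomp K \<alpha> (counits K \<epsilon> g js) = \<chi>"
proof (induction js arbitrary: g B \<chi> rule: rev_induct)
  case Nil
  then show ?case using hcomp_vidc_right[of p "[]" g] by auto
next
  case (snoc j js)
  have hj: "has_companion K j" using snoc.prems by simp
  note j = counit_cell[OF hj]
  have m: "mp A js (vdom K j)" and gj: "vdom K g = vcod K j" "g \<in> Ver K"
    using snoc.prems by (auto simp: mpath_append)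
  note M = mpath_comp_Ver[OF m]
  let ?g = "vcomp K g j"
  have eq: "vcomp K g (mc A (js @ [j])) = vcomp K ?g (mc A js)"
    using mpath_comp_append[OF m, of "[j]" "vcod K j"] M j gj by (auto simp: vcomp_assoc)
  have w: "is_cell K (vcomp K ?g (mc A js)) (map ch js) [] ?g (counits K \<epsilon> ?g js)"
    by (rule is_cell_counits[OF m]) (use snoc.prems gj j in auto)
  note e = is_cell_whisk_counit[OF hj gj(2) gj(1)]
  obtain \<eta> where cp: "companion_pair K j (ch j) (\<epsilon> j) \<eta>" using has_companion_pair hj by blast
  have x: "is_cell K p (map ch js @ [ch j]) [] g \<chi>" using snoc.prems by simp
  obtain \<alpha> where a: "is_cell K p [] [] (vcomp K ?g (mc A js)) \<alpha>"
    and t: "hcomp K \<alpha> (counits K \<epsilon> ?g js) = transpose_last \<eta> (map ch js) \<chi>"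
    using snoc.IH[OF m, of ?g] is_cell_transpose_last[OF cp x] snoc.prems gj j by auto
  have "hcomp K \<alpha> (counits K \<epsilon> g (js @ [j])) = \<chi>"
    using counits_snoc[OF snoc.prems(1,2,3,4)] hcomp_assoc[OF a w e] t hcomp_transpose_last[OF cp x]
    by simp
  then show ?case using a eq by auto
qed

text \<open>Over a path of length at most one, \<open>counits\<close> is either an identity cell or
  a single counit, and both can be factored through uniquely. This allows unary and nullary targets
  to be treated together.\<close>

lemma counits_factor:
  assumes l: "length ks \<le> 1" and m: "mp C ks D" and h: "\<forall>k\<in>set ks. has_companion K k"
    and f: "f \<in> Ver K" "vcod K f = C" and x: "is_cell K (vcomp K (mc C ks) f) Hs [] g \<chi>"
  shows "\<exists>!\<phi>. is_cell K f Hs (map ch ks) g \<phi> \<and> ccomp K (counits K \<epsilon> (vid K D) ks) [\<phi>] = \<chi>"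
proof (cases ks)
  case Nil
  then have x': "is_cell K f Hs [] g \<chi>" "C = D" using x m f by auto
  then show ?thesis using Nil vidc_is_cell_ccomp[of f Hs g] f(2) by auto
next
  case (Cons k ks')
  then have k: "ks = [k]" using l by simp
  then have hk: "has_companion K k" and C: "C = vdom K k" "D = vcod K k" using h m by auto
  note j = counit_cell[OF hk]
  obtain \<eta> where cp: "companion_pair K k (ch k) (\<epsilon> k) \<eta>" using has_companion_pair hk by blast
  have "counits K \<epsilon> (vid K D) ks = \<epsilon> k"
    unfolding k C(2) using counits_single[OF hk, of "vid K (vcod K k)"] j whisk_vid[OF j(1)]
    by (simp del: counits.simps)
  then show ?thesis using companion_factor[OF cp, of f Hs g \<chi>] x k C f j by simp
qed

end


section \<open>Quintets and their images\<close>

context aug_virt_dbl_cat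
begin

lemma is_cell_ccomp_vidc_right:
  assumes "is_cell K p [] [] q \<gamma>" "f \<in> Ver K" "vcod K f = vdom K p"
  shows "is_cell K (vcomp K p f) [] [] (vcomp K q f) (ccomp K \<gamma> [vidc K f])"
  by (rule is_cell_ccomp_1[OF assms(1) is_cell_vidc]) (use assms in auto)

end

locale quintet_companions = chosen_companions K \<epsilon> for K :: "'a univ avdc" and \<epsilon>
begin

abbreviation "QK \<equiv> QV_lower K"
abbreviation "paste \<equiv> qpaste (V K)"

section \<open>Pasting in V K in terms of horizontal composition\<close>

lemma QV_cell:
  assumes "is_cell QK f js ks g \<phi>"
  shows "f \<in> Ver K" "g \<in> Ver K" "mp (vdom K f) js (vdom K g)" "mp (vcod K f) ks (vcod K g)"
    "length ks \<le> 1" "\<forall>j\<in>set js. has_companion K j" "\<forall>k\<in>set ks. has_companion K k"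
    "is_cell K (vcomp K (mc (vcod K f) ks) f) [] [] (vcomp K g (mc (vdom K f) js)) (qc \<phi>)"
    "qf \<phi> = f" "qjs \<phi> = js" "qks \<phi> = ks" "qg \<phi> = g"
  using assms unfolding is_cell_QV by auto

lemma QV_cellI: "\<phi> \<in> Cell QK \<Longrightarrow> is_cell QK (qf \<phi>) (qjs \<phi>) (qks \<phi>) (qg \<phi>) \<phi>"
  using is_cellI[of \<phi> QK] by simp

text \<open>Composition of 2-cells in V K has its intended value on composable pairs only. The
  recursion of \<open>qpaste\<close> is therefore translated into \<odot> and whiskering together
  with the boundaries that justify it.\<close>

lemma qpaste_Cons:
  assumes "is_cell K p [] [] q P" "is_cell QK f js ks g \<phi>"
    and P: "paste g \<phi>s = P" "p = vcomp K m g" "m \<in> Ver K" "vdom K m = vcod K g"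
      "m = mc (vcod K g) (concat (map qks \<phi>s))"
  shows "paste f (\<phi> # \<phi>s) =
    hcomp K (whisk K m (qc \<phi>)) (ccomp K P [vidc K (mc (vdom K f) js)])"
    and "is_cell K (vcomp K m (vcomp K (mc (vcod K f) ks) f)) [] [] (vcomp K q (mc (vdom K f) js))
      (paste f (\<phi> # \<phi>s))"
proof -
  note C = QV_cell[OF assms(2)]
  note M = mpath_comp_Ver[OF C(3)] mpath_comp_Ver[OF C(4)]
  have w: "is_cell K (vcomp K m (vcomp K (mc (vcod K f) ks) f)) [] []
      (vcomp K m (vcomp K g (mc (vdom K f) js))) (whisk K m (qc \<phi>))"
    using is_cell_whisk[OF C(8) P(3)] P C M by simp
  have r: "is_cell K (vcomp K p (mc (vdom K f) js)) [] [] (vcomp K q (mc (vdom K f) js))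
      (ccomp K P [vidc K (mc (vdom K f) js)])"
    by (rule is_cell_ccomp_vidc_right[OF assms(1)]) (use P C M in auto)
  have r': "is_cell K (vcomp K m (vcomp K g (mc (vdom K f) js))) [] [] (vcomp K q (mc (vdom K f)
    js))
      (ccomp K P [vidc K (mc (vdom K f) js)])"
    using r P C M by (simp add: vcomp_assoc)
  show 1: "paste f (\<phi> # \<phi>s) = hcomp K (whisk K m (qc \<phi>)) (ccomp K P [vidc K (mc (vdom K f) js)])"
    using vert_V[OF w r'] P C by (simp add: whisk_def)
  show "is_cell K (vcomp K m (vcomp K (mc (vcod K f) ks) f)) [] [] (vcomp K q (mc (vdom K f) js))
      (paste f (\<phi> # \<phi>s))"
    unfolding 1 using is_cell_hcomp[OF w r'] by simp
qed

lemma is_cell_qpaste: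
  "cpath QK f \<phi>s g \<Longrightarrow>
     f \<in> Ver K \<and> g \<in> Ver K \<and>
     mp (vdom K f) (concat (map qjs \<phi>s)) (vdom K g)
       \<and> mp (vcod K f) (concat (map qks \<phi>s)) (vcod K g) \<and>
     (\<forall>j\<in>set (concat (map qjs \<phi>s)). has_companion K j) \<and>
     (\<forall>j\<in>set (concat (map qks \<phi>s)). has_companion K j) \<and>
     is_cell K (vcomp K (mc (vcod K f) (concat (map qks \<phi>s))) f) [] []
       (vcomp K g (mc (vdom K f) (concat (map qjs \<phi>s)))) (paste f \<phi>s)"
proof (induction \<phi>s arbitrary: f)
  case Nil
  then show ?case using is_cell_vidc by auto
next
  case (Cons \<phi> \<phi>s)
  then have f: "qf \<phi> = f" "cpath QK (qg \<phi>) \<phi>s g" and c: "is_cell QK f (qjs \<phi>) (qks \<phi>) (qg \<phi>) \<phi>"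
    using QV_cellI[of \<phi>] by auto
  note ih = Cons.IH[OF f(2)]
  note C = QV_cell[OF c]
  note M = mpath_comp_Ver[OF C(3)] mpath_comp_Ver[OF C(4)]
  let ?js = "concat (map qjs \<phi>s)" and ?ks = "concat (map qks \<phi>s)"
  have mj: "mp (vdom K (qg \<phi>)) ?js (vdom K g)" and mk: "mp (vcod K (qg \<phi>)) ?ks (vcod K g)" using ih
    by auto
  note M' = mpath_comp_Ver[OF mj] mpath_comp_Ver[OF mk]
  have p: "is_cell K (vcomp K (mc (vcod K (qg \<phi>)) ?ks) (qg \<phi>)) [] []
      (vcomp K g (mc (vdom K (qg \<phi>)) ?js)) (paste (qg \<phi>) \<phi>s)" using ih by simp
  have r: "is_cell K (vcomp K (mc (vcod K (qg \<phi>)) ?ks) (vcomp K (mc (vcod K f) (qks \<phi>)) f)) [] []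
      (vcomp K (vcomp K g (mc (vdom K (qg \<phi>)) ?js)) (mc (vdom K f) (qjs \<phi>))) (paste f (\<phi> # \<phi>s))"
    by (rule qpaste_Cons(2)[OF p c]) (use M' in auto)
  have "mc (vcod K f) (qks \<phi> @ ?ks) = vcomp K (mc (vcod K (qg \<phi>)) ?ks) (mc (vcod K f) (qks \<phi>))"
    "mc (vdom K f) (qjs \<phi> @ ?js) = vcomp K (mc (vdom K (qg \<phi>)) ?js) (mc (vdom K f) (qjs \<phi>))"
    using mpath_comp_append C mj mk by auto
  then have r': "is_cell K (vcomp K (mc (vcod K f) (qks \<phi> @ ?ks)) f) [] []
      (vcomp K g (mc (vdom K f) (qjs \<phi> @ ?js))) (paste f (\<phi> # \<phi>s))"
    using r M M' C ih by (simp add: vcomp_assoc del: qpaste.simps)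
  show ?case using r' C ih mj mk by (auto simp: mpath_append simp del: qpaste.simps)
qed

text \<open>The boundaries of the two factors are recorded along with the formula, because they are
  what allows the horizontal composite to be reassociated with counits later.\<close>

lemma qcomp_eq:
  assumes c: "is_cell QK p ms ls q \<psi>" and s: "\<phi>s \<noteq> []" "cpath QK f \<phi>s g" "ms = concat (map qks \<phi>s)"
    "vdom K p = vcod K f"
  shows "qcomp (V K) \<psi> \<phi>s = Quint (vcomp K p f) (concat (map qjs \<phi>s)) ls (vcomp K q g)
      (hcomp K (ccomp K (qc \<psi>) [vidc K f]) (whisk K q (paste f \<phi>s)))"
    and "is_cell QK (vcomp K p f) (concat (map qjs \<phi>s)) ls (vcomp K q g) (qcomp (V K) \<psi> \<phi>s)"
    and "is_cell K (vcomp K (mc (vcod K p) ls) (vcomp K p f)) [] [] (vcomp K q (vcomp K (mc (vcod K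
      f) ms) f))
       (ccomp K (qc \<psi>) [vidc K f])"
    and "is_cell K (vcomp K q (vcomp K (mc (vcod K f) ms) f)) [] []
       (vcomp K q (vcomp K g (mc (vdom K f) (concat (map qjs \<phi>s))))) (whisk K q (paste f \<phi>s))"
proof -
  note C = QV_cell[OF c]
  note P = is_cell_qpaste[OF s(2)]
  have mj: "mp (vdom K f) (concat (map qjs \<phi>s)) (vdom K g)"
    and mk: "mp (vcod K f) ms (vcod K g)" using P s by auto
  note M = mpath_comp_Ver[OF C(3)] mpath_comp_Ver[OF C(4)] mpath_comp_Ver[OF mj] mpath_comp_Ver[OF
    mk]
  have hl: "qf (hd \<phi>s) = f" "qg (last \<phi>s) = g"
    using s(1,2) by (induction \<phi>s arbitrary: f) auto
  have qg: "vdom K q = vcod K g" using mk C s M by simp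
  show a: "is_cell K (vcomp K (mc (vcod K p) ls) (vcomp K p f)) [] [] (vcomp K q (vcomp K (mc (vcod
    K f) ms) f))
     (ccomp K (qc \<psi>) [vidc K f])"
    using is_cell_ccomp_vidc_right[OF C(8), of f] M P C s by (simp add: vcomp_assoc)
  show b: "is_cell K (vcomp K q (vcomp K (mc (vcod K f) ms) f)) [] []
       (vcomp K q (vcomp K g (mc (vdom K f) (concat (map qjs \<phi>s))))) (whisk K q (paste f \<phi>s))"
    by (rule is_cell_whisk) (use P s M C qg in auto)
  show 1: "qcomp (V K) \<psi> \<phi>s = Quint (vcomp K p f) (concat (map qjs \<phi>s)) ls (vcomp K q g)
      (hcomp K (ccomp K (qc \<psi>) [vidc K f]) (whisk K q (paste f \<phi>s)))"
    using vert_V[OF a b] C hl by (simp add: qcomp_def Let_def whisk_def)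
  show "is_cell QK (vcomp K p f) (concat (map qjs \<phi>s)) ls (vcomp K q g) (qcomp (V K) \<psi> \<phi>s)"
    unfolding 1 is_cell_QV
    using is_cell_hcomp[OF a b] C P M s qg by (simp add: vcomp_assoc del: ball_simps)
qed

section \<open>The bijection between quintets and cells of K\<close>

definition star :: "'a univ \<Rightarrow> 'a univ" where
  "star \<phi> = (THE \<phi>'. is_lower_star_cell K \<epsilon> \<phi> \<phi>')"

text \<open>Both sides of the defining equation are expressed through \<open>counits\<close>: the
  iterated composite becomes the 2-cell of \<phi> followed by the counits of its source, and the
  case distinction on the target becomes the counits over a path of length at most one.\<close>

lemma is_lower_star_cell_iff:
  assumes c: "is_cell QK f js ks g \<phi>"
  shows "is_lower_star_cell K \<epsilon> \<phi> \<phi>' \<longleftrightarrow> is_cell K f (map ch js) (map ch ks) g \<phi>' \<and>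
     ccomp K (counits K \<epsilon> (vid K (vcod K g)) ks) [\<phi>'] = hcomp K (qc \<phi>) (counits K \<epsilon> g js)"
proof -
  note C = QV_cell[OF c]
  have 1: "(case ks of [] \<Rightarrow> vidc K (vid K (vcod K f)) | k # _ \<Rightarrow> \<epsilon> k)
    = counits K \<epsilon> (vid K (vcod K g)) ks"
  proof (cases ks)
    case Nil
    then show ?thesis using C by simp
  next
    case (Cons k ks')
    then have k: "ks = [k]" using C by simp
    then have hk: "has_companion K k" and g: "vcod K g = vcod K k" using C by auto
    note j = counit_cell[OF hk]
    show ?thesis unfolding k g using counits_single[OF hk, of
      "vid K (vcod K k)"] j whisk_vid[OF j(1)]
      by (simp del: counits.simps)
  qed
  show ?thesis
    unfolding is_lower_star_cell_def
    using foldl_hcomp_whiskered[OF C(3) C(6) C(2) refl C(8)] 1 C(9-12)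
    by (auto simp: is_cell_def)
qed

lemma ex1_lower_star_cell:
  assumes c: "is_cell QK f js ks g \<phi>"
  shows "\<exists>!\<phi>'. is_lower_star_cell K \<epsilon> \<phi> \<phi>'"
proof -
  note C = QV_cell[OF c]
  have w: "is_cell K (vcomp K g (mc (vdom K f) js)) (map ch js) [] g (counits K \<epsilon> g js)"
    by (rule is_cell_counits[OF C(3)]) (use C in auto)
  show ?thesis
    unfolding is_lower_star_cell_iff[OF c]
    using counits_factor[OF C(5) C(4) C(7) C(1) refl is_cell_hcomp[OF C(8) w, simplified]] by simp
qed

lemma star_cell:
  assumes c: "is_cell QK f js ks g \<phi>"
  shows "is_cell K f (map ch js) (map ch ks) g (star \<phi>)"
    "ccomp K (counits K \<epsilon> (vid K (vcod K g)) ks) [star \<phi>] = hcomp K (qc \<phi>) (counits K \<epsilon> g js)"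
  using theI'[OF ex1_lower_star_cell[OF c]] is_lower_star_cell_iff[OF c]
  by (auto simp: star_def)

lemma star_eqI:
  assumes c: "is_cell QK f js ks g \<phi>" "is_cell K f (map ch js) (map ch ks) g \<phi>'"
   "ccomp K (counits K \<epsilon> (vid K (vcod K g)) ks) [\<phi>'] = hcomp K (qc \<phi>) (counits K \<epsilon> g js)"
  shows "star \<phi> = \<phi>'"
  using the1_equality[OF ex1_lower_star_cell[OF c(1)]] is_lower_star_cell_iff[OF c(1)] c
  by (auto simp: star_def)

text \<open>The two quintets have the same composite with the counits of their source, and these
  cancel by \<open>hcomp_counits_inj\<close>; so the underlying 2-cells agree.\<close>

lemma star_inj:
  assumes c: "is_cell QK f js ks g \<phi>" "is_cell QK f js ks g \<phi>'" and s: "star \<phi> = star \<phi>'"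
  shows "\<phi> = \<phi>'"
proof -
  note C = QV_cell[OF c(1)] and C' = QV_cell[OF c(2)]
  have "hcomp K (qc \<phi>) (counits K \<epsilon> g js) = hcomp K (qc \<phi>') (counits K \<epsilon> g js)"
    using star_cell(2)[OF c(1)] star_cell(2)[OF c(2)] s by simp
  then have "qc \<phi> = qc \<phi>'"
    by (rule hcomp_counits_inj[OF C(3) C(6) C(2) refl C(8) C'(8)])
  moreover obtain \<alpha> \<alpha>' where "\<phi> = Quint f js ks g \<alpha>" "\<phi>' = Quint f js ks g \<alpha>'"
    using c unfolding is_cell_QV by blast
  ultimately show ?thesis by simp
qed

text \<open>The vertical boundary of a quintet can be read off from its image. Its horizontal
  boundary cannot, since distinct vertical morphisms may have the same chosen companion.\<close>

lemma star_inj':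
  assumes c: "\<phi> \<in> Cell QK" "\<phi>' \<in> Cell QK" and e: "qjs \<phi> = qjs \<phi>'" "qks \<phi> = qks \<phi>'"
    and s: "star \<phi> = star \<phi>'"
  shows "\<phi> = \<phi>'"
proof (rule star_inj[OF QV_cellI _ s])
  have "qf \<phi> = qf \<phi>'" "qg \<phi> = qg \<phi>'"
    using star_cell(1)[OF QV_cellI[OF c(1)]] star_cell(1)[OF QV_cellI[OF c(2)]] s
    by (auto simp: is_cell_def)
  then show "is_cell QK (qf \<phi>) (qjs \<phi>) (qks \<phi>) (qg \<phi>) \<phi>'" using QV_cellI[OF c(2)] e by simp
qed (rule c)

text \<open>Composing with the counits of the target makes \<chi> nullary; the counits of the source
  are then stripped by \<open>hcomp_counits_surj\<close>.\<close>

lemma star_surj: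
  assumes x: "is_cell K f (map ch js) (map ch ks) g \<chi>"
    and mj: "mp (vdom K f) js (vdom K g)" and mk: "mp (vcod K f) ks (vcod K g)"
    and h: "\<forall>j\<in>set js. has_companion K j" "\<forall>k\<in>set ks. has_companion K k" and l: "length ks \<le> 1"
  shows "\<exists>\<phi>. is_cell QK f js ks g \<phi> \<and> star \<phi> = \<chi>"
proof -
  have v: "f \<in> Ver K" "g \<in> Ver K" using is_cell_Ver[OF x] by auto
  note M = mpath_comp_Ver[OF mj] mpath_comp_Ver[OF mk]
  have w: "is_cell K (vcomp K (vid K (vcod K g)) (mc (vcod K f) ks)) (map ch ks) [] (vid K (vcod K
    g)) (counits K \<epsilon> (vid K (vcod K g)) ks)"
    by (rule is_cell_counits[OF mk h(2)]) (use v in auto)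
  have wx: "is_cell K (vcomp K (mc (vcod K f) ks) f) (map ch js) [] g (ccomp K (counits K \<epsilon> (vid K
    (vcod K g)) ks) [\<chi>])"
    using is_cell_ccomp_1[OF w x] M v by simp
  obtain \<alpha> where a: "is_cell K (vcomp K (mc (vcod K f) ks) f) [] [] (vcomp K g (mc (vdom K f) js))
    \<alpha>"
    "hcomp K \<alpha> (counits K \<epsilon> g js) = ccomp K (counits K \<epsilon> (vid K (vcod K g)) ks) [\<chi>]"
    using hcomp_counits_surj[OF mj h(1) v(2) refl wx] by blast
  have q: "is_cell QK f js ks g (Quint f js ks g \<alpha>)"
    unfolding is_cell_QV using a v mj mk h l by blast
  then show ?thesis using star_eqI[OF q x] a by auto
qed

text \<open>The leading identity cell makes the path of cells non-empty, so that the induction can start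
  at the empty path.\<close>

lemma counits_star_path:
  "cpath QK f \<phi>s g \<Longrightarrow>
     cpath K f (map star \<phi>s) g \<and>
     concat (map (htgt K) (map star \<phi>s)) = map ch (concat (map qks \<phi>s)) \<and>
     concat (map (hsrc K) (map star \<phi>s)) = map ch (concat (map qjs \<phi>s)) \<and>
     ccomp K (counits K \<epsilon> (vid K (vcod K g)) (concat (map qks \<phi>s))) (vidc K f # map star \<phi>s) =
     hcomp K (paste f \<phi>s) (counits K \<epsilon> g (concat (map qjs \<phi>s)))"
proof (induction \<phi>s arbitrary: f)
  case Nil
  then have f: "f \<in> Ver K" "f = g" by auto
  then show ?case
    using vidc_vidc[of f "vid K (vcod K f)"] hcomp_vidc_left[OF is_cell_vidc[OF f(1)]] by auto
next
  case (Cons \<phi> \<phi>s)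
  let ?h = "qg \<phi>"
  have f: "qf \<phi> = f" "cpath QK ?h \<phi>s g" and c: "is_cell QK f (qjs \<phi>) (qks \<phi>) ?h \<phi>"
    using Cons.prems QV_cellI[of \<phi>] by auto
  note ih = Cons.IH[OF f(2)]
  note C = QV_cell[OF c]
  note P = is_cell_qpaste[OF f(2)]
  note S = star_cell[OF c]
  let ?js = "concat (map qjs \<phi>s)" and ?ks = "concat (map qks \<phi>s)"
  have mj: "mp (vdom K ?h) ?js (vdom K g)" and mk: "mp (vcod K ?h) ?ks (vcod K g)" using P by auto
  note M = mpath_comp_Ver[OF C(3)] mpath_comp_Ver[OF C(4)] mpath_comp_Ver[OF mj] mpath_comp_Ver[OF
    mk]
  have v: "f \<in> Ver K" "g \<in> Ver K" "?h \<in> Ver K" using P C by auto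
  let ?i = "vid K (vcod K g)" and ?k = "mc (vcod K ?h) ?ks" and ?j = "mc (vdom K f) (qjs \<phi>)"
  let ?j' = "mc (vdom K ?h) ?js"
  have hk: "\<forall>k\<in>set ?ks. has_companion K k" and hj: "\<forall>k\<in>set ?js. has_companion K k"
    using P by blast+
  have cs: "cpath K f (map star (\<phi> # \<phi>s)) g"
    using ih S by (simp add: is_cell_def)
  have W1: "is_cell K (vcomp K ?k (mc (vcod K f) (qks \<phi>))) (map ch (qks \<phi>)) [] ?k (counits K \<epsilon> ?k
    (qks \<phi>))"
    by (rule is_cell_counits[OF C(4)]) (use M C in auto)
  have W2: "is_cell K ?k (map ch ?ks) [] ?i (counits K \<epsilon> ?i ?ks)"
    using is_cell_counits[OF mk, of ?i] hk v M by simp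
  have W3: "is_cell K (vcomp K ?h ?j) (map ch (qjs \<phi>)) [] ?h (counits K \<epsilon> ?h (qjs \<phi>))"
    by (rule is_cell_counits[OF C(3)]) (use M C in auto)
  have W4: "is_cell K (vcomp K g ?j') (map ch ?js) [] g (counits K \<epsilon> g ?js)"
    by (rule is_cell_counits[OF mj]) (use v hj in auto)
  have W5: "is_cell K (mc (vcod K f) (qks \<phi>)) (map ch (qks \<phi>)) [] (vid K (vcod K ?h)) (counits K \<epsilon>
    (vid K (vcod K ?h)) (qks \<phi>))"
    using is_cell_counits[OF C(4), of "vid K (vcod K ?h)"] C v M by simp
  have W6: "is_cell K (vcomp K ?j' ?j) (map ch (qjs \<phi>)) [] ?j' (counits K \<epsilon> ?j' (qjs \<phi>))"
    by (rule is_cell_counits[OF C(3)]) (use M C in auto)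
  have p: "is_cell K (vcomp K ?k ?h) [] [] (vcomp K g ?j') (paste ?h \<phi>s)" using P by simp
  have app: "counits K \<epsilon> ?i (qks \<phi> @ ?ks) = hcomp K (counits K \<epsilon> ?k (qks \<phi>)) (counits K \<epsilon> ?i ?ks)"
    using counits_append[OF C(4) mk C(7) hk, of ?i] v M by simp
  have app': "counits K \<epsilon> g (qjs \<phi> @ ?js)
    = hcomp K (counits K \<epsilon> (vcomp K g ?j') (qjs \<phi>)) (counits K \<epsilon> g ?js)"
    using counits_append[OF C(3) mj C(6) hj, of g] v M by simp
  have cm1: "composable K (counits K \<epsilon> ?k (qks \<phi>)) [star \<phi>]"
    by (rule composable_1[OF W1 S(1)]) (use M C in auto)
  have cm2: "composable K (counits K \<epsilon> ?k (qks \<phi>)) [vidc K f, star \<phi>]"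
    by (rule composable_2[of _ "[]", OF _ is_cell_vidc[OF v(1)] S(1)]) (use W1 M C in auto)
  have cm3: "composable K (counits K \<epsilon> ?i ?ks) (vidc K ?h # map star \<phi>s)"
    using ih by (intro composableI[OF _ _ _ , of _ _ ?h g])
      (use v W2 M in \<open>auto simp: is_cell_def vidc_in vsrc_vidc vtgt_vidc htgt_vidc\<close>)
  have cm4: "composable K (counits K \<epsilon> ?i (qks \<phi> @ ?ks)) (vidc K f # star \<phi> # map star \<phi>s)"
  proof (rule composableI[of _ _ f g])
    show "cpath K f (vidc K f # star \<phi> # map star \<phi>s) g"
      using cs v by (simp add: vidc_in vsrc_vidc vtgt_vidc)
    show "counits K \<epsilon> ?i (qks \<phi> @ ?ks) \<in> Cell K"
      "hsrc K (counits K \<epsilon> ?i (qks \<phi> @ ?ks))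
        = concat (map (htgt K) (vidc K f # star \<phi> # map star \<phi>s))"
      "vdom K (vsrc K (counits K \<epsilon> ?i (qks \<phi> @ ?ks))) = vcod K f"
      using is_cellD[OF is_cell_hcomp[OF W1 W2]] app v S(1) ih M C by
        (auto simp: htgt_vidc is_cell_def)
  qed simp
  \<comment> \<open>A second identity cell is inserted behind \<open>star \<phi>\<close>. It is the
    leading identity that the induction hypothesis asks for.\<close>
  have "ccomp K (counits K \<epsilon> ?i (qks \<phi> @ ?ks)) (vidc K f # star \<phi> # map star \<phi>s) =
      ccomp K (counits K \<epsilon> ?i (qks \<phi> @ ?ks)) ([vidc K f, star \<phi>] @ [vidc K ?h] @ map star \<phi>s)"
    using ccomp_insert_vidc[of _ "[vidc K f, star \<phi>]" "map star \<phi>s" f ?h g] cm4 S(1) ih v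
    by (simp add: is_cell_def vidc_in vsrc_vidc vtgt_vidc)
  also have "\<dots> = hcomp K (ccomp K (counits K \<epsilon> ?k (qks \<phi>)) [vidc K f, star \<phi>])
      (ccomp K (counits K \<epsilon> ?i ?ks) (vidc K ?h # map star \<phi>s))"
    unfolding app using hcomp_ccomp[OF W1 W2 cm2 cm3] S(1) v by (simp add: is_cell_def vsrc_vidc)
  also have "ccomp K (counits K \<epsilon> ?k (qks \<phi>)) [vidc K f, star \<phi>]
    = ccomp K (counits K \<epsilon> ?k (qks \<phi>)) [star \<phi>]"
    using ccomp_vidc_Cons[OF cm1] S(1) by (simp add: is_cell_def)
  also have "counits K \<epsilon> ?k (qks \<phi>) = whisk K ?k (counits K \<epsilon> (vid K (vcod K ?h)) (qks \<phi>))"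
    using whisk_counits[OF C(4) C(7), of "vid K (vcod K ?h)" ?k] v M by simp
  also have "ccomp K (whisk K ?k (counits K \<epsilon> (vid K (vcod K ?h)) (qks \<phi>))) [star \<phi>] =
      whisk K ?k (ccomp K (counits K \<epsilon> (vid K (vcod K ?h)) (qks \<phi>)) [star \<phi>])"
    by (rule whisk_ccomp[OF W5, symmetric]) (use M v in \<open>auto intro!: composable_1[OF W5 S(1)]\<close>)
  also have "\<dots> = whisk K ?k (hcomp K (qc \<phi>) (counits K \<epsilon> ?h (qjs \<phi>)))"
    using S(2) by simp
  also have "\<dots> = hcomp K (whisk K ?k (qc \<phi>)) (whisk K ?k (counits K \<epsilon> ?h (qjs \<phi>)))"
    by (rule whisk_hcomp[OF C(8) W3]) (use M v C(4) in auto)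
  also have "ccomp K (counits K \<epsilon> ?i ?ks) (vidc K ?h # map star \<phi>s) =
      hcomp K (paste ?h \<phi>s) (counits K \<epsilon> g ?js)"
    using ih by simp
  finally have 1: "ccomp K (counits K \<epsilon> ?i (qks \<phi> @ ?ks)) (vidc K f # star \<phi> # map star \<phi>s) =
     hcomp K (hcomp K (whisk K ?k (qc \<phi>)) (whisk K ?k (counits K \<epsilon> ?h (qjs \<phi>))))
       (hcomp K (paste ?h \<phi>s) (counits K \<epsilon> g ?js))" .
  have pj: "is_cell K (vcomp K (vcomp K ?k ?h) ?j) [] [] (vcomp K (vcomp K g ?j') ?j) (ccomp K
    (paste ?h \<phi>s) [vidc K ?j])"
    by (rule is_cell_ccomp_vidc_right[OF p]) (use M v in auto)
  have kq: "is_cell K (vcomp K ?k (vcomp K (mc (vcod K f) (qks \<phi>)) f)) [] [] (vcomp K ?k (vcomp K ?h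
    ?j)) (whisk K ?k (qc \<phi>))"
    by (rule is_cell_whisk[OF C(8)]) (use M v C in auto)
  have kE: "is_cell K (vcomp K ?k (vcomp K ?h ?j)) (map ch (qjs \<phi>)) [] (vcomp K ?k ?h) (whisk K ?k
    (counits K \<epsilon> ?h (qjs \<phi>)))"
    by (rule is_cell_whisk[OF W3]) (use M v C in auto)
  have pj': "is_cell K (vcomp K ?k (vcomp K ?h ?j)) [] [] (vcomp K (vcomp K g ?j') ?j) (ccomp K
    (paste ?h \<phi>s) [vidc K ?j])"
    using pj M v by (simp add: vcomp_assoc)
  have gE: "is_cell K (vcomp K (vcomp K g ?j') ?j) (map ch (qjs \<phi>)) [] (vcomp K g ?j') (counits K \<epsilon>
    (vcomp K g ?j') (qjs \<phi>))"
    by (rule is_cell_counits[OF C(3)]) (use M C v in auto)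
  let ?E = "counits K \<epsilon> (vid K (vdom K ?h)) (qjs \<phi>)"
  have E: "is_cell K ?j (map ch (qjs \<phi>)) [] (vid K (vdom K ?h)) ?E"
    using is_cell_counits[OF C(3) C(6), of "vid K (vdom K ?h)"] M v by simp
  \<comment> \<open>Interchange: both orders equal the pasting of \<phi>s composed with the
    unwhiskered counits \<open>?E\<close>, so the counits of \<phi> can be moved past the pasting of
    the remaining quintets.\<close>
  have "hcomp K (whisk K ?k (counits K \<epsilon> ?h (qjs \<phi>))) (paste ?h \<phi>s) =
      hcomp K (whisk K (vcomp K ?k ?h) ?E) (ccomp K (paste ?h \<phi>s) [vidc K (vid K (vdom K ?h))])"
  proof -
    have "whisk K ?k (counits K \<epsilon> ?h (qjs \<phi>)) = whisk K (vcomp K ?k ?h) ?E"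
      using whisk_counits[OF C(3) C(6), of ?h ?k] whisk_counits[OF C(3) C(6), of "vid K (vdom K ?h)"
        "vcomp K ?k ?h"] v M
      by simp
    then show ?thesis using is_cell_ccomp_vidc[OF p] M v by simp
  qed
  also have "\<dots> = ccomp K (paste ?h \<phi>s) [?E]"
    by (rule interchange_right[OF p E, symmetric]) (use M v in auto)
  also have "\<dots> = hcomp K (ccomp K (paste ?h \<phi>s) [vidc K ?j]) (whisk K (vcomp K g ?j') ?E)"
    by (rule interchange_left[OF p E]) (use M v in auto)
  also have "whisk K (vcomp K g ?j') ?E = counits K \<epsilon> (vcomp K g ?j') (qjs \<phi>)"
    using whisk_counits[OF C(3) C(6), of "vid K (vdom K ?h)" "vcomp K g ?j'"] v M by simp
  finally have 2: "hcomp K (whisk K ?k (counits K \<epsilon> ?h (qjs \<phi>))) (paste ?h \<phi>s) =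
     hcomp K (ccomp K (paste ?h \<phi>s) [vidc K ?j]) (counits K \<epsilon> (vcomp K g ?j') (qjs \<phi>))" .
  have 3: "paste f (\<phi> # \<phi>s) = hcomp K (whisk K ?k (qc \<phi>)) (ccomp K (paste ?h \<phi>s) [vidc K ?j])"
    by (rule qpaste_Cons(1)[OF p c refl refl]) (use M in auto)
  have "hcomp K (hcomp K (whisk K ?k (qc \<phi>)) (whisk K ?k (counits K \<epsilon> ?h (qjs \<phi>))))
       (hcomp K (paste ?h \<phi>s) (counits K \<epsilon> g ?js)) =
     hcomp K (whisk K ?k (qc \<phi>)) (hcomp K (hcomp K (whisk K ?k (counits K \<epsilon> ?h (qjs \<phi>))) (paste ?h
       \<phi>s)) (counits K \<epsilon> g ?js))"
    using hcomp_assoc[OF kq kE is_cell_hcomp[OF p W4]] hcomp_assoc[OF kE p W4] by simp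
  also have "\<dots> = hcomp K (hcomp K (whisk K ?k (qc \<phi>)) (ccomp K (paste ?h \<phi>s) [vidc K ?j]))
      (hcomp K (counits K \<epsilon> (vcomp K g ?j') (qjs \<phi>)) (counits K \<epsilon> g ?js))"
    unfolding 2 using hcomp_assoc[OF pj' gE W4] hcomp_assoc[OF kq pj' is_cell_hcomp[OF gE W4]]
      by simp
  also have "\<dots> = hcomp K (paste f (\<phi> # \<phi>s)) (counits K \<epsilon> g (qjs \<phi> @ ?js))"
    unfolding 3 app' ..
  finally have 4: "ccomp K (counits K \<epsilon> ?i (qks \<phi> @ ?ks)) (vidc K f # star \<phi> # map star \<phi>s) =
     hcomp K (paste f (\<phi> # \<phi>s)) (counits K \<epsilon> g (qjs \<phi> @ ?js))" using 1 by simp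
  show ?case using 4 cs ih S(1) by (simp add: is_cell_def del: qpaste.simps)
qed

text \<open>By uniqueness it suffices that the composite of the images satisfies the defining
  equation for the composite quintet. Composed with the counits of the target, the image of \<psi>
  turns into its 2-cell followed by the counits of its source, and these meet the images of \<phi>s
  as in \<open>counits_star_path\<close>.\<close>

lemma star_qcomp:
  assumes c: "is_cell QK p ms ls q \<psi>" and s: "\<phi>s \<noteq> []" "cpath QK f \<phi>s g" "ms = concat (map qks \<phi>s)"
    "vdom K p = vcod K f"
  shows "composable K (star \<psi>) (map star \<phi>s)"
    and "star (qcomp (V K) \<psi> \<phi>s) = ccomp K (star \<psi>) (map star \<phi>s)"
proof -
  note C = QV_cell[OF c]
  note P = is_cell_qpaste[OF s(2)]
  note R = counits_star_path[OF s(2)]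
  note S = star_cell[OF c]
  note qc = qcomp_eq[OF c s]
  let ?js = "concat (map qjs \<phi>s)"
  have mj: "mp (vdom K f) ?js (vdom K g)" and mk: "mp (vcod K f) ms (vcod K g)" using P s by auto
  note M = mpath_comp_Ver[OF C(3)] mpath_comp_Ver[OF C(4)] mpath_comp_Ver[OF mj] mpath_comp_Ver[OF
    mk]
  have v: "f \<in> Ver K" "g \<in> Ver K" "p \<in> Ver K" "q \<in> Ver K" "vdom K q = vcod K g"
    using P C s M by auto
  let ?i = "vid K (vcod K q)"
  let ?s = "map star \<phi>s"
  have hj: "\<forall>k\<in>set ?js. has_companion K k" using P by blast
  have hs: "cpath K f ?s g" "?s \<noteq> []" using R s by auto
  have hl: "vsrc K (hd ?s) = f" "vtgt K (last ?s) = g" using cpath_hd_last[OF hs] by auto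
  show cm: "composable K (star \<psi>) ?s"
    by (rule composableI[OF _ hs(2) hs(1)]) (use R S s in \<open>auto simp: is_cell_def\<close>)
  have b: "is_cell K (vcomp K p f) (map ch ?js) (map ch ls) (vcomp K q g) (ccomp K (star \<psi>) ?s)"
    using is_cell_ccomp[OF S(1) hs(2) hs(1)] R s by simp
  have W1: "is_cell K (mc (vcod K p) ls) (map ch ls) [] ?i (counits K \<epsilon> ?i ls)"
    using is_cell_counits[OF C(4) C(7), of ?i] v M by simp
  have W2: "is_cell K (vcomp K q (mc (vcod K f) ms)) (map ch ms) [] q (counits K \<epsilon> q ms)"
    using is_cell_counits[OF mk C(6), of q] v M by simp
  have W2': "is_cell K (mc (vcod K f) ms) (map ch ms) [] (vid K (vcod K g)) (counits K \<epsilon> (vid K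
    (vcod K g)) ms)"
    using is_cell_counits[OF mk C(6), of "vid K (vcod K g)"] v M by simp
  have W3: "is_cell K (vcomp K g (mc (vdom K f) ?js)) (map ch ?js) [] g (counits K \<epsilon> g ?js)"
    by (rule is_cell_counits[OF mj hj]) (use v in auto)
  have W3': "is_cell K (vcomp K q (vcomp K g (mc (vdom K f) ?js))) (map ch ?js) [] (vcomp K q g)
    (counits K \<epsilon> (vcomp K q g) ?js)"
    using is_cell_counits[OF mj hj, of "vcomp K q g"] v M by (simp add: vcomp_assoc)
  have pq: "is_cell K (vcomp K (mc (vcod K p) ls) p) [] [] (vcomp K q (mc (vcod K f) ms)) (qc \<psi>)"
    using C(8) s by simp
  have pp: "is_cell K (vcomp K (mc (vcod K f) ms) f) [] [] (vcomp K g (mc (vdom K f) ?js)) (paste f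
    \<phi>s)"
    using P s by simp
  have cf: "composable K (counits K \<epsilon> q ms) ?s"
    by (rule composableI[OF _ hs(2) hs(1)]) (use R W2 s M v in \<open>auto simp: is_cell_def\<close>)
  have cf': "composable K (counits K \<epsilon> (vid K (vcod K g)) ms) (vidc K f # ?s)"
    by (rule composableI[of _ _ f g])
      (use R W2' s M v in \<open>auto simp: is_cell_def vidc_in htgt_vidc vsrc_vidc vtgt_vidc\<close>)
  have cf2: "composable K (hcomp K (qc \<psi>) (counits K \<epsilon> q ms)) ?s"
    by (rule composableI[OF _ hs(2) hs(1)])
      (use R is_cell_hcomp[OF pq W2] s M v C(4) in \<open>auto simp: is_cell_def\<close>)
  have "ccomp K (counits K \<epsilon> ?i ls) [ccomp K (star \<psi>) ?s]
    = ccomp K (ccomp K (counits K \<epsilon> ?i ls) [star \<psi>]) ?s"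
    by (rule ccomp_assoc_1[OF composable_1[OF W1 S(1)] cm]) (use M in auto)
  also have "\<dots> = ccomp K (hcomp K (qc \<psi>) (counits K \<epsilon> q ms)) ?s" using S(2) by simp
  \<comment> \<open>The additional id_f is the argument of the vertical cell
    \<open>qc \<psi>\<close>, whose horizontal source is empty.\<close>
  also have "\<dots> = ccomp K (hcomp K (qc \<psi>) (counits K \<epsilon> q ms)) ([vidc K f] @ ?s)"
    using ccomp_vidc_Cons[OF cf2] hl by simp
  also have "\<dots> = hcomp K (ccomp K (qc \<psi>) [vidc K f]) (ccomp K (counits K \<epsilon> q ms) ?s)"
    by (rule hcomp_ccomp[OF pq W2 _ cf])
     (use v hl M s C(4) in \<open>auto simp: vtgt_vidc intro!: composable_1[OF pq is_cell_vidc]\<close>)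
  also have "ccomp K (counits K \<epsilon> q ms) ?s
    = ccomp K (whisk K q (counits K \<epsilon> (vid K (vcod K g)) ms)) (vidc K f # ?s)"
    using ccomp_vidc_Cons[OF cf] hl whisk_counits[OF mk C(6), of "vid K (vcod K g)" q] v by simp
  also have "\<dots> = whisk K q (ccomp K (counits K \<epsilon> (vid K (vcod K g)) ms) (vidc K f # ?s))"
    by (rule whisk_ccomp[OF W2' _ _ cf', symmetric]) (use v M in auto)
  also have "\<dots> = whisk K q (hcomp K (paste f \<phi>s) (counits K \<epsilon> g ?js))" using R s by simp
  also have "\<dots> = hcomp K (whisk K q (paste f \<phi>s)) (whisk K q (counits K \<epsilon> g ?js))"
    by (rule whisk_hcomp[OF pp W3]) (use v M in auto)
  also have "whisk K q (counits K \<epsilon> g ?js) = counits K \<epsilon> (vcomp K q g) ?js"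
    by (rule whisk_counits[OF mj hj]) (use v in auto)
  also have "hcomp K (ccomp K (qc \<psi>) [vidc K f]) (hcomp K (whisk K q (paste f \<phi>s)) (counits K \<epsilon>
    (vcomp K q g) ?js)) =
     hcomp K (qc (qcomp (V K) \<psi> \<phi>s)) (counits K \<epsilon> (vcomp K q g) ?js)"
    unfolding qc(1) using hcomp_assoc[OF qc(3) qc(4) W3'] by simp
  finally show "star (qcomp (V K) \<psi> \<phi>s) = ccomp K (star \<psi>) ?s"
    using v by (intro star_eqI[OF qc(2) b]) simp
qed

lemma is_cell_QV_vidc: "f \<in> Ver K \<Longrightarrow> is_cell QK f [] [] f (vidc QK f)"
  using is_cell_vidc by (auto simp: is_cell_QV)

lemma is_cell_QV_hidc:
  "has_companion K j \<Longrightarrow> is_cell QK (vid K (vdom K j)) [j] [j] (vid K (vcod K j)) (hidc QK j)"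
  using is_cell_vidc counit_cell[of j] by (auto simp: is_cell_QV)

lemma star_vidc: "f \<in> Ver K \<Longrightarrow> star (vidc QK f) = vidc K f"
  by (rule star_eqI[OF is_cell_QV_vidc])
    (use is_cell_vidc vidc_vidc[of f "vid K (vcod K f)"] hcomp_vidc_left[OF is_cell_vidc] in auto)

lemma star_hidc:
  assumes "has_companion K j"
  shows "star (hidc QK j) = hidc K (ch j)"
proof -
  note j = counit_cell[OF assms]
  have e: "counits K \<epsilon> (vid K (vcod K j)) [j] = \<epsilon> j"
    using counits_single[OF assms, of "vid K (vcod K j)"] j whisk_vid[OF j(1)] by
      (simp del: counits.simps)
  show ?thesis
    by (rule star_eqI[OF is_cell_QV_hidc[OF assms]])
      (use j e is_cell_hidc[OF j(3)] is_cell_ccomp_hidc[OF j(1)] hcomp_vidc_left[OF j(1)] in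
        \<open>auto simp del: counits.simps\<close>)
qed

end


section \<open>Full sub-structures and the transport of the axioms\<close>

text \<open>Facts about quintets that mention no choice of companions, such as the axioms for
  \<open>QV_lower\<close>, are still proved through \<open>star\<close>; this supplies the
  choice.\<close>

lemma ex_companion_choice: "\<exists>\<epsilon>. companion_choice K \<epsilon>"
proof
  show "companion_choice K (\<lambda>j. SOME e. companion_cell K j e)"
    by (simp add: companion_choice_def has_companion_def someI_ex)
qed

section \<open>Full sub-structures\<close>

lemma full_sub_simps [simp]:
  "Ob (full_sub K P) = Ob K" "Ver (full_sub K P) = Ver K" "vdom (full_sub K P) = vdom K"
  "vcod (full_sub K P) = vcod K" "vid (full_sub K P) = vid K" "vcomp (full_sub K P) = vcomp K"
  "Hor (full_sub K P) = {J \<in> Hor K. P J}"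
  "hdom (full_sub K P) = hdom K" "hcod (full_sub K P) = hcod K"
  "Cell (full_sub K P) =
     {\<phi> \<in> Cell K. (\<forall>J\<in>set (hsrc K \<phi>). P J) \<and> (\<forall>J\<in>set (htgt K \<phi>). P J)}"
  "hsrc (full_sub K P) = hsrc K" "htgt (full_sub K P) = htgt K" "vsrc (full_sub K P) = vsrc K"
  "vtgt (full_sub K P) = vtgt K"
  "ccomp (full_sub K P) = ccomp K" "hidc (full_sub K P) = hidc K" "vidc (full_sub K P) = vidc K"
  by (simp_all add: full_sub_def)

lemma hpath_full_sub: "hpath (full_sub K P) A Js B \<longleftrightarrow> hpath K A Js B \<and> (\<forall>J\<in>set Js. P J)"
  by (induction Js arbitrary: A) auto

lemma cpath_full_sub: "cpath (full_sub K P) f \<phi>s g \<Longrightarrow> cpath K f \<phi>s g"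
  by (induction \<phi>s arbitrary: f) auto

lemma cpath_Cell: "cpath K f \<phi>s g \<Longrightarrow> \<phi> \<in> set \<phi>s \<Longrightarrow> \<phi> \<in> Cell K"
  by (induction \<phi>s arbitrary: f) auto

lemma composable_full_sub: "composable (full_sub K P) \<psi> \<phi>s \<Longrightarrow> composable K \<psi> \<phi>s"
  unfolding composable_def using cpath_full_sub by auto

context aug_virt_dbl_cat
begin

text \<open>The sub-structure is closed under composition because the horizontal source of a
  composite is the concatenation of the sources of its inner cells, and its target is that of the
  outer cell. All equations are those of K.\<close>

lemma full_sub_avdc: "aug_virt_dbl_cat (full_sub K P)"
proof
  fix \<psi> \<phi>s assume c: "composable (full_sub K P) \<psi> \<phi>s"
  note c' = composable_full_sub[OF c]
  have "\<phi> \<in> Cell (full_sub K P)" if "\<phi> \<in> set \<phi>s" for \<phi>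
    using c[unfolded composable_def] cpath_Cell[OF _ that] by metis
  moreover have "\<psi> \<in> Cell (full_sub K P)" using c by (simp add: composable_def)
  ultimately show "ccomp (full_sub K P) \<psi> \<phi>s \<in> Cell (full_sub K P)"
    using ccomp_in[OF c'] hsrc_ccomp[OF c'] htgt_ccomp[OF c'] by auto
  show "hsrc (full_sub K P) (ccomp (full_sub K P) \<psi> \<phi>s) = concat (map (hsrc (full_sub K P)) \<phi>s)"
    "htgt (full_sub K P) (ccomp (full_sub K P) \<psi> \<phi>s) = htgt (full_sub K P) \<psi>"
    "vsrc (full_sub K P) (ccomp (full_sub K P) \<psi> \<phi>s) =
       vcomp (full_sub K P) (vsrc (full_sub K P) \<psi>) (vsrc (full_sub K P) (hd \<phi>s))"
    "vtgt (full_sub K P) (ccomp (full_sub K P) \<psi> \<phi>s) =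
       vcomp (full_sub K P) (vtgt (full_sub K P) \<psi>) (vtgt (full_sub K P) (last \<phi>s))"
    using hsrc_ccomp[OF c'] htgt_ccomp[OF c'] vsrc_ccomp[OF c'] vtgt_ccomp[OF c'] by auto
next
  fix \<psi>s \<phi>ss \<chi>
  assume l: "list_all2 (composable (full_sub K P)) \<psi>s \<phi>ss"
    and c: "composable (full_sub K P) \<chi> (map2 (ccomp (full_sub K P)) \<psi>s \<phi>ss)"
    "composable (full_sub K P) \<chi> \<psi>s"
    "composable (full_sub K P) (ccomp (full_sub K P) \<chi> \<psi>s) (concat \<phi>ss)"
  have "list_all2 (composable K) \<psi>s \<phi>ss"
    using l by (rule list_all2_mono) (rule composable_full_sub)
  from ccomp_assoc[OF this] show "ccomp (full_sub K P) \<chi> (map2 (ccomp (full_sub K P)) \<psi>s \<phi>ss) =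
      ccomp (full_sub K P) (ccomp (full_sub K P) \<chi> \<psi>s) (concat \<phi>ss)"
    using c[THEN composable_full_sub] by simp
next
  fix \<psi> \<phi>s \<chi>s f\<^sub>0 f f\<^sub>n
  assume c: "composable (full_sub K P) \<psi> (\<phi>s @ \<chi>s)"
    and p: "cpath (full_sub K P) f\<^sub>0 \<phi>s f" "cpath (full_sub K P) f \<chi>s f\<^sub>n"
  show "ccomp (full_sub K P) \<psi> (\<phi>s @ [vidc (full_sub K P) f] @ \<chi>s)
    = ccomp (full_sub K P) \<psi> (\<phi>s @ \<chi>s)"
    using ccomp_insert_vidc[OF composable_full_sub[OF c] p[THEN cpath_full_sub]] by simp
qed (auto simp: hpath_full_sub hsrc_path htgt_path htgt_length[simplified] vsrc_in vtgt_in hdom_in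
  hcod_in
    hidc_in hsrc_hidc htgt_hidc vsrc_hidc vtgt_hidc vidc_in hsrc_vidc htgt_vidc vsrc_vidc vtgt_vidc
    vidc_vidc vidc_ccomp hidc_ccomp ccomp_vidc ccomp_hidc vcomp_assoc)

end

text \<open>The two bracketings of an iterated composite have the same horizontal source. As
  \<open>star\<close> may forget this list, it has to be compared separately when associativity is
  transported.\<close>

lemma concat_map2_hsrc:
  assumes "list_all2 P \<psi>s \<phi>ss" "\<And>\<psi> \<phi>s. P \<psi> \<phi>s \<Longrightarrow> s (c \<psi> \<phi>s) = concat (map s \<phi>s)"
  shows "concat (map s (map2 c \<psi>s \<phi>ss)) = concat (map s (concat \<phi>ss))"
  using assms(1) by (induction rule: list_all2_induct) (auto simp: assms(2))

section \<open>The axioms for quintets\<close>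

context quintet_companions
begin

lemma hpath_QV: "hpath QK A js B \<longleftrightarrow> mp A js B \<and> (\<forall>j\<in>set js. has_companion K j)"
  by (induction js arbitrary: A) auto

lemma QV_composable:
  assumes "composable QK \<psi> \<phi>s"
  shows "is_cell QK (qf \<psi>) (concat (map qks \<phi>s)) (qks \<psi>) (qg \<psi>) \<psi>" "\<phi>s \<noteq> []"
    "cpath QK (qf (hd \<phi>s)) \<phi>s (qg (last \<phi>s))" "vdom K (qf \<psi>) = vcod K (qf (hd \<phi>s))"
  using assms QV_cellI[of \<psi>] unfolding composable_def by auto

lemma composable_star: "composable QK \<psi> \<phi>s \<Longrightarrow> composable K (star \<psi>) (map star \<phi>s)"
  using star_qcomp(1)[OF QV_composable(1-3) refl QV_composable(4)] by blast

lemma star_ccomp: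
  "composable QK \<psi> \<phi>s \<Longrightarrow> star (qcomp (V K) \<psi> \<phi>s) = ccomp K (star \<psi>) (map star \<phi>s)"
  using star_qcomp(2)[OF QV_composable(1-3) refl QV_composable(4)] by blast

lemma QV_ccomp_cell:
  "composable QK \<psi> \<phi>s \<Longrightarrow>
   is_cell QK (vcomp K (qf \<psi>) (qf (hd \<phi>s))) (concat (map qjs \<phi>s)) (qks \<psi>) (vcomp K (qg \<psi>) (qg (last
     \<phi>s)))
     (qcomp (V K) \<psi> \<phi>s)"
  using qcomp_eq(2)[OF QV_composable(1-3) refl QV_composable(4)] by blast

lemma star_Cell: "\<phi> \<in> Cell QK \<Longrightarrow>
  is_cell K (qf \<phi>) (map ch (qjs \<phi>)) (map ch (qks \<phi>)) (qg \<phi>) (star \<phi>)"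
  using star_cell(1)[OF QV_cellI] by blast

lemma cpath_star: "cpath QK f \<phi>s g \<Longrightarrow> cpath K f (map star \<phi>s) g"
  using counits_star_path by blast

text \<open>All equational axioms for quintets are transported along the injective, composition
  preserving map \<open>star\<close>, so that pasting in the 2-category need not be studied.\<close>

lemma QV_lower_avdc: "aug_virt_dbl_cat QK"
proof
  fix \<phi> assume c: "\<phi> \<in> Cell QK"
  note C = QV_cell[OF QV_cellI[OF c]]
  show "vsrc QK \<phi> \<in> Ver QK" "vtgt QK \<phi> \<in> Ver QK" "length (htgt QK \<phi>) \<le> 1"
    "hpath QK (vdom QK (vsrc QK \<phi>)) (hsrc QK \<phi>) (vdom QK (vtgt QK \<phi>))"
    "hpath QK (vcod QK (vsrc QK \<phi>)) (htgt QK \<phi>) (vcod QK (vtgt QK \<phi>))"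
    using C by (auto simp: hpath_QV)
next
  fix \<psi> \<phi>s assume "composable QK \<psi> \<phi>s"
  from QV_ccomp_cell[OF this]
  show "ccomp QK \<psi> \<phi>s \<in> Cell QK" "hsrc QK (ccomp QK \<psi> \<phi>s) = concat (map (hsrc QK) \<phi>s)"
    "htgt QK (ccomp QK \<psi> \<phi>s) = htgt QK \<psi>"
    "vsrc QK (ccomp QK \<psi> \<phi>s) = vcomp QK (vsrc QK \<psi>) (vsrc QK (hd \<phi>s))"
    "vtgt QK (ccomp QK \<psi> \<phi>s) = vcomp QK (vtgt QK \<psi>) (vtgt QK (last \<phi>s))"
    by (auto simp: is_cell_def)
next
  fix J assume "J \<in> Hor QK"
  then show "hidc QK J \<in> Cell QK" using is_cell_QV_hidc[of J] by (auto simp: is_cell_def)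
next
  fix f assume "f \<in> Ver QK"
  then show "vidc QK f \<in> Cell QK" using is_cell_QV_vidc[of f] by (auto simp: is_cell_def)
next
  fix f h assume a: "f \<in> Ver QK" "h \<in> Ver QK" "vcod QK f = vdom QK h"
  then have c: "composable QK (vidc QK h) [vidc QK f]"
    using is_cell_QV_vidc[of f] is_cell_QV_vidc[of h] by (auto simp: composable_def is_cell_def)
  show "ccomp QK (vidc QK h) [vidc QK f] = vidc QK (vcomp QK h f)"
    by (rule star_inj')
      (use a QV_ccomp_cell[OF c] star_ccomp[OF c] star_vidc[of f] star_vidc[of h] star_vidc[of
        "vcomp K h f"]
        is_cell_QV_vidc[of "vcomp K h f"] vidc_vidc[of f h] in \<open>auto simp: is_cell_def\<close>)
next
  fix \<psi>s \<phi>ss \<chi>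
  assume l: "list_all2 (composable QK) \<psi>s \<phi>ss"
    and c1: "composable QK \<chi> (map2 (ccomp QK) \<psi>s \<phi>ss)"
    and c2: "composable QK \<chi> \<psi>s"
    and c3: "composable QK (ccomp QK \<chi> \<psi>s) (concat \<phi>ss)"
  have l': "list_all2 (composable K) (map star \<psi>s) (map (map star) \<phi>ss)"
    using l by (simp add: list_all2_map1 list_all2_map2) (auto elim: list_all2_mono composable_star)
  have m: "map star (map2 (qcomp (V K)) \<psi>s \<phi>ss) = map2 (ccomp K) (map star \<psi>s) (map (map star) \<phi>ss)"
    using l by (induction rule: list_all2_induct) (auto simp: star_ccomp)
  show "ccomp QK \<chi> (map2 (ccomp QK) \<psi>s \<phi>ss) = ccomp QK (ccomp QK \<chi> \<psi>s) (concat \<phi>ss)"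
  proof (rule star_inj')
    have "concat (map qjs (map2 (qcomp (V K)) \<psi>s \<phi>ss)) = concat (map qjs (concat \<phi>ss))"
      by (rule concat_map2_hsrc[OF l]) (use QV_ccomp_cell in \<open>auto simp: is_cell_def\<close>)
    then show "qjs (ccomp QK \<chi> (map2 (ccomp QK) \<psi>s \<phi>ss))
      = qjs (ccomp QK (ccomp QK \<chi> \<psi>s) (concat \<phi>ss))"
      using QV_ccomp_cell[OF c1] QV_ccomp_cell[OF c3] by (simp add: is_cell_def)
    show "qks (ccomp QK \<chi> (map2 (ccomp QK) \<psi>s \<phi>ss)) = qks (ccomp QK (ccomp QK \<chi> \<psi>s) (concat \<phi>ss))"
      using QV_ccomp_cell[OF c1] QV_ccomp_cell[OF c2] QV_ccomp_cell[OF c3] by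
        (simp add: is_cell_def)
    have "star (ccomp QK \<chi> (map2 (ccomp QK) \<psi>s \<phi>ss)) =
        ccomp K (star \<chi>) (map2 (ccomp K) (map star \<psi>s) (map (map star) \<phi>ss))"
      using star_ccomp[OF c1] m by simp
    also have "\<dots> = ccomp K (ccomp K (star \<chi>) (map star \<psi>s)) (concat (map (map star) \<phi>ss))"
      by (rule ccomp_assoc[OF l'])
        (use composable_star[OF c1] composable_star[OF c2] composable_star[OF c3] m star_ccomp[OF
          c2]
          in \<open>auto simp: map_concat\<close>)
    also have "\<dots> = star (ccomp QK (ccomp QK \<chi> \<psi>s) (concat \<phi>ss))"
      using star_ccomp[OF c2] star_ccomp[OF c3] by (simp add: map_concat)
    finally show "star (ccomp QK \<chi> (map2 (ccomp QK) \<psi>s \<phi>ss))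
      = star (ccomp QK (ccomp QK \<chi> \<psi>s) (concat \<phi>ss))" .
  qed (use QV_ccomp_cell[OF c1] QV_ccomp_cell[OF c3] in \<open>auto simp: is_cell_def\<close>)
next
  fix \<phi> assume p: "\<phi> \<in> Cell QK" "htgt QK \<phi> = []"
  let ?i = "vidc QK (vid QK (vcod QK (vsrc QK \<phi>)))"
  note C = QV_cell[OF QV_cellI[OF p(1)]] and S = star_Cell[OF p(1)]
  have c: "composable QK ?i [\<phi>]"
    using p C is_cell_QV_vidc[of "vid K (vcod K (qf \<phi>))"] by (auto simp: composable_def is_cell_def)
  show "ccomp QK ?i [\<phi>] = \<phi>"
    by (rule star_inj')
      (use p C QV_ccomp_cell[OF c] star_ccomp[OF c] star_vidc[of "vid K (vcod K (qf \<phi>))"]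
        vidc_ccomp[of "star \<phi>"] S in \<open>auto simp: is_cell_def\<close>)
next
  fix \<phi> J assume p: "\<phi> \<in> Cell QK" "htgt QK \<phi> = [J]"
  note C = QV_cell[OF QV_cellI[OF p(1)]] and S = star_Cell[OF p(1)]
  have J: "has_companion K J" using C p by auto
  have c: "composable QK (hidc QK J) [\<phi>]"
    using p C is_cell_QV_hidc[OF J] by (auto simp: composable_def is_cell_def)
  show "ccomp QK (hidc QK J) [\<phi>] = \<phi>"
    by (rule star_inj')
      (use p C QV_ccomp_cell[OF c] star_ccomp[OF c] star_hidc[OF J]
        hidc_ccomp[of "star \<phi>"] S in \<open>auto simp: is_cell_def\<close>)
next
  fix \<phi> assume p: "\<phi> \<in> Cell QK" "hsrc QK \<phi> = []"
  let ?i = "vidc QK (vid QK (vdom QK (vsrc QK \<phi>)))"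
  note C = QV_cell[OF QV_cellI[OF p(1)]] and S = star_Cell[OF p(1)]
  have c: "composable QK \<phi> [?i]"
    using p C is_cell_QV_vidc[of "vid K (vdom K (qf \<phi>))"] by (auto simp: composable_def is_cell_def)
  show "ccomp QK \<phi> [?i] = \<phi>"
    by (rule star_inj')
      (use p C QV_ccomp_cell[OF c] star_ccomp[OF c] star_vidc[of "vid K (vdom K (qf \<phi>))"]
        ccomp_vidc[of "star \<phi>"] S in \<open>auto simp: is_cell_def\<close>)
next
  fix \<phi> assume p: "\<phi> \<in> Cell QK" "hsrc QK \<phi> \<noteq> []"
  note C = QV_cell[OF QV_cellI[OF p(1)]] and S = star_Cell[OF p(1)]
  have s: "concat (map qjs (map (hidc QK) js)) = js" "concat (map qks (map (hidc QK) js)) = js"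
    for js
    by (induction js) auto
  have h: "cpath QK (vid K A) (map (hidc QK) js) (vid K B)"
    if "mp A js B" "\<forall>j\<in>set js. has_companion K j" for A js B
    using that
    by (induction js arbitrary: A) (use is_cell_QV_hidc in \<open>auto simp: is_cell_def\<close>)
  have hp: "cpath QK (vid K (vdom K (qf \<phi>))) (map (hidc QK) (qjs \<phi>)) (vid K (vdom K (qg \<phi>)))"
    by (rule h) (use C in auto)
  have hd: "qf (hd (map (hidc QK) (qjs \<phi>))) = vid K (vdom K (qf \<phi>))"
    "qg (last (map (hidc QK) (qjs \<phi>))) = vid K (vdom K (qg \<phi>))"
    using cpath_hd_last[OF hp] p(2) by (auto simp del: QV_lower_simps(15))
  have c: "composable QK \<phi> (map (hidc QK) (qjs \<phi>))"
    using p s hp hd C by (auto simp: composable_def simp del: QV_lower_simps(15))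
  have m: "map star (map (hidc QK) (qjs \<phi>)) = map (hidc K) (map ch (qjs \<phi>))"
    using C star_hidc by (auto simp del: QV_lower_simps(15))
  show "ccomp QK \<phi> (map (hidc QK) (hsrc QK \<phi>)) = \<phi>"
    by (rule star_inj')
      (use p s QV_ccomp_cell[OF c] star_ccomp[OF c] m ccomp_hidc[of "star \<phi>"] S in
        \<open>auto simp: is_cell_def simp del: QV_lower_simps(15) map_map\<close>)
next
  fix \<psi> \<phi>s \<chi>s f\<^sub>0 f f\<^sub>n
  assume c: "composable QK \<psi> (\<phi>s @ \<chi>s)" and p: "cpath QK f\<^sub>0 \<phi>s f" "cpath QK f \<chi>s f\<^sub>n"
  have f: "f \<in> Ver K" using is_cell_qpaste[OF p(2)] by simp
  have cp: "cpath QK f\<^sub>0 (\<phi>s @ [vidc QK f] @ \<chi>s) f\<^sub>n"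
  proof -
    have "cpath QK f\<^sub>0 (\<phi>s @ \<chi>s') f\<^sub>n" if "cpath QK f \<chi>s' f\<^sub>n" for \<chi>s'
      using p(1) that by (induction \<phi>s arbitrary: f\<^sub>0) auto
    then show ?thesis using p f is_cell_QV_vidc[OF f] by (auto simp: is_cell_def)
  qed
  have hl: "qf (hd (\<phi>s @ \<chi>s)) = f\<^sub>0" "qf (hd (\<phi>s @ [vidc QK f] @ \<chi>s)) = f\<^sub>0"
    "qg (last (\<phi>s @ [vidc QK f] @ \<chi>s)) = f\<^sub>n"
    using cpath_hd_last[OF cp] cpath_hd_last[OF p(1)] cpath_hd_last[OF p(2)] p c
    by (auto simp: composable_def hd_append)
  have c': "composable QK \<psi> (\<phi>s @ [vidc QK f] @ \<chi>s)"
    using c cp hl by (simp add: composable_def)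
  have s: "star (ccomp QK \<psi> (\<phi>s @ [vidc QK f] @ \<chi>s)) = star (ccomp QK \<psi> (\<phi>s @ \<chi>s))"
    using star_ccomp[OF c] star_ccomp[OF c'] star_vidc[OF f]
      ccomp_insert_vidc[of "star \<psi>" "map star \<phi>s" "map star \<chi>s" f\<^sub>0 f f\<^sub>n]
      composable_star[OF c] cpath_star[OF p(1)] cpath_star[OF p(2)] by simp
  show "ccomp QK \<psi> (\<phi>s @ [vidc QK f] @ \<chi>s) = ccomp QK \<psi> (\<phi>s @ \<chi>s)"
    by (rule star_inj'[OF _ _ _ _ s])
      (use QV_ccomp_cell[OF c] QV_ccomp_cell[OF c'] in \<open>auto simp: is_cell_def\<close>)
qed (use is_cell_QV_hidc counit_cell vcomp_assoc in \<open>auto simp: is_cell_def vidc_ccomp hpath_QV\<close>)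

end


section \<open>The 2-category of augmented virtual double categories\<close>

lemma composable_Cell: "composable K \<psi> \<phi>s \<Longrightarrow> \<phi> \<in> set \<phi>s \<Longrightarrow> \<phi> \<in> Cell K"
  unfolding composable_def using cpath_Cell by metis

context aug_virt_dbl_cat
begin

lemma ccomp_assoc_11:
  assumes "is_cell K p Ks Ls q \<chi>" "is_cell K p' Ks' Ks q' \<psi>" "is_cell K f Js Ks' g \<phi>"
    "vdom K p = vcod K p'" "vdom K p' = vcod K f"
  shows "ccomp K \<chi> [ccomp K \<psi> [\<phi>]] = ccomp K (ccomp K \<chi> [\<psi>]) [\<phi>]"
  by (rule ccomp_assoc_1[OF composable_1[OF assms(1,2)] composable_1[OF assms(2,3)]]) (use assms
    in auto)

lemma singles_path:
  "list_all2 (\<lambda>\<psi> \<phi>. composable K \<psi> [\<phi>]) \<psi>s \<phi>s \<Longrightarrow> \<psi>s \<noteq> [] \<Longrightarrow> cpath K p \<psi>s q \<Longrightarrow> cpath K f \<phi>s g \<Longrightarrow>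
   cpath K (vcomp K p f) (map2 (\<lambda>\<psi> \<phi>. ccomp K \<psi> [\<phi>]) \<psi>s \<phi>s) (vcomp K q g) \<and>
   concat (map (htgt K) (map2 (\<lambda>\<psi> \<phi>. ccomp K \<psi> [\<phi>]) \<psi>s \<phi>s)) = concat (map (htgt K) \<psi>s) \<and>
   concat (map (hsrc K) \<psi>s) = concat (map (htgt K) \<phi>s) \<and> vdom K p = vcod K f"
proof (induction arbitrary: p f rule: list_all2_induct)
  case (Cons \<psi> \<psi>s \<phi> \<phi>s)
  have c: "composable K \<psi> [\<phi>]" by fact
  have b: "vsrc K \<psi> = p" "vsrc K \<phi> = f" using Cons.prems by auto
  have p: "\<psi> \<in> Cell K" "\<phi> \<in> Cell K" using Cons.prems by auto
  show ?case
  proof (cases "\<psi>s = []")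
    case True
    then have "\<phi>s = []" using Cons by auto
    then show ?thesis using True Cons.prems c b p vsrc_ccomp[OF c] vtgt_ccomp[OF c] htgt_ccomp[OF c]
      ccomp_in[OF c]
        vtgt_in[OF ccomp_in[OF c]]
      by (auto simp: composable_def)
  next
    case False
    then show ?thesis
      using Cons.IH[of "vtgt K \<psi>" "vtgt K \<phi>"] Cons.prems c b vsrc_ccomp[OF c] vtgt_ccomp[OF c]
        htgt_ccomp[OF c] ccomp_in[OF c]
      by (auto simp: composable_def)
  qed
qed simp

text \<open>Associativity for inner paths of one cell each, which is the shape of the paths in
  naturality squares. The boundaries of the intermediate composites come from
  \<open>singles_path\<close>.\<close>

lemma ccomp_assoc_singles:
  assumes l: "list_all2 (\<lambda>\<psi> \<phi>. composable K \<psi> [\<phi>]) \<psi>s \<phi>s" and c: "composable K \<chi> \<psi>s"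
    and p: "cpath K f \<phi>s g"
  shows "ccomp K \<chi> (map2 (\<lambda>\<psi> \<phi>. ccomp K \<psi> [\<phi>]) \<psi>s \<phi>s) = ccomp K (ccomp K \<chi> \<psi>s) \<phi>s"
    and "composable K (ccomp K \<chi> \<psi>s) \<phi>s"
proof -
  note D = c[unfolded composable_def]
  let ?p = "vsrc K (hd \<psi>s)" and ?q = "vtgt K (last \<psi>s)"
  have ne: "\<psi>s \<noteq> []" "\<phi>s \<noteq> []" using D l by auto
  have cp: "cpath K ?p \<psi>s ?q" using D by simp
  note R = singles_path[OF l ne(1) cp p]
  have v: "f \<in> Ver K" "?p \<in> Ver K" "vsrc K \<chi> \<in> Ver K"
    using cpath_ends[OF p] cpath_ends[OF cp] D vsrc_in by auto
  have m: "map2 (ccomp K) \<psi>s (map (\<lambda>\<phi>. [\<phi>]) \<phi>s) = map2 (\<lambda>\<psi> \<phi>. ccomp K \<psi> [\<phi>]) \<psi>s \<phi>s"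
    using list_all2_lengthD[OF l] by (induction \<psi>s \<phi>s rule: list_induct2) auto
  have l': "list_all2 (composable K) \<psi>s (map (\<lambda>\<phi>. [\<phi>]) \<phi>s)" using l by (simp add: list_all2_map2)
  have 1: "composable K \<chi> (map2 (\<lambda>\<psi> \<phi>. ccomp K \<psi> [\<phi>]) \<psi>s \<phi>s)"
    by (rule composableI[of _ _ "vcomp K ?p f" "vcomp K ?q g"])
      (use D R v ne in \<open>auto simp: zip_eq_Nil_iff\<close>)
  show 2: "composable K (ccomp K \<chi> \<psi>s) \<phi>s"
    by (rule composableI[OF _ ne(2) p])
      (use D R v ccomp_in[OF c] hsrc_ccomp[OF c] vsrc_ccomp[OF c] in auto)
  have cc: "concat (map (\<lambda>\<phi>. [\<phi>]) \<phi>s) = \<phi>s" by simp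
  show "ccomp K \<chi> (map2 (\<lambda>\<psi> \<phi>. ccomp K \<psi> [\<phi>]) \<psi>s \<phi>s) = ccomp K (ccomp K \<chi> \<psi>s) \<phi>s"
    using ccomp_assoc[OF l', unfolded m cc, OF 1 c 2] .
qed

end

section \<open>Functors and transformations with prescribed source and target\<close>

definition is_fun :: "'u avdc \<Rightarrow> 'u avdc \<Rightarrow> 'u avfun \<Rightarrow> bool" where
  "is_fun K L F \<longleftrightarrow> avdc_functor F \<and> fdom F = K \<and> fcod F = L"

definition is_trans :: "'u avdc \<Rightarrow> 'u avdc \<Rightarrow> 'u avfun \<Rightarrow> 'u avfun \<Rightarrow> 'u avtrans \<Rightarrow> bool" where
  "is_trans K L F G \<xi> \<longleftrightarrow>
     avdc_transformation \<xi> \<and> tsrc \<xi> = F \<and> ttgt \<xi> = G \<and> fdom F = K \<and> fcod F = L"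

text \<open>Functors are extensional outside the carriers, so agreement on the carriers is equality
  of records. This is what makes the laws of a strict 2-category hold literally.\<close>

lemma is_fun_eqI:
  assumes F: "is_fun K L F" and G: "is_fun K L G"
    and e: "\<And>A. A \<in> Ob K \<Longrightarrow> omap F A = omap G A" "\<And>f. f \<in> Ver K \<Longrightarrow> vmap F f = vmap G f"
      "\<And>J. J \<in> Hor K \<Longrightarrow> hmap F J = hmap G J" "\<And>\<phi>. \<phi> \<in> Cell K \<Longrightarrow> cmap F \<phi> = cmap G \<phi>"
  shows "F = G"
proof -
  interpret F: avdc_functor F using F by (simp add: is_fun_def)
  interpret G: avdc_functor G using G by (simp add: is_fun_def)
  have d: "fdom F = K" "fcod F = L" "fdom G = K" "fcod G = L" using F G by (auto simp: is_fun_def)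
  note i = F.omap_in F.vmap_in F.hmap_in F.cmap_in G.omap_in G.vmap_in G.hmap_in G.cmap_in
  show ?thesis
    by (rule avfun.equality) (use i[unfolded d] d e in \<open>auto intro: PiE_ext\<close>)
qed

lemma is_trans_eqI:
  assumes \<xi>: "is_trans K L F G \<xi>" and \<zeta>: "is_trans K L F G \<zeta>"
    and e: "\<And>A. A \<in> Ob K \<Longrightarrow> tob \<xi> A = tob \<zeta> A" "\<And>J. J \<in> Hor K \<Longrightarrow> thor \<xi> J = thor \<zeta> J"
  shows "\<xi> = \<zeta>"
proof -
  have t: "avdc_transformation \<xi>" "avdc_transformation \<zeta>" using \<xi> \<zeta> by (auto simp: is_trans_def)
  have d: "tsrc \<xi> = F" "ttgt \<xi> = G" "tsrc \<zeta> = F" "ttgt \<zeta> = G" "fdom F = K" "fcod F = L"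
    using \<xi> \<zeta> by (auto simp: is_trans_def)
  note i = t[THEN avdc_transformation.tob_in] t[THEN avdc_transformation.thor_in]
  show ?thesis
    by (rule avtrans.equality) (use i[unfolded d] d e in \<open>auto intro: PiE_ext\<close>)
qed

locale functor_between =
  fixes K L :: "'u avdc" and F
  assumes F: "is_fun K L F"
begin

sublocale functr: avdc_functor F using F by (simp add: is_fun_def)

lemma dom_cod [simp]: "fdom F = K" "fcod F = L" using F by (auto simp: is_fun_def)

sublocale src: aug_virt_dbl_cat K using functr.fdom_avdc by simp
sublocale tgt: aug_virt_dbl_cat L using functr.fcod_avdc by simp

lemma map_in [simp]:
  "A \<in> Ob K \<Longrightarrow> omap F A \<in> Ob L" "f \<in> Ver K \<Longrightarrow> vmap F f \<in> Ver L"
  "J \<in> Hor K \<Longrightarrow> hmap F J \<in> Hor L" "\<phi> \<in> Cell K \<Longrightarrow> cmap F \<phi> \<in> Cell L"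
  using functr.omap_in functr.vmap_in functr.hmap_in functr.cmap_in by (auto simp: PiE_iff)

lemmas map_simps [simp] = functr.vdom_vmap[simplified] functr.vcod_vmap[simplified]
  functr.vmap_vid[simplified] functr.vmap_vcomp[simplified] functr.hdom_hmap[simplified]
  functr.hcod_hmap[simplified] functr.hsrc_cmap[simplified] functr.htgt_cmap[simplified]
  functr.vsrc_cmap[simplified] functr.vtgt_cmap[simplified] functr.cmap_hidc[simplified]
  functr.cmap_vidc[simplified]

lemmas cmap_ccomp = functr.cmap_ccomp[simplified]

lemma is_cell_cmap:
  "is_cell K f Js Ks g \<phi> \<Longrightarrow> is_cell L (vmap F f) (map (hmap F) Js) (map (hmap F) Ks) (vmap F g) (cmap
    F \<phi>)"
  by (auto simp: is_cell_def)

lemma cpath_cmap: "cpath K f \<phi>s g \<Longrightarrow> cpath L (vmap F f) (map (cmap F) \<phi>s) (vmap F g)"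
  by (induction \<phi>s arbitrary: f) auto

lemma composable_cmap:
  assumes "composable K \<psi> \<phi>s"
  shows "composable L (cmap F \<psi>) (map (cmap F) \<phi>s)"
proof -
  note D = assms[unfolded composable_def]
  have s: "\<phi> \<in> set \<phi>s \<Longrightarrow> \<phi> \<in> Cell K" for \<phi> using D cpath_Cell by metis
  have "vsrc K (hd \<phi>s) \<in> Ver K" using D src.cpath_ends by blast
  moreover have "concat (map (htgt L) (map (cmap F) \<phi>s)) = map (hmap F) (concat (map (htgt K) \<phi>s))"
    using s by (induction \<phi>s) auto
  ultimately show ?thesis
    using D src.vsrc_in[of \<psi>] by (intro tgt.composableI[OF _ _ cpath_cmap]) auto
qed

lemma cmap_hcomp:
  assumes "is_cell K f Js [] g \<alpha>" "is_cell K g Ls [] h \<beta>"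
  shows "cmap F (hcomp K \<alpha> \<beta>) = hcomp L (cmap F \<alpha>) (cmap F \<beta>)"
proof -
  have v: "f \<in> Ver K" "vcod K g = vcod K f"
    using src.is_cell_Ver[OF assms(1)] src.nullary_vcod[OF assms(1)] by auto
  have c: "composable K (vidc K (vid K (vcod K f))) [\<alpha>, \<beta>]"
    by (rule src.composable_2[OF _ assms]) (use src.is_cell_vidc[of "vid K (vcod K f)"] v in auto)
  show ?thesis
    using cmap_ccomp[OF c] v src.hcomp_nullary[OF assms]
      tgt.hcomp_nullary[OF is_cell_cmap[OF assms(1), simplified] is_cell_cmap[OF assms(2),
        simplified]]
    by simp
qed

lemma cmap_whisk:
  assumes "is_cell K f Js [] g \<alpha>" "h \<in> Ver K" "vdom K h = vcod K f"
  shows "cmap F (whisk K h \<alpha>) = whisk L (vmap F h) (cmap F \<alpha>)"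
proof -
  have "composable K (vidc K h) [\<alpha>]"
    by (rule src.composable_1[OF src.is_cell_vidc assms(1)]) (use assms in auto)
  then show ?thesis using cmap_ccomp assms by (simp add: whisk_def)
qed

end

lemma is_fun_between: "is_fun K L F \<Longrightarrow> functor_between K L F"
  by unfold_locales

locale trans_between =
  fixes K L :: "'u avdc" and F G \<xi>
  assumes \<xi>: "is_trans K L F G \<xi>"
begin

lemma trans: "avdc_transformation \<xi>" and ends [simp]: "tsrc \<xi> = F" "ttgt \<xi> = G"
  and fdom_fcod: "fdom F = K" "fcod F = L"
  using \<xi> by (auto simp: is_trans_def)

sublocale F: functor_between K L F
  using avdc_transformation.src_functor[OF trans] fdom_fcod by unfold_locales (simp add: is_fun_def)

sublocale G: functor_between K L G
  using avdc_transformation.tgt_functor[OF trans] fdom_fcod avdc_transformation.fdom_eq[OF trans]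
    avdc_transformation.fcod_eq[OF trans]
  by unfold_locales (simp add: is_fun_def)

lemma tob_in [simp]: "A \<in> Ob K \<Longrightarrow> tob \<xi> A \<in> Ver L"
  and thor_in [simp]: "J \<in> Hor K \<Longrightarrow> thor \<xi> J \<in> Cell L"
  using avdc_transformation.tob_in[OF trans] avdc_transformation.thor_in[OF trans]
  by (auto simp: PiE_iff)

lemmas comp_simps [simp] = avdc_transformation.vdom_tob[OF trans, simplified]
  avdc_transformation.vcod_tob[OF trans, simplified]
  avdc_transformation.hsrc_thor[OF trans, simplified] avdc_transformation.htgt_thor[OF trans,
    simplified]
  avdc_transformation.vsrc_thor[OF trans, simplified] avdc_transformation.vtgt_thor[OF trans,
    simplified]

lemmas tob_natural = avdc_transformation.tob_natural[OF trans, simplified]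
lemmas thor_natural = avdc_transformation.thor_natural[OF trans, simplified]

lemma is_cell_thor:
  "J \<in> Hor K \<Longrightarrow> is_cell L (tob \<xi> (hdom K J)) [hmap F J] [hmap G J] (tob \<xi> (hcod K J)) (thor \<xi> J)"
  by (simp add: is_cell_def)

text \<open>The path of components is never empty, as the empty path is sent to an identity cell.
  That cell depends on the object at which the empty path sits, which is why A is carried
  along.\<close>

lemma tpath_props:
  assumes "hpath K A Js B"
  shows "cpath L (tob \<xi> A) (tpath \<xi> A Js) (tob \<xi> B)" "tpath \<xi> A Js \<noteq> []"
    "concat (map (hsrc L) (tpath \<xi> A Js)) = map (hmap F) Js"
    "concat (map (htgt L) (tpath \<xi> A Js)) = map (hmap G) Js"
proof -
  have A: "A \<in> Ob K" "B \<in> Ob K" using F.src.hpath_ends[OF assms] by auto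
  have 1: "cpath L (tob \<xi> A) (map (thor \<xi>) Js) (tob \<xi> B)" if "hpath K A Js B" for A
    using that by (induction Js arbitrary: A) auto
  show "cpath L (tob \<xi> A) (tpath \<xi> A Js) (tob \<xi> B)" "tpath \<xi> A Js \<noteq> []"
    using 1[OF assms] A assms F.tgt.vidc_in[of "tob \<xi> A"]
    by (auto simp: tpath_def F.tgt.vsrc_vidc F.tgt.vtgt_vidc)
  have "concat (map (hsrc L) (map (thor \<xi>) Js)) = map (hmap F) Js"
    "concat (map (htgt L) (map (thor \<xi>) Js)) = map (hmap G) Js"
    using F.src.hpath_Hor[OF assms] by (induction Js) auto
  then show "concat (map (hsrc L) (tpath \<xi> A Js)) = map (hmap F) Js"
    "concat (map (htgt L) (tpath \<xi> A Js)) = map (hmap G) Js"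
    using A by (auto simp: tpath_def F.tgt.hsrc_vidc F.tgt.htgt_vidc)
qed

lemma is_cell_tpath_hd:
  assumes "hpath K A Ks B" "length Ks \<le> 1"
  shows "is_cell L (tob \<xi> A) (map (hmap F) Ks) (map (hmap G) Ks) (tob \<xi> B) (hd (tpath \<xi> A Ks))"
    and "tpath \<xi> A Ks = [hd (tpath \<xi> A Ks)]"
  using assms F.tgt.is_cell_vidc[of "tob \<xi> A"] is_cell_thor
  by (cases Ks; auto simp: tpath_def)+

lemma natural:
  assumes "is_cell K f Js Ks g \<phi>"
  shows "ccomp L (cmap G \<phi>) (tpath \<xi> (vdom K f) Js)
    = ccomp L (hd (tpath \<xi> (vcod K f) Ks)) [cmap F \<phi>]"
  using thor_natural[of \<phi>] assms by (auto simp: is_cell_def)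

lemma composable_tpath:
  assumes "is_cell K f Js Ks g \<phi>"
  shows "composable L (cmap G \<phi>) (tpath \<xi> (vdom K f) Js)"
proof -
  note H = F.src.is_cell_hpath[OF assms] and V = F.src.is_cell_Ver[OF assms]
  show ?thesis
    by (rule F.tgt.composableI[OF _ _ tpath_props(1)])
      (use H V tpath_props[of "vdom K f" Js "vdom K g"] G.is_cell_cmap[OF assms]
        in \<open>auto simp: is_cell_def\<close>)
qed

end

lemma is_trans_between: "is_trans K L F G \<xi> \<Longrightarrow> trans_between K L F G \<xi>"
  by unfold_locales

lemma is_transI:
  assumes F: "is_fun K L F" and G: "is_fun K L G"
    and s: "tsrc \<xi> = F" "ttgt \<xi> = G"
    and t: "tob \<xi> \<in> extensional (Ob K)" "thor \<xi> \<in> extensional (Hor K)"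
    and o: "\<And>A. A \<in> Ob K \<Longrightarrow> tob \<xi> A \<in> Ver L \<and> vdom L (tob \<xi> A) = omap F A \<and> vcod L (tob \<xi> A)
      = omap G A"
    and n: "\<And>f. f \<in> Ver K \<Longrightarrow>
      vcomp L (vmap G f) (tob \<xi> (vdom K f)) = vcomp L (tob \<xi> (vcod K f)) (vmap F f)"
    and h: "\<And>J. J \<in> Hor K \<Longrightarrow>
      is_cell L (tob \<xi> (hdom K J)) [hmap F J] [hmap G J] (tob \<xi> (hcod K J)) (thor \<xi> J)"
    and c: "\<And>f Js Ks g \<phi>. is_cell K f Js Ks g \<phi> \<Longrightarrow>
      ccomp L (cmap G \<phi>) (tpath \<xi> (vdom K f) Js) = ccomp L (hd (tpath \<xi> (vcod K f) Ks)) [cmap F \<phi>]"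
  shows "is_trans K L F G \<xi>"
proof -
  have d: "fdom F = K" "fcod F = L" "fdom G = K" "fcod G = L" "avdc_functor F" "avdc_functor G"
    using F G by (auto simp: is_fun_def)
  have "ccomp L (cmap G \<phi>) (tpath \<xi> (vdom K (vsrc K \<phi>)) (hsrc K \<phi>)) =
      ccomp L (hd (tpath \<xi> (vcod K (vsrc K \<phi>)) (htgt K \<phi>))) [cmap F \<phi>]" if "\<phi> \<in> Cell K" for \<phi>
    using c[OF is_cellI[OF that]] .
  then have "avdc_transformation \<xi>"
    by (intro avdc_transformation.intro)
      (use d s t o n h in \<open>auto simp: PiE_iff is_cell_def\<close>)
  then show ?thesis using d s by (simp add: is_trans_def)
qed

lemma is_fun_avdc: "is_fun K L F \<Longrightarrow> aug_virt_dbl_cat K \<and> aug_virt_dbl_cat L"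
  using avdc_functor.fdom_avdc avdc_functor.fcod_avdc by (auto simp: is_fun_def)

lemma is_fun_id:
  assumes "aug_virt_dbl_cat K"
  shows "is_fun K K (avfun_id K)"
proof -
  interpret aug_virt_dbl_cat K by fact
  have s: "\<phi> \<in> Cell K \<Longrightarrow> map (\<lambda>J\<in>Hor K. J) (hsrc K \<phi>) = hsrc K \<phi> \<and> map (\<lambda>J\<in>Hor K. J) (htgt K \<phi>)
    = htgt K \<phi>" for \<phi>
    using hsrc_path[of \<phi>] htgt_path[of \<phi>] hpath_Hor by (auto intro!: map_idI) blast+
  have "map (\<lambda>\<phi>\<in>Cell K. \<phi>) \<phi>s = \<phi>s" if "composable K \<psi> \<phi>s" for \<psi> \<phi>s
    using composable_Cell[OF that] by (auto intro!: map_idI)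
  moreover have "composable K \<psi> \<phi>s \<Longrightarrow> \<psi> \<in> Cell K" for \<psi> \<phi>s by (simp add: composable_def)
  ultimately have "avdc_functor (avfun_id K)"
    by (intro avdc_functor.intro)
     (use assms s in \<open>auto simp: avfun_id_def PiE_iff hdom_in hcod_in vsrc_in vtgt_in hidc_in
       vidc_in ccomp_in\<close>)
  then show ?thesis by (simp add: is_fun_def avfun_id_def)
qed

lemma is_fun_comp:
  assumes "is_fun K L F" "is_fun L M G"
  shows "is_fun K M (avfun_comp G F)"
proof -
  interpret F: functor_between K L F using assms by (simp add: is_fun_between)
  interpret G: functor_between L M G using assms by (simp add: is_fun_between)
  have s: "\<phi> \<in> Cell K \<Longrightarrow> map (\<lambda>J\<in>Hor K. hmap G (hmap F J)) (hsrc K \<phi>)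
    = map (hmap G) (map (hmap F) (hsrc K \<phi>))
     \<and> map (\<lambda>J\<in>Hor K. hmap G (hmap F J)) (htgt K \<phi>) = map (hmap G) (map (hmap F) (htgt K \<phi>))" for \<phi>
    using F.src.hsrc_path[of \<phi>] F.src.htgt_path[of \<phi>] F.src.hpath_Hor by auto
  have c: "cmap G (cmap F (ccomp K \<psi> \<phi>s))
    = ccomp M (cmap G (cmap F \<psi>)) (map (\<lambda>\<phi>\<in>Cell K. cmap G (cmap F \<phi>)) \<phi>s)"
    if "composable K \<psi> \<phi>s" for \<psi> \<phi>s
  proof -
    have e: "map (\<lambda>\<phi>\<in>Cell K. cmap G (cmap F \<phi>)) \<phi>s = map (cmap G) (map (cmap F) \<phi>s)"
      using composable_Cell[OF that] by auto
    show ?thesis unfolding e using F.cmap_ccomp[OF that] G.cmap_ccomp[OF F.composable_cmap[OF that]]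
      by simp
  qed
  have d: "composable K \<psi> \<phi>s \<Longrightarrow> \<psi> \<in> Cell K" for \<psi> \<phi>s by (simp add: composable_def)
  have "avdc_functor (avfun_comp G F)"
    by (rule avdc_functor.intro)
     (use F.src.aug_virt_dbl_cat_axioms G.tgt.aug_virt_dbl_cat_axioms s c d in
       \<open>auto simp: avfun_comp_def PiE_iff F.src.hdom_in F.src.hcod_in F.src.vsrc_in F.src.vtgt_in
         F.src.hidc_in F.src.vidc_in F.src.ccomp_in\<close>)
  then show ?thesis by (simp add: is_fun_def avfun_comp_def)
qed

lemma is_trans_id:
  assumes F: "is_fun K L F"
  shows "is_trans K L F F (avtrans_id F)"
proof -
  interpret F: functor_between K L F using assms by (simp add: is_fun_between)
  show ?thesis
  proof (rule is_transI[OF F F])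
    fix f Js Ks g \<phi> assume p: "is_cell K f Js Ks g \<phi>"
    note H = F.src.is_cell_hpath[OF p] and V = F.src.is_cell_Ver[OF p] and D = is_cellD[OF p]
    have Js: "tpath (avtrans_id F) (vdom K f) Js = (if Js
      = [] then [vidc L (vid L (omap F (vdom K f)))] else map (hidc L) (map (hmap F) Js))"
      using V F.src.hpath_Hor[of "vdom K f" Js "vdom K g"] H by
        (auto simp: tpath_def avtrans_id_def)
    have l: "length Ks \<le> 1" using F.src.htgt_length D by blast
    have Ks: "tpath (avtrans_id F) (vcod K f) Ks = (if Ks
      = [] then [vidc L (vid L (omap F (vcod K f)))] else map (hidc L) (map (hmap F) Ks))"
      using V F.src.hpath_Hor[of "vcod K f" Ks "vcod K g"] H by
        (auto simp: tpath_def avtrans_id_def)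
    have 1: "ccomp L (cmap F \<phi>) (tpath (avtrans_id F) (vdom K f) Js) = cmap F \<phi>"
      unfolding Js using F.tgt.ccomp_vidc[of "cmap F \<phi>"] F.tgt.ccomp_hidc[of "cmap F \<phi>"] D V by auto
    have 2: "ccomp L (hd (tpath (avtrans_id F) (vcod K f) Ks)) [cmap F \<phi>] = cmap F \<phi>"
      unfolding Ks using F.tgt.vidc_ccomp[of "cmap F \<phi>"] F.tgt.hidc_ccomp[of "cmap F \<phi>"] D V l
      by (cases Ks) auto
    show "ccomp L (cmap F \<phi>) (tpath (avtrans_id F) (vdom K f) Js)
      = ccomp L (hd (tpath (avtrans_id F) (vcod K f) Ks)) [cmap F \<phi>]"
      unfolding 1 2 ..
  next
    fix J assume "J \<in> Hor K"
    then show "is_cell L (tob (avtrans_id F) (hdom K J)) [hmap F J] [hmap F J]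
        (tob (avtrans_id F) (hcod K J)) (thor (avtrans_id F) J)"
      using F.tgt.is_cell_hidc[of "hmap F J"]
      by (simp add: avtrans_id_def F.src.hdom_in F.src.hcod_in)
  qed (auto simp: avtrans_id_def)
qed

text \<open>On every path the components of the composite are the cellwise composites of the two
  \<open>tpath\<close>s; for the empty path this holds because vertical identity cells compose to
  such cells. The naturality squares of \<xi> and \<zeta> are then pasted by associativity for
  single cells.\<close>

lemma is_trans_vert:
  assumes "is_trans K L F G \<xi>" "is_trans K L G H \<zeta>"
  shows "is_trans K L F H (avtrans_vert \<zeta> \<xi>)"
proof -
  interpret \<xi>: trans_between K L F G \<xi> using assms by (simp add: is_trans_between)
  interpret \<zeta>: trans_between K L G H \<zeta> using assms by (simp add: is_trans_between)
  let ?v = "avtrans_vert \<zeta> \<xi>"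
  have thor: "thor ?v J = ccomp L (thor \<zeta> J) [thor \<xi> J]" if "J \<in> Hor K" for J
    using that by (simp add: avtrans_vert_def)
  have tob: "tob ?v A = vcomp L (tob \<zeta> A) (tob \<xi> A)" if "A \<in> Ob K" for A
    using that by (simp add: avtrans_vert_def)
  have ends: "tsrc ?v = F" "ttgt ?v = H" by (simp_all add: avtrans_vert_def)
  have tp: "tpath ?v A Js = map2 (\<lambda>\<psi> \<phi>. ccomp L \<psi> [\<phi>]) (tpath \<zeta> A Js) (tpath \<xi> A Js)"
    and tl: "list_all2 (\<lambda>\<psi> \<phi>. composable L \<psi> [\<phi>]) (tpath \<zeta> A Js) (tpath \<xi> A Js)"
    if "hpath K A Js B" for A Js B
  proof -
    have A: "A \<in> Ob K" "set Js \<subseteq> Hor K" using that \<xi>.F.src.hpath_ends \<xi>.F.src.hpath_Hor by auto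
    have c: "composable L (thor \<zeta> J) [thor \<xi> J]" if "J \<in> Hor K" for J
      using \<xi>.F.tgt.composable_1[OF \<zeta>.is_cell_thor \<xi>.is_cell_thor] that by
        (simp add: \<xi>.F.src.hdom_in)
    have c': "composable L (vidc L (tob \<zeta> A)) [vidc L (tob \<xi> A)]"
      using \<xi>.F.tgt.composable_1[OF \<xi>.F.tgt.is_cell_vidc \<xi>.F.tgt.is_cell_vidc] A by simp
    have "map (thor ?v) Js = map2 (\<lambda>\<psi> \<phi>. ccomp L \<psi> [\<phi>]) (map (thor \<zeta>) Js) (map (thor \<xi>) Js)"
      using A thor by (induction Js) auto
    then show "tpath ?v A Js = map2 (\<lambda>\<psi> \<phi>. ccomp L \<psi> [\<phi>]) (tpath \<zeta> A Js) (tpath \<xi> A Js)"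
      using A tob ends by (auto simp: tpath_def \<xi>.F.tgt.vidc_vidc)
    show "list_all2 (\<lambda>\<psi> \<phi>. composable L \<psi> [\<phi>]) (tpath \<zeta> A Js) (tpath \<xi> A Js)"
      using A c c' by (auto simp: tpath_def list_all2_map1 list_all2_map2 list_all2_same)
  qed
  show ?thesis
  proof (rule is_transI[OF \<xi>.F.F \<zeta>.G.F ends])
    fix A assume "A \<in> Ob K"
    then show "tob ?v A \<in> Ver L \<and> vdom L (tob ?v A) = omap F A \<and> vcod L (tob ?v A) = omap H A"
      by (simp add: tob)
  next
    fix f assume f: "f \<in> Ver K"
    then show "vcomp L (vmap H f) (tob ?v (vdom K f)) = vcomp L (tob ?v (vcod K f)) (vmap F f)"
      using \<xi>.tob_natural[OF f] \<zeta>.tob_natural[OF f]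
      by (simp add: tob \<xi>.F.tgt.vcomp_assoc) (simp add: \<xi>.F.tgt.vcomp_assoc[symmetric])
  next
    fix J assume J: "J \<in> Hor K"
    then show "is_cell L (tob ?v (hdom K J)) [hmap F J] [hmap H J] (tob ?v (hcod K J)) (thor ?v J)"
      using \<xi>.F.tgt.is_cell_ccomp_1[OF \<zeta>.is_cell_thor \<xi>.is_cell_thor]
      by (simp add: tob thor \<xi>.F.src.hdom_in \<xi>.F.src.hcod_in)
  next
    fix f Js Ks g \<phi> assume p: "is_cell K f Js Ks g \<phi>"
    note Hp = \<xi>.F.src.is_cell_hpath[OF p] and V = \<xi>.F.src.is_cell_Ver[OF p] and D = is_cellD[OF p]
    have l: "length Ks \<le> 1" using \<xi>.F.src.htgt_length D by blast
    have HJ: "hpath K (vdom K f) Js (vdom K g)" and HK: "hpath K (vcod K f) Ks (vcod K g)" using Hp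
      by auto
    note zK = \<zeta>.is_cell_tpath_hd[OF HK l] and xK = \<xi>.is_cell_tpath_hd[OF HK l]
    note Fp = \<xi>.F.is_cell_cmap[OF p] and Gp = \<xi>.G.is_cell_cmap[OF p]
    have "ccomp L (cmap H \<phi>) (tpath ?v (vdom K f) Js)
      = ccomp L (ccomp L (cmap H \<phi>) (tpath \<zeta> (vdom K f) Js)) (tpath \<xi> (vdom K f) Js)"
      unfolding tp[OF HJ]
      by (rule \<xi>.F.tgt.ccomp_assoc_singles(1)[OF tl[OF HJ] \<zeta>.composable_tpath[OF p]
        \<xi>.tpath_props(1)[OF HJ]])
    also have "\<dots> = ccomp L (ccomp L (hd (tpath \<zeta> (vcod K f) Ks)) [cmap G \<phi>]) (tpath \<xi> (vdom K f)
      Js)"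
      using \<zeta>.natural[OF p] by simp
    also have "\<dots> = ccomp L (hd (tpath \<zeta> (vcod K f) Ks)) [ccomp L (cmap G \<phi>) (tpath \<xi> (vdom K f)
      Js)]"
      by (rule \<xi>.F.tgt.ccomp_assoc_1[OF \<xi>.F.tgt.composable_1[OF zK(1) Gp] \<xi>.composable_tpath[OF p],
        symmetric])
        (use V in simp)
    also have "\<dots> = ccomp L (hd (tpath \<zeta> (vcod K f) Ks)) [ccomp L (hd (tpath \<xi> (vcod K f) Ks)) [cmap
      F \<phi>]]"
      using \<xi>.natural[OF p] by simp
    also have "\<dots> = ccomp L (ccomp L (hd (tpath \<zeta> (vcod K f) Ks)) [hd (tpath \<xi> (vcod K f) Ks)]) [cmap
      F \<phi>]"
      by (rule \<xi>.F.tgt.ccomp_assoc_11[OF zK(1) xK(1) Fp]) (use V in auto)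
    also have "ccomp L (hd (tpath \<zeta> (vcod K f) Ks)) [hd (tpath \<xi> (vcod K f) Ks)]
      = hd (tpath ?v (vcod K f) Ks)"
      unfolding tp[OF HK] by (subst zK(2), subst xK(2)) simp
    finally show "ccomp L (cmap H \<phi>) (tpath ?v (vdom K f) Js)
      = ccomp L (hd (tpath ?v (vcod K f) Ks)) [cmap F \<phi>]" .
  qed (auto simp: avtrans_vert_def)
qed

section \<open>Whiskering of transformations by functors\<close>

definition trans_post :: "'u avfun \<Rightarrow> 'u avtrans \<Rightarrow> 'u avtrans" where
  "trans_post S \<xi> = \<lparr>tsrc = avfun_comp S (tsrc \<xi>), ttgt = avfun_comp S (ttgt \<xi>),
     tob = (\<lambda>A\<in>Ob (fdom (tsrc \<xi>)). vmap S (tob \<xi> A)),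
     thor = (\<lambda>J\<in>Hor (fdom (tsrc \<xi>)). cmap S (thor \<xi> J))\<rparr>"

definition trans_pre :: "'u avtrans \<Rightarrow> 'u avfun \<Rightarrow> 'u avtrans" where
  "trans_pre \<zeta> F = \<lparr>tsrc = avfun_comp (tsrc \<zeta>) F, ttgt = avfun_comp (ttgt \<zeta>) F,
     tob = (\<lambda>A\<in>Ob (fdom F). tob \<zeta> (omap F A)),
     thor = (\<lambda>J\<in>Hor (fdom F). thor \<zeta> (hmap F J))\<rparr>"

lemma is_trans_post:
  assumes "is_trans K L F G \<xi>" "is_fun L M S"
  shows "is_trans K M (avfun_comp S F) (avfun_comp S G) (trans_post S \<xi>)"
proof -
  interpret \<xi>: trans_between K L F G \<xi> using assms by (simp add: is_trans_between)
  interpret S: functor_between L M S using assms by (simp add: is_fun_between)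
  have tp: "tpath (trans_post S \<xi>) A Js = map (cmap S) (tpath \<xi> A Js)" if "hpath K A Js B"
    for A Js B
    using \<xi>.F.src.hpath_Hor[OF that] \<xi>.F.src.hpath_ends[OF that]
    by (auto simp: tpath_def trans_post_def avfun_comp_def)
  show ?thesis
  proof (rule is_transI)
    fix f assume f: "f \<in> Ver K"
    then show "vcomp M (vmap (avfun_comp S G) f) (tob (trans_post S \<xi>) (vdom K f)) =
       vcomp M (tob (trans_post S \<xi>) (vcod K f)) (vmap (avfun_comp S F) f)"
      using arg_cong[OF \<xi>.tob_natural[OF f], of "vmap S"] by
        (simp add: trans_post_def avfun_comp_def)
  next
    fix J assume J: "J \<in> Hor K"
    show "is_cell M (tob (trans_post S \<xi>) (hdom K J)) [hmap (avfun_comp S F) J] [hmap (avfun_comp S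
      G) J]
      (tob (trans_post S \<xi>) (hcod K J)) (thor (trans_post S \<xi>) J)"
      using S.is_cell_cmap[OF \<xi>.is_cell_thor[OF J]] J
      by (simp add: trans_post_def avfun_comp_def \<xi>.F.src.hdom_in \<xi>.F.src.hcod_in)
  next
    fix f Js Ks g \<phi> assume p: "is_cell K f Js Ks g \<phi>"
    note Hp = \<xi>.F.src.is_cell_hpath[OF p] and V = \<xi>.F.src.is_cell_Ver[OF p] and D = is_cellD[OF p]
    have l: "length Ks \<le> 1" using \<xi>.F.src.htgt_length D by blast
    have HJ: "hpath K (vdom K f) Js (vdom K g)" and HK: "hpath K (vcod K f) Ks (vcod K g)" using Hp
      by auto
    note xK = \<xi>.is_cell_tpath_hd[OF HK l] and Fp = \<xi>.F.is_cell_cmap[OF p]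
    have "composable L (hd (tpath \<xi> (vcod K f) Ks)) [cmap F \<phi>]"
      by (rule \<xi>.F.tgt.composable_1[OF xK(1) Fp]) (use V in simp)
    then have "cmap S (ccomp L (hd (tpath \<xi> (vcod K f) Ks)) [cmap F \<phi>])
      = ccomp M (cmap S (hd (tpath \<xi> (vcod K f) Ks))) [cmap S (cmap F \<phi>)]"
      using S.cmap_ccomp by simp
    moreover have "cmap S (ccomp L (cmap G \<phi>) (tpath \<xi> (vdom K f) Js))
      = ccomp M (cmap S (cmap G \<phi>)) (map (cmap S) (tpath \<xi> (vdom K f) Js))"
      by (rule S.cmap_ccomp[OF \<xi>.composable_tpath[OF p]])
    ultimately show "ccomp M (cmap (avfun_comp S G) \<phi>) (tpath (trans_post S \<xi>) (vdom K f) Js) =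
       ccomp M (hd (tpath (trans_post S \<xi>) (vcod K f) Ks)) [cmap (avfun_comp S F) \<phi>]"
      using tp[OF HJ] tp[OF HK] \<xi>.natural[OF p] \<xi>.tpath_props(2)[OF HK] D
      by (simp add: avfun_comp_def hd_map)
  qed (auto simp: trans_post_def avfun_comp_def intro: is_fun_comp[OF \<xi>.F.F S.F, unfolded
    avfun_comp_def, simplified]
    is_fun_comp[OF \<xi>.G.F S.F, unfolded avfun_comp_def, simplified])
qed

lemma is_trans_pre:
  assumes "is_trans L M S T \<zeta>" "is_fun K L F"
  shows "is_trans K M (avfun_comp S F) (avfun_comp T F) (trans_pre \<zeta> F)"
proof -
  interpret \<zeta>: trans_between L M S T \<zeta> using assms by (simp add: is_trans_between)
  interpret F: functor_between K L F using assms by (simp add: is_fun_between)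
  have tp: "tpath (trans_pre \<zeta> F) A Js = tpath \<zeta> (omap F A) (map (hmap F) Js)" if "hpath K A Js B"
    for A Js B
    using F.src.hpath_Hor[OF that] F.src.hpath_ends[OF that]
    by (auto simp: tpath_def trans_pre_def avfun_comp_def)
  show ?thesis
  proof (rule is_transI)
    fix f assume f: "f \<in> Ver K"
    then show "vcomp M (vmap (avfun_comp T F) f) (tob (trans_pre \<zeta> F) (vdom K f)) =
       vcomp M (tob (trans_pre \<zeta> F) (vcod K f)) (vmap (avfun_comp S F) f)"
      using \<zeta>.tob_natural[of "vmap F f"] by (simp add: trans_pre_def avfun_comp_def)
  next
    fix J assume J: "J \<in> Hor K"
    show "is_cell M (tob (trans_pre \<zeta> F) (hdom K J)) [hmap (avfun_comp S F) J] [hmap (avfun_comp T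
      F) J]
      (tob (trans_pre \<zeta> F) (hcod K J)) (thor (trans_pre \<zeta> F) J)"
      using \<zeta>.is_cell_thor[of "hmap F J"] J
      by (simp add: trans_pre_def avfun_comp_def F.src.hdom_in F.src.hcod_in)
  next
    fix f Js Ks g \<phi> assume p: "is_cell K f Js Ks g \<phi>"
    note Hp = F.src.is_cell_hpath[OF p] and V = F.src.is_cell_Ver[OF p] and D = is_cellD[OF p]
    have HJ: "hpath K (vdom K f) Js (vdom K g)" and HK: "hpath K (vcod K f) Ks (vcod K g)" using Hp
      by auto
    show "ccomp M (cmap (avfun_comp T F) \<phi>) (tpath (trans_pre \<zeta> F) (vdom K f) Js) =
       ccomp M (hd (tpath (trans_pre \<zeta> F) (vcod K f) Ks)) [cmap (avfun_comp S F) \<phi>]"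
      using tp[OF HJ] tp[OF HK] \<zeta>.natural[OF F.is_cell_cmap[OF p]] D V
      by (simp add: avfun_comp_def)
  qed (auto simp: trans_pre_def avfun_comp_def intro: is_fun_comp[OF F.F \<zeta>.F.F, unfolded
    avfun_comp_def, simplified]
    is_fun_comp[OF F.F \<zeta>.G.F, unfolded avfun_comp_def, simplified])
qed

text \<open>Reduces horizontal composition to the two whiskerings, so that its naturality is a case
  of \<open>is_trans_vert\<close>.\<close>

lemma horz_eq_vert:
  assumes "is_trans K L F G \<xi>" "is_trans L M S T \<zeta>"
  shows "avtrans_horz \<zeta> \<xi> = avtrans_vert (trans_pre \<zeta> G) (trans_post S \<xi>)"
proof -
  interpret \<xi>: trans_between K L F G \<xi> using assms by (simp add: is_trans_between)
  interpret \<zeta>: trans_between L M S T \<zeta> using assms by (simp add: is_trans_between)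
  show ?thesis
    by (simp add: avtrans_horz_def avtrans_vert_def trans_pre_def trans_post_def avfun_comp_def
        cong: restrict_cong)
qed

lemma is_trans_horz:
  assumes "is_trans K L F G \<xi>" "is_trans L M S T \<zeta>"
  shows "is_trans K M (avfun_comp S F) (avfun_comp T G) (avtrans_horz \<zeta> \<xi>)"
proof -
  interpret \<xi>: trans_between K L F G \<xi> using assms by (simp add: is_trans_between)
  interpret \<zeta>: trans_between L M S T \<zeta> using assms by (simp add: is_trans_between)
  show ?thesis unfolding horz_eq_vert[OF assms]
    by (rule is_trans_vert[OF is_trans_post[OF assms(1) \<zeta>.F.F] is_trans_pre[OF assms(2) \<xi>.G.F]])
qed

section \<open>The axioms of a 2-category\<close>

lemma mor_AVDC: "mor AugVirtDblCat K L F \<longleftrightarrow> is_fun K L F"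
  by (auto simp: mor_def AugVirtDblCat_def is_fun_def)

lemma two_AVDC: "two AugVirtDblCat F G \<xi> \<longleftrightarrow> is_trans (fdom F) (fcod F) F G \<xi>"
  by (auto simp: two_def AugVirtDblCat_def is_trans_def)

lemma AVDC_simps [simp]:
  "Obj AugVirtDblCat = {K. aug_virt_dbl_cat K}" "Mor AugVirtDblCat = {F. avdc_functor F}"
  "mdom AugVirtDblCat = fdom" "mcod AugVirtDblCat = fcod" "mid AugVirtDblCat = avfun_id"
  "mcomp AugVirtDblCat = avfun_comp" "cid AugVirtDblCat = avtrans_id"
  "vert AugVirtDblCat = avtrans_vert" "horz AugVirtDblCat = avtrans_horz"
  by (simp_all add: AugVirtDblCat_def)

lemma is_funD: "is_fun K L F \<Longrightarrow> fdom F = K" "is_fun K L F \<Longrightarrow> fcod F = L"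
  by (auto simp: is_fun_def)

lemma is_trans_funs: "is_trans K L F G \<xi> \<Longrightarrow> is_fun K L F \<and> is_fun K L G"
proof -
  assume "is_trans K L F G \<xi>"
  then interpret trans_between K L F G \<xi> by (simp add: is_trans_between)
  show ?thesis using F.F G.F by simp
qed

lemma two_AVDC_E:
  assumes "two AugVirtDblCat F G \<xi>"
  obtains K L where "is_trans K L F G \<xi>" "is_fun K L F" "is_fun K L G" "K = fdom F" "L = fcod F"
  using assms is_trans_funs unfolding two_AVDC by blast

lemma two_AVDC_D:
  "two AugVirtDblCat F G \<xi> \<Longrightarrow>
     is_trans (fdom F) (fcod F) F G \<xi> \<and> fdom G = fdom F \<and> fcod G = fcod F"
  by (elim two_AVDC_E) (metis is_funD)

lemma avfun_id_simps [simp]: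
  "A \<in> Ob K \<Longrightarrow> omap (avfun_id K) A = A" "f \<in> Ver K \<Longrightarrow> vmap (avfun_id K) f = f"
  "J \<in> Hor K \<Longrightarrow> hmap (avfun_id K) J = J" "\<phi> \<in> Cell K \<Longrightarrow> cmap (avfun_id K) \<phi> = \<phi>"
  "fdom (avfun_id K) = K" "fcod (avfun_id K) = K"
  by (simp_all add: avfun_id_def)

lemma avfun_comp_simps [simp]:
  "A \<in> Ob (fdom F) \<Longrightarrow> omap (avfun_comp G F) A = omap G (omap F A)"
  "f \<in> Ver (fdom F) \<Longrightarrow> vmap (avfun_comp G F) f = vmap G (vmap F f)"
  "J \<in> Hor (fdom F) \<Longrightarrow> hmap (avfun_comp G F) J = hmap G (hmap F J)"
  "\<phi> \<in> Cell (fdom F) \<Longrightarrow> cmap (avfun_comp G F) \<phi> = cmap G (cmap F \<phi>)"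
  "fdom (avfun_comp G F) = fdom F" "fcod (avfun_comp G F) = fcod G"
  by (simp_all add: avfun_comp_def)

lemma avtrans_id_simps [simp]:
  "A \<in> Ob (fdom F) \<Longrightarrow> tob (avtrans_id F) A = vid (fcod F) (omap F A)"
  "J \<in> Hor (fdom F) \<Longrightarrow> thor (avtrans_id F) J = hidc (fcod F) (hmap F J)"
  by (simp_all add: avtrans_id_def)

lemma avtrans_vert_simps [simp]:
  "A \<in> Ob (fdom (tsrc \<xi>)) \<Longrightarrow> tob (avtrans_vert \<zeta> \<xi>) A = vcomp (fcod (tsrc \<xi>)) (tob \<zeta> A) (tob \<xi> A)"
  "J \<in> Hor (fdom (tsrc \<xi>)) \<Longrightarrow> thor (avtrans_vert \<zeta> \<xi>) J
    = ccomp (fcod (tsrc \<xi>)) (thor \<zeta> J) [thor \<xi> J]"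
  "tsrc (avtrans_vert \<zeta> \<xi>) = tsrc \<xi>" "ttgt (avtrans_vert \<zeta> \<xi>) = ttgt \<zeta>"
  by (simp_all add: avtrans_vert_def)

lemma avtrans_horz_simps [simp]:
  "A \<in> Ob (fdom (tsrc \<xi>)) \<Longrightarrow> tob (avtrans_horz \<zeta> \<xi>) A =
     vcomp (fcod (tsrc \<zeta>)) (tob \<zeta> (omap (ttgt \<xi>) A)) (vmap (tsrc \<zeta>) (tob \<xi> A))"
  "J \<in> Hor (fdom (tsrc \<xi>)) \<Longrightarrow> thor (avtrans_horz \<zeta> \<xi>) J =
     ccomp (fcod (tsrc \<zeta>)) (thor \<zeta> (hmap (ttgt \<xi>) J)) [cmap (tsrc \<zeta>) (thor \<xi> J)]"
  "tsrc (avtrans_horz \<zeta> \<xi>) = avfun_comp (tsrc \<zeta>) (tsrc \<xi>)"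
  "ttgt (avtrans_horz \<zeta> \<xi>) = avfun_comp (ttgt \<zeta>) (ttgt \<xi>)"
  by (simp_all add: avtrans_horz_def)

lemma avfun_comp_id:
  assumes F: "is_fun K L F"
  shows "avfun_comp F (avfun_id K) = F" "avfun_comp (avfun_id L) F = F"
proof -
  interpret functor_between K L F using F by (rule is_fun_between)
  show "avfun_comp F (avfun_id K) = F"
    by (rule is_fun_eqI[OF is_fun_comp[OF is_fun_id F] F]) (use is_fun_avdc[OF F] in auto)
  show "avfun_comp (avfun_id L) F = F"
    by (rule is_fun_eqI[OF is_fun_comp[OF F is_fun_id] F]) (use is_fun_avdc[OF F] in auto)
qed

lemma avfun_comp_assoc:
  assumes F: "is_fun K L F" and G: "is_fun L M G" and H: "is_fun M N H"
  shows "avfun_comp H (avfun_comp G F) = avfun_comp (avfun_comp H G) F"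
proof -
  interpret F: functor_between K L F using F by (rule is_fun_between)
  interpret G: functor_between L M G using G by (rule is_fun_between)
  show ?thesis
    by (rule is_fun_eqI[OF is_fun_comp[OF is_fun_comp[OF F G] H] is_fun_comp[OF F is_fun_comp[OF G
      H]]]) auto
qed

text \<open>Equations between transformations are checked on components, where they reduce to unit
  laws, associativity and functoriality in the target. Only the interchange law draws on a
  naturality square.\<close>

lemma AugVirtDblCat_two_category: "two_category (AugVirtDblCat :: ('u avdc, 'u avfun, 'u avtrans)
  two_cat)"
proof
  fix A B :: "'u avdc" and f assume "mor AugVirtDblCat A B f"
  then show "A \<in> Obj AugVirtDblCat \<and> B \<in> Obj AugVirtDblCat" using is_fun_avdc by
    (simp add: mor_AVDC)
next
  fix A :: "'u avdc" assume "A \<in> Obj AugVirtDblCat"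
  then show "mor AugVirtDblCat A A (mid AugVirtDblCat A)" using is_fun_id by (simp add: mor_AVDC)
next
  fix A B D :: "'u avdc" and f g assume "mor AugVirtDblCat A B f" "mor AugVirtDblCat B D g"
  then show "mor AugVirtDblCat A D (mcomp AugVirtDblCat g f)" using is_fun_comp by
    (auto simp: mor_AVDC)
next
  fix A B :: "'u avdc" and f assume "mor AugVirtDblCat A B f"
  then show "mcomp AugVirtDblCat f (mid AugVirtDblCat A) = f"
    "mcomp AugVirtDblCat (mid AugVirtDblCat B) f = f"
    using avfun_comp_id by (auto simp: mor_AVDC)
next
  fix A B D E :: "'u avdc" and f g h
  assume "mor AugVirtDblCat A B f" "mor AugVirtDblCat B D g" "mor AugVirtDblCat D E h"
  then show "mcomp AugVirtDblCat h (mcomp AugVirtDblCat g f)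
    = mcomp AugVirtDblCat (mcomp AugVirtDblCat h g) f"
    using avfun_comp_assoc by (auto simp: mor_AVDC)
next
  fix f g :: "'u avfun" and \<alpha> assume "two AugVirtDblCat f g \<alpha>"
  then show "\<exists>A B. mor AugVirtDblCat A B f \<and> mor AugVirtDblCat A B g"
    by (auto simp: mor_AVDC elim!: two_AVDC_E)
next
  fix f :: "'u avfun" assume "f \<in> Mor AugVirtDblCat"
  then show "two AugVirtDblCat f f (cid AugVirtDblCat f)" using is_trans_id[of _ _ f] by
    (simp add: two_AVDC is_fun_def)
next
  fix f g h :: "'u avfun" and \<alpha> \<beta> assume t: "two AugVirtDblCat f g \<alpha>" "two AugVirtDblCat g h \<beta>"
  then have "fdom g = fdom f" "fcod g = fcod f"
    using two_AVDC_D[OF t(1)] by auto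
  then show "two AugVirtDblCat f h (vert AugVirtDblCat \<beta> \<alpha>)"
    using t is_trans_vert by (auto simp: two_AVDC)
next
  fix f g :: "'u avfun" and \<alpha> assume "two AugVirtDblCat f g \<alpha>"
  then obtain K L where t: "is_trans K L f g \<alpha>" and f: "is_fun K L f" "is_fun K L g"
    by (elim two_AVDC_E)
  interpret trans_between K L f g \<alpha> using t by (rule is_trans_between)
  have "ccomp L (thor \<alpha> J) [hidc L (hmap f J)] = thor \<alpha> J" if "J \<in> Hor K" for J
    using F.tgt.ccomp_hidc[of "thor \<alpha> J"] that by simp
  then show "vert AugVirtDblCat \<alpha> (cid AugVirtDblCat f) = \<alpha>"
    by (simp, intro is_trans_eqI[OF is_trans_vert[OF is_trans_id[OF f(1)] t] t])
      (auto simp: avtrans_id_def)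
  have "ccomp L (hidc L (hmap g J)) [thor \<alpha> J] = thor \<alpha> J" if "J \<in> Hor K" for J
    using F.tgt.hidc_ccomp[of "thor \<alpha> J"] that by simp
  then show "vert AugVirtDblCat (cid AugVirtDblCat g) \<alpha> = \<alpha>"
    by (simp, intro is_trans_eqI[OF is_trans_vert[OF t is_trans_id[OF f(2)]] t]) auto
next
  fix f g h k :: "'u avfun" and \<alpha> \<beta> \<gamma>
  assume "two AugVirtDblCat f g \<alpha>" "two AugVirtDblCat g h \<beta>" "two AugVirtDblCat h k \<gamma>"
  then obtain K L where t: "is_trans K L f g \<alpha>" "is_trans K L g h \<beta>" "is_trans K L h k \<gamma>" by
    (auto dest!: two_AVDC_D)
  interpret \<alpha>: trans_between K L f g \<alpha> using t(1) by (rule is_trans_between)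
  interpret \<beta>: trans_between K L g h \<beta> using t(2) by (rule is_trans_between)
  interpret \<gamma>: trans_between K L h k \<gamma> using t(3) by (rule is_trans_between)
  have "ccomp L (thor \<gamma> J) [ccomp L (thor \<beta> J) [thor \<alpha> J]]
    = ccomp L (ccomp L (thor \<gamma> J) [thor \<beta> J]) [thor \<alpha> J]"
    if "J \<in> Hor K" for J
    using that by (intro \<alpha>.F.tgt.ccomp_assoc_11[OF \<gamma>.is_cell_thor \<beta>.is_cell_thor \<alpha>.is_cell_thor])
      (auto simp: \<alpha>.F.src.hdom_in)
  then show "vert AugVirtDblCat \<gamma> (vert AugVirtDblCat \<beta> \<alpha>)
    = vert AugVirtDblCat (vert AugVirtDblCat \<gamma> \<beta>) \<alpha>"
    by (simp, intro is_trans_eqI[OF is_trans_vert[OF is_trans_vert[OF t(1,2)] t(3)] is_trans_vert[OF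
      t(1) is_trans_vert[OF t(2,3)]]])
      (auto simp: \<alpha>.F.tgt.vcomp_assoc)
next
  fix f g h k :: "'u avfun" and \<alpha> \<beta>
  assume "two AugVirtDblCat f g \<alpha>" "two AugVirtDblCat h k \<beta>" "mcod AugVirtDblCat f
    = mdom AugVirtDblCat h"
  then show "two AugVirtDblCat (mcomp AugVirtDblCat h f) (mcomp AugVirtDblCat k g) (horz
    AugVirtDblCat \<beta> \<alpha>)"
    using is_trans_horz by (auto simp: two_AVDC elim!: two_AVDC_E)
next
  fix f g :: "'u avfun" and \<alpha> A
  assume "two AugVirtDblCat f g \<alpha>" and A: "mdom AugVirtDblCat f = A"
  then obtain L where t: "is_trans A L f g \<alpha>" and f: "is_fun A L f" "is_fun A L g" by
    (auto elim!: two_AVDC_E)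
  interpret trans_between A L f g \<alpha> using t by (rule is_trans_between)
  have i: "is_trans A L f g (avtrans_horz \<alpha> (avtrans_id (avfun_id A)))"
    using is_trans_horz[OF is_trans_id[OF is_fun_id] t] avfun_comp_id[OF f(1)] avfun_comp_id[OF
      f(2)]
      F.src.aug_virt_dbl_cat_axioms by simp
  have "ccomp L (thor \<alpha> J) [hidc L (hmap f J)] = thor \<alpha> J" if "J \<in> Hor A" for J
    using F.tgt.ccomp_hidc[of "thor \<alpha> J"] that by simp
  then show "horz AugVirtDblCat \<alpha> (cid AugVirtDblCat (mid AugVirtDblCat A)) = \<alpha>"
    by (simp, intro is_trans_eqI[OF i t]) (auto simp: avtrans_horz_def avtrans_id_def)
next
  fix f g :: "'u avfun" and \<alpha> B
  assume "two AugVirtDblCat f g \<alpha>" and B: "mcod AugVirtDblCat f = B"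
  then obtain K where t: "is_trans K B f g \<alpha>" and f: "is_fun K B f" "is_fun K B g" by
    (auto elim!: two_AVDC_E)
  interpret trans_between K B f g \<alpha> using t by (rule is_trans_between)
  have i: "is_trans K B f g (avtrans_horz (avtrans_id (avfun_id B)) \<alpha>)"
    using is_trans_horz[OF t is_trans_id[OF is_fun_id]] avfun_comp_id[OF f(1)] avfun_comp_id[OF
      f(2)]
      F.tgt.aug_virt_dbl_cat_axioms by simp
  have "ccomp B (hidc B (hmap g J)) [thor \<alpha> J] = thor \<alpha> J" if "J \<in> Hor K" for J
    using F.tgt.hidc_ccomp[of "thor \<alpha> J"] that by simp
  then show "horz AugVirtDblCat (cid AugVirtDblCat (mid AugVirtDblCat B)) \<alpha> = \<alpha>"
    by (simp, intro is_trans_eqI[OF i t]) (auto simp: avtrans_horz_def avtrans_id_def)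
next
  fix f f' g g' h h' :: "'u avfun" and \<alpha> \<beta> \<gamma>
  assume a: "two AugVirtDblCat f f' \<alpha>" "two AugVirtDblCat g g' \<beta>" "two AugVirtDblCat h h' \<gamma>"
    "mcod AugVirtDblCat f = mdom AugVirtDblCat g" "mcod AugVirtDblCat g = mdom AugVirtDblCat h"
  then obtain K L M N where t: "is_trans K L f f' \<alpha>" "is_trans L M g g' \<beta>" "is_trans M N h h' \<gamma>"
    by (auto dest!: two_AVDC_D)
  interpret \<alpha>: trans_between K L f f' \<alpha> using t(1) by (rule is_trans_between)
  interpret \<beta>: trans_between L M g g' \<beta> using t(2) by (rule is_trans_between)
  interpret \<gamma>: trans_between M N h h' \<gamma> using t(3) by (rule is_trans_between)
  note T = avfun_comp_assoc[OF \<alpha>.F.F \<beta>.F.F \<gamma>.F.F] avfun_comp_assoc[OF \<alpha>.G.F \<beta>.G.F \<gamma>.G.F]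
  have c: "ccomp N (thor \<gamma> (hmap g' (hmap f' J))) [cmap h (ccomp M (thor \<beta> (hmap f' J)) [cmap g
    (thor \<alpha> J)])] =
     ccomp N (ccomp N (thor \<gamma> (hmap g' (hmap f' J))) [cmap h (thor \<beta> (hmap f' J))]) [cmap h (cmap g
       (thor \<alpha> J))]"
    if J: "J \<in> Hor K" for J
  proof -
    have ga: "is_cell M (vmap g (tob \<alpha> (hdom K J))) [hmap g (hmap f J)] [hmap g (hmap f' J)] (vmap g
      (tob \<alpha> (hcod K J))) (cmap g (thor \<alpha> J))"
      using \<beta>.F.is_cell_cmap[OF \<alpha>.is_cell_thor[OF J]] by simp
    have b: "is_cell M (tob \<beta> (omap f' (hdom K J))) [hmap g (hmap f' J)] [hmap g' (hmap f' J)] (tob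
      \<beta> (omap f' (hcod K J))) (thor \<beta> (hmap f' J))"
      using \<beta>.is_cell_thor[of "hmap f' J"] J by simp
    have c: "is_cell N (tob \<gamma> (omap g' (omap f' (hdom K J)))) [hmap h (hmap g' (hmap f' J))] [hmap
      h' (hmap g' (hmap f' J))] (tob \<gamma> (omap g' (omap f' (hcod K J)))) (thor \<gamma> (hmap g' (hmap f'
      J)))"
      using \<gamma>.is_cell_thor[of "hmap g' (hmap f' J)"] J by simp
    have cm: "composable M (thor \<beta> (hmap f' J)) [cmap g (thor \<alpha> J)]"
      using J by (intro \<beta>.F.tgt.composable_1[OF b ga]) (auto simp: \<alpha>.F.src.hdom_in)
    show ?thesis
      using \<gamma>.F.cmap_ccomp[OF cm] J
        \<gamma>.F.tgt.ccomp_assoc_11[OF c \<gamma>.F.is_cell_cmap[OF b, simplified] \<gamma>.F.is_cell_cmap[OF ga,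
          simplified]]
      by (simp add: \<alpha>.F.src.hdom_in)
  qed
  have "avtrans_horz \<gamma> (avtrans_horz \<beta> \<alpha>) = avtrans_horz (avtrans_horz \<gamma> \<beta>) \<alpha>"
  proof (rule is_trans_eqI)
    show "is_trans K N (avfun_comp h (avfun_comp g f)) (avfun_comp h' (avfun_comp g' f'))
      (avtrans_horz \<gamma> (avtrans_horz \<beta> \<alpha>))"
      by (rule is_trans_horz[OF is_trans_horz[OF t(1,2)] t(3)])
    show "is_trans K N (avfun_comp h (avfun_comp g f)) (avfun_comp h' (avfun_comp g' f'))
      (avtrans_horz (avtrans_horz \<gamma> \<beta>) \<alpha>)"
      unfolding T by (rule is_trans_horz[OF t(1) is_trans_horz[OF t(2,3)]])
  qed (auto simp: c \<gamma>.F.tgt.vcomp_assoc)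
  then show "horz AugVirtDblCat \<gamma> (horz AugVirtDblCat \<beta> \<alpha>)
    = horz AugVirtDblCat (horz AugVirtDblCat \<gamma> \<beta>) \<alpha>" by simp
next
  fix A B D :: "'u avdc" and f g
  assume "mor AugVirtDblCat A B f" "mor AugVirtDblCat B D g"
  then have f: "is_fun A B f" "is_fun B D g" by (auto simp: mor_AVDC)
  interpret f: functor_between A B f using f(1) by (rule is_fun_between)
  interpret g: functor_between B D g using f(2) by (rule is_fun_between)
  have "ccomp D (hidc D (hmap g (hmap f J))) [hidc D (hmap g (hmap f J))]
    = hidc D (hmap g (hmap f J))" if "J \<in> Hor A" for J
    using g.tgt.hidc_is_cell_ccomp[OF g.tgt.is_cell_hidc] that by simp
  then show "horz AugVirtDblCat (cid AugVirtDblCat g) (cid AugVirtDblCat f)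
    = cid AugVirtDblCat (mcomp AugVirtDblCat g f)"
    by (simp, intro is_trans_eqI[OF is_trans_horz[OF is_trans_id[OF f(1)] is_trans_id[OF f(2)]]
      is_trans_id[OF is_fun_comp[OF f]]])
      (auto simp: avtrans_horz_def avtrans_id_def)
next
  fix f f' f'' g g' g'' :: "'u avfun" and \<alpha> \<alpha>' \<beta> \<beta>'
  assume a: "two AugVirtDblCat f f' \<alpha>" "two AugVirtDblCat f' f'' \<alpha>'" "two AugVirtDblCat g g' \<beta>"
    "two AugVirtDblCat g' g'' \<beta>'"
    "mcod AugVirtDblCat f = mdom AugVirtDblCat g"
  then obtain K L M where t: "is_trans K L f f' \<alpha>" "is_trans K L f' f'' \<alpha>'" "is_trans L M g g' \<beta>"
    "is_trans L M g' g'' \<beta>'"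
    by (auto dest!: two_AVDC_D)
  interpret \<alpha>: trans_between K L f f' \<alpha> using t(1) by (rule is_trans_between)
  interpret \<alpha>': trans_between K L f' f'' \<alpha>' using t(2) by (rule is_trans_between)
  interpret \<beta>: trans_between L M g g' \<beta> using t(3) by (rule is_trans_between)
  interpret \<beta>': trans_between L M g' g'' \<beta>' using t(4) by (rule is_trans_between)
  have c: "ccomp M (ccomp M (thor \<beta>' (hmap f'' J)) [thor \<beta> (hmap f'' J)]) [cmap g (ccomp L (thor \<alpha>'
    J) [thor \<alpha> J])] =
      ccomp M (ccomp M (thor \<beta>' (hmap f'' J)) [cmap g' (thor \<alpha>' J)]) [ccomp M (thor \<beta> (hmap f' J))
        [cmap g (thor \<alpha> J)]]"
    if J: "J \<in> Hor K" for J
  proof -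
    have J': "hdom K J \<in> Ob K" "hcod K J \<in> Ob K" using J by
      (auto simp: \<alpha>.F.src.hdom_in \<alpha>.F.src.hcod_in)
    note a = \<alpha>.is_cell_thor[OF J] and a' = \<alpha>'.is_cell_thor[OF J]
    note b' = \<beta>.is_cell_thor[of "hmap f' J"]
    note ga = \<beta>.F.is_cell_cmap[OF a, simplified] and ga' = \<beta>.F.is_cell_cmap[OF a', simplified]
      and g'a' = \<beta>.G.is_cell_cmap[OF a', simplified]
    have b1: "is_cell M (tob \<beta> (omap f' (hdom K J))) [hmap g (hmap f' J)] [hmap g' (hmap f' J)] (tob
      \<beta> (omap f' (hcod K J))) (thor \<beta> (hmap f' J))"
      using \<beta>.is_cell_thor[of "hmap f' J"] J by simp
    have b2: "is_cell M (tob \<beta> (omap f'' (hdom K J))) [hmap g (hmap f'' J)] [hmap g' (hmap f'' J)]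
      (tob \<beta> (omap f'' (hcod K J))) (thor \<beta> (hmap f'' J))"
      using \<beta>.is_cell_thor[of "hmap f'' J"] J by simp
    have b3: "is_cell M (tob \<beta>' (omap f'' (hdom K J))) [hmap g' (hmap f'' J)] [hmap g'' (hmap f''
      J)] (tob \<beta>' (omap f'' (hcod K J))) (thor \<beta>' (hmap f'' J))"
      using \<beta>'.is_cell_thor[of "hmap f'' J"] J by simp
    have cm: "composable L (thor \<alpha>' J) [thor \<alpha> J]"
      using J' by (intro \<alpha>.F.tgt.composable_1[OF a' a]) auto
    \<comment> \<open>Naturality of \<beta> at the component of \<alpha>' at J, the heart of the
      interchange law.\<close>
    have n: "ccomp M (cmap g' (thor \<alpha>' J)) [thor \<beta> (hmap f' J)]
      = ccomp M (thor \<beta> (hmap f'' J)) [cmap g (thor \<alpha>' J)]"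
      using \<beta>.natural[OF a'] J by (simp add: tpath_def)
    have m1: "is_cell M (vcomp M (tob \<beta> (omap f' (hdom K J))) (vmap g (tob \<alpha> (hdom K J)))) [hmap g
      (hmap f J)] [hmap g' (hmap f' J)]
       (vcomp M (tob \<beta> (omap f' (hcod K J))) (vmap g (tob \<alpha> (hcod K J)))) (ccomp M (thor \<beta> (hmap f'
         J)) [cmap g (thor \<alpha> J)])"
      using J' by (intro \<beta>.F.tgt.is_cell_ccomp_1[OF b1 ga]) auto
    have m2: "is_cell M (vcomp M (vmap g (tob \<alpha>' (hdom K J))) (vmap g (tob \<alpha> (hdom K J)))) [hmap g
      (hmap f J)] [hmap g (hmap f'' J)]
       (vcomp M (vmap g (tob \<alpha>' (hcod K J))) (vmap g (tob \<alpha> (hcod K J)))) (ccomp M (cmap g (thor \<alpha>'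
         J)) [cmap g (thor \<alpha> J)])"
      using J' by (intro \<beta>.F.tgt.is_cell_ccomp_1[OF ga' ga]) auto
    have "ccomp M (ccomp M (thor \<beta>' (hmap f'' J)) [cmap g' (thor \<alpha>' J)]) [ccomp M (thor \<beta> (hmap f'
      J)) [cmap g (thor \<alpha> J)]]
      = ccomp M (thor \<beta>' (hmap f'' J)) [ccomp M (cmap g' (thor \<alpha>' J)) [ccomp M (thor \<beta> (hmap f' J))
        [cmap g (thor \<alpha> J)]]]"
      by (rule \<beta>.F.tgt.ccomp_assoc_11[OF b3 g'a' m1, symmetric]) (use J' in auto)
    also have "\<dots> = ccomp M (thor \<beta>' (hmap f'' J)) [ccomp M (ccomp M (thor \<beta> (hmap f'' J)) [cmap g
      (thor \<alpha>' J)]) [cmap g (thor \<alpha> J)]]"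
      using \<beta>.F.tgt.ccomp_assoc_11[OF g'a' b1 ga] n J' by simp
    also have "\<dots> = ccomp M (thor \<beta>' (hmap f'' J)) [ccomp M (thor \<beta> (hmap f'' J)) [ccomp M (cmap g
      (thor \<alpha>' J)) [cmap g (thor \<alpha> J)]]]"
      using \<beta>.F.tgt.ccomp_assoc_11[OF b2 ga' ga] J' by simp
    also have "\<dots> = ccomp M (ccomp M (thor \<beta>' (hmap f'' J)) [thor \<beta> (hmap f'' J)]) [ccomp M (cmap g
      (thor \<alpha>' J)) [cmap g (thor \<alpha> J)]]"
      by (rule \<beta>.F.tgt.ccomp_assoc_11[OF b3 b2 m2]) (use J' in auto)
    finally show ?thesis using \<beta>.F.cmap_ccomp[OF cm] by simp
  qed
  have o: "vcomp M (vcomp M (tob \<beta>' (omap f'' A)) (tob \<beta> (omap f'' A))) (vcomp M (vmap g (tob \<alpha>' A))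
    (vmap g (tob \<alpha> A))) =
     vcomp M (vcomp M (tob \<beta>' (omap f'' A)) (vmap g' (tob \<alpha>' A))) (vcomp M (tob \<beta> (omap f' A)) (vmap
       g (tob \<alpha> A)))"
    if A: "A \<in> Ob K" for A
  proof -
    have n: "vcomp M (vmap g' (tob \<alpha>' A)) (tob \<beta> (omap f' A))
      = vcomp M (tob \<beta> (omap f'' A)) (vmap g (tob \<alpha>' A))"
      using \<beta>.tob_natural[of "tob \<alpha>' A"] A by simp
    show ?thesis using A
      by (simp add: \<beta>.F.tgt.vcomp_assoc) (simp add: \<beta>.F.tgt.vcomp_assoc[symmetric] n)
  qed
  show "horz AugVirtDblCat (vert AugVirtDblCat \<beta>' \<beta>) (vert AugVirtDblCat \<alpha>' \<alpha>) =
      vert AugVirtDblCat (horz AugVirtDblCat \<beta>' \<alpha>') (horz AugVirtDblCat \<beta> \<alpha>)"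
    by (simp, intro is_trans_eqI[OF is_trans_horz[OF is_trans_vert[OF t(1,2)] is_trans_vert[OF
      t(3,4)]]
        is_trans_vert[OF is_trans_horz[OF t(1,3)] is_trans_horz[OF t(2,4)]]]) (auto simp: c o)
qed


section \<open>Families of horizontal cells\<close>

context aug_virt_dbl_cat
begin

text \<open>Cells with identity vertical boundary, indexed by labels. The labels have an arbitrary
  type since for comparison cells both ends, the F-image of the companion of j and the companion of
  the F-image of j, are functions of the vertical morphism j.\<close>

definition horizontal_family :: "('b \<Rightarrow> 'u) \<Rightarrow> ('b \<Rightarrow> 'u) \<Rightarrow> ('b \<Rightarrow> 'u) \<Rightarrow> 'b set \<Rightarrow> bool" where
  "horizontal_family a b u X \<longleftrightarrow>
     (\<forall>x\<in>X. is_cell K (vid K (hdom K (a x))) [a x] [b x] (vid K (hcod K (a x))) (u x))"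

lemma horizontal_family_ends:
  assumes "horizontal_family a b u X" "x \<in> X"
  shows "a x \<in> Hor K" "b x \<in> Hor K" "hdom K (b x) = hdom K (a x)" "hcod K (b x) = hcod K (a x)"
proof -
  have c: "is_cell K (vid K (hdom K (a x))) [a x] [b x] (vid K (hcod K (a x))) (u x)"
    using assms by (simp add: horizontal_family_def)
  show "a x \<in> Hor K" "b x \<in> Hor K" "hdom K (b x) = hdom K (a x)" "hcod K (b x) = hcod K (a x)"
    using is_cell_hpath[OF c] hdom_in hcod_in by auto
qed

lemma horizontal_family_path:
  assumes f: "horizontal_family a b u (set xs)" and h: "hpath K A (map a xs) B"
  shows "cpath K (vid K A) (map u xs) (vid K B)" "hpath K A (map b xs) B"
    "cpath K (vid K A) (vidc K (vid K A) # map u xs) (vid K B)"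
    "concat (map (hsrc K) (map u xs)) = map a xs" "concat (map (htgt K) (map u xs)) = map b xs"
proof -
  have 1: "cpath K (vid K A) (map u xs) (vid K B) \<and> hpath K A (map b xs) B \<and>
     concat (map (hsrc K) (map u xs)) = map a xs \<and> concat (map (htgt K) (map u xs)) = map b xs"
    using f h
  proof (induction xs arbitrary: A)
    case (Cons x xs)
    have x: "is_cell K (vid K (hdom K (a x))) [a x] [b x] (vid K (hcod K (a x))) (u x)"
      using Cons.prems by (simp add: horizontal_family_def)
    have "horizontal_family a b u (set xs)" using Cons.prems by (simp add: horizontal_family_def)
    then show ?case
      using Cons.IH[of "hcod K (a x)"] Cons.prems is_cellD[OF x]
        horizontal_family_ends[OF Cons.prems(1), of x] by auto
  qed auto
  then show "cpath K (vid K A) (map u xs) (vid K B)" "hpath K A (map b xs) B"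
    "concat (map (hsrc K) (map u xs)) = map a xs" "concat (map (htgt K) (map u xs)) = map b xs"
    by blast+
  show "cpath K (vid K A) (vidc K (vid K A) # map u xs) (vid K B)"
    using 1 hpath_ends[OF h] by (simp add: vidc_in vsrc_vidc vtgt_vidc)
qed

lemma composable_vidc_family:
  assumes f: "horizontal_family a b u (set xs)" and x: "is_cell K p (map b xs) Ks q X"
    and h: "hpath K (vdom K p) (map a xs) (vdom K q)"
  shows "composable K X (vidc K (vid K (vdom K p)) # map u xs)"
    and "is_cell K p (map a xs) Ks q (ccomp K X (vidc K (vid K (vdom K p)) # map u xs))"
proof -
  note P = horizontal_family_path[OF f h] and V = is_cell_Ver[OF x]
  show "composable K X (vidc K (vid K (vdom K p)) # map u xs)"
    by (rule composableI[OF _ _ P(3)]) (use P V is_cellD[OF x] in \<open>auto simp: htgt_vidc\<close>)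
  have "is_cell K (vcomp K p (vid K (vdom K p))) (concat (map (hsrc K) (vidc K (vid K (vdom K p)) #
    map u xs))) Ks
      (vcomp K q (vid K (vdom K q))) (ccomp K X (vidc K (vid K (vdom K p)) # map u xs))"
    by (rule is_cell_ccomp[OF x _ P(3)]) (use P V in \<open>auto simp: htgt_vidc\<close>)
  then show "is_cell K p (map a xs) Ks q (ccomp K X (vidc K (vid K (vdom K p)) # map u xs))"
    using P V by (simp add: hsrc_vidc)
qed

text \<open>Associativity for single cells combines the two paths into a path of identity cells,
  which the unit axioms remove. This is how invertible families are cancelled along a horizontal
  source.\<close>

lemma ccomp_family_inverse:
  assumes u: "horizontal_family a b u (set xs)" and v: "horizontal_family b a v (set xs)"
    and i: "\<And>x. x \<in> set xs \<Longrightarrow> ccomp K (v x) [u x] = hidc K (a x)"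
    and x: "is_cell K p (map a xs) Ks q X"
  shows "ccomp K (ccomp K X (vidc K (vid K (vdom K p)) # map v xs)) (vidc K (vid K (vdom K p)) # map
    u xs) = X"
proof -
  have h: "hpath K (vdom K p) (map a xs) (vdom K q)" using is_cell_hpath[OF x] by simp
  have h': "hpath K (vdom K p) (map b xs) (vdom K q)" using horizontal_family_path(2)[OF u h] .
  let ?i = "vidc K (vid K (vdom K p))"
  have A: "vdom K p \<in> Ob K" using hpath_ends[OF h] by simp
  have uv: "composable K (v y) [u y]" if "y \<in> set xs" for y
    using that u v horizontal_family_ends[OF u that] hdom_in
    by (intro composable_1) (auto simp: horizontal_family_def)
  have ii: "composable K ?i [?i]" using composable_1[OF is_cell_vidc is_cell_vidc] A by simp
  have l: "list_all2 (\<lambda>\<psi> \<phi>. composable K \<psi> [\<phi>]) (?i # map v xs) (?i # map u xs)"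
    using uv ii by (simp add: list_all2_map1 list_all2_map2 list_all2_same)
  have m: "map2 (\<lambda>\<psi> \<phi>. ccomp K \<psi> [\<phi>]) (?i # map v xs) (?i # map u xs)
    = ?i # map (hidc K) (map a xs)"
    using i A by (auto simp: vidc_vidc map2_map_map)
  show ?thesis
    using ccomp_assoc_singles(1)[OF l composable_vidc_family(1)[OF v x h']
      horizontal_family_path(3)[OF u h]]
      ccomp_vidc_hidc(1)[OF x] m by simp
qed

section \<open>Identity cells inserted along a path\<close>

lemma ccomp_insert_vidc':
  assumes c: "composable K \<psi> (\<phi>s @ \<chi>s)" and p: "cpath K f \<phi>s (vid K A)" and A: "A \<in> Ob K"
    and ne: "\<phi>s \<noteq> []"
  shows "composable K \<psi> (\<phi>s @ [vidc K (vid K A)] @ \<chi>s)"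
    and "ccomp K \<psi> (\<phi>s @ [vidc K (vid K A)] @ \<chi>s) = ccomp K \<psi> (\<phi>s @ \<chi>s)"
proof -
  note D = c[unfolded composable_def]
  have f: "vsrc K (hd (\<phi>s @ \<chi>s)) = f" using cpath_hd_last[OF p ne] ne by simp
  have g: "cpath K (vid K A) \<chi>s (vtgt K (last (\<phi>s @ \<chi>s)))"
  proof -
    have e: "cpath K f \<phi>s x \<Longrightarrow> x = vid K A" for x
      using cpath_hd_last[OF _ ne] p by metis
    show ?thesis using D f e by (auto simp: cpath_append)
  qed
  have c2: "cpath K f (\<phi>s @ [vidc K (vid K A)] @ \<chi>s) (vtgt K (last (\<phi>s @ \<chi>s)))"
    using p g A by (auto simp: cpath_append vidc_in vsrc_vidc vtgt_vidc)
  show "composable K \<psi> (\<phi>s @ [vidc K (vid K A)] @ \<chi>s)"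
    by (rule composableI[OF _ _ c2]) (use D f A in \<open>auto simp: htgt_vidc\<close>)
  show "ccomp K \<psi> (\<phi>s @ [vidc K (vid K A)] @ \<chi>s) = ccomp K \<psi> (\<phi>s @ \<chi>s)"
    by (rule ccomp_insert_vidc[OF c p g])
qed

text \<open>A path of labels \<open>xs\<close> cut into segments \<open>(b, A, xs)\<close>, where \<open>A\<close> is the object at which the
  segment starts and \<open>b\<close> tells whether an identity cell at \<open>A\<close> is inserted there.\<close>

primrec segments :: "('b \<Rightarrow> 'u) \<Rightarrow> 'u \<Rightarrow> (bool \<times> 'u \<times> 'b list) list \<Rightarrow> 'u \<Rightarrow> bool" where
  "segments a A [] B \<longleftrightarrow> A \<in> Ob K \<and> A = B"
| "segments a A (l # ls) B \<longleftrightarrow>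
     (\<exists>C. fst (snd l) = A \<and> hpath K A (map a (snd (snd l))) C \<and> segments a C ls B)"

definition spread :: "('b \<Rightarrow> 'u) \<Rightarrow> (bool \<times> 'u \<times> 'b list) list \<Rightarrow> 'u list" where
  "spread u ls = concat (map (\<lambda>(b, A, xs). (if b then [vidc K (vid K A)] else []) @ map u xs) ls)"

text \<open>The induction moves one segment after another from \<open>ls\<close> into the prefix
  \<phi>s. Because the prefix is non-empty, it fixes the vertical morphism at which the next
  identity cell may be inserted.\<close>

lemma ccomp_spread_aux:
  "segments a A ls B \<Longrightarrow> horizontal_family a b u (set (concat (map (snd \<circ> snd) ls))) \<Longrightarrow> \<phi>s \<noteq> [] \<Longrightarrow>
     cpath K f \<phi>s (vid K A) \<Longrightarrow> composable K X (\<phi>s @ map u (concat (map (snd \<circ> snd) ls))) \<Longrightarrow>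
     composable K X (\<phi>s @ spread u ls) \<and>
     ccomp K X (\<phi>s @ spread u ls) = ccomp K X (\<phi>s @ map u (concat (map (snd \<circ> snd) ls)))"
proof (induction ls arbitrary: A \<phi>s)
  case Nil
  then show ?case by (simp add: spread_def)
next
  case (Cons l ls)
  obtain b' A' xs where l: "l = (b', A', xs)" by (cases l) auto
  obtain C where C: "A' = A" "hpath K A (map a xs) C" "segments a C ls B"
    using Cons.prems(1) l by auto
  have f: "horizontal_family a b u (set xs)"
    "horizontal_family a b u (set (concat (map (snd \<circ> snd) ls)))"
    using Cons.prems(2) l by (auto simp: horizontal_family_def)
  have c: "cpath K f (\<phi>s @ map u xs) (vid K C)"
    using Cons.prems(4) horizontal_family_path(1)[OF f(1) C(2)] by (auto simp: cpath_append)
  have ih: "composable K X ((\<phi>s @ map u xs) @ spread u ls) \<and>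
     ccomp K X ((\<phi>s @ map u xs) @ spread u ls)
       = ccomp K X ((\<phi>s @ map u xs) @ map u (concat (map (snd \<circ> snd) ls)))"
    by (rule Cons.IH[OF C(3) f(2) _ c]) (use Cons.prems l in auto)
  have e: "spread u (l # ls) = (if b' then [vidc K (vid K A)] else []) @ map u xs @ spread u ls"
    using l C by (simp add: spread_def)
  have A: "A \<in> Ob K" using hpath_ends[OF C(2)] by simp
  show ?case
    using ccomp_insert_vidc'[of X \<phi>s "map u xs @ spread u ls" f A] ih Cons.prems(3,4) A e l
    by (auto simp: comp_def)
qed

text \<open>A leading identity serves as the non-empty prefix of the induction and is removed
  afterwards. The result compares different ways of cutting one path, as is needed when a horizontal
  path is the concatenation of the sources or targets of a path of cells.\<close>

lemma ccomp_spread: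
  assumes s: "segments a (vdom K p) ls (vdom K q)" and f: "horizontal_family a b u (set xs)"
    and xs: "xs = concat (map (snd \<circ> snd) ls)" and h: "hpath K (vdom K p) (map a xs) (vdom K q)"
    and x: "is_cell K p (map b xs) Ks q X" and ne: "spread u ls \<noteq> []"
  shows "ccomp K X (spread u ls) = ccomp K X (vidc K (vid K (vdom K p)) # map u xs)"
    and "composable K X (spread u ls)"
proof -
  let ?i = "vidc K (vid K (vdom K p))"
  have A: "vdom K p \<in> Ob K" using hpath_ends[OF h] by simp
  have i: "cpath K (vid K (vdom K p)) [?i] (vid K (vdom K p))"
    using A by (simp add: vidc_in vsrc_vidc vtgt_vidc)
  have 1: "composable K X ([?i] @ spread u ls) \<and> ccomp K X ([?i] @ spread u ls)
    = ccomp K X ([?i] @ map u xs)"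
    unfolding xs
    by (rule ccomp_spread_aux[OF s _ _ i]) (use f composable_vidc_family(1)[OF f x h] xs in auto)
  let ?g = "vtgt K (last (spread u ls))"
  have c: "cpath K (vid K (vdom K p)) (spread u ls) ?g"
    using 1 ne A by (auto simp: composable_def vsrc_vidc vtgt_vidc)
  show c2: "composable K X (spread u ls)"
    by (rule composableI[OF _ ne c]) (use 1 A
      in \<open>auto simp: composable_def vsrc_vidc vtgt_vidc htgt_vidc\<close>)
  have "vsrc K (hd (spread u ls)) = vid K (vdom K p)" using cpath_hd_last[OF c ne] by simp
  then show "ccomp K X (spread u ls) = ccomp K X (?i # map u xs)"
    using ccomp_vidc_Cons[OF c2] 1 by simp
qed

lemma segments_single: "hpath K A (map a xs) B \<Longrightarrow> segments a A [(b, A, xs)] B"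
  using hpath_ends by simp

text \<open>The left-hand side has the shape of \<open>tpath\<close>, the right-hand side is uniform
  in \<open>xs\<close>. The path is regarded as a single segment, with an identity inserted exactly
  when it is empty.\<close>

lemma ccomp_family_path:
  assumes f: "horizontal_family a b u (set xs)" and h: "hpath K (vdom K p) (map a xs) (vdom K q)"
    and x: "is_cell K p (map b xs) Ks q X"
  shows "ccomp K X (if xs = [] then [vidc K (vid K (vdom K p))] else map u xs) =
      ccomp K X (vidc K (vid K (vdom K p)) # map u xs)"
    and "composable K X (if xs = [] then [vidc K (vid K (vdom K p))] else map u xs)"
proof -
  let ?ls = "[(xs = [], vdom K p, xs)]"
  have e: "spread u ?ls = (if xs = [] then [vidc K (vid K (vdom K p))] else map u xs)"
    by (simp add: spread_def)
  have xs: "xs = concat (map (snd \<circ> snd) ?ls)" by simp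
  show "ccomp K X (if xs = [] then [vidc K (vid K (vdom K p))] else map u xs) =
      ccomp K X (vidc K (vid K (vdom K p)) # map u xs)"
    "composable K X (if xs = [] then [vidc K (vid K (vdom K p))] else map u xs)"
    using ccomp_spread[OF segments_single[OF h, where b = "xs = []"] f xs h x, unfolded e] by auto
qed

end

context trans_between
begin

text \<open>Brings the naturality squares of a transformation with identity vertical components into
  the uniform shape with a leading identity, in which invertible families can be cancelled.\<close>

lemma ccomp_tpath_vidc:
  assumes i: "\<And>A. A \<in> Ob K \<Longrightarrow> tob \<xi> A = vid L (omap F A)" and h: "hpath K (vdom K p) Js (vdom K q)"
    and x: "is_cell L (vmap F p) (map (hmap G) Js) Ks q' X" and p: "p \<in> Ver K"
  shows "ccomp L X (tpath \<xi> (vdom K p) Js)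
    = ccomp L X (vidc L (vid L (omap F (vdom K p))) # map (thor \<xi>) Js)"
proof (cases "Js = []")
  case True
  then show ?thesis using i p by (simp add: tpath_def)
next
  case False
  have c: "composable L X (tpath \<xi> (vdom K p) Js)"
    by (rule F.tgt.composableI[OF _ _ tpath_props(1)[OF h]])
      (use tpath_props[OF h] x i p in \<open>auto simp: is_cell_def\<close>)
  have "vsrc L (hd (tpath \<xi> (vdom K p) Js)) = vid L (omap F (vdom K p))"
    using cpath_hd_last[OF tpath_props(1,2)[OF h]] i p by simp
  then show ?thesis using F.tgt.ccomp_vidc_Cons[OF c] False by (simp add: tpath_def)
qed

end

text \<open>Naturality of the inverse family is the naturality square of \<xi> with its components
  cancelled on both sides: by the cells v along the horizontal source, and by the inverse component
  at the horizontal target.\<close>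

lemma invertible_if_horizontal:
  assumes t: "is_trans K L F G \<xi>" and i: "\<And>A. A \<in> Ob K \<Longrightarrow> tob \<xi> A = vid L (omap F A)"
    and v: "\<And>J. J \<in> Hor K \<Longrightarrow>
      is_cell L (vid L (omap F (hdom K J))) [hmap G J] [hmap F J] (vid L (omap F (hcod K J))) (v J)
        \<and>
      ccomp L (v J) [thor \<xi> J] = hidc L (hmap F J) \<and> ccomp L (thor \<xi> J) [v J] = hidc L (hmap G J)"
  shows "invertible_two AugVirtDblCat F G \<xi>"
proof -
  interpret \<xi>: trans_between K L F G \<xi> using t by (rule is_trans_between)
  define \<zeta> where "\<zeta> = \<lparr>tsrc = G, ttgt = F, tob = restrict (tob \<xi>) (Ob K), thor
    = restrict v (Hor K)\<rparr>"
  have GF: "omap G A = omap F A" if "A \<in> Ob K" for A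
    using that \<xi>.comp_simps(2)[OF that] i[OF that] by simp
  \<comment> \<open>With identity components, naturality in vertical morphisms says that F and G
    agree on them.\<close>
  have GFv: "vmap G f = vmap F f" if f: "f \<in> Ver K" for f
    using \<xi>.tob_natural[OF f] i f GF by simp
  have fu: "\<xi>.F.tgt.horizontal_family (hmap F) (hmap G) (thor \<xi>) (Hor K)"
    using \<xi>.is_cell_thor i by (auto simp: \<xi>.F.tgt.horizontal_family_def \<xi>.F.src.hdom_in
      \<xi>.F.src.hcod_in)
  have fv: "\<xi>.F.tgt.horizontal_family (hmap G) (hmap F) v (Hor K)"
    using v GF by (auto simp: \<xi>.F.tgt.horizontal_family_def \<xi>.F.src.hdom_in \<xi>.F.src.hcod_in)
  have fuX: "\<xi>.F.tgt.horizontal_family (hmap F) (hmap G) (thor \<xi>) X"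
    "\<xi>.F.tgt.horizontal_family (hmap G) (hmap F) v X"
    if "X \<subseteq> Hor K" for X using fu fv that by (auto simp: \<xi>.F.tgt.horizontal_family_def)
  have z: "is_trans K L G F \<zeta>"
  proof (rule is_transI[OF \<xi>.G.F \<xi>.F.F])
    fix f assume "f \<in> Ver K"
    then show "vcomp L (vmap F f) (tob \<zeta> (vdom K f)) = vcomp L (tob \<zeta> (vcod K f)) (vmap G f)"
      using i GFv GF by (simp add: \<zeta>_def)
  next
    fix J assume J: "J \<in> Hor K"
    then show "is_cell L (tob \<zeta> (hdom K J)) [hmap G J] [hmap F J] (tob \<zeta> (hcod K J)) (thor \<zeta> J)"
      using v[OF J] i by (simp add: \<zeta>_def \<xi>.F.src.hdom_in \<xi>.F.src.hcod_in)
  next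
    fix f Js Ks g \<phi> assume p: "is_cell K f Js Ks g \<phi>"
    note H = \<xi>.F.src.is_cell_hpath[OF p] and V = \<xi>.F.src.is_cell_Ver[OF p] and D = is_cellD[OF p]
    have l: "length Ks \<le> 1" using \<xi>.F.src.htgt_length D by blast
    have HJ: "hpath K (vdom K f) Js (vdom K g)" and HK: "hpath K (vcod K f) Ks (vcod K g)" using H
      by auto
    note sJ = \<xi>.F.src.hpath_Hor[OF HJ] and sK = \<xi>.F.src.hpath_Hor[OF HK]
    note Fp = \<xi>.F.is_cell_cmap[OF p] and Gp = \<xi>.G.is_cell_cmap[OF p]
    have Gp': "is_cell L (vmap F f) (map (hmap G) Js) (map (hmap G) Ks) (vmap F g) (cmap G \<phi>)"
      using Gp GFv V by simp
    have rJ: "map (restrict v (Hor K)) Js = map v Js" using sJ by auto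
    let ?i = "vidc L (vid L (omap F (vdom K f)))"
    have Z: "tpath \<zeta> (vdom K f) Js = (if Js = [] then [?i] else map v Js)"
      using rJ V i by (simp add: tpath_def \<zeta>_def)
    have FH: "hpath L (omap F (vdom K f)) (map (hmap F) Js) (omap F (vdom K g))"
      using \<xi>.F.tgt.is_cell_hpath[OF Fp] V by simp
    have GH: "hpath L (vdom L (vmap F f)) (map (hmap G) Js) (vdom L (vmap F g))"
      using \<xi>.F.tgt.is_cell_hpath[OF Gp'] by simp
    have zi: "ccomp L X (tpath \<zeta> (vdom K f) Js) = ccomp L X (?i # map v Js)"
      "composable L X (?i # map v Js)"
      if X: "is_cell L (vmap F f) (map (hmap F) Js) Ms (vmap F g) X" for X Ms
      using \<xi>.F.tgt.ccomp_family_path(1)[OF fuX(2)[OF sJ] GH X]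
        \<xi>.F.tgt.composable_vidc_family(1)[OF fuX(2)[OF sJ] X GH]
      unfolding Z \<xi>.F.map_simps(1)[OF conjunct1[OF V]] by simp_all
    define zK where "zK = hd (tpath \<zeta> (vcod K f) Ks)"
    define xK where "xK = hd (tpath \<xi> (vcod K f) Ks)"
    have zK: "is_cell L (vid L (omap F (vcod K f))) (map (hmap G) Ks) (map (hmap F) Ks) (vid L (omap
      F (vcod K g))) zK"
      and xK: "is_cell L (vid L (omap F (vcod K f))) (map (hmap F) Ks) (map (hmap G) Ks) (vid L
        (omap F (vcod K g))) xK"
      and zx: "ccomp L zK [xK] = (if Ks = [] then vidc L (vid L (omap F (vcod K f))) else hidc L
        (hmap F (hd Ks)))"
      using v[of "hd Ks"] \<xi>.is_cell_thor[of "hd Ks"] HK V l i \<xi>.F.tgt.is_cell_vidc[of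
        "vid L (omap F (vcod K f))"]
      by (cases Ks; auto simp: zK_def xK_def tpath_def \<zeta>_def \<xi>.F.tgt.vidc_vidc)+
    have 1: "ccomp L (ccomp L (cmap G \<phi>) (?i # map (thor \<xi>) Js)) (?i # map v Js) = cmap G \<phi>"
      using \<xi>.F.tgt.ccomp_family_inverse[OF fuX(2)[OF sJ] fuX(1)[OF sJ] _ Gp'] v sJ V by auto
    have n: "ccomp L (cmap G \<phi>) (?i # map (thor \<xi>) Js) = ccomp L xK [cmap F \<phi>]"
      using \<xi>.natural[OF p] \<xi>.ccomp_tpath_vidc[OF i HJ Gp'] V xK_def by simp
    have xF: "is_cell L (vmap F f) (map (hmap F) Js) (map (hmap G) Ks) (vmap F g) (ccomp L xK [cmap
      F \<phi>])"
      using \<xi>.F.tgt.is_cell_ccomp_1[OF xK Fp] V \<xi>.F.src.is_cell_hpath[OF p] by simp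
    have "ccomp L zK [cmap G \<phi>] = ccomp L zK [ccomp L (ccomp L xK [cmap F \<phi>]) (?i # map v Js)]"
      using 1 n by simp
    also have "\<dots> = ccomp L (ccomp L zK [ccomp L xK [cmap F \<phi>]]) (?i # map v Js)"
      by (rule \<xi>.F.tgt.ccomp_assoc_1[OF \<xi>.F.tgt.composable_1[OF zK xF] zi(2)[OF xF]]) (use V
        in simp)
    also have "ccomp L zK [ccomp L xK [cmap F \<phi>]] = ccomp L (ccomp L zK [xK]) [cmap F \<phi>]"
      by (rule \<xi>.F.tgt.ccomp_assoc_11[OF zK xK Fp]) (use V in auto)
    also have "\<dots> = cmap F \<phi>"
      using zx Fp \<xi>.F.tgt.vidc_is_cell_ccomp[of "vmap F f"] \<xi>.F.tgt.hidc_is_cell_ccomp[of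
        "vmap F f"] l V
      by (cases Ks) auto
    also have "ccomp L (cmap F \<phi>) (?i # map v Js) = ccomp L (cmap F \<phi>) (tpath \<zeta> (vdom K f) Js)"
      using zi(1)[OF Fp] by simp
    finally show "ccomp L (cmap F \<phi>) (tpath \<zeta> (vdom K f) Js)
      = ccomp L (hd (tpath \<zeta> (vcod K f) Ks)) [cmap G \<phi>]"
      unfolding zK_def by simp
  qed (use GF i in \<open>auto simp: \<zeta>_def\<close>)
  have "avtrans_vert \<zeta> \<xi> = avtrans_id F"
    by (rule is_trans_eqI[OF is_trans_vert[OF t z] is_trans_id[OF \<xi>.F.F]]) (use v i
      in \<open>auto simp: \<zeta>_def\<close>)
  moreover have "avtrans_vert \<xi> \<zeta> = avtrans_id G"
    by (rule is_trans_eqI[OF is_trans_vert[OF z t] is_trans_id[OF \<xi>.G.F]]) (use v i GF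
      in \<open>auto simp: \<zeta>_def\<close>)
  ultimately show ?thesis
    using t z unfolding invertible_two_def two_AVDC by (auto intro!: exI[of _ \<zeta>])
qed


section \<open>Equivalences from essential surjectivity\<close>

text \<open>Isolates what makes the functor on quintets an equivalence: it is the identity on
  objects and vertical morphisms, bijective on cells with given boundary, and every horizontal
  morphism J of L is isomorphic to F (s J). As the isomorphisms \<theta> are horizontal cells, no
  vertical morphism has to be inverted.\<close>

locale essentially_surjective = functor_between K L F for K L :: "'u avdc" and F +
  fixes s \<theta> \<theta>' :: "'u \<Rightarrow> 'u"
  assumes Ob_eq: "Ob L = Ob K" and Ver_eq: "Ver L = Ver K"
    and omap_id: "A \<in> Ob K \<Longrightarrow> omap F A = A" and vmap_id: "f \<in> Ver K \<Longrightarrow> vmap F f = f"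
    and fully_faithful: "\<lbrakk>is_cell L f (map (hmap F) Js) (map (hmap F) Ks) g \<chi>;
      hpath K (vdom L f) Js (vdom L g); hpath K (vcod L f) Ks (vcod L g); length Ks \<le> 1\<rbrakk>
      \<Longrightarrow> \<exists>!\<phi>. is_cell K f Js Ks g \<phi> \<and> cmap F \<phi> = \<chi>"
    and s: "J \<in> Hor L \<Longrightarrow> s J \<in> Hor K \<and> hdom K (s J) = hdom L J \<and> hcod K (s J) = hcod L J"
    and \<theta>: "J \<in> Hor L \<Longrightarrow> is_cell L (vid L (hdom L J)) [J] [hmap F (s J)] (vid L (hcod L J)) (\<theta> J)"
    and \<theta>': "J \<in> Hor L \<Longrightarrow> is_cell L (vid L (hdom L J)) [hmap F (s J)] [J] (vid L (hcod L J)) (\<theta>' J)"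
    and \<theta>_inv: "J \<in> Hor L \<Longrightarrow> ccomp L (\<theta>' J) [\<theta> J] = hidc L J \<and> ccomp L (\<theta> J) [\<theta>' J]
      = hidc L (hmap F (s J))"
begin

text \<open>Since F is the identity on the vertical part, its compatibility with the vertical
  structure becomes equality of the operations of K and L on the carriers.\<close>

lemma struct_eq:
  "f \<in> Ver K \<Longrightarrow> vdom K f = vdom L f" "f \<in> Ver K \<Longrightarrow> vcod K f = vcod L f"
  "A \<in> Ob K \<Longrightarrow> vid K A = vid L A"
  "f \<in> Ver K \<Longrightarrow> g \<in> Ver K \<Longrightarrow> vcod L f = vdom L g \<Longrightarrow> vcomp K g f = vcomp L g f"
  "J \<in> Hor K \<Longrightarrow> hdom L (hmap F J) = hdom K J" "J \<in> Hor K \<Longrightarrow> hcod L (hmap F J) = hcod K J"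
proof -
  show 1: "vdom K f = vdom L f" "vcod K f = vcod L f" if "f \<in> Ver K" for f
    using that map_simps(1)[OF that] map_simps(2)[OF that] omap_id vmap_id src.vdom_in src.vcod_in
      by auto
  show "A \<in> Ob K \<Longrightarrow> vid K A = vid L A"
    using map_simps(3)[of A] omap_id vmap_id src.vid_in by simp
  show "f \<in> Ver K \<Longrightarrow> g \<in> Ver K \<Longrightarrow> vcod L f = vdom L g \<Longrightarrow> vcomp K g f = vcomp L g f"
    using map_simps(4)[of f g] vmap_id src.vcomp_in[of f g] 1 by simp
  show "J \<in> Hor K \<Longrightarrow> hdom L (hmap F J) = hdom K J" "J \<in> Hor K \<Longrightarrow> hcod L (hmap F J) = hcod K J"
    using omap_id src.hdom_in src.hcod_in by auto
qed

abbreviation "r J \<equiv> hmap F (s J)"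

lemma omap_ends: "J \<in> Hor L \<Longrightarrow> omap F (hdom L J) = hdom L J" "J \<in> Hor L \<Longrightarrow> omap F (hcod L J)
  = hcod L J"
  using omap_id tgt.hdom_in tgt.hcod_in Ob_eq by auto

lemma family: "X \<subseteq> Hor L \<Longrightarrow> tgt.horizontal_family (\<lambda>J. J) r \<theta> X"
  and family': "X \<subseteq> Hor L \<Longrightarrow> tgt.horizontal_family r (\<lambda>J. J) \<theta>' X"
  using \<theta> \<theta>' s by (auto simp: tgt.horizontal_family_def subset_iff omap_ends)

lemma hpath_s: "hpath L A Js B \<Longrightarrow> hpath K A (map s Js) B"
  using s by (induction Js arbitrary: A) (auto simp: Ob_eq)

section \<open>The inverse functor\<close>

definition th :: "'u \<Rightarrow> 'u list \<Rightarrow> 'u" where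
  "th A Ks = (case Ks of [] \<Rightarrow> vidc L (vid L A) | J # _ \<Rightarrow> \<theta> J)"

lemma is_cell_th:
  assumes "hpath L A Ks B" "length Ks \<le> 1"
  shows "is_cell L (vid L A) Ks (map r Ks) (vid L B) (th A Ks)"
  using assms \<theta> tgt.is_cell_vidc[of "vid L A"] by (cases Ks) (auto simp: th_def)

text \<open>The conjugate of \<chi> by the isomorphisms \<theta>, lifted along F. It is specified by
  the naturality square of \<theta> at \<chi>, so that functoriality amounts to the pasting of such
  squares.\<close>

definition \<gamma> :: "'u \<Rightarrow> 'u" where
  "\<gamma> \<chi> = (THE \<phi>. is_cell K (vsrc L \<chi>) (map s (hsrc L \<chi>)) (map s (htgt L \<chi>)) (vtgt L \<chi>) \<phi> \<and>
     ccomp L (cmap F \<phi>) (vidc L (vid L (vdom L (vsrc L \<chi>))) # map \<theta> (hsrc L \<chi>)) =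
     ccomp L (th (vcod L (vsrc L \<chi>)) (htgt L \<chi>)) [\<chi>])"

text \<open>Composition with the cells \<theta> along the source is inverted by composition with the
  cells \<theta>'. Hence the equation determines F \<phi>, and full faithfulness determines
  \<phi>.\<close>

lemma ex1_\<gamma>:
  assumes x: "is_cell L f Js Ks g \<chi>"
  shows "\<exists>!\<phi>. is_cell K f (map s Js) (map s Ks) g \<phi> \<and>
     ccomp L (cmap F \<phi>) (vidc L (vid L (vdom L f)) # map \<theta> Js) = ccomp L (th (vcod L f) Ks) [\<chi>]"
proof -
  note H = tgt.is_cell_hpath[OF x] and V = tgt.is_cell_Ver[OF x] and D = is_cellD[OF x]
  have HJ: "hpath L (vdom L f) Js (vdom L g)" and HK: "hpath L (vcod L f) Ks (vcod L g)" using H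
    by auto
  have l: "length Ks \<le> 1" using tgt.htgt_length D by blast
  let ?i = "vidc L (vid L (vdom L f))"
  have sub: "set Js \<subseteq> Hor L" using tgt.hpath_Hor[OF HJ] .
  note fam = family[OF sub] and fam' = family'[OF sub]
  have Hr: "hpath L (vdom L f) (map r Js) (vdom L g)"
    using tgt.horizontal_family_path(2)[OF fam] HJ by simp
  note T = is_cell_th[OF HK l]
  define Y where "Y = ccomp L (th (vcod L f) Ks) [\<chi>]"
  have Y: "is_cell L f Js (map r Ks) g Y"
    using tgt.is_cell_ccomp_1[OF T x] V HK tgt.hpath_ends[OF HK] by (simp add: Y_def)
  have x': "is_cell L f (map r Js) (map r Ks) g (ccomp L Y (?i # map \<theta>' Js))"
    using tgt.composable_vidc_family(2)[OF fam', of f "map r Ks" g Y] Y Hr by simp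
  have e1: "ccomp L (ccomp L Y (?i # map \<theta>' Js)) (?i # map \<theta> Js) = Y"
    using tgt.ccomp_family_inverse[OF fam fam', of f "map r Ks" g Y] \<theta>_inv sub Y by auto
  have e2: "ccomp L (ccomp L X (?i # map \<theta> Js)) (?i # map \<theta>' Js) = X"
    if "is_cell L f (map r Js) (map r Ks) g X" for X
    using tgt.ccomp_family_inverse[OF fam' fam, of f "map r Ks" g X] \<theta>_inv sub that by auto
  have "is_cell L f (map (hmap F) (map s Js)) (map (hmap F) (map s Ks)) g (ccomp L Y (?i # map \<theta>'
    Js))"
    using x' by (simp add: comp_def)
  from fully_faithful[OF this hpath_s[OF HJ] hpath_s[OF HK]] l
  have u: "\<exists>!\<phi>. is_cell K f (map s Js) (map s Ks) g \<phi> \<and> cmap F \<phi> = ccomp L Y (?i # map \<theta>' Js)"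
    by simp
  have "ccomp L (cmap F \<phi>) (?i # map \<theta> Js) = Y \<longleftrightarrow> cmap F \<phi> = ccomp L Y (?i # map \<theta>' Js)"
    if "is_cell K f (map s Js) (map s Ks) g \<phi>" for \<phi>
  proof -
    have "is_cell L f (map r Js) (map r Ks) g (cmap F \<phi>)"
      using is_cell_cmap[OF that] V vmap_id by (simp add: Ver_eq comp_def)
    from e2[OF this] show ?thesis using e1 by metis
  qed
  then show ?thesis unfolding Y_def[symmetric] using u by metis
qed

lemma \<gamma>:
  assumes x: "is_cell L f Js Ks g \<chi>"
  shows "is_cell K f (map s Js) (map s Ks) g (\<gamma> \<chi>)"
    "ccomp L (cmap F (\<gamma> \<chi>)) (vidc L (vid L (vdom L f)) # map \<theta> Js) = ccomp L (th (vcod L f) Ks) [\<chi>]"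
  using theI'[OF ex1_\<gamma>[OF x]] is_cellD[OF x] by (auto simp: \<gamma>_def)

lemma \<gamma>_eqI:
  assumes x: "is_cell L f Js Ks g \<chi>" and p: "is_cell K f (map s Js) (map s Ks) g \<phi>"
    "ccomp L (cmap F \<phi>) (vidc L (vid L (vdom L f)) # map \<theta> Js) = ccomp L (th (vcod L f) Ks) [\<chi>]"
  shows "\<gamma> \<chi> = \<phi>"
  using the1_equality[OF ex1_\<gamma>[OF x]] p is_cellD[OF x] by (auto simp: \<gamma>_def)

lemma F\<gamma>_cell: "is_cell L f Js Ks g \<chi> \<Longrightarrow> is_cell L f (map r Js) (map r Ks) g (cmap F (\<gamma> \<chi>))"
  using is_cell_cmap[OF \<gamma>(1)] tgt.is_cell_Ver vmap_id by (auto simp: Ver_eq comp_def)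

lemma cpath_\<gamma>:
  "cpath L f \<phi>s g \<Longrightarrow> cpath K f (map \<gamma> \<phi>s) g \<and>
     concat (map (hsrc K) (map \<gamma> \<phi>s)) = map s (concat (map (hsrc L) \<phi>s)) \<and>
     concat (map (htgt K) (map \<gamma> \<phi>s)) = map s (concat (map (htgt L) \<phi>s))"
proof (induction \<phi>s arbitrary: f)
  case (Cons \<phi> \<phi>s)
  have "is_cell L f (hsrc L \<phi>) (htgt L \<phi>) (vtgt L \<phi>) \<phi>" using Cons.prems by (simp add: is_cell_def)
  from \<gamma>(1)[OF this] show ?case using Cons.IH[of "vtgt L \<phi>"] Cons.prems by (simp add: is_cell_def)
qed (simp add: Ver_eq)

lemma segments_hsrc:
  "cpath L f \<phi>s g \<Longrightarrow>
     tgt.segments (\<lambda>J. J) (vdom L f) (map (\<lambda>\<phi>. (b \<phi>, vdom L (vsrc L \<phi>), hsrc L \<phi>)) \<phi>s) (vdom L g)"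
  by (induction \<phi>s arbitrary: f) (auto, blast intro: tgt.hsrc_path)

lemma segments_htgt:
  "cpath L f \<phi>s g \<Longrightarrow>
     tgt.segments (\<lambda>J. J) (vcod L f) (map (\<lambda>\<phi>. (b \<phi>, vcod L (vsrc L \<phi>), htgt L \<phi>)) \<phi>s) (vcod L g)"
  by (induction \<phi>s arbitrary: f) (auto, blast intro: tgt.htgt_path)

lemma segments_hpath:
  "tgt.segments a A ls B \<Longrightarrow> hpath L A (map a (concat (map (snd \<circ> snd) ls))) B"
  by (induction ls arbitrary: A) (auto simp: tgt.hpath_append)

text \<open>By uniqueness only the defining equation has to be verified for the composite of the
  images. The cells \<theta> along the sources of \<phi>s are moved past the images of \<phi>s,
  where they become cells along the targets, and then past the image of \<psi>.\<close>

lemma \<gamma>_ccomp: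
  assumes c: "composable L \<psi> \<phi>s"
  shows "\<gamma> (ccomp L \<psi> \<phi>s) = ccomp K (\<gamma> \<psi>) (map \<gamma> \<phi>s)"
proof -
  note D = c[unfolded composable_def]
  obtain f g where fg: "f = vsrc L (hd \<phi>s)" "g = vtgt L (last \<phi>s)" by blast
  have pth: "cpath L f \<phi>s g" and ne: "\<phi>s \<noteq> []" using D fg by auto
  define p Ms Ls q where "p = vsrc L \<psi>" "Ms = hsrc L \<psi>" "Ls = htgt L \<psi>" "q = vtgt L \<psi>"
  have ps: "is_cell L p Ms Ls q \<psi>" using D by (simp add: is_cell_def p_Ms_Ls_q_def)
  have Ms: "Ms = concat (map (htgt L) \<phi>s)" and pf: "vdom L p = vcod L f"
    using D fg by (auto simp: p_Ms_Ls_q_def)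
  let ?Js = "concat (map (hsrc L) \<phi>s)"
  have v: "f \<in> Ver L" "g \<in> Ver L" "p \<in> Ver L" "q \<in> Ver L"
    using tgt.cpath_ends[OF pth] tgt.is_cell_Ver[OF ps] by auto
  have mem: "is_cell L (vsrc L \<phi>) (hsrc L \<phi>) (htgt L \<phi>) (vtgt L \<phi>) \<phi>" if "\<phi> \<in> set \<phi>s" for \<phi>
    using composable_Cell[OF c that] by (rule is_cellI)
  have len: "length (htgt L \<phi>) \<le> 1" if "\<phi> \<in> set \<phi>s" for \<phi>
    using composable_Cell[OF c that] tgt.htgt_length by blast
  have comp: "is_cell L (vcomp L p f) ?Js Ls (vcomp L q g) (ccomp L \<psi> \<phi>s)"
    by (rule tgt.is_cell_ccomp[OF ps ne pth Ms pf])
  note C = cpath_\<gamma>[OF pth]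
  have ne': "map \<gamma> \<phi>s \<noteq> []" using ne by simp
  have cK: "composable K (\<gamma> \<psi>) (map \<gamma> \<phi>s)"
    by (rule src.composableI[OF _ ne' conjunct1[OF C]])
      (use C \<gamma>(1)[OF ps] Ms pf v struct_eq in \<open>auto simp: is_cell_def Ver_eq\<close>)
  \<comment> \<open>The list and the starting object of a horizontal path determine its end, so the
    source of \<psi> ends where the targets of \<phi>s end.\<close>
  have qg: "vdom L q = vcod L g"
  proof -
    have "hpath L (vdom L p) (map (\<lambda>J. J) (concat (map (snd \<circ> snd) (map (\<lambda>\<phi>. (True, vcod L (vsrc L
      \<phi>), htgt L \<phi>)) \<phi>s)))) (vcod L g)"
      unfolding pf by (rule segments_hpath[OF segments_htgt[OF pth]])
    then have h: "hpath L (vdom L p) Ms (vcod L g)" using Ms by (simp add: comp_def)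
    have "hpath L A Js B \<Longrightarrow> hpath L A Js B' \<Longrightarrow> B = B'" for A Js B B'
      by (induction Js arbitrary: A) auto
    then show ?thesis using h tgt.is_cell_hpath[OF ps] by blast
  qed
  have rc: "is_cell K (vcomp L p f) (map s ?Js) (map s Ls) (vcomp L q g) (ccomp K (\<gamma> \<psi>) (map \<gamma> \<phi>s))"
    using src.is_cell_ccomp[OF \<gamma>(1)[OF ps] ne' conjunct1[OF C]] C Ms pf v qg struct_eq by
      (simp add: Ver_eq)
  let ?X = "cmap F (\<gamma> \<psi>)" and ?G = "\<lambda>\<phi>. cmap F (\<gamma> \<phi>)"
  let ?e = "\<lambda>\<phi>. vidc L (vid L (vdom L (vsrc L \<phi>))) # map \<theta> (hsrc L \<phi>)"
  let ?t = "\<lambda>\<phi>. th (vcod L (vsrc L \<phi>)) (htgt L \<phi>)"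
  have X: "is_cell L p (map r Ms) (map r Ls) q ?X" by (rule F\<gamma>_cell[OF ps])
  have cX: "composable L ?X (map ?G \<phi>s)" using composable_cmap[OF cK] by (simp add: comp_def)
  have FY: "cmap F (ccomp K (\<gamma> \<psi>) (map \<gamma> \<phi>s)) = ccomp L ?X (map ?G \<phi>s)"
    using cmap_ccomp[OF cK] by (simp add: comp_def)
  have Y: "is_cell L (vcomp L p f) (map r ?Js) (map r Ls) (vcomp L q g) (ccomp L ?X (map ?G \<phi>s))"
    using is_cell_cmap[OF rc] FY v vmap_id pf qg by (simp add: Ver_eq[symmetric] comp_def)
  \<comment> \<open>The cells \<theta> are grouped according to \<phi>s. Along the sources every
    group starts with an identity, as in the equation for \<gamma>; along the targets only the empty
    groups do, as in \<open>th\<close>.\<close>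
  let ?ls = "map (\<lambda>\<phi>. (True, vdom L (vsrc L \<phi>), hsrc L \<phi>)) \<phi>s"
  let ?ls' = "map (\<lambda>\<phi>. (htgt L \<phi> = [], vcod L (vsrc L \<phi>), htgt L \<phi>)) \<phi>s"
  have sp: "tgt.spread \<theta> ?ls = concat (map ?e \<phi>s)" by (simp add: tgt.spread_def comp_def)
  have sp': "tgt.spread \<theta> ?ls' = map ?t \<phi>s"
  proof -
    have "(if htgt L \<phi> = [] then [vidc L (vid L (vcod L (vsrc L \<phi>)))] else []) @ map \<theta> (htgt L \<phi>)
      = [?t \<phi>]"
      if "\<phi> \<in> set \<phi>s" for \<phi> using len[OF that] by (cases "htgt L \<phi>") (auto simp: th_def)
    then show ?thesis by (induction \<phi>s) (auto simp: tgt.spread_def)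
  qed
  have hJ: "hpath L (vdom L f) (map (\<lambda>J. J) ?Js) (vdom L g)"
    using segments_hpath[OF segments_hsrc[OF pth]] by (simp add: comp_def)
  have hM: "hpath L (vcod L f) (map (\<lambda>J. J) Ms) (vcod L g)"
    using segments_hpath[OF segments_htgt[OF pth]] Ms by (simp add: comp_def)
  have fJ: "tgt.horizontal_family (\<lambda>J. J) r \<theta> (set ?Js)" using family[OF tgt.hpath_Hor[OF hJ]]
    by simp
  have fM: "tgt.horizontal_family (\<lambda>J. J) r \<theta> (set Ms)" using family[OF tgt.hpath_Hor[OF hM]]
    by simp
  have nsp: "concat (map ?e \<phi>s) \<noteq> []" "map ?t \<phi>s \<noteq> []" using ne by (cases \<phi>s, auto)+
  have cs: "ccomp L (ccomp L ?X (map ?G \<phi>s)) (concat (map ?e \<phi>s)) =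
      ccomp L (ccomp L ?X (map ?G \<phi>s)) (vidc L (vid L (vdom L (vcomp L p f))) # map \<theta> ?Js)"
    "composable L (ccomp L ?X (map ?G \<phi>s)) (concat (map ?e \<phi>s))"
    using tgt.ccomp_spread[OF _ fJ, of "vcomp L p f" ?ls "vcomp L q g" "map r Ls"
      "ccomp L ?X (map ?G \<phi>s)"]
      segments_hsrc[OF pth] hJ Y nsp v pf qg unfolding sp by (auto simp: comp_def)
  have cs': "ccomp L ?X (map ?t \<phi>s) = ccomp L ?X (vidc L (vid L (vdom L p)) # map \<theta> Ms)"
    "composable L ?X (map ?t \<phi>s)"
    using tgt.ccomp_spread[OF _ fM, of p ?ls' q
      "map r Ls" ?X] segments_htgt[OF pth] hM X nsp pf qg Ms
    unfolding sp' by (auto simp: comp_def)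
  have l1: "list_all2 (composable L) (map ?G \<phi>s) (map ?e \<phi>s)"
  proof -
    have "composable L (?G \<phi>) (?e \<phi>)" if "\<phi> \<in> set \<phi>s" for \<phi>
    proof -
      have h: "hpath L (vdom L (vsrc L \<phi>)) (map (\<lambda>J. J) (hsrc L \<phi>)) (vdom L (vtgt L \<phi>))"
        using tgt.is_cell_hpath[OF mem[OF that]] by simp
      show ?thesis
        using tgt.composable_vidc_family(1)[OF family F\<gamma>_cell[OF mem[OF that]] h] tgt.hpath_Hor[OF
          h] by simp
    qed
    then show ?thesis by (simp add: list_all2_map1 list_all2_map2 list_all2_same)
  qed
  have m1: "map2 (ccomp L) (map ?G \<phi>s) (map ?e \<phi>s) = map2 (\<lambda>\<psi> \<phi>. ccomp L \<psi> [\<phi>]) (map ?t \<phi>s) \<phi>s"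
  proof -
    have "map2 (ccomp L) (map ?G \<phi>s) (map ?e \<phi>s) = map (\<lambda>\<phi>. ccomp L (?t \<phi>) [\<phi>]) \<phi>s"
      using \<gamma>(2)[OF mem] by (simp add: map2_map_map)
    also have "\<dots> = map2 (\<lambda>\<psi> \<phi>. ccomp L \<psi> [\<phi>]) (map ?t \<phi>s) \<phi>s"
      by (induction \<phi>s) auto
    finally show ?thesis .
  qed
  have tc: "is_cell L (vid L (vcod L (vsrc L \<phi>))) (htgt L \<phi>) (map r (htgt L \<phi>)) (vid L (vcod L (vtgt
    L \<phi>))) (?t \<phi>)"
    if "\<phi> \<in> set \<phi>s" for \<phi>
    using is_cell_th[OF _ len[OF that]] tgt.is_cell_hpath[OF mem[OF that]] by blast
  have l2: "list_all2 (\<lambda>\<psi> \<phi>. composable L \<psi> [\<phi>]) (map ?t \<phi>s) \<phi>s"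
  proof -
    have "composable L (?t \<phi>) [\<phi>]" if "\<phi> \<in> set \<phi>s" for \<phi>
      using tgt.composable_1[OF tc[OF that] mem[OF that]] tgt.is_cell_Ver[OF mem[OF that]] by simp
    then show ?thesis by (simp add: list_all2_map1 list_all2_same)
  qed
  have c1: "composable L ?X (map2 (ccomp L) (map ?G \<phi>s) (map ?e \<phi>s))"
  proof -
    have "cpath L f (map (\<lambda>\<phi>. ccomp L (?t \<phi>) [\<phi>]) \<phi>s) g \<and>
        concat (map (htgt L) (map (\<lambda>\<phi>. ccomp L (?t \<phi>) [\<phi>]) \<phi>s)) = map r (concat (map (htgt L) \<phi>s))"
      using pth mem tc
    proof (induction \<phi>s arbitrary: f)
      case (Cons \<phi> \<phi>s)
      have m: "is_cell L (vsrc L \<phi>) (hsrc L \<phi>) (htgt L \<phi>) (vtgt L \<phi>) \<phi>" using Cons.prems(2) by simp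
      note t = tgt.is_cell_ccomp_1[OF Cons.prems(3)[of \<phi>] m]
      show ?case using Cons.IH[of "vtgt L \<phi>"] Cons.prems t tgt.is_cell_Ver[OF m] by
        (auto simp: is_cell_def)
    qed simp
    note P = this
    have "composable L ?X (map (\<lambda>\<phi>. ccomp L (?t \<phi>) [\<phi>]) \<phi>s)"
      by (rule tgt.composableI[OF _ _ conjunct1[OF P]]) (use P X Ms pf ne
        in \<open>auto simp: is_cell_def\<close>)
    moreover have "map (\<lambda>\<phi>. ccomp L (?t \<phi>) [\<phi>]) \<phi>s = map2 (\<lambda>\<psi> \<phi>. ccomp L \<psi> [\<phi>]) (map ?t \<phi>s) \<phi>s"
      by (induction \<phi>s) auto
    ultimately show ?thesis unfolding m1 by simp
  qed
  have hl: "vsrc L (hd \<phi>s) = f" using fg by simp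
  have HL: "hpath L (vcod L p) Ls (vcod L q)" "length Ls \<le> 1"
    using tgt.is_cell_hpath[OF ps] tgt.htgt_length is_cellD[OF ps] by auto
  have "ccomp L (cmap F (ccomp K (\<gamma> \<psi>) (map \<gamma> \<phi>s))) (vidc L (vid L (vdom L (vcomp L p f))) # map \<theta>
    ?Js) =
      ccomp L (ccomp L ?X (map ?G \<phi>s)) (concat (map ?e \<phi>s))"
    unfolding FY using cs(1) by simp
  also have "\<dots> = ccomp L ?X (map2 (ccomp L) (map ?G \<phi>s) (map ?e \<phi>s))"
    by (rule tgt.ccomp_assoc[OF l1 c1 cX cs(2), symmetric])
  also have "\<dots> = ccomp L (ccomp L ?X (map ?t \<phi>s)) \<phi>s"
    unfolding m1 by (rule tgt.ccomp_assoc_singles(1)[OF l2 cs'(2) pth])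
  also have "ccomp L ?X (map ?t \<phi>s) = ccomp L (th (vcod L p) Ls) [\<psi>]"
    using cs'(1) \<gamma>(2)[OF ps] by simp
  also have "ccomp L (ccomp L (th (vcod L p) Ls) [\<psi>]) \<phi>s
    = ccomp L (th (vcod L p) Ls) [ccomp L \<psi> \<phi>s]"
    by (rule tgt.ccomp_assoc_1[OF tgt.composable_1[OF is_cell_th[OF HL] ps] c, symmetric]) (use v
      in simp)
  finally show ?thesis
    using v pf by (intro \<gamma>_eqI[OF comp rc]) simp
qed

definition inverse :: "'u avfun" where
  "inverse = \<lparr>fdom = L, fcod = K, omap = (\<lambda>A\<in>Ob L. A), vmap = (\<lambda>f\<in>Ver L. f),
     hmap = (\<lambda>J\<in>Hor L. s J), cmap = (\<lambda>\<chi>\<in>Cell L. \<gamma> \<chi>)\<rparr>"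

lemma map_restrict: "hpath L A Js B \<Longrightarrow> map (\<lambda>J\<in>Hor L. s J) Js = map s Js"
  using tgt.hpath_Hor by (fastforce)

lemma is_fun_inverse: "is_fun L K inverse"
proof -
  have "avdc_functor inverse"
  proof (rule avdc_functor.intro)
    fix \<phi> assume p: "\<phi> \<in> Cell (fdom inverse)"
    then have p: "\<phi> \<in> Cell L" by (simp add: inverse_def)
    note c = \<gamma>(1)[OF is_cellI[OF p]]
    show "hsrc (fcod inverse) (cmap inverse \<phi>) = map (hmap inverse) (hsrc (fdom inverse) \<phi>)"
      "htgt (fcod inverse) (cmap inverse \<phi>) = map (hmap inverse) (htgt (fdom inverse) \<phi>)"
      "vsrc (fcod inverse) (cmap inverse \<phi>) = vmap inverse (vsrc (fdom inverse) \<phi>)"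
      "vtgt (fcod inverse) (cmap inverse \<phi>) = vmap inverse (vtgt (fdom inverse) \<phi>)"
      using c p map_restrict[OF tgt.hsrc_path[OF p]] map_restrict[OF tgt.htgt_path[OF p]]
      by (auto simp: inverse_def is_cell_def tgt.vsrc_in tgt.vtgt_in)
  next
    fix \<psi> \<phi>s assume "composable (fdom inverse) \<psi> \<phi>s"
    then have c: "composable L \<psi> \<phi>s" by (simp add: inverse_def)
    have e: "map (\<lambda>\<chi>\<in>Cell L. \<gamma> \<chi>) \<phi>s = map \<gamma> \<phi>s" using composable_Cell[OF c] by auto
    show "cmap inverse (ccomp (fdom inverse) \<psi> \<phi>s)
      = ccomp (fcod inverse) (cmap inverse \<psi>) (map (cmap inverse) \<phi>s)"
      using \<gamma>_ccomp[OF c] tgt.ccomp_in[OF c] c by (simp add: inverse_def composable_def e)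
  next
    fix J assume "J \<in> Hor (fdom inverse)"
    then have J: "J \<in> Hor L" by (simp add: inverse_def)
    note sJ = s[OF J] and t = \<theta>[OF J]
    have ends: "hdom L J \<in> Ob K" "hcod L J \<in> Ob K" using J tgt.hdom_in tgt.hcod_in by
      (auto simp: Ob_eq)
    have h: "is_cell K (vid L (hdom L J)) (map s [J]) (map s [J]) (vid L (hcod L J)) (hidc K (s J))"
      using src.is_cell_hidc[of "s J"] sJ struct_eq ends by simp
    have i: "is_cell L (vid L (hdom L J)) [r J] [r J] (vid L (hcod L J)) (hidc L (r J))"
      using tgt.is_cell_hidc[of "r J"] sJ omap_ends[OF J] by simp
    have "composable L (hidc L (r J)) [\<theta> J]" using tgt.composable_1[OF i t] J ends by
      (simp add: Ob_eq)
    from tgt.ccomp_vidc_Cons[OF this] have "ccomp L (hidc L (r J)) [vidc L (vid L (hdom L J)), \<theta> J]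
      = \<theta> J"
      using tgt.hidc_is_cell_ccomp[OF t] is_cellD[OF t] by simp
    then have "\<gamma> (hidc L J) = hidc K (s J)"
      using tgt.is_cell_ccomp_hidc[OF t] sJ ends
      by (intro \<gamma>_eqI[OF tgt.is_cell_hidc[OF J] h]) (simp add: th_def Ob_eq)
    then show "cmap inverse (hidc (fdom inverse) J) = hidc (fcod inverse) (hmap inverse J)"
      using J tgt.hidc_in[OF J] by (simp add: inverse_def)
  next
    fix f assume "f \<in> Ver (fdom inverse)"
    then have f: "f \<in> Ver L" "f \<in> Ver K" by (auto simp: inverse_def Ver_eq)
    have "\<gamma> (vidc L f) = vidc K f"
      by (rule \<gamma>_eqI[OF tgt.is_cell_vidc[OF f(1)]])
        (use src.is_cell_vidc[OF f(2)] f vmap_id tgt.vidc_vidc[of f "vid L (vcod L f)"]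
           tgt.vidc_vidc[of "vid L (vdom L f)" f] in \<open>auto simp: th_def\<close>)
    then show "cmap inverse (vidc (fdom inverse) f) = vidc (fcod inverse) (vmap inverse f)"
      using f tgt.vidc_in[OF f(1)] by (simp add: inverse_def)
  qed (use src.aug_virt_dbl_cat_axioms tgt.aug_virt_dbl_cat_axioms s struct_eq \<gamma>(1)[OF is_cellI] in
      \<open>auto simp: inverse_def Ob_eq[symmetric] Ver_eq[symmetric] is_cell_def tgt.hdom_in
        tgt.hcod_in\<close>)
  then show ?thesis by (simp add: is_fun_def inverse_def)
qed

section \<open>Unit and counit of the equivalence\<close>

lemma inverse_simps [simp]:
  "A \<in> Ob L \<Longrightarrow> omap inverse A = A" "f \<in> Ver L \<Longrightarrow> vmap inverse f = f"
  "J \<in> Hor L \<Longrightarrow> hmap inverse J = s J" "\<chi> \<in> Cell L \<Longrightarrow> cmap inverse \<chi> = \<gamma> \<chi>"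
  "fdom inverse = L" "fcod inverse = K"
  by (simp_all add: inverse_def)

text \<open>The components \<theta> point from J to F (s J), hence from the identity to the
  composite functor. The counit itself is obtained by inverting this transformation.\<close>

definition counit_inverse :: "'u avtrans" where
  "counit_inverse = \<lparr>tsrc = avfun_id L, ttgt = avfun_comp F inverse,
     tob = (\<lambda>A\<in>Ob L. vid L A), thor = (\<lambda>J\<in>Hor L. \<theta> J)\<rparr>"

lemma \<gamma>_natural:
  assumes p: "is_cell L f Js Ks g \<chi>"
  shows "ccomp L (cmap F (\<gamma> \<chi>)) (if Js = [] then [vidc L (vid L (vdom L f))] else map \<theta> Js) =
    ccomp L (th (vcod L f) Ks) [\<chi>]"
proof -
  have h: "hpath L (vdom L f) (map (\<lambda>J. J) Js) (vdom L g)" using tgt.is_cell_hpath[OF p] by simp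
  have fam: "tgt.horizontal_family (\<lambda>J. J) r \<theta> (set Js)" using family tgt.hpath_Hor[OF h] by simp
  show ?thesis using tgt.ccomp_family_path(1)[OF fam h F\<gamma>_cell[OF p]] \<gamma>(2)[OF p] by simp
qed

lemma is_trans_counit_inverse: "is_trans L L (avfun_id L) (avfun_comp F inverse) counit_inverse"
proof (rule is_transI[OF is_fun_id[OF tgt.aug_virt_dbl_cat_axioms] is_fun_comp[OF is_fun_inverse
  F]])
  fix J assume "J \<in> Hor L"
  then show "is_cell L (tob counit_inverse (hdom L J)) [hmap (avfun_id L) J] [hmap (avfun_comp F
    inverse) J]
     (tob counit_inverse (hcod L J)) (thor counit_inverse J)"
    using \<theta> by (simp add: counit_inverse_def tgt.hdom_in tgt.hcod_in)
next
  fix f Js Ks g \<chi> assume p: "is_cell L f Js Ks g \<chi>"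
  note H = tgt.is_cell_hpath[OF p] and V = tgt.is_cell_Ver[OF p] and D = is_cellD[OF p]
  have l: "length Ks \<le> 1" using tgt.htgt_length D by blast
  have "map (\<lambda>J\<in>Hor L. \<theta> J) Js = map \<theta> Js" using H tgt.hpath_Hor[of "vdom L f" Js "vdom L g"]
    by auto
  then have tJ: "tpath counit_inverse (vdom L f) Js = (if Js
    = [] then [vidc L (vid L (vdom L f))] else map \<theta> Js)"
    using V by (simp add: tpath_def counit_inverse_def)
  have tK: "hd (tpath counit_inverse (vcod L f) Ks) = th (vcod L f) Ks"
    using H V l by (cases Ks) (auto simp: tpath_def counit_inverse_def th_def)
  show "ccomp L (cmap (avfun_comp F inverse) \<chi>) (tpath counit_inverse (vdom L f) Js) =
      ccomp L (hd (tpath counit_inverse (vcod L f) Ks)) [cmap (avfun_id L) \<chi>]"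
    unfolding tJ tK using \<gamma>_natural[OF p] D by simp
qed (use omap_id vmap_id in \<open>auto simp: counit_inverse_def Ob_eq[symmetric] Ver_eq[symmetric]\<close>)

text \<open>J and s (F J) have F-images related by \<theta>. Full faithfulness lifts this
  isomorphism to K, and \<open>unit_cell'\<close> is the lift of its inverse.\<close>

definition unit_cell :: "'u \<Rightarrow> 'u" where
  "unit_cell J = (THE \<phi>. is_cell K (vid L (hdom K J)) [J] [s (hmap F J)] (vid L (hcod K J)) \<phi>
    \<and> cmap F \<phi> = \<theta> (hmap F J))"

definition unit_cell' :: "'u \<Rightarrow> 'u" where
  "unit_cell' J = (THE \<phi>. is_cell K (vid L (hdom K J)) [s (hmap F J)] [J] (vid L (hcod K J)) \<phi>
    \<and> cmap F \<phi> = \<theta>' (hmap F J))"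

lemma unit_cell:
  assumes J: "J \<in> Hor K"
  shows "is_cell K (vid K (hdom K J)) [J] [s (hmap F J)] (vid K (hcod K J)) (unit_cell J)"
    "cmap F (unit_cell J) = \<theta> (hmap F J)"
    "is_cell K (vid K (hdom K J)) [s (hmap F J)] [J] (vid K (hcod K J)) (unit_cell' J)"
    "cmap F (unit_cell' J) = \<theta>' (hmap F J)"
proof -
  have FJ: "hmap F J \<in> Hor L" using J by simp
  note t = \<theta>[OF FJ] \<theta>'[OF FJ] and sJ = s[OF FJ]
  have e: "hdom K J \<in> Ob K" "hcod K J \<in> Ob K" using J src.hdom_in src.hcod_in by auto
  have h1: "hpath K (hdom K J) [J] (hcod K J)" using J e by simp
  have h2: "hpath K (hdom K J) [s (hmap F J)] (hcod K J)" using J e sJ struct_eq by simp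
  have c1: "is_cell L (vid L (hdom K J)) (map (hmap F) [J]) (map (hmap F) [s (hmap F J)]) (vid L
    (hcod K J)) (\<theta> (hmap F J))"
    using t struct_eq J by simp
  have c2: "is_cell L (vid L (hdom K J)) (map (hmap F) [s (hmap F J)]) (map (hmap F) [J]) (vid L
    (hcod K J)) (\<theta>' (hmap F J))"
    using t struct_eq J by simp
  have "\<exists>!\<phi>. is_cell K (vid L (hdom K J)) [J] [s (hmap F J)] (vid L (hcod K J)) \<phi> \<and> cmap F \<phi>
    = \<theta> (hmap F J)"
    by (rule fully_faithful[OF c1]) (use h1 h2 e Ob_eq in auto)
  from theI'[OF this] show "is_cell K (vid K (hdom K J)) [J] [s (hmap F J)] (vid K (hcod K J))
    (unit_cell J)"
    "cmap F (unit_cell J) = \<theta> (hmap F J)" using e struct_eq by (auto simp: unit_cell_def)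
  have "\<exists>!\<phi>. is_cell K (vid L (hdom K J)) [s (hmap F J)] [J] (vid L (hcod K J)) \<phi> \<and> cmap F \<phi>
    = \<theta>' (hmap F J)"
    by (rule fully_faithful[OF c2]) (use h1 h2 e Ob_eq in auto)
  from theI'[OF this] show "is_cell K (vid K (hdom K J)) [s (hmap F J)] [J] (vid K (hcod K J))
    (unit_cell' J)"
    "cmap F (unit_cell' J) = \<theta>' (hmap F J)" using e struct_eq by (auto simp: unit_cell'_def)
qed

lemma faithful:
  assumes p: "is_cell K f Js Ks g \<phi>" "is_cell K f Js Ks g \<phi>'" and e: "cmap F \<phi> = cmap F \<phi>'"
  shows "\<phi> = \<phi>'"
proof -
  have v: "f \<in> Ver K" "g \<in> Ver K" using src.is_cell_Ver[OF p(1)] by auto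
  have "is_cell L f (map (hmap F) Js) (map (hmap F) Ks) g (cmap F \<phi>)"
    using is_cell_cmap[OF p(1)] v vmap_id by simp
  from fully_faithful[OF this] src.is_cell_hpath[OF p(1)] v struct_eq src.htgt_length is_cellD[OF
    p(1)]
  show ?thesis using p e by metis
qed

definition unit :: "'u avtrans" where
  "unit = \<lparr>tsrc = avfun_id K, ttgt = avfun_comp inverse F,
     tob = (\<lambda>A\<in>Ob K. vid K A), thor = (\<lambda>J\<in>Hor K. unit_cell J)\<rparr>"

text \<open>F is faithful on cells with a fixed boundary, so naturality may be tested after applying
  F; there it is the square \<open>\<gamma>_natural\<close>.\<close>

lemma is_trans_unit: "is_trans K K (avfun_id K) (avfun_comp inverse F) unit"
proof (rule is_transI[OF is_fun_id[OF src.aug_virt_dbl_cat_axioms] is_fun_comp[OF F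
  is_fun_inverse]])
  fix J assume "J \<in> Hor K"
  then show "is_cell K (tob unit (hdom K J)) [hmap (avfun_id K) J] [hmap (avfun_comp inverse F) J]
     (tob unit (hcod K J)) (thor unit J)"
    using unit_cell by (simp add: unit_def src.hdom_in src.hcod_in)
next
  fix f Js Ks g \<phi> assume p: "is_cell K f Js Ks g \<phi>"
  note H = src.is_cell_hpath[OF p] and V = src.is_cell_Ver[OF p] and D = is_cellD[OF p]
  have HJ: "hpath K (vdom K f) Js (vdom K g)" and HK: "hpath K (vcod K f) Ks (vcod K g)" using H
    by auto
  have l: "length Ks \<le> 1" using src.htgt_length D by blast
  have sJ: "set Js \<subseteq> Hor K" using src.hpath_Hor[OF HJ] .
  have Fp: "is_cell L f (map (hmap F) Js) (map (hmap F) Ks) g (cmap F \<phi>)"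
    using is_cell_cmap[OF p] V vmap_id by simp
  note gp = \<gamma>(1)[OF Fp]
  let ?tJ = "if Js = [] then [vidc K (vid K (vdom K f))] else map unit_cell Js"
  let ?tK = "case Ks of [] \<Rightarrow> vidc K (vid K (vcod K f)) | J # _ \<Rightarrow> unit_cell J"
  have "map (\<lambda>J\<in>Hor K. unit_cell J) Js = map unit_cell Js" using sJ by auto
  then have tJ: "tpath unit (vdom K f) Js = ?tJ"
    using V by (simp add: tpath_def unit_def)
  have tK: "hd (tpath unit (vcod K f) Ks) = ?tK"
    using HK V l by (cases Ks) (auto simp: tpath_def unit_def)
  have fam: "src.horizontal_family (\<lambda>J. J) (\<lambda>J. s (hmap F J)) unit_cell (set Js)"
    using unit_cell sJ by (auto simp: src.horizontal_family_def)
  have gp': "is_cell K f (map (\<lambda>J. s (hmap F J)) Js) (map (\<lambda>J. s (hmap F J)) Ks) g (\<gamma> (cmap F \<phi>))"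
    using gp by (simp add: comp_def)
  have HJ': "hpath K (vdom K f) (map (\<lambda>J. J) Js) (vdom K g)" using HJ by simp
  note fp = src.ccomp_family_path[OF fam HJ' gp']
  have c1: "is_cell K f Js (map (\<lambda>J. s (hmap F J)) Ks) g (ccomp K (\<gamma> (cmap F \<phi>)) ?tJ)"
    unfolding fp(1) using src.composable_vidc_family(2)[OF fam gp' HJ'] by simp
  have tKc: "is_cell K (vid K (vcod K f)) Ks (map (\<lambda>J. s (hmap F J)) Ks) (vid K (vcod K g)) ?tK"
    using HK l unit_cell(1)[of "hd Ks"] src.is_cell_vidc[of "vid K (vcod K f)"] V by (cases Ks) auto
  have cm: "composable K ?tK [\<phi>]" using src.composable_1[OF tKc p] V by simp
  have c2: "is_cell K f Js (map (\<lambda>J. s (hmap F J)) Ks) g (ccomp K ?tK [\<phi>])"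
    using src.is_cell_ccomp_1[OF tKc p] V by simp
  have a: "vdom L f \<in> Ob K" "vcod L f \<in> Ob K"
    using V tgt.vdom_in[of f] tgt.vcod_in[of f] by (auto simp: Ob_eq Ver_eq)
  have i: "cmap F (vidc K (vid K A)) = vidc L (vid L A)" if "A \<in> Ob K" for A
    using that omap_id by simp
  have m1: "map (cmap F) ?tJ = (if map (hmap F) Js
    = [] then [vidc L (vid L (vdom L f))] else map \<theta> (map (hmap F) Js))"
    using V sJ unit_cell(2) struct_eq(1) i[OF a(1)] by auto
  have m2: "cmap F ?tK = th (vcod L f) (map (hmap F) Ks)"
    using V l HK unit_cell(2) struct_eq(2) i[OF a(2)] by (cases Ks) (auto simp: th_def)
  have "cmap F (ccomp K (\<gamma> (cmap F \<phi>)) ?tJ) = cmap F (ccomp K ?tK [\<phi>])"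
    using cmap_ccomp[OF fp(2)] cmap_ccomp[OF cm] m1 m2 \<gamma>_natural[OF Fp] by simp
  from faithful[OF c1 c2 this]
  show "ccomp K (cmap (avfun_comp inverse F) \<phi>) (tpath unit (vdom K f) Js) =
      ccomp K (hd (tpath unit (vcod K f) Ks)) [cmap (avfun_id K) \<phi>]"
    unfolding tJ tK using D by simp
qed (use omap_id vmap_id Ob_eq Ver_eq in \<open>auto simp: unit_def\<close>)

lemma equivalence: "equivalence_in AugVirtDblCat K L F"
proof -
  have 1: "invertible_two AugVirtDblCat (avfun_id K) (avfun_comp inverse F) unit"
  proof (rule invertible_if_horizontal[OF is_trans_unit, where v = unit_cell'])
    fix J assume J: "J \<in> Hor K"
    note u = unit_cell[OF J]
    have e: "hdom K J \<in> Ob K" "hcod K J \<in> Ob K" using J src.hdom_in src.hcod_in by auto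
    have FJ: "hmap F J \<in> Hor L" using J by simp
    note sJ = s[OF FJ]
    have c: "composable K (unit_cell' J) [unit_cell J]" "composable K (unit_cell J) [unit_cell' J]"
      using src.composable_1[OF u(3) u(1)] src.composable_1[OF u(1) u(3)] e by auto
    have i1: "is_cell K (vid K (hdom K J)) [J] [J] (vid K (hcod K J)) (ccomp K (unit_cell' J)
      [unit_cell J])"
      using src.is_cell_ccomp_1[OF u(3) u(1)] e by simp
    have i2: "is_cell K (vid K (hdom K J)) [s (hmap F J)] [s (hmap F J)] (vid K (hcod K J)) (ccomp K
      (unit_cell J) [unit_cell' J])"
      using src.is_cell_ccomp_1[OF u(1) u(3)] e by simp
    have "ccomp K (unit_cell' J) [unit_cell J] = hidc K J"
      by (rule faithful[OF i1 src.is_cell_hidc[OF J]])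
        (use cmap_ccomp[OF c(1)] u \<theta>_inv[OF FJ] J in simp)
    moreover have "ccomp K (unit_cell J) [unit_cell' J] = hidc K (s (hmap F J))"
      by (rule faithful[OF i2])
        (use cmap_ccomp[OF c(2)] u \<theta>_inv[OF FJ] J sJ src.is_cell_hidc[of "s (hmap F J)"] struct_eq
          in simp_all)
    ultimately show "is_cell K (vid K (omap (avfun_id K) (hdom K J))) [hmap (avfun_comp inverse F)
      J]
        [hmap (avfun_id K) J] (vid K (omap (avfun_id K) (hcod K J))) (unit_cell' J) \<and>
       ccomp K (unit_cell' J) [thor unit J] = hidc K (hmap (avfun_id K) J) \<and>
       ccomp K (thor unit J) [unit_cell' J] = hidc K (hmap (avfun_comp inverse F) J)"
      using u J e by (simp add: unit_def)
  qed (simp add: unit_def)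
  have 2: "invertible_two AugVirtDblCat (avfun_id L) (avfun_comp F inverse) counit_inverse"
    by (rule invertible_if_horizontal[OF is_trans_counit_inverse, where v = \<theta>'])
      (use \<theta>' \<theta>_inv in \<open>auto simp: counit_inverse_def tgt.hdom_in tgt.hcod_in\<close>)
  \<comment> \<open>Invertibility is symmetric, so the counit gets the direction that the definition
    of an equivalence asks for.\<close>
  from 2 obtain \<beta> where "invertible_two AugVirtDblCat (avfun_comp F inverse) (avfun_id L) \<beta>"
    unfolding invertible_two_def by blast
  then show ?thesis
    unfolding equivalence_in_def mor_AVDC using F is_fun_inverse 1 by auto
qed

end


section \<open>The equivalence with representable horizontal morphisms\<close>

context aug_virt_dbl_cat
begin

text \<open>Each counit factors uniquely through the other. The two factorizations are mutually
  inverse because their composites, like the identities, are factorizations of a counit through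
  itself.\<close>

lemma companion_comparison:
  assumes p: "companion_pair K j J e \<eta>" and p': "companion_pair K j J' e' \<eta>'"
  shows "\<exists>\<phi> \<psi>. is_cell K (vid K (vdom K j)) [J] [J'] (vid K (vcod K j)) \<phi> \<and> ccomp K e' [\<phi>] = e \<and>
     is_cell K (vid K (vdom K j)) [J'] [J] (vid K (vcod K j)) \<psi> \<and> ccomp K e [\<psi>] = e' \<and>
     ccomp K \<psi> [\<phi>] = hidc K J \<and> ccomp K \<phi> [\<psi>] = hidc K J'"
proof -
  have e: "is_cell K j [J] [] (vid K (vcod K j)) e" and e':
    "is_cell K j [J'] [] (vid K (vcod K j)) e'"
    using p p' by (auto simp: companion_pair_def)
  note E = companion_counit_ends[OF e] and E' = companion_counit_ends[OF e']
  have j: "vid K (vdom K j) \<in> Ver K" "vcod K (vid K (vdom K j)) = vdom K j" using E by auto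
  have ei: "is_cell K (vcomp K j (vid K (vdom K j))) [J] [] (vid K (vcod K j)) e"
    and ei': "is_cell K (vcomp K j (vid K (vdom K j))) [J'] [] (vid K (vcod K j)) e'"
    using e e' E by auto
  obtain \<phi> where f: "is_cell K (vid K (vdom K j)) [J] [J'] (vid K (vcod K j)) \<phi>" "ccomp K e' [\<phi>]
    = e"
    using companion_factor[OF p' ei j] by blast
  obtain \<psi> where g: "is_cell K (vid K (vdom K j)) [J'] [J] (vid K (vcod K j)) \<psi>" "ccomp K e [\<psi>]
    = e'"
    using companion_factor[OF p ei' j] by blast
  have gf: "is_cell K (vid K (vdom K j)) [J] [J] (vid K (vcod K j)) (ccomp K \<psi> [\<phi>])"
    using is_cell_ccomp_1[OF g(1) f(1)] E by simp
  have fg: "is_cell K (vid K (vdom K j)) [J'] [J'] (vid K (vcod K j)) (ccomp K \<phi> [\<psi>])"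
    using is_cell_ccomp_1[OF f(1) g(1)] E by simp
  have "ccomp K e [ccomp K \<psi> [\<phi>]] = ccomp K (ccomp K e [\<psi>]) [\<phi>]"
    by (rule ccomp_assoc_11[OF e g(1) f(1)]) (use E in auto)
  then have 1: "ccomp K e [ccomp K \<psi> [\<phi>]] = e" using f g by simp
  have "ccomp K e' [ccomp K \<phi> [\<psi>]] = ccomp K (ccomp K e' [\<phi>]) [\<psi>]"
    by (rule ccomp_assoc_11[OF e' f(1) g(1)]) (use E in auto)
  then have 2: "ccomp K e' [ccomp K \<phi> [\<psi>]] = e'" using f g by simp
  have "ccomp K \<psi> [\<phi>] = hidc K J"
    using companion_factor[OF p ei j] gf 1 is_cell_hidc[OF E(2)] is_cell_ccomp_hidc[OF e] E by auto
  moreover have "ccomp K \<phi> [\<psi>] = hidc K J'"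
    using companion_factor[OF p' ei' j] fg 2 is_cell_hidc[OF E'(2)] is_cell_ccomp_hidc[OF e'] E'
      by auto
  ultimately show ?thesis using f g by blast
qed

lemma Rep_avdc: "aug_virt_dbl_cat (Rep K)"
  unfolding Rep_def by (rule full_sub_avdc)

end

lemma Rep_simps [simp]:
  "Ob (Rep K) = Ob K" "Ver (Rep K) = Ver K" "vdom (Rep K) = vdom K"
  "vcod (Rep K) = vcod K" "vid (Rep K) = vid K" "vcomp (Rep K) = vcomp K"
  "Hor (Rep K) = {J \<in> Hor K. representable K J}"
  "hdom (Rep K) = hdom K" "hcod (Rep K) = hcod K"
  "hsrc (Rep K) = hsrc K" "htgt (Rep K) = htgt K" "vsrc (Rep K) = vsrc K" "vtgt (Rep K) = vtgt K"
  "ccomp (Rep K) = ccomp K" "hidc (Rep K) = hidc K" "vidc (Rep K) = vidc K"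
  by (simp_all add: Rep_def)

lemma is_cell_Rep:
  "is_cell (Rep K) f Js Ks g \<phi> \<longleftrightarrow> is_cell K f Js Ks g \<phi> \<and>
     (\<forall>J\<in>set Js. representable K J) \<and> (\<forall>J\<in>set Ks. representable K J)"
  by (auto simp: is_cell_def Rep_def)

lemma companion_cell_cases:
  assumes "aug_virt_dbl_cat K" "companion_cell K j e" "hsrc K e = [J]"
  obtains \<eta> where "companion_pair K j J e \<eta>"
  using aug_virt_dbl_cat.companion_cell_pair[OF assms(1,2)] assms(3) by auto

context quintet_companions
begin

lemma chosen_representable: "has_companion K j \<Longrightarrow> representable K (ch j)"
  unfolding representable_def
  using counit_cell(1)[of j] choice by (auto simp: is_cell_def companion_choice_def)

lemma is_cell_star_Rep:
  assumes "is_cell QK f js ks g \<phi>"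
  shows "is_cell (Rep K) f (map ch js) (map ch ks) g (star \<phi>)"
  using star_cell(1)[OF assms] QV_cell(6,7)[OF assms] chosen_representable by
    (auto simp: is_cell_Rep)

lemma lower_star_simps [simp]:
  "fdom (lower_star K \<epsilon>) = QK" "fcod (lower_star K \<epsilon>) = Rep K"
  "A \<in> Ob K \<Longrightarrow> omap (lower_star K \<epsilon>) A = A" "f \<in> Ver K \<Longrightarrow> vmap (lower_star K \<epsilon>) f = f"
  "has_companion K j \<Longrightarrow> hmap (lower_star K \<epsilon>) j = ch j"
  "\<phi> \<in> Cell QK \<Longrightarrow> cmap (lower_star K \<epsilon>) \<phi> = star \<phi>"
  using counit_cell(2)[of j] by (auto simp: lower_star_def star_def)

lemma is_fun_lower_star: "is_fun QK (Rep K) (lower_star K \<epsilon>)"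
proof -
  have "avdc_functor (lower_star K \<epsilon>)"
  proof (rule avdc_functor.intro)
    show "aug_virt_dbl_cat (fdom (lower_star K \<epsilon>))" "aug_virt_dbl_cat (fcod (lower_star K \<epsilon>))"
      using QV_lower_avdc Rep_avdc by auto
    show "omap (lower_star K \<epsilon>) \<in> Ob (fdom (lower_star K \<epsilon>)) \<rightarrow>\<^sub>E Ob (fcod (lower_star K \<epsilon>))"
      "vmap (lower_star K \<epsilon>) \<in> Ver (fdom (lower_star K \<epsilon>)) \<rightarrow>\<^sub>E Ver (fcod (lower_star K \<epsilon>))"
      by (auto simp: lower_star_def)
    show "hmap (lower_star K \<epsilon>) \<in> Hor (fdom (lower_star K \<epsilon>)) \<rightarrow>\<^sub>E Hor (fcod (lower_star K \<epsilon>))"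
      using counit_cell chosen_representable by (auto simp: lower_star_def)
    show "cmap (lower_star K \<epsilon>) \<in> Cell (fdom (lower_star K \<epsilon>)) \<rightarrow>\<^sub>E Cell (fcod (lower_star K \<epsilon>))"
      using is_cell_star_Rep[OF QV_cellI] by
        (auto simp: lower_star_def star_def[symmetric] is_cell_def)
  next
    fix \<phi> assume "\<phi> \<in> Cell (fdom (lower_star K \<epsilon>))"
    then have p: "\<phi> \<in> Cell QK" by simp
    note C = QV_cell[OF QV_cellI[OF p]] and S = star_Cell[OF p]
    show "hsrc (fcod (lower_star K \<epsilon>)) (cmap (lower_star K \<epsilon>) \<phi>)
      = map (hmap (lower_star K \<epsilon>)) (hsrc (fdom (lower_star K \<epsilon>)) \<phi>)"
      "htgt (fcod (lower_star K \<epsilon>)) (cmap (lower_star K \<epsilon>) \<phi>)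
        = map (hmap (lower_star K \<epsilon>)) (htgt (fdom (lower_star K \<epsilon>)) \<phi>)"
      "vsrc (fcod (lower_star K \<epsilon>)) (cmap (lower_star K \<epsilon>) \<phi>)
        = vmap (lower_star K \<epsilon>) (vsrc (fdom (lower_star K \<epsilon>)) \<phi>)"
      "vtgt (fcod (lower_star K \<epsilon>)) (cmap (lower_star K \<epsilon>) \<phi>)
        = vmap (lower_star K \<epsilon>) (vtgt (fdom (lower_star K \<epsilon>)) \<phi>)"
      using p C S by (auto simp: is_cell_def)
  next
    fix \<psi> \<phi>s assume "composable (fdom (lower_star K \<epsilon>)) \<psi> \<phi>s"
    then have c: "composable QK \<psi> \<phi>s" by simp
    have e: "map (cmap (lower_star K \<epsilon>)) \<phi>s = map star \<phi>s" using composable_Cell[OF c] by auto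
    show "cmap (lower_star K \<epsilon>) (ccomp (fdom (lower_star K \<epsilon>)) \<psi> \<phi>s) =
        ccomp (fcod (lower_star K \<epsilon>)) (cmap (lower_star K \<epsilon>) \<psi>) (map (cmap (lower_star K \<epsilon>)) \<phi>s)"
      unfolding e using star_ccomp[OF c] QV_ccomp_cell[OF c] c by
        (simp add: is_cell_def composable_def)
  next
    fix J assume "J \<in> Hor (fdom (lower_star K \<epsilon>))"
    then have J: "has_companion K J" by simp
    show "cmap (lower_star K \<epsilon>) (hidc (fdom (lower_star K \<epsilon>)) J)
      = hidc (fcod (lower_star K \<epsilon>)) (hmap (lower_star K \<epsilon>) J)"
      using star_hidc[OF J] J is_cellD(1)[OF is_cell_QV_hidc[OF J]] by simp
  next
    fix f assume "f \<in> Ver (fdom (lower_star K \<epsilon>))"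
    then have f: "f \<in> Ver K" by simp
    show "cmap (lower_star K \<epsilon>) (vidc (fdom (lower_star K \<epsilon>)) f)
      = vidc (fcod (lower_star K \<epsilon>)) (vmap (lower_star K \<epsilon>) f)"
      using star_vidc[OF f] f is_cellD(1)[OF is_cell_QV_vidc[OF f]] by simp
  qed (auto simp: counit_cell)
  then show ?thesis by (simp add: is_fun_def)
qed

text \<open>J need not determine a vertical morphism, so some j that has J as a companion is picked;
  J is then isomorphic to the companion chosen for j.\<close>

lemma ex_lower_star_section:
  assumes "J \<in> Hor (Rep K)"
  shows "\<exists>j \<theta> \<theta>'. has_companion K j \<and> vdom K j = hdom K J \<and> vcod K j = hcod K J \<and>
    is_cell (Rep K) (vid K (hdom K J)) [J] [ch j] (vid K (hcod K J)) \<theta> \<and>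
    is_cell (Rep K) (vid K (hdom K J)) [ch j] [J] (vid K (hcod K J)) \<theta>' \<and>
    ccomp K \<theta>' [\<theta>] = hidc K J \<and> ccomp K \<theta> [\<theta>'] = hidc K (ch j)"
proof -
  from assms obtain j e where je: "companion_cell K j e" "hsrc K e = [J]" by
    (auto simp: representable_def)
  have hj: "has_companion K j" using je(1) unfolding has_companion_def by blast
  obtain \<eta> where p: "companion_pair K j J e \<eta>"
    using companion_cell_cases[OF aug_virt_dbl_cat_axioms je] .
  obtain \<eta>' where p': "companion_pair K j (ch j) (\<epsilon> j) \<eta>'" using has_companion_pair[OF hj] by blast
  have e: "is_cell K j [J] [] (vid K (vcod K j)) e" using p by (simp add: companion_pair_def)
  note E = companion_counit_ends[OF e]
  show ?thesis
    using companion_comparison[OF p p'] E hj assms chosen_representable[OF hj]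
    by (auto simp: is_cell_Rep)
qed

lemma equivalence_lower_star: "equivalence_in AugVirtDblCat QK (Rep K) (lower_star K \<epsilon>)"
proof -
  obtain s \<theta> \<theta>' where S: "\<And>J. J \<in> Hor (Rep K) \<Longrightarrow> has_companion K (s J) \<and> vdom K (s J) = hdom K J
    \<and> vcod K (s J) = hcod K J \<and>
    is_cell (Rep K) (vid K (hdom K J)) [J] [ch (s J)] (vid K (hcod K J)) (\<theta> J) \<and>
    is_cell (Rep K) (vid K (hdom K J)) [ch (s J)] [J] (vid K (hcod K J)) (\<theta>' J) \<and>
    ccomp K (\<theta>' J) [\<theta> J] = hidc K J \<and> ccomp K (\<theta> J) [\<theta>' J] = hidc K (ch (s J))"
    using ex_lower_star_section by metis
  have sV: "J \<in> Hor (Rep K) \<Longrightarrow> s J \<in> Ver K" for J using S counit_cell(2) by blast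
  have "essentially_surjective QK (Rep K) (lower_star K \<epsilon>) s \<theta> \<theta>'"
  proof
    show "is_fun QK (Rep K) (lower_star K \<epsilon>)" by (rule is_fun_lower_star)
  next
    fix f js ks g \<chi>
    assume x: "is_cell (Rep K) f (map (hmap (lower_star K \<epsilon>)) js) (map (hmap (lower_star K \<epsilon>)) ks) g
      \<chi>"
      and hj: "hpath QK (vdom (Rep K) f) js (vdom (Rep K) g)"
      and hk: "hpath QK (vcod (Rep K) f) ks (vcod (Rep K) g)" and l: "length ks \<le> 1"
    have mj: "mp (vdom K f) js (vdom K g)" "\<forall>j\<in>set js. has_companion K j"
      and mk: "mp (vcod K f) ks (vcod K g)" "\<forall>j\<in>set ks. has_companion K j"
      using hj hk by (auto simp: hpath_QV)
    have e: "map (hmap (lower_star K \<epsilon>)) js = map ch js" "map (hmap (lower_star K \<epsilon>)) ks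
      = map ch ks"
      using mj mk by auto
    \<comment> \<open>Full faithfulness is the bijectivity of \<open>star\<close> for a fixed
      boundary.\<close>
    have x': "is_cell K f (map ch js) (map ch ks) g \<chi>" using x e by (simp add: is_cell_Rep)
    obtain \<phi> where p: "is_cell QK f js ks g \<phi>" "star \<phi> = \<chi>"
      using star_surj[OF x' mj(1) mk(1) mj(2) mk(2) l] by blast
    have u: "\<phi>' = \<phi>" if "is_cell QK f js ks g \<phi>'" "cmap (lower_star K \<epsilon>) \<phi>' = \<chi>" for \<phi>'
      using star_inj[OF that(1) p(1)] that p is_cellD(1)[OF that(1)] by simp
    show "\<exists>!\<phi>. is_cell QK f js ks g \<phi> \<and> cmap (lower_star K \<epsilon>) \<phi> = \<chi>"
    proof (rule ex1I[of _ \<phi>])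
      show "is_cell QK f js ks g \<phi> \<and> cmap (lower_star K \<epsilon>) \<phi> = \<chi>"
        using p is_cellD(1)[OF p(1)] by simp
    qed (use u in blast)
  qed (use S sV in auto)
  then interpret essentially_surjective QK "Rep K" "lower_star K \<epsilon>" s \<theta> \<theta>' .
  show ?thesis by (rule equivalence)
qed

end


section \<open>The 2-functors\<close>

context functor_between
begin

text \<open>The companion identities are equations between composites, so functors preserve them.
  Through the passage between pairs and cartesian cells, functors thus preserve companions although
  cartesianness is not an equational condition.\<close>

lemma companion_pair_map:
  assumes "companion_pair K j J e \<eta>"
  shows "companion_pair L (vmap F j) (hmap F J) (cmap F e) (cmap F \<eta>)"
proof -
  have e: "is_cell K j [J] [] (vid K (vcod K j)) e"
    and u: "is_cell K (vid K (vdom K j)) [] [J] j \<eta>" and eq: "ccomp K e [\<eta>] = vidc K j"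
      "ccomp K (hidc K J) [\<eta>, e] = hidc K J"
    using assms by (auto simp: companion_pair_def)
  note E = src.companion_counit_ends[OF e]
  have i: "is_cell K (vid K (hdom K J)) ([J] @ []) [J] (vid K (hcod K J)) (hidc K J)"
    using src.is_cell_hidc[OF E(2)] by simp
  have c: "composable K e [\<eta>]" "composable K (hidc K J) [\<eta>, e]"
    using src.composable_1[OF e u] src.composable_2[OF i u e] E by auto
  show ?thesis
    unfolding companion_pair_def
    using is_cell_cmap[OF e] is_cell_cmap[OF u] cmap_ccomp[OF c(1)] cmap_ccomp[OF c(2)] eq E by simp
qed

lemma has_companion_map: "has_companion K j \<Longrightarrow> has_companion L (vmap F j)"
  unfolding has_companion_def
  using src.companion_cell_pair companion_pair_map tgt.companion_pair_cell by blast

lemma representable_map: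
  assumes "representable K J"
  shows "representable L (hmap F J)"
proof -
  obtain j e where je: "companion_cell K j e" "hsrc K e = [J]" using assms by
    (auto simp: representable_def)
  obtain \<eta> where "companion_pair K j J e \<eta>"
    using companion_cell_cases[OF src.aug_virt_dbl_cat_axioms je] .
  note p = companion_pair_map[OF this]
  have "hsrc L (cmap F e) = [hmap F J]" using p by (auto simp: companion_pair_def is_cell_def)
  then show ?thesis unfolding representable_def using tgt.companion_pair_cell[OF p] by blast
qed

end

lemma avfun_restrict_simps [simp]:
  "fdom (avfun_restrict K L F) = K" "fcod (avfun_restrict K L F) = L"
  "A \<in> Ob K \<Longrightarrow> omap (avfun_restrict K L F) A = omap F A"
  "f \<in> Ver K \<Longrightarrow> vmap (avfun_restrict K L F) f = vmap F f"
  "J \<in> Hor K \<Longrightarrow> hmap (avfun_restrict K L F) J = hmap F J"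
  "\<phi> \<in> Cell K \<Longrightarrow> cmap (avfun_restrict K L F) \<phi> = cmap F \<phi>"
  by (simp_all add: avfun_restrict_def)

lemma avtrans_restrict_simps [simp]:
  "tsrc (avtrans_restrict F G \<xi>) = F" "ttgt (avtrans_restrict F G \<xi>) = G"
  "A \<in> Ob (fdom F) \<Longrightarrow> tob (avtrans_restrict F G \<xi>) A = tob \<xi> A"
  "J \<in> Hor (fdom F) \<Longrightarrow> thor (avtrans_restrict F G \<xi>) J = thor \<xi> J"
  by (simp_all add: avtrans_restrict_def)

lemma map_restrict_path:
  assumes "hpath K A Js B"
  shows "map (hmap (avfun_restrict K L F)) Js = map (hmap F) Js"
proof -
  have "\<forall>J\<in>set Js. J \<in> Hor K" using assms by (induction Js arbitrary: A) auto
  then show ?thesis by (simp add: avfun_restrict_def)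
qed

text \<open>Cells are sent into the sub-structure because the horizontal boundary of F \<phi>
  consists of the images of that of \<phi>.\<close>

lemma is_fun_full_sub:
  assumes F: "is_fun K L F" and P: "\<And>J. J \<in> Hor K \<Longrightarrow> P J \<Longrightarrow> P' (hmap F J)"
  shows "is_fun (full_sub K P) (full_sub L P') (avfun_restrict (full_sub K P) (full_sub L P') F)"
proof -
  interpret F: functor_between K L F using F by (rule is_fun_between)
  interpret S: aug_virt_dbl_cat "full_sub K P" by (rule F.src.full_sub_avdc)
  let ?R = "avfun_restrict (full_sub K P) (full_sub L P') F"
  have fam: "map (hmap ?R) (hsrc K \<phi>) = map (hmap F) (hsrc K \<phi>)" "map (hmap ?R) (htgt K \<phi>)
    = map (hmap F) (htgt K \<phi>)"
    if p: "\<phi> \<in> Cell (full_sub K P)" for \<phi>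
    using map_restrict_path[OF S.hsrc_path[OF p]] map_restrict_path[OF S.htgt_path[OF p]] by auto
  have PQ: "cmap F \<phi> \<in> Cell (full_sub L P')" if p: "\<phi> \<in> Cell (full_sub K P)" for \<phi>
  proof -
    have "set (hsrc K \<phi>) \<subseteq> Hor K" "set (htgt K \<phi>) \<subseteq> Hor K"
      using p F.src.hpath_Hor[OF F.src.hsrc_path] F.src.hpath_Hor[OF F.src.htgt_path] by auto
    then show ?thesis using p P by auto
  qed
  have "avdc_functor ?R"
  proof (rule avdc_functor.intro)
    fix \<psi> \<phi>s assume "composable (fdom ?R) \<psi> \<phi>s"
    then have c: "composable (full_sub K P) \<psi> \<phi>s" by simp
    have e: "map (cmap ?R) \<phi>s = map (cmap F) \<phi>s" using composable_Cell[OF c] by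
      (auto simp: avfun_restrict_def)
    have "\<psi> \<in> Cell (full_sub K P)" using c by (simp add: composable_def)
    then show "cmap ?R (ccomp (fdom ?R) \<psi> \<phi>s) = ccomp (fcod ?R) (cmap ?R \<psi>) (map (cmap ?R) \<phi>s)"
      unfolding e using F.cmap_ccomp[OF composable_full_sub[OF c]] S.ccomp_in[OF c]
      by (simp add: avfun_restrict_def)
  next
    show "cmap ?R \<in> Cell (fdom ?R) \<rightarrow>\<^sub>E Cell (fcod ?R)"
      using PQ by (simp add: avfun_restrict_def PiE_iff)
    show "hmap ?R \<in> Hor (fdom ?R) \<rightarrow>\<^sub>E Hor (fcod ?R)"
      using P by (auto simp: avfun_restrict_def)
  next
    fix \<phi> assume p: "\<phi> \<in> Cell (fdom ?R)"
    then show "hsrc (fcod ?R) (cmap ?R \<phi>) = map (hmap ?R) (hsrc (fdom ?R) \<phi>)"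
      "htgt (fcod ?R) (cmap ?R \<phi>) = map (hmap ?R) (htgt (fdom ?R) \<phi>)"
      using fam[of \<phi>] by auto
  qed (simp_all add: F.src.full_sub_avdc F.tgt.full_sub_avdc avfun_restrict_def F.src.hdom_in
    F.src.hcod_in
      F.src.vsrc_in F.src.vtgt_in F.src.hidc_in F.src.hsrc_hidc F.src.htgt_hidc F.src.vidc_in
      F.src.hsrc_vidc F.src.htgt_vidc)
  then show ?thesis by (simp add: is_fun_def)
qed

lemma is_trans_full_sub:
  assumes t: "is_trans K L F G \<xi>" and P: "\<And>J. J \<in> Hor K \<Longrightarrow> P J \<Longrightarrow> P' (hmap F J)" "\<And>J. J \<in> Hor K \<Longrightarrow> P J
    \<Longrightarrow> P' (hmap G J)"
  defines "K' \<equiv> full_sub K P" and "L' \<equiv> full_sub L P'"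
  shows "is_trans K' L' (avfun_restrict K' L' F) (avfun_restrict K' L' G)
     (avtrans_restrict (avfun_restrict K' L' F) (avfun_restrict K' L' G) \<xi>)"
proof -
  interpret \<xi>: trans_between K L F G \<xi> using t by (rule is_trans_between)
  let ?F = "avfun_restrict K' L' F" and ?G = "avfun_restrict K' L' G"
  let ?x = "avtrans_restrict ?F ?G \<xi>"
  have F: "is_fun K' L' ?F" and G: "is_fun K' L' ?G"
    unfolding K'_def L'_def using is_fun_full_sub \<xi>.F.F \<xi>.G.F P by blast+
  have tp: "tpath ?x A Js = tpath \<xi> A Js" if h: "hpath K' A Js B" for A Js B
  proof -
    have "A \<in> Ob K" "\<forall>J\<in>set Js. J \<in> Hor K'"
      using h unfolding K'_def by (auto simp: hpath_full_sub dest: \<xi>.F.src.hpath_ends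
        \<xi>.F.src.hpath_Hor)
    then show ?thesis by (auto simp: tpath_def avtrans_restrict_def L'_def K'_def)
  qed
  show ?thesis
  proof (rule is_transI[OF F G])
    fix f Js Ks g \<phi> assume p: "is_cell K' f Js Ks g \<phi>"
    have p': "is_cell K f Js Ks g \<phi>" using p by (auto simp: is_cell_def K'_def)
    have h: "hpath K' (vdom K f) Js (vdom K g)" "hpath K' (vcod K f) Ks (vcod K g)"
      using \<xi>.F.src.is_cell_hpath[OF p'] p unfolding K'_def by
        (auto simp: hpath_full_sub is_cell_def)
    show "ccomp L' (cmap ?G \<phi>) (tpath ?x (vdom K' f) Js)
      = ccomp L' (hd (tpath ?x (vcod K' f) Ks)) [cmap ?F \<phi>]"
      using \<xi>.natural[OF p'] tp[OF h(1)] tp[OF h(2)] is_cellD(1)[OF p] by (simp add: K'_def L'_def)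
  qed (use \<xi>.tob_natural \<xi>.is_cell_thor P in
      \<open>auto simp: K'_def L'_def avtrans_restrict_def is_cell_def \<xi>.F.src.hdom_in \<xi>.F.src.hcod_in\<close>)
qed

section \<open>Rep as a strict 2-functor\<close>

definition Rep_fun :: "'u avfun \<Rightarrow> 'u avfun" where
  "Rep_fun F = avfun_restrict (Rep (fdom F)) (Rep (fcod F)) F"

definition Rep_trans :: "'u avtrans \<Rightarrow> 'u avtrans" where
  "Rep_trans \<xi> = avtrans_restrict (Rep_fun (tsrc \<xi>)) (Rep_fun (ttgt \<xi>)) \<xi>"

lemma Rep_two_fun_simps [simp]:
  "Tdom Rep_two_fun = AugVirtDblCat" "Tcod Rep_two_fun = AugVirtDblCat"
  "T0 Rep_two_fun = Rep" "T1 Rep_two_fun = Rep_fun" "T2 Rep_two_fun = Rep_trans"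
  by (auto simp: Rep_two_fun_def sub_two_fun_def Let_def Rep_fun_def Rep_trans_def)

lemma is_fun_Rep: "is_fun K L F \<Longrightarrow> is_fun (Rep K) (Rep L) (Rep_fun F)"
  using is_fun_full_sub[of K L F "representable K" "representable L"]
    functor_between.representable_map[OF is_fun_between]
  unfolding Rep_fun_def Rep_def by (metis is_funD)

lemma is_trans_Rep: "is_trans K L F G \<xi> \<Longrightarrow> is_trans (Rep K) (Rep L) (Rep_fun F) (Rep_fun G)
  (Rep_trans \<xi>)"
proof -
  assume t: "is_trans K L F G \<xi>"
  interpret \<xi>: trans_between K L F G \<xi> using t by (rule is_trans_between)
  show ?thesis
    using is_trans_full_sub[OF t, of "representable K" "representable L"]
      \<xi>.F.representable_map \<xi>.G.representable_map
    by (simp add: Rep_fun_def Rep_trans_def Rep_def)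
qed

lemma Rep_fun_simps [simp]:
  "fdom (Rep_fun F) = Rep (fdom F)" "fcod (Rep_fun F) = Rep (fcod F)"
  "A \<in> Ob (fdom F) \<Longrightarrow> omap (Rep_fun F) A = omap F A"
  "f \<in> Ver (fdom F) \<Longrightarrow> vmap (Rep_fun F) f = vmap F f"
  "J \<in> Hor (Rep (fdom F)) \<Longrightarrow> hmap (Rep_fun F) J = hmap F J"
  "\<phi> \<in> Cell (Rep (fdom F)) \<Longrightarrow> cmap (Rep_fun F) \<phi> = cmap F \<phi>"
  by (simp_all add: Rep_fun_def)

lemma Rep_trans_simps [simp]:
  "tsrc (Rep_trans \<xi>) = Rep_fun (tsrc \<xi>)" "ttgt (Rep_trans \<xi>) = Rep_fun (ttgt \<xi>)"
  "A \<in> Ob (fdom (tsrc \<xi>)) \<Longrightarrow> tob (Rep_trans \<xi>) A = tob \<xi> A"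
  "J \<in> Hor (Rep (fdom (tsrc \<xi>))) \<Longrightarrow> thor (Rep_trans \<xi>) J = thor \<xi> J"
  by (simp_all add: Rep_trans_def)

lemma Rep_Cell: "\<phi> \<in> Cell (Rep K) \<longleftrightarrow>
  \<phi> \<in> Cell K \<and> (\<forall>J\<in>set (hsrc K \<phi>). representable K J) \<and> (\<forall>J\<in>set (htgt K \<phi>). representable K J)"
  by (simp add: Rep_def)

text \<open>Restates the axioms of a 2-functor with the source and target of each functor made
  explicit, as the locales for functors and transformations require. It serves for Rep, for the
  quintets and for their duals.\<close>

lemma strict_two_functor_AVDC:
  fixes T :: "('u avdc, 'u avfun, 'u avtrans, 'u avdc, 'u avfun, 'u avtrans) two_fun"
  assumes T: "Tdom T = AugVirtDblCat" "Tcod T = AugVirtDblCat"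
    and o: "\<And>K. aug_virt_dbl_cat K \<Longrightarrow> aug_virt_dbl_cat (T0 T K)"
    and fn: "\<And>K L F. is_fun K L F \<Longrightarrow> is_fun (T0 T K) (T0 T L) (T1 T F)"
    and t: "\<And>K L F G \<xi>. is_trans K L F G \<xi> \<Longrightarrow> is_trans (T0 T K) (T0 T L) (T1 T F) (T1 T G) (T2 T \<xi>)"
    and i: "\<And>K. aug_virt_dbl_cat K \<Longrightarrow> T1 T (avfun_id K) = avfun_id (T0 T K)"
    and c: "\<And>K L M F G. is_fun K L F \<Longrightarrow> is_fun L M G \<Longrightarrow>
      T1 T (avfun_comp G F) = avfun_comp (T1 T G) (T1 T F)"
    and ti: "\<And>K L F. is_fun K L F \<Longrightarrow> T2 T (avtrans_id F) = avtrans_id (T1 T F)"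
    and tv: "\<And>K L F G H \<xi> \<zeta>. is_trans K L F G \<xi> \<Longrightarrow> is_trans K L G H \<zeta> \<Longrightarrow>
      T2 T (avtrans_vert \<zeta> \<xi>) = avtrans_vert (T2 T \<zeta>) (T2 T \<xi>)"
    and th: "\<And>K L M F G S R \<xi> \<zeta>. is_trans K L F G \<xi> \<Longrightarrow> is_trans L M S R \<zeta> \<Longrightarrow>
      T2 T (avtrans_horz \<zeta> \<xi>) = avtrans_horz (T2 T \<zeta>) (T2 T \<xi>)"
  shows "strict_two_functor AugVirtDblCat AugVirtDblCat T"
proof (rule strict_two_functor.intro[OF AugVirtDblCat_two_category AugVirtDblCat_two_category],
    rule strict_two_functor_axioms.intro)
  fix f g :: "'u avfun" and \<alpha> assume "two AugVirtDblCat f g \<alpha>"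
  then have a: "is_trans (fdom f) (fcod f) f g \<alpha>" "is_fun (fdom f) (fcod f) f" by
    (auto elim!: two_AVDC_E)
  from is_funD[OF fn[OF a(2)]] t[OF a(1)] show "two AugVirtDblCat (T1 T f) (T1 T g) (T2 T \<alpha>)"
    by (simp add: two_AVDC)
next
  fix f :: "'u avfun" assume "f \<in> Mor AugVirtDblCat"
  then show "T2 T (cid AugVirtDblCat f) = cid AugVirtDblCat (T1 T f)" using ti[of "fdom f" "fcod f"]
    by (simp add: is_fun_def)
next
  fix f g h :: "'u avfun" and \<alpha> \<beta> assume a: "two AugVirtDblCat f g \<alpha>" "two AugVirtDblCat g h \<beta>"
  show "T2 T (vert AugVirtDblCat \<beta> \<alpha>) = vert AugVirtDblCat (T2 T \<beta>) (T2 T \<alpha>)"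
    using tv[where K = "fdom f" and L = "fcod f" and F = f and G = g and H = h and \<xi> = \<alpha> and \<zeta>
      = \<beta>] a[THEN two_AVDC_D] by simp
next
  fix f g h k :: "'u avfun" and \<alpha> \<beta>
  assume a: "two AugVirtDblCat f g \<alpha>" "two AugVirtDblCat h k \<beta>" "mcod AugVirtDblCat f
    = mdom AugVirtDblCat h"
  then show "T2 T (horz AugVirtDblCat \<beta> \<alpha>) = horz AugVirtDblCat (T2 T \<beta>) (T2 T \<alpha>)"
    using th[where K = "fdom f" and L = "fcod f" and M = "fcod h" and F = f and G = g and S
      = h and R = k and \<xi> = \<alpha> and \<zeta> = \<beta>] a(1,2)[THEN two_AVDC_D] by simp
next
  fix A B and f :: "'u avfun" assume "mor AugVirtDblCat A B f"
  then show "mor AugVirtDblCat (T0 T A) (T0 T B) (T1 T f)" using fn by (simp add: mor_AVDC)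
next
  fix A B E and f g :: "'u avfun" assume "mor AugVirtDblCat A B f" "mor AugVirtDblCat B E g"
  then show "T1 T (mcomp AugVirtDblCat g f) = mcomp AugVirtDblCat (T1 T g) (T1 T f)"
    using c[where K = A and L = B and M = E and F = f and G = g] by (simp add: mor_AVDC)
qed (simp_all add: T o i)

lemma Rep_fun_comp:
  assumes F: "is_fun K L F" and G: "is_fun L M G"
  shows "Rep_fun (avfun_comp G F) = avfun_comp (Rep_fun G) (Rep_fun F)"
proof -
  interpret F: functor_between K L F using F by (rule is_fun_between)
  interpret G: functor_between L M G using G by (rule is_fun_between)
  interpret RF: functor_between "Rep K" "Rep L" "Rep_fun F" using is_fun_Rep[OF F] by
    (rule is_fun_between)
  show ?thesis
  proof (rule is_fun_eqI[OF is_fun_Rep[OF is_fun_comp[OF F G]] is_fun_comp[OF is_fun_Rep[OF F]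
    is_fun_Rep[OF G]]])
    fix \<phi> assume p: "\<phi> \<in> Cell (Rep K)"
    then show "cmap (Rep_fun (avfun_comp G F)) \<phi> = cmap (avfun_comp (Rep_fun G) (Rep_fun F)) \<phi>"
      using RF.map_in(4)[OF p] by (simp add: Rep_Cell)
  next
    fix J assume J: "J \<in> Hor (Rep K)"
    then show "hmap (Rep_fun (avfun_comp G F)) J = hmap (avfun_comp (Rep_fun G) (Rep_fun F)) J"
      using RF.map_in(3)[OF J] by simp
  qed auto
qed

lemma Rep_strict_two_functor: "strict_two_functor AugVirtDblCat AugVirtDblCat Rep_two_fun"
proof (rule strict_two_functor_AVDC)
  fix K :: "'u avdc" assume K: "aug_virt_dbl_cat K"
  then interpret aug_virt_dbl_cat K .
  show "aug_virt_dbl_cat (T0 Rep_two_fun K)" using Rep_avdc by simp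
  have "Rep_fun (avfun_id K) = avfun_id (Rep K)"
    by (rule is_fun_eqI[of "Rep K" "Rep K"])
      (use is_fun_Rep[OF is_fun_id[OF K]] is_fun_id[OF Rep_avdc] in \<open>auto simp: Rep_Cell\<close>)
  then show "T1 Rep_two_fun (avfun_id K) = avfun_id (T0 Rep_two_fun K)" by simp
next
  fix K L F assume "is_fun K L F"
  then show "is_fun (T0 Rep_two_fun K) (T0 Rep_two_fun L) (T1 Rep_two_fun F)" by
    (simp add: is_fun_Rep)
next
  fix K L F G \<xi> assume "is_trans K L F G \<xi>"
  then show "is_trans (T0 Rep_two_fun K) (T0 Rep_two_fun L) (T1 Rep_two_fun F) (T1 Rep_two_fun G)
    (T2 Rep_two_fun \<xi>)"
    by (simp add: is_trans_Rep)
next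
  fix K L M :: "'u avdc" and F G assume F: "is_fun K L F" and G: "is_fun L M G"
  have "Rep_fun (avfun_comp G F) = avfun_comp (Rep_fun G) (Rep_fun F)" by
    (rule Rep_fun_comp[OF F G])
  then show "T1 Rep_two_fun (avfun_comp G F) = avfun_comp (T1 Rep_two_fun G) (T1 Rep_two_fun F)"
    by simp
next
  fix K L :: "'u avdc" and F assume F: "is_fun K L F"
  interpret F: functor_between K L F using F by (rule is_fun_between)
  have "Rep_trans (avtrans_id F) = avtrans_id (Rep_fun F)"
    using is_trans_Rep[OF is_trans_id[OF F]] is_trans_id[OF is_fun_Rep[OF F]]
    by (rule is_trans_eqI) (auto simp: avtrans_id_def)
  then show "T2 Rep_two_fun (avtrans_id F) = avtrans_id (T1 Rep_two_fun F)" by simp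
next
  fix K L :: "'u avdc" and F G H \<xi> \<zeta> assume x: "is_trans K L F G \<xi>" and z: "is_trans K L G H \<zeta>"
  interpret \<xi>: trans_between K L F G \<xi> using x by (rule is_trans_between)
  interpret \<zeta>: trans_between K L G H \<zeta> using z by (rule is_trans_between)
  have "Rep_trans (avtrans_vert \<zeta> \<xi>) = avtrans_vert (Rep_trans \<zeta>) (Rep_trans \<xi>)"
    using is_trans_Rep[OF is_trans_vert[OF x z]] is_trans_vert[OF is_trans_Rep[OF x] is_trans_Rep[OF
      z]]
    by (rule is_trans_eqI) auto
  then show "T2 Rep_two_fun (avtrans_vert \<zeta> \<xi>) = avtrans_vert (T2 Rep_two_fun \<zeta>) (T2 Rep_two_fun \<xi>)"
    by simp
next
  fix K L M :: "'u avdc" and F G S R \<xi> \<zeta> assume x: "is_trans K L F G \<xi>" and z: "is_trans L M S R \<zeta>"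
  interpret \<xi>: trans_between K L F G \<xi> using x by (rule is_trans_between)
  interpret \<zeta>: trans_between L M S R \<zeta> using z by (rule is_trans_between)
  interpret RG: functor_between "Rep K" "Rep L" "Rep_fun G" using is_fun_Rep[OF \<xi>.G.F] by
    (rule is_fun_between)
  interpret RX: trans_between "Rep K" "Rep L" "Rep_fun F" "Rep_fun G" "Rep_trans \<xi>"
    using is_trans_Rep[OF x] by (rule is_trans_between)
  have c: "Rep_fun (avfun_comp S F) = avfun_comp (Rep_fun S) (Rep_fun F)"
    "Rep_fun (avfun_comp R G) = avfun_comp (Rep_fun R) (Rep_fun G)"
    using Rep_fun_comp \<xi>.F.F \<xi>.G.F \<zeta>.F.F \<zeta>.G.F by blast+
  have "Rep_trans (avtrans_horz \<zeta> \<xi>) = avtrans_horz (Rep_trans \<zeta>) (Rep_trans \<xi>)"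
    using is_trans_Rep[OF is_trans_horz[OF x z], unfolded c] is_trans_horz[OF is_trans_Rep[OF x]
      is_trans_Rep[OF z]]
  proof (rule is_trans_eqI)
    fix J assume J: "J \<in> Hor (Rep K)"
    then show "thor (Rep_trans (avtrans_horz \<zeta> \<xi>)) J
      = thor (avtrans_horz (Rep_trans \<zeta>) (Rep_trans \<xi>)) J"
      using RG.map_in(3)[OF J] RX.thor_in[OF J] by simp
  qed auto
  then show "T2 Rep_two_fun (avtrans_horz \<zeta> \<xi>) = avtrans_horz (T2 Rep_two_fun \<zeta>) (T2 Rep_two_fun \<xi>)"
    by simp
qed auto

section \<open>Quintets on companions as a strict 2-functor\<close>

definition qmap :: "'a univ avfun \<Rightarrow> 'a univ \<Rightarrow> 'a univ" where
  "qmap F \<phi> = Quint (vmap F (qf \<phi>)) (map (vmap F) (qjs \<phi>)) (map (vmap F) (qks \<phi>)) (vmap F (qg \<phi>))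
    (cmap F (qc \<phi>))"

lemma qc_qmap: "qc (qmap F \<phi>) = cmap F (qc \<phi>)"
  by (simp add: qmap_def)

definition QV_fun :: "'a univ avfun \<Rightarrow> 'a univ avfun" where
  "QV_fun F = avfun_restrict (QV_lower (fdom F)) (QV_lower (fcod F)) (Q_fun (V_fun F))"

definition QV_trans :: "'a univ avtrans \<Rightarrow> 'a univ avtrans" where
  "QV_trans \<xi> = avtrans_restrict (QV_fun (tsrc \<xi>)) (QV_fun (ttgt \<xi>)) (Q_trans (V_nat \<xi>))"

text \<open>The quintet of a commuting square \<open>k \<circ> u = v \<circ> h\<close>.\<close>

definition square :: "'a univ avdc \<Rightarrow> 'a univ \<Rightarrow> 'a univ \<Rightarrow> 'a univ \<Rightarrow> 'a univ \<Rightarrow> 'a univ" where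
  "square L u h k v = Quint u [h] [k] v (vidc L (vcomp L v h))"

lemma QV_lower_two_fun_simps [simp]:
  "Tdom QV_lower_two_fun = AugVirtDblCat" "Tcod QV_lower_two_fun = AugVirtDblCat"
  "T0 QV_lower_two_fun = QV_lower" "T1 QV_lower_two_fun = QV_fun" "T2 QV_lower_two_fun = QV_trans"
  by (auto simp: QV_lower_two_fun_def sub_two_fun_def Let_def QV_fun_def QV_trans_def)

lemma QV_Cell_quintets: "\<phi> \<in> Cell (QV_lower K) \<Longrightarrow> \<phi> \<in> quintets (V K)"
  by (simp add: QV_lower_def full_sub_def Q_def)

lemma QV_fun_simps [simp]:
  "fdom (QV_fun F) = QV_lower (fdom F)" "fcod (QV_fun F) = QV_lower (fcod F)"
  "A \<in> Ob (fdom F) \<Longrightarrow> omap (QV_fun F) A = omap F A"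
  "f \<in> Ver (fdom F) \<Longrightarrow> vmap (QV_fun F) f = vmap F f"
  "j \<in> Ver (fdom F) \<Longrightarrow> has_companion (fdom F) j \<Longrightarrow> hmap (QV_fun F) j = vmap F j"
  "\<phi> \<in> Cell (QV_lower (fdom F)) \<Longrightarrow> cmap (QV_fun F) \<phi> = qmap F \<phi>"
  using QV_Cell_quintets[of \<phi> "fdom F"] by (simp_all add: QV_fun_def Q_fun_def V_fun_def qmap_def)

lemma QV_trans_simps [simp]:
  "tsrc (QV_trans \<xi>) = QV_fun (tsrc \<xi>)" "ttgt (QV_trans \<xi>) = QV_fun (ttgt \<xi>)"
  "A \<in> Ob (fdom (tsrc \<xi>)) \<Longrightarrow> tob (QV_trans \<xi>) A = tob \<xi> A"
  "j \<in> Ver (fdom (tsrc \<xi>)) \<Longrightarrow> has_companion (fdom (tsrc \<xi>)) j \<Longrightarrow> thor (QV_trans \<xi>) j =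
     square (fcod (tsrc \<xi>)) (tob \<xi> (vdom (fdom (tsrc \<xi>)) j)) (vmap (tsrc \<xi>) j) (vmap (ttgt \<xi>) j)
       (tob \<xi> (vcod (fdom (tsrc \<xi>)) j))"
  by (simp_all add: QV_trans_def Q_trans_def V_fun_def V_nat_def square_def Let_def)

context quintet_companions
begin

lemma qpaste_single:
  assumes c: "is_cell QK f js ks g \<phi>"
  shows "paste f [\<phi>] = qc \<phi>"
proof -
  note C = QV_cell[OF c]
  note M = mpath_comp_Ver[OF C(3)] mpath_comp_Ver[OF C(4)]
  have i: "is_cell K g [] [] g (vidc K g)" using is_cell_vidc C by simp
  have "paste f [\<phi>] = hcomp K (whisk K (vid K (vcod K g)) (qc \<phi>)) (ccomp K (vidc K g) [vidc K (mc
    (vdom K f) js)])"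
    by (rule qpaste_Cons(1)[OF i c]) (use C in auto)
  also have "\<dots> = qc \<phi>"
    using whisk_vid[OF C(8)] hcomp_vidc_right[OF C(8)] M C by (simp add: vidc_vidc)
  finally show ?thesis .
qed

lemma is_cell_square:
  assumes "u \<in> Ver K" "v \<in> Ver K" "has_companion K h" "has_companion K k"
    "vdom K u = vdom K h" "vcod K u = vdom K k" "vdom K v = vcod K h" "vcod K v = vcod K k"
    and e: "vcomp K k u = vcomp K v h"
  shows "is_cell QK u [h] [k] v (square K u h k v)"
proof -
  have "h \<in> Ver K" "k \<in> Ver K" using assms counit_cell(2) by auto
  then show ?thesis using assms is_cell_vidc[of "vcomp K v h"]
    by (auto simp: is_cell_QV square_def)
qed

lemma qcomp_single:
  assumes c: "is_cell QK p ms ls q \<psi>" and s: "is_cell QK f js ms g \<phi>" "vdom K p = vcod K f"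
  shows "qcomp (V K) \<psi> [\<phi>] = Quint (vcomp K p f) js ls (vcomp K q g)
      (hcomp K (ccomp K (qc \<psi>) [vidc K f]) (whisk K q (qc \<phi>)))"
proof -
  have "cpath QK f [\<phi>] g" using s(1) QV_cell(2)[OF s(1)] by (auto simp: is_cell_def)
  from qcomp_eq(1)[OF c _ this _ s(2)] show ?thesis
    using QV_cell(10,11)[OF s(1)] qpaste_single[OF s(1)] by simp
qed

text \<open>Both factors of the pasted 2-cell are the identity on v' \<circ> v \<circ> h. As the
  components of the transformations between quintets are such squares, this settles their vertical
  and their horizontal composition.\<close>

lemma qcomp_square:
  assumes 1: "u \<in> Ver K" "v \<in> Ver K" "has_companion K h" "has_companion K k"
    "vdom K u = vdom K h" "vcod K u = vdom K k" "vdom K v = vcod K h" "vcod K v = vcod K k"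
    "vcomp K k u = vcomp K v h"
   and 2: "u' \<in> Ver K" "v' \<in> Ver K" "has_companion K l"
    "vdom K u' = vdom K k" "vcod K u' = vdom K l" "vdom K v' = vcod K k" "vcod K v' = vcod K l"
    "vcomp K l u' = vcomp K v' k"
  shows "qcomp (V K) (square K u' k l v') [square K u h k v]
    = square K (vcomp K u' u) h l (vcomp K v' v)"
proof -
  have v: "h \<in> Ver K" "k \<in> Ver K" "l \<in> Ver K" using 1 2 counit_cell(2) by auto
  note c1 = is_cell_square[OF 1] and c2 = is_cell_square[OF 2(1,2) 1(4) 2(3-)]
  have e: "vcomp K (vcomp K v' k) u = vcomp K v' (vcomp K v h)"
    using 1 2 v by (simp add: vcomp_assoc[symmetric])
  have i: "is_cell K (vcomp K v' (vcomp K v h)) [] [] (vcomp K v' (vcomp K v h)) (vidc K (vcomp K v'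
    (vcomp K v h)))"
    using is_cell_vidc 1 2 v by simp
  have "ccomp K (vidc K (vcomp K v' k)) [vidc K u] = vidc K (vcomp K v' (vcomp K v h))"
    using 1 2 v e by (simp add: vidc_vidc)
  moreover have "whisk K v' (vidc K (vcomp K v h)) = vidc K (vcomp K v' (vcomp K v h))"
    using 1 2 v by (simp add: whisk_vidc)
  ultimately show ?thesis
    using qcomp_single[OF c2 c1] 1 2 v hcomp_vidc_left[OF i] by (simp add: square_def vcomp_assoc)
qed

end

locale quintet_functor = functor_between K L F + QK: quintet_companions K \<epsilon> + QL: quintet_companions
  L \<epsilon>'
  for K L :: "'a univ avdc" and F \<epsilon> \<epsilon>'
begin

lemma mpath_map: "QK.mp A js B \<Longrightarrow> QL.mp (omap F A) (map (vmap F) js) (omap F B)"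
  by (induction js arbitrary: A) auto

lemma mpath_comp_map: "QK.mp A js B \<Longrightarrow> vmap F (QK.mc A js) = QL.mc (omap F A) (map (vmap F) js)"
  by (induction js arbitrary: A) (auto simp: src.mpath_comp_Ver)

lemma is_cell_qmap:
  assumes "is_cell (QV_lower K) f js ks g \<phi>"
  shows "is_cell (QV_lower L) (vmap F f) (map (vmap F) js) (map (vmap F) ks) (vmap F g) (qmap F \<phi>)"
proof -
  note C = QK.QV_cell[OF assms]
  note M = src.mpath_comp_Ver[OF C(3)] src.mpath_comp_Ver[OF C(4)]
  have m: "QL.mp (vdom L (vmap F f)) (map (vmap F) js) (vdom L (vmap F g))"
    "QL.mp (vcod L (vmap F f)) (map (vmap F) ks) (vcod L (vmap F g))"
    using mpath_map[OF C(3)] mpath_map[OF C(4)] C by simp_all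
  have "is_cell L (vcomp L (QL.mc (vcod L (vmap F f)) (map (vmap F) ks)) (vmap F f)) [] []
     (vcomp L (vmap F g) (QL.mc (vdom L (vmap F f)) (map (vmap F) js))) (cmap F (qc \<phi>))"
    using is_cell_cmap[OF C(8)] mpath_comp_map[OF C(3)] mpath_comp_map[OF C(4)] C M by simp
  then show ?thesis using C m has_companion_map unfolding is_cell_QV qmap_def by auto
qed

lemma cpath_qmap: "cpath (QV_lower K) f \<phi>s g
  \<Longrightarrow> cpath (QV_lower L) (vmap F f) (map (qmap F) \<phi>s) (vmap F g)"
proof (induction \<phi>s arbitrary: f)
  case (Cons \<phi> \<phi>s)
  then show ?case using is_cell_qmap[OF QK.QV_cellI[of \<phi>]] by (auto simp: is_cell_def)
qed simp

text \<open>A pasting is built from \<odot>, whiskering and composition with vertical identity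
  cells, all of which F preserves.\<close>

lemma qpaste_map:
  "cpath (QV_lower K) f \<phi>s g \<Longrightarrow> QL.paste (vmap F f) (map (qmap F) \<phi>s) = cmap F (QK.paste f \<phi>s)"
proof (induction \<phi>s arbitrary: f)
  case (Cons \<phi> \<phi>s)
  have c: "is_cell (QV_lower K) f (qjs \<phi>) (qks \<phi>) (qg \<phi>) \<phi>" and pt: "cpath (QV_lower K) (qg \<phi>) \<phi>s g"
    using Cons.prems QK.QV_cellI[of \<phi>] by auto
  note C = QK.QV_cell[OF c]
  note P = QK.is_cell_qpaste[OF pt]
  let ?js = "concat (map qjs \<phi>s)" and ?ks = "concat (map qks \<phi>s)"
  let ?m = "QK.mc (vcod K (qg \<phi>)) ?ks" and ?j = "QK.mc (vdom K f) (qjs \<phi>)"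
  have mj: "QK.mp (vdom K (qg \<phi>)) ?js (vdom K g)" and mk: "QK.mp (vcod K (qg \<phi>)) ?ks (vcod K g)"
    using P by auto
  note M = src.mpath_comp_Ver[OF C(3)] src.mpath_comp_Ver[OF C(4)] src.mpath_comp_Ver[OF mj]
    src.mpath_comp_Ver[OF mk]
  have p: "is_cell K (vcomp K ?m (qg \<phi>)) [] [] (vcomp K g (QK.mc (vdom K (qg \<phi>)) ?js)) (QK.paste (qg
    \<phi>) \<phi>s)"
    using P by simp
  have 1: "QK.paste f (\<phi> # \<phi>s) = hcomp K (whisk K ?m (qc \<phi>)) (ccomp K (QK.paste (qg \<phi>) \<phi>s) [vidc K
    ?j])"
    by (rule QK.qpaste_Cons(1)[OF p c refl refl]) (use M in auto)
  have ks: "concat (map qks (map (qmap F) \<phi>s)) = map (vmap F) ?ks"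
    by (induction \<phi>s) (auto simp: qmap_def)
  have pL: "is_cell L (vcomp L (vmap F ?m) (vmap F (qg \<phi>))) [] [] (vmap F (vcomp K g (QK.mc (vdom K
    (qg \<phi>)) ?js))) (cmap F (QK.paste (qg \<phi>) \<phi>s))"
    using is_cell_cmap[OF p] M C by simp
  have 2: "QL.paste (vmap F f) (qmap F \<phi> # map (qmap F) \<phi>s) =
      hcomp L (whisk L (vmap F ?m) (qc (qmap F \<phi>))) (ccomp L (cmap F (QK.paste (qg \<phi>) \<phi>s)) [vidc L
        (QL.mc (vdom L (vmap F f)) (map (vmap F) (qjs \<phi>)))])"
    by (rule QL.qpaste_Cons(1)[OF pL is_cell_qmap[OF c]])
      (use Cons.IH[OF pt] mpath_comp_map[OF mk] tgt.mpath_comp_Ver[OF mpath_map[OF mk]] M C ks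
        in auto)
  have w: "is_cell K (vcomp K ?m (vcomp K (QK.mc (vcod K f) (qks \<phi>)) f)) [] [] (vcomp K ?m (vcomp K
    (qg \<phi>) ?j)) (whisk K ?m (qc \<phi>))"
    by (rule src.is_cell_whisk[OF C(8)]) (use M C in auto)
  have r: "is_cell K (vcomp K (vcomp K ?m (qg \<phi>)) ?j) [] [] (vcomp K (vcomp K g (QK.mc (vdom K (qg
    \<phi>)) ?js)) ?j) (ccomp K (QK.paste (qg \<phi>) \<phi>s) [vidc K ?j])"
    by (rule src.is_cell_ccomp_vidc_right[OF p]) (use M C in auto)
  have r': "is_cell K (vcomp K ?m (vcomp K (qg \<phi>) ?j)) [] [] (vcomp K (vcomp K g (QK.mc (vdom K (qg
    \<phi>)) ?js)) ?j) (ccomp K (QK.paste (qg \<phi>) \<phi>s) [vidc K ?j])"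
    using r M C by (simp add: src.vcomp_assoc)
  have cm: "composable K (QK.paste (qg \<phi>) \<phi>s) [vidc K ?j]"
    by (rule src.composable_1[OF p src.is_cell_vidc]) (use M C in auto)
  have "cmap F (QK.paste f (\<phi> # \<phi>s)) = hcomp L (whisk L (vmap F ?m) (cmap F (qc \<phi>))) (ccomp L (cmap
    F (QK.paste (qg \<phi>) \<phi>s)) [vidc L (vmap F ?j)])"
    unfolding 1 using cmap_hcomp[OF w r'] cmap_whisk[OF C(8)] cmap_ccomp[OF cm] M C by simp
  then show ?case using 2 mpath_comp_map[OF C(3)] C by (simp add: qc_qmap del: qpaste.simps)
qed simp

lemma is_fun_QV: "is_fun (QV_lower K) (QV_lower L) (QV_fun F)"
proof -
  have map_eq: "map (hmap (QV_fun F)) js = map (vmap F) js" if "\<forall>j\<in>set js. has_companion K j" for js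
    using that QK.counit_cell(2) by auto
  have "avdc_functor (QV_fun F)"
  proof (rule avdc_functor.intro)
    show "aug_virt_dbl_cat (fdom (QV_fun F))" "aug_virt_dbl_cat (fcod (QV_fun F))"
      using QK.QV_lower_avdc QL.QV_lower_avdc by auto
    show "omap (QV_fun F) \<in> Ob (fdom (QV_fun F)) \<rightarrow>\<^sub>E Ob (fcod (QV_fun F))"
      "vmap (QV_fun F) \<in> Ver (fdom (QV_fun F)) \<rightarrow>\<^sub>E Ver (fcod (QV_fun F))"
      "hmap (QV_fun F) \<in> Hor (fdom (QV_fun F)) \<rightarrow>\<^sub>E Hor (fcod (QV_fun F))"
      using has_companion_map by (auto simp: PiE_iff) (auto simp: QV_fun_def avfun_restrict_def)
    have "cmap (QV_fun F) \<in> extensional (Cell (QV_lower K))" by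
      (simp add: QV_fun_def avfun_restrict_def)
    then show "cmap (QV_fun F) \<in> Cell (fdom (QV_fun F)) \<rightarrow>\<^sub>E Cell (fcod (QV_fun F))"
      using is_cellD(1)[OF is_cell_qmap[OF QK.QV_cellI]] by (auto simp: PiE_iff)
  next
    fix \<phi> assume "\<phi> \<in> Cell (fdom (QV_fun F))"
    then have p: "\<phi> \<in> Cell (QV_lower K)" by simp
    note C = QK.QV_cell[OF QK.QV_cellI[OF p]]
    show "hsrc (fcod (QV_fun F)) (cmap (QV_fun F) \<phi>)
      = map (hmap (QV_fun F)) (hsrc (fdom (QV_fun F)) \<phi>)"
      "htgt (fcod (QV_fun F)) (cmap (QV_fun F) \<phi>)
        = map (hmap (QV_fun F)) (htgt (fdom (QV_fun F)) \<phi>)"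
      "vsrc (fcod (QV_fun F)) (cmap (QV_fun F) \<phi>) = vmap (QV_fun F) (vsrc (fdom (QV_fun F)) \<phi>)"
      "vtgt (fcod (QV_fun F)) (cmap (QV_fun F) \<phi>) = vmap (QV_fun F) (vtgt (fdom (QV_fun F)) \<phi>)"
      using p C map_eq by (auto simp: qmap_def)
  next
    fix \<psi> \<phi>s assume "composable (fdom (QV_fun F)) \<psi> \<phi>s"
    then have c: "composable (QV_lower K) \<psi> \<phi>s" by simp
    note R = QK.QV_composable[OF c]
    note eq = QK.qcomp_eq[OF R(1-3) refl R(4)]
    let ?f = "qf (hd \<phi>s)" and ?g = "qg (last \<phi>s)"
    have ps: "\<psi> \<in> Cell (QV_lower K)" using R by (simp add: is_cell_def)
    have e: "map (cmap (QV_fun F)) \<phi>s = map (qmap F) \<phi>s" using composable_Cell[OF c] by auto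
    have s: "concat (map qks (map (qmap F) \<phi>s)) = map (vmap F) (concat (map qks \<phi>s))"
      "concat (map qjs (map (qmap F) \<phi>s)) = map (vmap F) (concat (map qjs \<phi>s))"
      by (induction \<phi>s) (auto simp: qmap_def)
    note C = QK.QV_cell[OF R(1)]
    have v: "?f \<in> Ver K" "?g \<in> Ver K" using QK.is_cell_qpaste[OF R(3)] by auto
    note P = QK.is_cell_qpaste[OF R(3)]
    have mj: "QK.mp (vdom K ?f) (concat (map qjs \<phi>s)) (vdom K ?g)" and mk:
      "QK.mp (vcod K ?f) (concat (map qks \<phi>s)) (vcod K ?g)"
      using P by auto
    note M = src.mpath_comp_Ver[OF mj] src.mpath_comp_Ver[OF mk] src.mpath_comp_Ver[OF C(4)]
      src.mpath_comp_Ver[OF C(3)]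
    have qg: "vdom K (qg \<psi>) = vcod K ?g" using mk R(4) M by simp
    have eqL: "qcomp (V L) (qmap F \<psi>) (map (qmap F) \<phi>s)
      = Quint (vcomp L (vmap F (qf \<psi>)) (vmap F ?f))
        (concat (map qjs (map (qmap F) \<phi>s))) (map (vmap F) (qks \<psi>)) (vcomp L (vmap F (qg \<psi>)) (vmap F
          ?g))
        (hcomp L (ccomp L (qc (qmap F \<psi>)) [vidc L (vmap F ?f)]) (whisk L (vmap F (qg \<psi>)) (QL.paste
          (vmap F ?f) (map (qmap F) \<phi>s))))"
      by (rule QL.qcomp_eq(1)[OF is_cell_qmap[OF R(1)] _ cpath_qmap[OF R(3)]]) (use R s v C in auto)
    have cm: "composable K (qc \<psi>) [vidc K ?f]"
      by (rule src.composable_1[OF C(8) src.is_cell_vidc]) (use v R C M in auto)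
    have pp: "is_cell K (vcomp K (QK.mc (vcod K ?f) (concat (map qks \<phi>s))) ?f) [] []
       (vcomp K ?g (QK.mc (vdom K ?f) (concat (map qjs \<phi>s)))) (QK.paste ?f \<phi>s)" using P by simp
    have "cmap F (hcomp K (ccomp K (qc \<psi>) [vidc K ?f]) (whisk K (qg \<psi>) (QK.paste ?f \<phi>s))) =
       hcomp L (ccomp L (cmap F (qc \<psi>)) [vidc L (vmap F ?f)]) (whisk L (vmap F (qg \<psi>)) (cmap F
         (QK.paste ?f \<phi>s)))"
      using cmap_hcomp[OF eq(3,4)] cmap_ccomp[OF cm] cmap_whisk[OF pp, of "qg \<psi>"] v C M qg by simp
    then have "qmap F (qcomp (V K) \<psi> \<phi>s) = qcomp (V L) (qmap F \<psi>) (map (qmap F) \<phi>s)"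
      unfolding eqL eq(1) using qpaste_map[OF R(3)] s v C R qg by (simp add: qmap_def)
    then show "cmap (QV_fun F) (ccomp (fdom (QV_fun F)) \<psi> \<phi>s)
      = ccomp (fcod (QV_fun F)) (cmap (QV_fun F) \<psi>) (map (cmap (QV_fun F)) \<phi>s)"
      unfolding e using is_cellD(1)[OF eq(2)] ps by simp
  next
    fix J assume "J \<in> Hor (fdom (QV_fun F))"
    then have J: "J \<in> Ver K" "has_companion K J" by auto
    show "cmap (QV_fun F) (hidc (fdom (QV_fun F)) J) = hidc (fcod (QV_fun F)) (hmap (QV_fun F) J)"
      using J is_cellD(1)[OF QK.is_cell_QV_hidc[OF J(2)]] by (simp add: qmap_def)
  next
    fix f assume "f \<in> Ver (fdom (QV_fun F))"
    then have f: "f \<in> Ver K" by simp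
    show "cmap (QV_fun F) (vidc (fdom (QV_fun F)) f) = vidc (fcod (QV_fun F)) (vmap (QV_fun F) f)"
      using f is_cellD(1)[OF QK.is_cell_QV_vidc[OF f]] by (simp add: qmap_def)
  qed auto
  then show ?thesis by (simp add: is_fun_def)
qed

end

lemma ex_quintet_companions:
  assumes "aug_virt_dbl_cat (K :: 'a univ avdc)"
  obtains \<epsilon> where "quintet_companions K \<epsilon>"
proof -
  obtain \<epsilon> where "companion_choice K \<epsilon>" using ex_companion_choice by blast
  then have "quintet_companions K \<epsilon>"
    using assms by (simp add: quintet_companions_def chosen_companions_def
      chosen_companions_axioms_def)
  then show ?thesis by (rule that)
qed

lemma ex_quintet_functor:
  assumes F: "is_fun K L F"
  obtains \<epsilon> \<epsilon>' where "quintet_functor K L F \<epsilon> \<epsilon>'"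
proof -
  obtain \<epsilon> where "quintet_companions K \<epsilon>" using ex_quintet_companions is_fun_avdc[OF F] by blast
  moreover obtain \<epsilon>' where "quintet_companions L \<epsilon>'" using ex_quintet_companions is_fun_avdc[OF F]
    by blast
  ultimately have "quintet_functor K L F \<epsilon> \<epsilon>'" by (intro quintet_functor.intro is_fun_between[OF F])
  then show ?thesis by (rule that)
qed

lemma is_fun_QV:
  assumes "is_fun K L F"
  shows "is_fun (QV_lower K) (QV_lower L) (QV_fun F)"
proof -
  obtain \<epsilon> \<epsilon>' where "quintet_functor K L F \<epsilon> \<epsilon>'" using ex_quintet_functor[OF assms] .
  then interpret quintet_functor K L F \<epsilon> \<epsilon>' .
  show ?thesis by (rule is_fun_QV)
qed

locale quintet_trans = trans_between K L F G \<xi> + QK: quintet_companions K \<epsilon> + QL: quintet_companions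
  L \<epsilon>'
  for K L :: "'a univ avdc" and F G \<xi> \<epsilon> \<epsilon>'
begin

sublocale QF: quintet_functor K L F \<epsilon> \<epsilon>' by unfold_locales
sublocale QG: quintet_functor K L G \<epsilon> \<epsilon>' by unfold_locales

abbreviation sq :: "'a univ \<Rightarrow> 'a univ" where
  "sq j \<equiv> square L (tob \<xi> (vdom K j)) (vmap F j) (vmap G j) (tob \<xi> (vcod K j))"

lemma is_cell_sq:
  assumes "has_companion K j"
  shows "is_cell (QV_lower L) (tob \<xi> (vdom K j)) [vmap F j] [vmap G j] (tob \<xi> (vcod K j)) (sq j)"
proof -
  have j: "j \<in> Ver K" using QK.counit_cell(2)[OF assms] .
  then show ?thesis
    using tob_natural[OF j] F.has_companion_map[OF assms] G.has_companion_map[OF assms]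
    by (intro QL.is_cell_square) auto
qed

text \<open>Each square contributes an identity 2-cell, and naturality of \<xi> identifies the
  intermediate boundaries; so the pasting along the whole path is an identity.\<close>

lemma qpaste_squares:
  "QK.mp A js B \<Longrightarrow> \<forall>j\<in>set js. has_companion K j \<Longrightarrow>
     cpath (QV_lower L) (tob \<xi> A) (map sq js) (tob \<xi> B) \<and>
     QL.paste (tob \<xi> A) (map sq js) = vidc L (vcomp L (QL.mc (omap G A) (map (vmap G) js)) (tob \<xi>
       A)) \<and>
     concat (map qks (map sq js)) = map (vmap G) js \<and> concat (map qjs (map sq js))
       = map (vmap F) js"
proof (induction js arbitrary: A)
  case (Cons j js)
  let ?C = "vcod K j"
  have m: "QK.mp ?C js B" and h: "has_companion K j" and j: "j \<in> Ver K" and A: "A = vdom K j"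
    using Cons.prems by auto
  have ih: "cpath (QV_lower L) (tob \<xi> ?C) (map sq js) (tob \<xi> B)"
    "QL.paste (tob \<xi> ?C) (map sq js) = vidc L (vcomp L (QL.mc (omap G ?C) (map (vmap G) js)) (tob \<xi>
      ?C))"
    "concat (map qks (map sq js)) = map (vmap G) js" "concat (map qjs (map sq js))
      = map (vmap F) js"
    using Cons.IH[OF m] Cons.prems by auto
  note c = is_cell_sq[OF h]
  let ?m = "QL.mc (omap G ?C) (map (vmap G) js)"
  note M = F.tgt.mpath_comp_Ver[OF QG.mpath_map[OF m]]
  have i: "is_cell L (vcomp L ?m (tob \<xi> ?C)) [] [] (vcomp L ?m (tob \<xi> ?C)) (vidc L (vcomp L ?m (tob
    \<xi> ?C)))"
    using F.tgt.is_cell_vidc M j by simp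
  have 1: "QL.paste (tob \<xi> A) (sq j # map sq js) = hcomp L (whisk L ?m (qc (sq j)))
      (ccomp L (vidc L (vcomp L ?m (tob \<xi> ?C))) [vidc L (QL.mc (vdom L (tob \<xi> A)) [vmap F j])])"
    unfolding A by (rule QL.qpaste_Cons(1)[OF i c ih(2) refl]) (use M j ih in auto)
  let ?x = "vcomp L ?m (vcomp L (vmap G j) (tob \<xi> A))"
  have e: "?x = vcomp L ?m (vcomp L (tob \<xi> ?C) (vmap F j))"
    using tob_natural[OF j] A by simp
  have "whisk L ?m (qc (sq j)) = vidc L ?x"
    using M j e by (simp add: square_def F.tgt.whisk_vidc)
  moreover have "ccomp L (vidc L (vcomp L ?m (tob \<xi> ?C))) [vidc L (QL.mc (vdom L (tob \<xi> A)) [vmap F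
    j])] = vidc L ?x"
    using M j e A by (simp add: F.tgt.vidc_vidc F.tgt.vcomp_assoc)
  moreover have "is_cell L ?x [] [] ?x (vidc L ?x)" using F.tgt.is_cell_vidc M j A by simp
  ultimately have "QL.paste (tob \<xi> A) (sq j # map sq js) = vidc L ?x"
    using 1 F.tgt.hcomp_vidc_left by simp
  then show ?case using ih M j A c
    by (simp add: is_cell_def F.tgt.vcomp_assoc del: qpaste.simps)
qed auto

text \<open>The components of \<xi> contribute only identities, so both composites in the naturality
  square of a quintet reduce to whiskerings of its 2-cell. What remains is naturality of \<xi> at
  this vertical cell of K, whose horizontal source and target are empty.\<close>

lemma is_trans_QV: "is_trans (QV_lower K) (QV_lower L) (QV_fun F) (QV_fun G) (QV_trans \<xi>)"
proof (rule is_transI[OF QF.is_fun_QV QG.is_fun_QV])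
  fix j assume "j \<in> Hor (QV_lower K)"
  then have j: "j \<in> Ver K" "has_companion K j" by auto
  then show "is_cell (QV_lower L) (tob (QV_trans \<xi>) (hdom (QV_lower K) j)) [hmap (QV_fun F) j]
      [hmap (QV_fun G) j] (tob (QV_trans \<xi>) (hcod (QV_lower K) j)) (thor (QV_trans \<xi>) j)"
    using is_cell_sq[OF j(2)] by simp
next
  fix f js ks g \<phi> assume p: "is_cell (QV_lower K) f js ks g \<phi>"
  note C = QK.QV_cell[OF p]
  note M = F.src.mpath_comp_Ver[OF C(3)] F.src.mpath_comp_Ver[OF C(4)]
  note mcL = F.tgt.mpath_comp_Ver[OF QG.mpath_map[OF C(3)]] F.tgt.mpath_comp_Ver[OF QG.mpath_map[OF
    C(4)]]
    F.tgt.mpath_comp_Ver[OF QF.mpath_map[OF C(3)]] F.tgt.mpath_comp_Ver[OF QF.mpath_map[OF C(4)]]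
  let ?A = "vdom K f" and ?B = "vdom K g" and ?C = "vcod K f" and ?D = "vcod K g"
  have obs: "?A \<in> Ob K" "?B \<in> Ob K" "?C \<in> Ob K" "?D \<in> Ob K" using C by auto
  have ms: "map (thor (QV_trans \<xi>)) js = map sq js" if "\<forall>j\<in>set js. has_companion K j" for js
    using that QK.counit_cell(2) by auto
  have tp: "tpath (QV_trans \<xi>) A js = (if js
    = [] then [Quint (tob \<xi> A) [] [] (tob \<xi> A) (vidc L (tob \<xi> A))] else map sq js)"
    if "\<forall>j\<in>set js. has_companion K j" "A \<in> Ob K" for A js
    using ms[OF that(1)] that(2) by (simp add: tpath_def)
  define tJ where "tJ = tpath (QV_trans \<xi>) ?A js"
  define tK where "tK = hd (tpath (QV_trans \<xi>) ?C ks)"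
  have i: "is_cell (QV_lower L) (tob \<xi> A) [] [] (tob \<xi> A) (Quint (tob \<xi> A) [] [] (tob \<xi> A) (vidc L
    (tob \<xi> A)))" if "A \<in> Ob K" for A
    using QL.is_cell_QV_vidc[of "tob \<xi> A"] that by simp
  \<comment> \<open>For the empty path \<open>tJ\<close> is a single identity quintet and otherwise
    a path of squares; either way its pasting is an identity 2-cell.\<close>
  have J: "cpath (QV_lower L) (tob \<xi> ?A) tJ (tob \<xi> ?B)" "tJ \<noteq> []"
    "QL.paste (tob \<xi> ?A) tJ = vidc L (vcomp L (QL.mc (omap G ?A) (map (vmap G) js)) (tob \<xi> ?A))"
    "concat (map qks tJ) = map (vmap G) js" "concat (map qjs tJ) = map (vmap F) js"
    using qpaste_squares[OF C(3) C(6)] C(3) obs tp[OF C(6)] i[of ?A] QL.qpaste_single[OF i[of ?A]]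
    by (auto simp: tJ_def is_cell_def simp del: qpaste.simps)
  have Kc: "is_cell (QV_lower L) (tob \<xi> ?C) (map (vmap F) ks) (map (vmap G) ks) (tob \<xi> ?D) tK"
    and Kq: "qc tK = vidc L (vcomp L (tob \<xi> ?D) (QL.mc (omap F ?C) (map (vmap F) ks)))"
    using tp[OF C(7), of ?C] C(4,5,7) obs i[of ?C] is_cell_sq[of "hd ks"]
    by (cases ks; auto simp: tK_def square_def)+
  note qp = QG.is_cell_qmap[OF p] and qp' = QF.is_cell_qmap[OF p]
  have qcp: "is_cell K (vcomp K (QK.mc ?C ks) f) [] [] (vcomp K g (QK.mc ?A js)) (qc \<phi>)" using C
    by simp
  have Gq: "is_cell L (vcomp L (QL.mc (omap G ?C) (map (vmap G) ks)) (vmap G f)) [] [] (vcomp L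
    (vmap G g) (QL.mc (omap G ?A) (map (vmap G) js))) (cmap G (qc \<phi>))"
    using QL.QV_cell(8)[OF qp] C by (simp add: qc_qmap)
  have Fq: "is_cell L (vcomp L (QL.mc (omap F ?C) (map (vmap F) ks)) (vmap F f)) [] [] (vcomp L
    (vmap F g) (QL.mc (omap F ?A) (map (vmap F) js))) (cmap F (qc \<phi>))"
    using QL.QV_cell(8)[OF qp'] C by (simp add: qc_qmap)
  have Gx: "is_cell L (vcomp L (vcomp L (QL.mc (omap G ?C) (map (vmap G) ks)) (vmap G f)) (tob \<xi>
    ?A)) [] []
      (vcomp L (vcomp L (vmap G g) (QL.mc (omap G ?A) (map (vmap G) js))) (tob \<xi> ?A)) (ccomp L (cmap
        G (qc \<phi>)) [vidc L (tob \<xi> ?A)])"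
    by (rule F.tgt.is_cell_ccomp_vidc_right[OF Gq]) (use obs mcL C in auto)
  have Fx: "is_cell L (vcomp L (tob \<xi> ?D) (vcomp L (QL.mc (omap F ?C) (map (vmap F) ks)) (vmap F
    f))) [] []
     (vcomp L (tob \<xi> ?D) (vcomp L (vmap F g) (QL.mc (omap F ?A) (map (vmap F) js)))) (whisk L (tob \<xi>
       ?D) (cmap F (qc \<phi>)))"
    by (rule F.tgt.is_cell_whisk[OF Fq]) (use obs mcL C in auto)
  have w: "whisk L (vmap G g) (QL.paste (tob \<xi> ?A) tJ)
    = vidc L (vcomp L (vcomp L (vmap G g) (QL.mc (omap G ?A) (map (vmap G) js))) (tob \<xi> ?A))"
    unfolding J(3) using mcL obs C by (simp add: F.tgt.whisk_vidc F.tgt.vcomp_assoc)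
  have v: "ccomp L (qc tK) [vidc L (vmap F f)]
    = vidc L (vcomp L (tob \<xi> ?D) (vcomp L (QL.mc (omap F ?C) (map (vmap F) ks)) (vmap F f)))"
    unfolding Kq using mcL obs C by (simp add: F.tgt.vidc_vidc F.tgt.vcomp_assoc)
  have L1: "qcomp (V L) (qmap G \<phi>) tJ = Quint (vcomp L (vmap G f) (tob \<xi> ?A)) (map (vmap F) js) (map
    (vmap G) ks) (vcomp L (vmap G g) (tob \<xi> ?B))
       (ccomp L (cmap G (qc \<phi>)) [vidc L (tob \<xi> ?A)])"
    using QL.qcomp_eq(1)[OF qp J(2,1)] J C obs w F.tgt.hcomp_vidc_right[OF Gx] by
      (simp add: qc_qmap)
  have L2: "qcomp (V L) tK [qmap F \<phi>] = Quint (vcomp L (tob \<xi> ?C) (vmap F f)) (map (vmap F) js) (map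
    (vmap G) ks) (vcomp L (tob \<xi> ?D) (vmap F g))
       (whisk L (tob \<xi> ?D) (cmap F (qc \<phi>)))"
    using QL.qcomp_single[OF Kc qp'] C obs v F.tgt.hcomp_vidc_left[OF Fx] by (simp add: qc_qmap)
  have "ccomp L (cmap G (qc \<phi>)) [vidc L (tob \<xi> ?A)] = whisk L (tob \<xi> ?D) (cmap F (qc \<phi>))"
    using natural[OF qcp] M C by (simp add: tpath_def whisk_def)
  then have "qcomp (V L) (qmap G \<phi>) tJ = qcomp (V L) tK [qmap F \<phi>]"
    unfolding L1 L2 using tob_natural[OF C(1)] tob_natural[OF C(2)] by simp
  then show "ccomp (QV_lower L) (cmap (QV_fun G) \<phi>) (tpath (QV_trans \<xi>) (vdom (QV_lower K) f) js) =
     ccomp (QV_lower L) (hd (tpath (QV_trans \<xi>) (vcod (QV_lower K) f) ks)) [cmap (QV_fun F) \<phi>]"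
    using is_cellD(1)[OF p] by (simp add: tJ_def tK_def)
next
  show "tob (QV_trans \<xi>) \<in> extensional (Ob (QV_lower K))"
    "thor (QV_trans \<xi>) \<in> extensional (Hor (QV_lower K))"
    by (simp_all add: QV_trans_def avtrans_restrict_def)
qed (use tob_natural in auto)

end

lemma ex_quintet_trans:
  assumes "is_trans K L F G \<xi>"
  obtains \<epsilon> \<epsilon>' where "quintet_trans K L F G \<xi> \<epsilon> \<epsilon>'"
proof -
  have F: "is_fun K L F" using is_trans_funs[OF assms] by simp
  obtain \<epsilon> where "quintet_companions K \<epsilon>" using ex_quintet_companions is_fun_avdc[OF F] by blast
  moreover obtain \<epsilon>' where "quintet_companions L \<epsilon>'" using ex_quintet_companions is_fun_avdc[OF F]
    by blast
  ultimately have "quintet_trans K L F G \<xi> \<epsilon> \<epsilon>'"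
    by (intro quintet_trans.intro is_trans_between[OF assms])
  then show ?thesis by (rule that)
qed

lemma is_trans_QV:
  assumes "is_trans K L F G \<xi>"
  shows "is_trans (QV_lower K) (QV_lower L) (QV_fun F) (QV_fun G) (QV_trans \<xi>)"
proof -
  obtain \<epsilon> \<epsilon>' where "quintet_trans K L F G \<xi> \<epsilon> \<epsilon>'" using ex_quintet_trans[OF assms] .
  then interpret quintet_trans K L F G \<xi> \<epsilon> \<epsilon>' .
  show ?thesis by (rule is_trans_QV)
qed

lemma (in quintet_companions) mpath_Ver: "mp A js B \<Longrightarrow> j \<in> set js \<Longrightarrow> j \<in> Ver K"
  by (induction js arbitrary: A) auto

text \<open>Stated for cells of \<open>QV_lower K\<close> because \<open>avfun_comp\<close> takes
  its intended values only on the carriers, so every constituent of the quintet has to be located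
  there.\<close>

lemma qmap_comp:
  assumes F: "is_fun K L F" and p: "is_cell (QV_lower K) f js ks g \<phi>"
  shows "qmap (avfun_comp G F) \<phi> = qmap G (qmap F \<phi>)"
proof -
  obtain \<epsilon> where "quintet_companions K \<epsilon>" using ex_quintet_companions is_fun_avdc[OF F] by blast
  then interpret quintet_companions K \<epsilon> .
  interpret F: functor_between K L F using F by (rule is_fun_between)
  note C = QV_cell[OF p]
  show ?thesis
    using C mpath_Ver[OF C(3)] mpath_Ver[OF C(4)] is_cellD(1)[OF C(8)] by (simp add: qmap_def)
qed

lemma qmap_id:
  assumes K: "aug_virt_dbl_cat K" and p: "is_cell (QV_lower K) f js ks g \<phi>"
  shows "qmap (avfun_id K) \<phi> = \<phi>"
proof -
  obtain \<epsilon> where "quintet_companions K \<epsilon>" using ex_quintet_companions K by blast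
  then interpret quintet_companions K \<epsilon> .
  note C = QV_cell[OF p]
  have "\<phi> = Quint f js ks g (qc \<phi>)" using p by (auto simp: is_cell_QV)
  then show ?thesis
    using C mpath_Ver[OF C(3)] mpath_Ver[OF C(4)] is_cellD(1)[OF C(8)]
    by (simp add: qmap_def map_idI)
qed

lemma QV_fun_comp:
  assumes F: "is_fun K L F" and G: "is_fun L M G"
  shows "QV_fun (avfun_comp G F) = avfun_comp (QV_fun G) (QV_fun F)"
proof -
  interpret F: functor_between K L F using F by (rule is_fun_between)
  interpret G: functor_between L M G using G by (rule is_fun_between)
  interpret RF: functor_between "QV_lower K" "QV_lower L" "QV_fun F" using is_fun_QV[OF F] by
    (rule is_fun_between)
  show ?thesis
  proof (rule is_fun_eqI[OF is_fun_QV[OF is_fun_comp[OF F G]] is_fun_comp[OF is_fun_QV[OF F]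
    is_fun_QV[OF G]]])
    fix \<phi> assume p: "\<phi> \<in> Cell (QV_lower K)"
    then show "cmap (QV_fun (avfun_comp G F)) \<phi> = cmap (avfun_comp (QV_fun G) (QV_fun F)) \<phi>"
      using RF.map_in(4)[OF p] qmap_comp[OF F is_cellI[OF p]] by simp
  next
    fix J assume J: "J \<in> Hor (QV_lower K)"
    then show "hmap (QV_fun (avfun_comp G F)) J = hmap (avfun_comp (QV_fun G) (QV_fun F)) J"
      using RF.map_in(3)[OF J] by simp
  qed auto
qed

lemma qmap_square:
  assumes F: "is_fun K L F" and "v \<in> Ver K" "h \<in> Ver K" "vcod K h = vdom K v"
  shows "qmap F (square K u h k v) = square L (vmap F u) (vmap F h) (vmap F k) (vmap F v)"
proof -
  interpret F: functor_between K L F using F by (rule is_fun_between)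
  show ?thesis using assms by (simp add: qmap_def square_def)
qed

lemma QV_lower_strict_two_functor:
  "strict_two_functor AugVirtDblCat AugVirtDblCat (QV_lower_two_fun :: ('a univ avdc, _, _, _, _, _)
    two_fun)"
proof (rule strict_two_functor_AVDC)
  fix K :: "'a univ avdc" assume K: "aug_virt_dbl_cat K"
  obtain \<epsilon> where "quintet_companions K \<epsilon>" using ex_quintet_companions K by blast
  then interpret quintet_companions K \<epsilon> .
  show "aug_virt_dbl_cat (T0 QV_lower_two_fun K)" using QV_lower_avdc by simp
  have "QV_fun (avfun_id K) = avfun_id (QV_lower K)"
  proof (rule is_fun_eqI[of "QV_lower K" "QV_lower K"])
    show "is_fun QK QK (QV_fun (avfun_id K))" using is_fun_QV[OF is_fun_id[OF K]] .
    show "is_fun QK QK (avfun_id QK)" using is_fun_id[OF QV_lower_avdc] .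
    fix \<phi> assume p: "\<phi> \<in> Cell QK"
    then show "cmap (QV_fun (avfun_id K)) \<phi> = cmap (avfun_id QK) \<phi>"
      using qmap_id[OF K is_cellI[OF p]] by simp
  qed auto
  then show "T1 QV_lower_two_fun (avfun_id K) = avfun_id (T0 QV_lower_two_fun K)" by simp
next
  fix K L :: "'a univ avdc" and F assume "is_fun K L F"
  then show "is_fun (T0 QV_lower_two_fun K) (T0 QV_lower_two_fun L) (T1 QV_lower_two_fun F)" by
    (simp add: is_fun_QV)
next
  fix K L :: "'a univ avdc" and F G \<xi> assume "is_trans K L F G \<xi>"
  then show "is_trans (T0 QV_lower_two_fun K) (T0 QV_lower_two_fun L) (T1 QV_lower_two_fun F) (T1
    QV_lower_two_fun G) (T2 QV_lower_two_fun \<xi>)"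
    by (simp add: is_trans_QV)
next
  fix K L M :: "'a univ avdc" and F G assume F: "is_fun K L F" and G: "is_fun L M G"
  show "T1 QV_lower_two_fun (avfun_comp G F)
    = avfun_comp (T1 QV_lower_two_fun G) (T1 QV_lower_two_fun F)"
    using QV_fun_comp[OF F G] by simp
next
  fix K L :: "'a univ avdc" and F assume F: "is_fun K L F"
  interpret F: functor_between K L F using F by (rule is_fun_between)
  have "QV_trans (avtrans_id F) = avtrans_id (QV_fun F)"
    using is_trans_QV[OF is_trans_id[OF F]] is_trans_id[OF is_fun_QV[OF F]]
    by (rule is_trans_eqI) (auto simp: avtrans_id_def square_def)
  then show "T2 QV_lower_two_fun (avtrans_id F) = avtrans_id (T1 QV_lower_two_fun F)" by simp
next
  fix K L :: "'a univ avdc" and F G H \<xi> \<zeta> assume x: "is_trans K L F G \<xi>" and z: "is_trans K L G H \<zeta>"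
  interpret \<xi>: trans_between K L F G \<xi> using x by (rule is_trans_between)
  interpret \<zeta>: trans_between K L G H \<zeta> using z by (rule is_trans_between)
  obtain \<epsilon> where "quintet_companions L \<epsilon>"
    using ex_quintet_companions \<xi>.F.tgt.aug_virt_dbl_cat_axioms by blast
  then interpret QL: quintet_companions L \<epsilon> .
  have "QV_trans (avtrans_vert \<zeta> \<xi>) = avtrans_vert (QV_trans \<zeta>) (QV_trans \<xi>)"
    using is_trans_QV[OF is_trans_vert[OF x z]] is_trans_vert[OF is_trans_QV[OF x] is_trans_QV[OF
      z]]
  proof (rule is_trans_eqI)
    fix j assume "j \<in> Hor (QV_lower K)"
    then have j: "j \<in> Ver K" "has_companion K j" by auto
    have "qcomp (V L) (square L (tob \<zeta> (vdom K j)) (vmap G j) (vmap H j) (tob \<zeta> (vcod K j)))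
        [square L (tob \<xi> (vdom K j)) (vmap F j) (vmap G j) (tob \<xi> (vcod K j))] =
       square L (vcomp L (tob \<zeta> (vdom K j)) (tob \<xi> (vdom K j))) (vmap F j) (vmap H j) (vcomp L (tob
         \<zeta> (vcod K j)) (tob \<xi> (vcod K j)))"
      by (rule QL.qcomp_square)
        (use j \<xi>.F.has_companion_map \<xi>.G.has_companion_map \<zeta>.G.has_companion_map \<xi>.tob_natural
          \<zeta>.tob_natural in auto)
    then show "thor (QV_trans (avtrans_vert \<zeta> \<xi>)) j
      = thor (avtrans_vert (QV_trans \<zeta>) (QV_trans \<xi>)) j"
      using j by simp
  qed auto
  then show "T2 QV_lower_two_fun (avtrans_vert \<zeta> \<xi>)
    = avtrans_vert (T2 QV_lower_two_fun \<zeta>) (T2 QV_lower_two_fun \<xi>)" by simp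
next
  fix K L M :: "'a univ avdc" and F G S R \<xi> \<zeta> assume x: "is_trans K L F G \<xi>" and z:
    "is_trans L M S R \<zeta>"
  interpret \<xi>: trans_between K L F G \<xi> using x by (rule is_trans_between)
  interpret \<zeta>: trans_between L M S R \<zeta> using z by (rule is_trans_between)
  interpret RX: trans_between "QV_lower K" "QV_lower L" "QV_fun F" "QV_fun G" "QV_trans \<xi>"
    using is_trans_QV[OF x] by (rule is_trans_between)
  obtain \<epsilon> where "quintet_companions M \<epsilon>"
    using ex_quintet_companions \<zeta>.F.tgt.aug_virt_dbl_cat_axioms by blast
  then interpret QM: quintet_companions M \<epsilon> .
  have c: "QV_fun (avfun_comp S F) = avfun_comp (QV_fun S) (QV_fun F)"
    "QV_fun (avfun_comp R G) = avfun_comp (QV_fun R) (QV_fun G)"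
    using QV_fun_comp \<xi>.F.F \<xi>.G.F \<zeta>.F.F \<zeta>.G.F by blast+
  have "QV_trans (avtrans_horz \<zeta> \<xi>) = avtrans_horz (QV_trans \<zeta>) (QV_trans \<xi>)"
    using is_trans_QV[OF is_trans_horz[OF x z], unfolded c] is_trans_horz[OF is_trans_QV[OF x]
      is_trans_QV[OF z]]
  proof (rule is_trans_eqI)
    fix j assume jj: "j \<in> Hor (QV_lower K)"
    then have j: "j \<in> Ver K" "has_companion K j" by auto
    let ?a = "tob \<xi> (vdom K j)" and ?b = "tob \<xi> (vcod K j)"
    \<comment> \<open>The horizontal composite at j is made of S applied to the square of \<xi> at j
      and the square of \<zeta> at G j. That these commute is the content of \<open>n\<close> and
      \<open>n2\<close>.\<close>
    have n: "vcomp M (vmap S (vmap G j)) (vmap S ?a) = vcomp M (vmap S ?b) (vmap S (vmap F j))"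
      using arg_cong[OF \<xi>.tob_natural[OF j(1)], of "vmap S"] j by simp
    have hc: "has_companion M (vmap S (vmap F j))" "has_companion M (vmap S (vmap G j))"
      "has_companion M (vmap R (vmap G j))"
      using j \<xi>.F.has_companion_map \<xi>.G.has_companion_map \<zeta>.F.has_companion_map
        \<zeta>.G.has_companion_map by auto
    have n2: "vcomp M (vmap R (vmap G j)) (tob \<zeta> (omap G (vdom K j)))
      = vcomp M (tob \<zeta> (omap G (vcod K j))) (vmap S (vmap G j))"
      using \<zeta>.tob_natural[of "vmap G j"] j by simp
    have "qcomp (V M) (square M (tob \<zeta> (omap G (vdom K j))) (vmap S (vmap G j)) (vmap R (vmap G j))
      (tob \<zeta> (omap G (vcod K j))))
        [square M (vmap S ?a) (vmap S (vmap F j)) (vmap S (vmap G j)) (vmap S ?b)] =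
       square M (vcomp M (tob \<zeta> (omap G (vdom K j))) (vmap S ?a)) (vmap S (vmap F j)) (vmap R (vmap
         G j)) (vcomp M (tob \<zeta> (omap G (vcod K j))) (vmap S ?b))"
      by (rule QM.qcomp_square) (use j hc n n2 in auto)
    then show "thor (QV_trans (avtrans_horz \<zeta> \<xi>)) j
      = thor (avtrans_horz (QV_trans \<zeta>) (QV_trans \<xi>)) j"
      using j RX.thor_in[OF jj] \<xi>.G.has_companion_map qmap_square[OF \<zeta>.F.F] by simp
  qed auto
  then show "T2 QV_lower_two_fun (avtrans_horz \<zeta> \<xi>)
    = avtrans_horz (T2 QV_lower_two_fun \<zeta>) (T2 QV_lower_two_fun \<xi>)" by simp
qed auto


section \<open>Pseudonaturality\<close>

context quintet_functor
begin

text \<open>Functors preserve companions, so \<open>F (j\<^sub>*)\<close> and \<open>(F j)\<^sub>*\<close> are canonically isomorphic.\<close>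

lemma ex_comparison:
  assumes j: "has_companion K j"
  shows "\<exists>s s'. is_cell L (vid L (vdom L (vmap F j))) [hmap F (QK.ch j)] [QL.ch (vmap F j)] (vid L
    (vcod L (vmap F j))) s \<and>
      ccomp L (\<epsilon>' (vmap F j)) [s] = cmap F (\<epsilon> j) \<and>
      is_cell L (vid L (vdom L (vmap F j))) [QL.ch (vmap F j)] [hmap F (QK.ch j)] (vid L (vcod L
        (vmap F j))) s' \<and>
      ccomp L s' [s] = hidc L (hmap F (QK.ch j)) \<and> ccomp L s [s'] = hidc L (QL.ch (vmap F j))"
proof -
  obtain \<eta> where p: "companion_pair K j (QK.ch j) (\<epsilon> j) \<eta>" using QK.has_companion_pair[OF j]
    by blast
  obtain \<eta>' where p': "companion_pair L (vmap F j) (QL.ch (vmap F j)) (\<epsilon>' (vmap F j)) \<eta>'"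
    using QL.has_companion_pair[OF has_companion_map[OF j]] by blast
  show ?thesis using tgt.companion_comparison[OF companion_pair_map[OF p] p'] by blast
qed

text \<open>Factorizations through the counit are unique, so it can be cancelled. All identities
  between comparison cells are obtained by this test.\<close>

lemma comparison_unique:
  assumes j: "has_companion L j"
    and s: "is_cell L h Hs [QL.ch j] k s" "is_cell L h Hs [QL.ch j] k s'" "vcod L h = vdom L j"
    and e: "ccomp L (\<epsilon>' j) [s] = ccomp L (\<epsilon>' j) [s']"
  shows "s = s'"
proof -
  obtain \<eta> where p: "companion_pair L j (QL.ch j) (\<epsilon>' j) \<eta>" using QL.has_companion_pair[OF j]
    by blast
  have v: "h \<in> Ver L" "k \<in> Ver L" using tgt.is_cell_Ver[OF s(1)] by auto
  note jj = QL.counit_cell[OF j]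
  have kd: "vdom L (vid L (vcod L j)) = vcod L k"
    using tgt.is_cell_hpath[OF s(1)] jj v by simp
  have "is_cell L (vcomp L j h) Hs [] (vcomp L (vid L (vcod L j)) k) (ccomp L (\<epsilon>' j) [s])"
    by (rule tgt.is_cell_ccomp_1[OF jj(1) s(1)]) (use s v in simp)
  then have "is_cell L (vcomp L j h) Hs [] k (ccomp L (\<epsilon>' j) [s])" using kd v jj by simp
  from tgt.companion_factor[OF p this v(1) s(3)] s e show ?thesis by auto
qed

text \<open>The direction, from the F-image of the companion of j to the companion of F j, is that
  of the structure cells in \<open>pseudonatural\<close>.\<close>

definition comparison :: "'a univ \<Rightarrow> 'a univ" where
  "comparison j = (THE s. is_cell L (vid L (vdom L (vmap F j))) [hmap F (QK.ch j)] [QL.ch (vmap F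
    j)] (vid L (vcod L (vmap F j))) s \<and>
      ccomp L (\<epsilon>' (vmap F j)) [s] = cmap F (\<epsilon> j))"

lemma comparison_eqI:
  assumes j: "has_companion K j"
    and s: "is_cell L (vid L (vdom L (vmap F j))) [hmap F (QK.ch j)] [QL.ch (vmap F j)] (vid L (vcod
      L (vmap F j))) s"
      "ccomp L (\<epsilon>' (vmap F j)) [s] = cmap F (\<epsilon> j)"
  shows "comparison j = s"
  unfolding comparison_def
proof (rule the_equality)
  fix s' assume s': "is_cell L (vid L (vdom L (vmap F j))) [hmap F (QK.ch j)] [QL.ch (vmap F j)]
    (vid L (vcod L (vmap F j))) s' \<and>
    ccomp L (\<epsilon>' (vmap F j)) [s'] = cmap F (\<epsilon> j)"
  have "vmap F j \<in> Ver L" using QL.counit_cell(2)[OF has_companion_map[OF j]] .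
  then show "s' = s"
    by (intro comparison_unique[OF has_companion_map[OF j] conjunct1[OF s'] s(1)])
      (use s(2) s' in simp_all)
qed (use s in simp)

lemma comparison:
  assumes j: "has_companion K j"
  shows "is_cell L (vid L (vdom L (vmap F j))) [hmap F (QK.ch j)] [QL.ch (vmap F j)] (vid L (vcod L
    (vmap F j))) (comparison j)"
    "ccomp L (\<epsilon>' (vmap F j)) [comparison j] = cmap F (\<epsilon> j)"
    "\<exists>s'. is_cell L (vid L (vdom L (vmap F j))) [QL.ch (vmap F j)] [hmap F (QK.ch j)] (vid L (vcod L
      (vmap F j))) s' \<and>
      ccomp L s' [comparison j] = hidc L (hmap F (QK.ch j)) \<and> ccomp L (comparison j) [s']
        = hidc L (QL.ch (vmap F j))"
  using ex_comparison[OF j] comparison_eqI[OF j] by metis+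

lemma comparison_family:
  "\<forall>j\<in>X. has_companion K j \<Longrightarrow>
     tgt.horizontal_family (\<lambda>j. hmap F (QK.ch j)) (\<lambda>j. QL.ch (vmap F j)) comparison X"
  using comparison(1) QK.counit_cell by (auto simp: tgt.horizontal_family_def)

text \<open>In each factor of \<open>counits\<close> the defining equation of a comparison cell
  turns the chosen counit of L into the image of that of K. The leading identity covers the empty
  path.\<close>

lemma counits_comparison:
  "QK.mp A js B \<Longrightarrow> \<forall>j\<in>set js. has_companion K j \<Longrightarrow> g \<in> Ver K \<Longrightarrow> vdom K g = B \<Longrightarrow>
   ccomp L (counits L \<epsilon>' (vmap F g) (map (vmap F) js)) (vidc L (vid L (omap F A)) # map comparison
     js) =
   cmap F (counits K \<epsilon> g js)"
proof (induction js arbitrary: A)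
  case Nil
  then show ?case using tgt.vidc_vidc[of "vid L (omap F B)" "vmap F g"] by auto
next
  case (Cons j js)
  let ?C = "vcod K j"
  have m: "QK.mp ?C js B" and h: "has_companion K j" and j: "j \<in> Ver K" and A: "A = vdom K j"
    and hs: "\<forall>j\<in>set js. has_companion K j"
    using Cons.prems by auto
  note mL = mpath_map[OF m]
  note hL = has_companion_map[OF h]
  have hsL: "\<forall>j\<in>set (map (vmap F) js). has_companion L j" using hs has_companion_map by auto
  note M = src.mpath_comp_Ver[OF m] and mcL = tgt.mpath_comp_Ver[OF mL]
  let ?g = "vcomp K g (QK.mc ?C js)"
  have Fg: "vmap F ?g = vcomp L (vmap F g) (QL.mc (omap F ?C) (map (vmap F) js))"
    using mpath_comp_map[OF m] M Cons.prems by simp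
  have e: "is_cell K (vcomp K ?g j) [QK.ch j] [] ?g (whisk K ?g (\<epsilon> j))"
    by (rule QK.is_cell_whisk_counit[OF h]) (use M Cons.prems in auto)
  have w: "is_cell K ?g (map QK.ch js) [] g (counits K \<epsilon> g js)"
    by (rule QK.is_cell_counits[OF m hs]) (use Cons.prems in auto)
  have eL: "is_cell L (vcomp L (vmap F ?g) (vmap F j)) [QL.ch (vmap F j)] [] (vmap F ?g) (whisk L
    (vmap F ?g) (\<epsilon>' (vmap F j)))"
    by (rule QL.is_cell_whisk_counit[OF hL]) (use M Cons.prems in auto)
  have wL: "is_cell L (vmap F ?g) (map QL.ch (map (vmap F) js)) [] (vmap F g) (counits L \<epsilon>' (vmap F
    g) (map (vmap F) js))"
    unfolding Fg by (rule QL.is_cell_counits[OF mL hsL]) (use Cons.prems in auto)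
  note s = comparison(1)[OF h]
  let ?X = "counits L \<epsilon>' (vmap F g) (map (vmap F) (j # js))"
  have X: "?X = hcomp L (whisk L (vmap F ?g) (\<epsilon>' (vmap F j))) (counits L \<epsilon>' (vmap F g) (map (vmap F)
    js))"
    using Fg j by simp
  have Xc: "is_cell L (vcomp L (vmap F ?g) (vmap F j)) (map (\<lambda>j. QL.ch (vmap F j)) (j # js)) []
    (vmap F g) ?X"
    unfolding X using tgt.is_cell_hcomp[OF eL wL] by (simp add: comp_def)
  have hp: "hpath L (vdom L (vcomp L (vmap F ?g) (vmap F j))) (map (\<lambda>j. hmap F (QK.ch j)) (j # js))
    (vdom L (vmap F g))"
    using tgt.is_cell_hpath[OF is_cell_cmap[OF src.is_cell_hcomp[OF e w]]] M j Cons.prems by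
      (simp add: comp_def)
  have vd: "vdom L (vcomp L (vmap F ?g) (vmap F j)) = omap F A" using M j Cons.prems A by simp
  have cX: "composable L ?X (vidc L (vid L (omap F A)) # map comparison (j # js))"
    using tgt.composable_vidc_family(1)[OF comparison_family Xc hp] Cons.prems vd by simp
  let ?i = "vidc L (vid L (omap F A))"
  have obs: "omap F A \<in> Ob L" "omap F ?C \<in> Ob L" using j A by auto
  have ii: "is_cell L (vid L (omap F A)) [] [] (vid L (omap F A)) ?i" using tgt.is_cell_vidc obs
    by simp
  have cp: "cpath L (vid L (omap F A)) [?i, comparison j] (vid L (omap F ?C))"
    using s A j obs by (simp add: is_cell_def tgt.vidc_in tgt.vsrc_vidc tgt.vtgt_vidc)
  have c1: "composable L (whisk L (vmap F ?g) (\<epsilon>' (vmap F j))) [?i, comparison j]"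
    by (rule tgt.composable_2[of _ "[]", OF _ ii]) (use eL s A j M obs Cons.prems in auto)
  have c1': "composable L (whisk L (vmap F ?g) (\<epsilon>' (vmap F j))) [comparison j]"
    by (rule tgt.composable_1[OF eL s]) (use A j M obs Cons.prems in auto)
  have hpj: "hpath L (vdom L (vmap F ?g)) (map (\<lambda>j. hmap F (QK.ch j)) js) (vdom L (vmap F g))"
    using hp M j Cons.prems QK.counit_cell[OF h] by simp
  have wL': "is_cell L (vmap F ?g) (map (\<lambda>j. QL.ch (vmap F j)) js) [] (vmap F g) (counits L \<epsilon>' (vmap
    F g) (map (vmap F) js))"
    using wL by (simp add: comp_def)
  have c2: "composable L (counits L \<epsilon>' (vmap F g) (map (vmap F) js)) (vidc L (vid L (omap F ?C)) #
    map comparison js)"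
    using tgt.composable_vidc_family(1)[OF comparison_family[OF hs] wL' hpj] M Cons.prems by simp
  \<comment> \<open>The identity inserted at the object between j and js becomes the leading
    identity of the induction hypothesis.\<close>
  have "ccomp L ?X (?i # map comparison (j # js))
    = ccomp L ?X ([?i, comparison j] @ [vidc L (vid L (omap F ?C))] @ map comparison js)"
    using tgt.ccomp_insert_vidc'(2)[OF _ cp obs(2), of ?X "map comparison js"] cX by simp
  also have "\<dots> = hcomp L (ccomp L (whisk L (vmap F ?g) (\<epsilon>' (vmap F j))) [?i, comparison j])
      (ccomp L (counits L \<epsilon>' (vmap F g) (map (vmap F) js)) (vidc L (vid L (omap F ?C)) # map
        comparison js))"
    unfolding X using tgt.hcomp_ccomp[OF eL wL c1 c2] s obs j by
      (simp add: is_cell_def tgt.vsrc_vidc)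
  also have "ccomp L (counits L \<epsilon>' (vmap F g) (map (vmap F) js)) (vidc L (vid L (omap F ?C)) # map
    comparison js) = cmap F (counits K \<epsilon> g js)"
    using Cons.IH[OF m hs] Cons.prems by simp
  also have "ccomp L (whisk L (vmap F ?g) (\<epsilon>' (vmap F j))) [?i, comparison j]
    = ccomp L (whisk L (vmap F ?g) (\<epsilon>' (vmap F j))) [comparison j]"
    using tgt.ccomp_vidc_Cons[OF c1'] s A j by (simp add: is_cell_def)
  also have "\<dots> = whisk L (vmap F ?g) (ccomp L (\<epsilon>' (vmap F j)) [comparison j])"
    by (rule tgt.whisk_ccomp[symmetric, OF QL.counit_cell(1)[OF hL]])
      (use M j Cons.prems obs s in \<open>auto intro!: tgt.composable_1[OF QL.counit_cell(1)[OF hL] s]\<close>)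
  also have "\<dots> = cmap F (whisk K ?g (\<epsilon> j))"
    using comparison(2)[OF h] cmap_whisk[OF QK.counit_cell(1)[OF h], of ?g] M Cons.prems by simp
  also have "hcomp L (cmap F (whisk K ?g (\<epsilon> j))) (cmap F (counits K \<epsilon> g js))
    = cmap F (counits K \<epsilon> g (j # js))"
    using cmap_hcomp[OF e w] by simp
  finally show ?case .
qed

definition comparison_trans :: "'a univ avtrans" where
  "comparison_trans = \<lparr>tsrc = avfun_comp (Rep_fun F) (lower_star K \<epsilon>), ttgt
    = avfun_comp (lower_star L \<epsilon>') (QV_fun F),
     tob = (\<lambda>A\<in>Ob K. vid L (omap F A)), thor = (\<lambda>j\<in>Hor (QV_lower K). comparison j)\<rparr>"

lemma counits_single_vid:
  assumes "has_companion L j"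
  shows "counits L \<epsilon>' (vid L (vcod L j)) [j] = \<epsilon>' j"
  using QL.counits_single[OF assms, of "vid L (vcod L j)"] QL.counit_cell[OF assms]
    tgt.whisk_vid[OF QL.counit_cell(1)[OF assms]] by (simp del: counits.simps)

lemma is_fun_ends:
  "is_fun (QV_lower K) (Rep L) (avfun_comp (Rep_fun F) (lower_star K \<epsilon>))"
  "is_fun (QV_lower K) (Rep L) (avfun_comp (lower_star L \<epsilon>') (QV_fun F))"
  using is_fun_comp[OF QK.is_fun_lower_star is_fun_Rep[OF F]] is_fun_comp[OF is_fun_QV
    QL.is_fun_lower_star] by auto

text \<open>Naturality at a quintet is tested after composition with the counits of its horizontal
  target in L. There the defining equation of the image of F \<phi> and
  \<open>counits_comparison\<close> reduce it to F applied to the defining equation of the image of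
  \<phi>.\<close>

lemma is_trans_comparison:
  "is_trans (QV_lower K) (Rep L) (avfun_comp (Rep_fun F) (lower_star K \<epsilon>)) (avfun_comp (lower_star L
    \<epsilon>') (QV_fun F)) comparison_trans"
proof (rule is_transI[OF is_fun_ends])
  fix j assume "j \<in> Hor (QV_lower K)"
  then have j: "j \<in> Ver K" "has_companion K j" by auto
  show "is_cell (Rep L) (tob comparison_trans (hdom (QV_lower K) j)) [hmap (avfun_comp (Rep_fun F)
    (lower_star K \<epsilon>)) j]
      [hmap (avfun_comp (lower_star L \<epsilon>') (QV_fun F)) j] (tob comparison_trans (hcod (QV_lower K)
        j)) (thor comparison_trans j)"
    using comparison(1)[OF j(2)] j QK.counit_cell[OF j(2)] QK.chosen_representable[OF j(2)]
      has_companion_map[OF j(2)]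
      QL.chosen_representable[OF has_companion_map[OF j(2)]] representable_map
    by (simp add: comparison_trans_def is_cell_Rep)
next
  fix f js ks g \<phi> assume p: "is_cell (QV_lower K) f js ks g \<phi>"
  note C = QK.QV_cell[OF p] and S = QK.star_cell[OF p]
  note M = src.mpath_comp_Ver[OF C(3)] src.mpath_comp_Ver[OF C(4)]
  note q = is_cell_qmap[OF p]
  note S' = QL.star_cell[OF q]
  let ?A = "vdom K f" and ?C = "vcod K f" and ?D = "vcod K g"
  let ?i = "vidc L (vid L (omap F ?A))"
  have obs: "?A \<in> Ob K" "?C \<in> Ob K" "?D \<in> Ob K" using C by auto
  have tp: "tpath comparison_trans A js = (if js
    = [] then [vidc L (vid L (omap F A))] else map comparison js)"
    if "\<forall>j\<in>set js. has_companion K j" "A \<in> Ob K" for A js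
  proof -
    have "map (\<lambda>j\<in>Hor (QV_lower K). comparison j) js = map comparison js"
      using that QK.counit_cell(2) by auto
    then show ?thesis using that by (simp add: tpath_def comparison_trans_def)
  qed
  define X where "X = QL.star (qmap F \<phi>)"
  define tJ where "tJ = (if js = [] then [?i] else map comparison js)"
  define tK where "tK = hd (tpath comparison_trans ?C ks)"
  have X: "is_cell L (vmap F f) (map (\<lambda>j. QL.ch (vmap F j)) js) (map (\<lambda>j. QL.ch (vmap F j)) ks)
    (vmap F g) X"
    using S'(1) by (simp add: X_def comp_def)
  have FS: "is_cell L (vmap F f) (map (\<lambda>j. hmap F (QK.ch j)) js) (map (\<lambda>j. hmap F (QK.ch j)) ks)
    (vmap F g) (cmap F (QK.star \<phi>))"
    using is_cell_cmap[OF S(1)] by (simp add: comp_def)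
  have HJ: "hpath L (vdom L (vmap F f)) (map (\<lambda>j. hmap F (QK.ch j)) js) (vdom L (vmap F g))"
    and HK: "hpath L (vcod L (vmap F f)) (map (\<lambda>j. hmap F (QK.ch j)) ks) (vcod L (vmap F g))"
    using tgt.is_cell_hpath[OF FS] by auto
  note fam = comparison_family[OF C(6)]
  have tJ: "ccomp L X tJ = ccomp L X (?i # map comparison js)"
    "composable L X (?i # map comparison js)"
    "is_cell L (vmap F f) (map (\<lambda>j. hmap F (QK.ch j)) js) (map (\<lambda>j. QL.ch (vmap F j)) ks) (vmap F g)
      (ccomp L X (?i # map comparison js))"
    using tgt.ccomp_family_path(1)[OF fam HJ X] tgt.composable_vidc_family[OF fam X HJ]
    unfolding tJ_def map_simps(1)[OF C(1)] by simp_all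
  let ?E = "counits L \<epsilon>' (vid L (vcod L (vmap F g))) (map (vmap F) ks)"
  \<comment> \<open>A unary target contributes one comparison cell and a nullary one an identity
    cell; composed with the counits in L, both give the F-image of the counits in K.\<close>
  have tK: "is_cell L (vid L (omap F ?C)) (map (\<lambda>j. hmap F (QK.ch j)) ks) (map (\<lambda>j. QL.ch (vmap F
    j)) ks) (vid L (omap F ?D)) tK"
    and Kc: "ccomp L ?E [tK] = cmap F (counits K \<epsilon> (vid K ?D) ks)"
  proof -
    have "is_cell L (vid L (omap F ?C)) (map (\<lambda>j. hmap F (QK.ch j)) ks) (map (\<lambda>j. QL.ch (vmap F j))
      ks) (vid L (omap F ?D)) tK \<and>
      ccomp L ?E [tK] = cmap F (counits K \<epsilon> (vid K ?D) ks)"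
    proof (cases ks)
      case Nil
      then show ?thesis using tp[of "[]" ?C] C(4) obs tgt.is_cell_vidc[of "vid L (omap F ?C)"] C
        by (simp add: tK_def tgt.vidc_vidc)
    next
      case (Cons k ks')
      then have k: "ks = [k]" "has_companion K k" "k \<in> Ver K" "vdom K k = ?C" "?D = vcod K k"
        using C(4,5,7) by auto
      have "tK = comparison k" using tp[OF C(7), of ?C] obs k by (simp add: tK_def)
      moreover have "counits K \<epsilon> (vid K ?D) ks = \<epsilon> k"
        unfolding k(1,5) using QK.counits_single[OF k(2), of
          "vid K (vcod K k)"] QK.counit_cell[OF k(2)]
          src.whisk_vid[OF QK.counit_cell(1)[OF k(2)]] by (simp del: counits.simps)
      moreover have "?E = \<epsilon>' (vmap F k)"
        using counits_single_vid[OF has_companion_map[OF k(2)]] k C by (simp del: counits.simps)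
      ultimately show ?thesis using comparison[OF k(2)] k C by simp
    qed
    then show "is_cell L (vid L (omap F ?C)) (map (\<lambda>j. hmap F (QK.ch j)) ks) (map (\<lambda>j. QL.ch (vmap F
      j)) ks) (vid L (omap F ?D)) tK"
      "ccomp L ?E [tK] = cmap F (counits K \<epsilon> (vid K ?D) ks)" by auto
  qed
  have rhs: "is_cell L (vmap F f) (map (\<lambda>j. hmap F (QK.ch j)) js) (map (\<lambda>j. QL.ch (vmap F j)) ks)
    (vmap F g) (ccomp L tK [cmap F (QK.star \<phi>)])"
    using tgt.is_cell_ccomp_1[OF tK FS] C by simp
  note qC = QL.QV_cell[OF q]
  note qM = tgt.mpath_comp_Ver[OF qC(3)] tgt.mpath_comp_Ver[OF qC(4)]
  have E: "is_cell L (QL.mc (omap F ?C) (map (vmap F) ks)) (map QL.ch (map (vmap F) ks)) [] (vid L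
    (omap F ?D)) ?E"
    using QL.is_cell_counits[OF qC(4) qC(7), of "vid L (vcod L (vmap F g))"] C qM by simp
  have E': "is_cell L (QL.mc (omap F ?C) (map (vmap F) ks)) (map (\<lambda>j. QL.ch (vmap F j)) ks) [] (vid
    L (omap F ?D)) ?E"
    using E by (simp add: comp_def)
  have W: "is_cell L (vcomp L (vmap F g) (QL.mc (omap F ?A) (map (vmap F) js))) (map QL.ch (map
    (vmap F) js)) [] (vmap F g) (counits L \<epsilon>' (vmap F g) (map (vmap F) js))"
    using QL.is_cell_counits[OF qC(3) qC(6), of "vmap F g"] C by simp
  have W': "is_cell L (vcomp L (vmap F g) (QL.mc (omap F ?A) (map (vmap F) js))) (map (\<lambda>j. QL.ch
    (vmap F j)) js) [] (vmap F g) (counits L \<epsilon>' (vmap F g) (map (vmap F) js))"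
    using W by (simp add: comp_def)
  have qq: "is_cell L (vcomp L (QL.mc (omap F ?C) (map (vmap F) ks)) (vmap F f)) [] [] (vcomp L
    (vmap F g) (QL.mc (omap F ?A) (map (vmap F) js))) (cmap F (qc \<phi>))"
    using qC(8) C by (simp add: qc_qmap)
  have kW: "is_cell K (vcomp K g (QK.mc ?A js)) (map QK.ch js) [] g (counits K \<epsilon> g js)"
    by (rule QK.is_cell_counits[OF C(3) C(6)]) (use C in auto)
  have kE: "is_cell K (QK.mc ?C ks) (map QK.ch ks) [] (vid K ?D) (counits K \<epsilon> (vid K ?D) ks)"
    using QK.is_cell_counits[OF C(4) C(7), of "vid K ?D"] obs M by simp
  have oA: "omap F ?A \<in> Ob L" using obs by simp
  have ii: "is_cell L (vid L (omap F ?A)) [] [] (vid L (omap F ?A)) ?i" using tgt.is_cell_vidc oA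
    by simp
  have hp2: "hpath L (vdom L (vcomp L (vmap F g) (QL.mc (omap F ?A) (map (vmap F) js)))) (map (\<lambda>j.
    hmap F (QK.ch j)) js) (vdom L (vmap F g))"
    using HJ qM C by simp
  have cW: "composable L (counits L \<epsilon>' (vmap F g) (map (vmap F) js)) (?i # map comparison js)"
    using tgt.composable_vidc_family(1)[OF fam W' hp2] qM C by simp
  have cq: "composable L (cmap F (qc \<phi>)) [?i]"
    by (rule tgt.composable_1[OF qq ii]) (use qM C oA in auto)
  have qW: "is_cell L (vcomp L (QL.mc (omap F ?C) (map (vmap F) ks)) (vmap F f)) (map (\<lambda>j. QL.ch
    (vmap F j)) js) [] (vmap F g)
      (hcomp L (cmap F (qc \<phi>)) (counits L \<epsilon>' (vmap F g) (map (vmap F) js)))"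
    using tgt.is_cell_hcomp[OF qq W'] by simp
  have hp3: "hpath L (vdom L (vcomp L (QL.mc (omap F ?C) (map (vmap F) ks)) (vmap F f))) (map (\<lambda>j.
    hmap F (QK.ch j)) js) (vdom L (vmap F g))"
    using HJ qM C by simp
  have cqW: "composable L (hcomp L (cmap F (qc \<phi>)) (counits L \<epsilon>' (vmap F g) (map (vmap F) js))) (?i
    # map comparison js)"
    using tgt.composable_vidc_family(1)[OF fam qW hp3] qM C by simp
  have "ccomp L ?E [ccomp L X (?i # map comparison js)]
    = ccomp L (ccomp L ?E [X]) (?i # map comparison js)"
    by (rule tgt.ccomp_assoc_1[OF tgt.composable_1[OF E' X] tJ(2)]) (use qM C in auto)
  also have "ccomp L ?E [X] = hcomp L (cmap F (qc \<phi>)) (counits L \<epsilon>' (vmap F g) (map (vmap F) js))"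
    using S'(2) by (simp add: X_def qc_qmap)
  also have "ccomp L (hcomp L (cmap F (qc \<phi>)) (counits L \<epsilon>' (vmap F g) (map (vmap F) js))) (?i # map
    comparison js) =
      ccomp L (hcomp L (cmap F (qc \<phi>)) (counits L \<epsilon>' (vmap F g) (map (vmap F) js))) ([?i] @ (?i #
        map comparison js))"
    using tgt.ccomp_vidc_Cons[OF cqW] oA by (simp add: tgt.vsrc_vidc)
  also have "\<dots> = hcomp L (ccomp L (cmap F (qc \<phi>)) [?i]) (ccomp L (counits L \<epsilon>' (vmap F g) (map (vmap
    F) js)) (?i # map comparison js))"
    by (rule tgt.hcomp_ccomp[OF qq W' cq cW]) (use oA in \<open>simp add: tgt.vsrc_vidc tgt.vtgt_vidc\<close>)
  also have "ccomp L (cmap F (qc \<phi>)) [?i] = cmap F (qc \<phi>)"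
    using tgt.is_cell_ccomp_vidc[OF qq] qM C by simp
  also have "ccomp L (counits L \<epsilon>' (vmap F g) (map (vmap F) js)) (?i # map comparison js)
    = cmap F (counits K \<epsilon> g js)"
    by (rule counits_comparison[OF C(3) C(6) C(2) refl])
  also have "hcomp L (cmap F (qc \<phi>)) (cmap F (counits K \<epsilon> g js))
    = cmap F (ccomp K (counits K \<epsilon> (vid K ?D) ks) [QK.star \<phi>])"
    using cmap_hcomp[OF C(8) kW] S(2) by simp
  also have "\<dots> = ccomp L (cmap F (counits K \<epsilon> (vid K ?D) ks)) [cmap F (QK.star \<phi>)]"
  proof -
    have "composable K (counits K \<epsilon> (vid K ?D) ks) [QK.star \<phi>]"
      by (rule src.composable_1[OF kE S(1)]) (use M in auto)
    then show ?thesis using cmap_ccomp by simp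
  qed
  also have "\<dots> = ccomp L (ccomp L ?E [tK]) [cmap F (QK.star \<phi>)]" using Kc by simp
  also have "\<dots> = ccomp L ?E [ccomp L tK [cmap F (QK.star \<phi>)]]"
    by (rule tgt.ccomp_assoc_11[OF E' tK FS, symmetric]) (use qM C obs in auto)
  finally have eq: "ccomp L ?E [ccomp L X (?i # map comparison js)]
    = ccomp L ?E [ccomp L tK [cmap F (QK.star \<phi>)]]" .
  have "is_cell L (vcomp L (QL.mc (omap F ?C) (map (vmap F) ks)) (vmap F f)) (map (\<lambda>j. hmap F (QK.ch
    j)) js) [] (vmap F g)
      (ccomp L ?E [ccomp L X (?i # map comparison js)])"
    using tgt.is_cell_ccomp_1[OF E' tJ(3)] qM C by simp
  \<comment> \<open>Both cells factor the same nullary cell through the counits of the target, hence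
    they agree.\<close>
  from QL.counits_factor[OF qC(5) qC(4) qC(7) qC(1) refl this[folded map_simps(2)[OF C(1)]]]
  have "ccomp L X (?i # map comparison js) = ccomp L tK [cmap F (QK.star \<phi>)]"
    using tJ(3) rhs eq by (auto simp: comp_def)
  then have "ccomp L X tJ = ccomp L tK [cmap F (QK.star \<phi>)]" using tJ(1) by simp
  then show "ccomp (Rep L) (cmap (avfun_comp (lower_star L \<epsilon>') (QV_fun F)) \<phi>) (tpath
    comparison_trans (vdom (QV_lower K) f) js) =
     ccomp (Rep L) (hd (tpath comparison_trans (vcod (QV_lower K) f) ks)) [cmap (avfun_comp (Rep_fun
       F) (lower_star K \<epsilon>)) \<phi>]"
    using is_cellD(1)[OF p] is_cellD(1)[OF q] tp[OF C(6) obs(1)] is_cellD(1)[OF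
      QK.is_cell_star_Rep[OF p]]
    by (simp add: X_def tJ_def tK_def)
qed (auto simp: comparison_trans_def)

lemma invertible_comparison:
  "invertible_two AugVirtDblCat (avfun_comp (Rep_fun F) (lower_star K \<epsilon>)) (avfun_comp (lower_star L
    \<epsilon>') (QV_fun F)) comparison_trans"
proof -
  obtain v where v: "\<And>j. has_companion K j
    \<Longrightarrow> is_cell L (vid L (vdom L (vmap F j))) [QL.ch (vmap F j)] [hmap F (QK.ch j)] (vid L (vcod L
    (vmap F j))) (v j) \<and>
      ccomp L (v j) [comparison j] = hidc L (hmap F (QK.ch j)) \<and> ccomp L (comparison j) [v j]
        = hidc L (QL.ch (vmap F j))"
    using comparison(3) by metis
  show ?thesis
  proof (rule invertible_if_horizontal[OF is_trans_comparison, where v = v])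
    fix j assume "j \<in> Hor (QV_lower K)"
    then have j: "j \<in> Ver K" "has_companion K j" by auto
    then show "is_cell (Rep L) (vid (Rep L) (omap (avfun_comp (Rep_fun F) (lower_star K \<epsilon>)) (hdom
      (QV_lower K) j))) [hmap (avfun_comp (lower_star L \<epsilon>') (QV_fun F)) j]
          [hmap (avfun_comp (Rep_fun F) (lower_star K \<epsilon>)) j] (vid (Rep L) (omap (avfun_comp (Rep_fun
            F) (lower_star K \<epsilon>)) (hcod (QV_lower K) j))) (v j) \<and>
      ccomp (Rep L) (v j) [thor comparison_trans j]
        = hidc (Rep L) (hmap (avfun_comp (Rep_fun F) (lower_star K \<epsilon>)) j) \<and>
      ccomp (Rep L) (thor comparison_trans j) [v j]
        = hidc (Rep L) (hmap (avfun_comp (lower_star L \<epsilon>') (QV_fun F)) j)"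
      using v[OF j(2)] QK.counit_cell[OF j(2)] QK.chosen_representable[OF j(2)] has_companion_map[OF
        j(2)]
        QL.chosen_representable[OF has_companion_map[OF j(2)]] representable_map
      by (simp add: comparison_trans_def is_cell_Rep)
  qed (auto simp: comparison_trans_def)
qed

end

text \<open>Tested against the counit at G j, both sides become the G-image of the counit at j
  composed with the component of \<xi>: one by the equation for the comparison cell of G, the other
  by that for F and naturality of \<xi> at the counit.\<close>

lemma (in quintet_trans) comparison_natural:
  assumes h: "has_companion K j"
  shows "ccomp L (QG.comparison j) [thor \<xi> (QK.ch j)] = ccomp L (QL.star (sq j)) [QF.comparison j]"
proof -
  note jj = QK.counit_cell[OF h]
  have j: "j \<in> Ver K" using jj by simp
  have hG: "has_companion L (vmap G j)" and hF: "has_companion L (vmap F j)"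
    using h F.has_companion_map G.has_companion_map by auto
  let ?a = "tob \<xi> (vdom K j)" and ?b = "tob \<xi> (vcod K j)"
  note s = QG.comparison[OF h] and s' = QF.comparison[OF h]
  have x: "is_cell L ?a [hmap F (QK.ch j)] [hmap G (QK.ch j)] ?b (thor \<xi> (QK.ch j))"
    using is_cell_thor[OF jj(3)] jj by simp
  note c = is_cell_sq[OF h]
  note t = QL.star_cell[OF c]
  note eG = QL.counit_cell[OF hG] and eF = QL.counit_cell[OF hF]
  have 1: "is_cell L ?a [hmap F (QK.ch j)] [QL.ch (vmap G j)] ?b (ccomp L (QG.comparison j) [thor \<xi>
    (QK.ch j)])"
    using F.tgt.is_cell_ccomp_1[OF s(1) x] j by simp
  have 2: "is_cell L ?a [hmap F (QK.ch j)] [QL.ch (vmap G j)] ?b (ccomp L (QL.star (sq j))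
    [QF.comparison j])"
    using F.tgt.is_cell_ccomp_1[OF t(1), of "vid L (vdom L (vmap F j))" "[hmap F (QK.ch j)]"
      "vid L (vcod L (vmap F j))" "QF.comparison j"] s'(1) j
    by simp
  have w: "is_cell L (vcomp L ?b (vmap F j)) [QL.ch (vmap F j)] [] ?b (whisk L ?b (\<epsilon>' (vmap F j)))"
    using QL.is_cell_whisk_counit[OF hF] j by simp
  \<comment> \<open>The 2-cell of a commuting square is an identity, so the image of the square is
    determined by a whiskered counit alone.\<close>
  have "ccomp L (\<epsilon>' (vmap G j)) [QL.star (sq j)]
    = hcomp L (vidc L (vcomp L ?b (vmap F j))) (counits L \<epsilon>' ?b [vmap F j])"
    using t(2) QG.counits_single_vid[OF hG] j by (simp add: square_def del: counits.simps)
  also have "\<dots> = whisk L ?b (\<epsilon>' (vmap F j))"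
    using QL.counits_single[OF hF, of ?b] j F.tgt.hcomp_vidc_left[OF w] by (simp del: counits.simps)
  finally have st: "ccomp L (\<epsilon>' (vmap G j)) [QL.star (sq j)] = whisk L ?b (\<epsilon>' (vmap F j))" .
  have "ccomp L (\<epsilon>' (vmap G j)) [ccomp L (QL.star (sq j)) [QF.comparison j]] =
      ccomp L (whisk L ?b (\<epsilon>' (vmap F j))) [QF.comparison j]"
    unfolding st[symmetric] by (rule F.tgt.ccomp_assoc_11[OF eG(1) _ s'(1)]) (use t(1) j in auto)
  also have "\<dots> = whisk L ?b (ccomp L (\<epsilon>' (vmap F j)) [QF.comparison j])"
    by (rule F.tgt.whisk_ccomp[symmetric, OF eF(1)])
      (use j in \<open>auto intro!: F.tgt.composable_1[OF eF(1) s'(1)]\<close>)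
  also have "\<dots> = whisk L ?b (cmap F (\<epsilon> j))" using s'(2) by simp
  also have "\<dots> = ccomp L (cmap G (\<epsilon> j)) [thor \<xi> (QK.ch j)]"
    using natural[OF jj(1)] j by (simp add: tpath_def whisk_def fdom_fcod)
  also have "\<dots> = ccomp L (ccomp L (\<epsilon>' (vmap G j)) [QG.comparison j]) [thor \<xi> (QK.ch j)]"
    using s(2) by simp
  also have "\<dots> = ccomp L (\<epsilon>' (vmap G j)) [ccomp L (QG.comparison j) [thor \<xi> (QK.ch j)]]"
    by (rule F.tgt.ccomp_assoc_11[OF eG(1) s(1) x, symmetric]) (use j in auto)
  finally show ?thesis
    by (intro QG.comparison_unique[OF hG 1 2]) (use j in auto)
qed

section \<open>The pseudonatural transformation\<close>

definition lower_structure :: "('a univ avdc \<Rightarrow> 'a univ \<Rightarrow> 'a univ) \<Rightarrow> 'a univ avfun \<Rightarrow> 'a univ avtrans"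
  where
  "lower_structure \<epsilon> F = quintet_functor.comparison_trans (fdom F) (fcod F) F (\<epsilon> (fdom F)) (\<epsilon> (fcod
    F))"

text \<open>The unit and composition laws follow from uniqueness of comparison cells. For an
  identity functor the identity cell solves the defining equation, as the same companion is chosen
  on both sides; for a composite functor the pasted comparison cell solves it.\<close>

lemma pseudonatural_lower_star:
  fixes \<epsilon> :: "'a univ avdc \<Rightarrow> 'a univ \<Rightarrow> 'a univ"
  assumes ch: "\<And>K. aug_virt_dbl_cat K \<Longrightarrow> companion_choice K (\<epsilon> K)"
  shows "pseudonatural AugVirtDblCat AugVirtDblCat QV_lower_two_fun Rep_two_fun
     (\<lambda>K. lower_star K (\<epsilon> K)) (lower_structure \<epsilon>)"
proof -
  have qc: "quintet_companions K (\<epsilon> K)" if "aug_virt_dbl_cat K" for K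
    using that ch by (simp add: quintet_companions_def chosen_companions_def
      chosen_companions_axioms_def)
  have qf: "quintet_functor K L F (\<epsilon> K) (\<epsilon> L)" if "is_fun K L F" for K L F
    using qc is_fun_avdc[OF that] by (intro quintet_functor.intro is_fun_between[OF that]) auto
  have qt: "quintet_trans K L F G \<xi> (\<epsilon> K) (\<epsilon> L)" if "is_trans K L F G \<xi>" for K L F G \<xi>
    using qc is_fun_avdc is_trans_funs[OF that]
      by (intro quintet_trans.intro is_trans_between[OF that]) blast+
  show ?thesis
  proof (rule pseudonatural.intro[OF QV_lower_strict_two_functor Rep_strict_two_functor], rule
    pseudonatural_axioms.intro)
    fix K :: "'a univ avdc" assume "K \<in> Obj AugVirtDblCat"
    then interpret quintet_companions K "\<epsilon> K" by (intro qc) simp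
    show "mor AugVirtDblCat (T0 QV_lower_two_fun K) (T0 Rep_two_fun K) (lower_star K (\<epsilon> K))"
      using is_fun_lower_star by (simp add: mor_AVDC)
  next
    fix K L :: "'a univ avdc" and F assume "mor AugVirtDblCat K L F"
    then have F: "is_fun K L F" by (simp add: mor_AVDC)
    interpret quintet_functor K L F "\<epsilon> K" "\<epsilon> L" using qf[OF F] .
    show "invertible_two AugVirtDblCat (mcomp AugVirtDblCat (T1 Rep_two_fun F) (lower_star K (\<epsilon> K)))
       (mcomp AugVirtDblCat (lower_star L (\<epsilon> L)) (T1 QV_lower_two_fun F)) (lower_structure \<epsilon> F)"
      using invertible_comparison by (simp add: lower_structure_def)
  next
    fix K L :: "'a univ avdc" and F G \<xi>
    assume "mor AugVirtDblCat K L F" "mor AugVirtDblCat K L G" "two AugVirtDblCat F G \<xi>"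
    then have F: "is_fun K L F" and G: "is_fun K L G" and x: "is_trans K L F G \<xi>"
      by (auto simp: mor_AVDC two_AVDC is_fun_def)
    interpret quintet_trans K L F G \<xi> "\<epsilon> K" "\<epsilon> L" using qt[OF x] .
    let ?p = "lower_star K (\<epsilon> K)" and ?p' = "lower_star L (\<epsilon> L)"
    note t1 = is_trans_vert[OF is_trans_horz[OF is_trans_id[OF QK.is_fun_lower_star] is_trans_Rep[OF
      x]] QG.is_trans_comparison]
    note t2 = is_trans_vert[OF QF.is_trans_comparison is_trans_horz[OF is_trans_QV is_trans_id[OF
      QL.is_fun_lower_star]]]
    interpret RF: functor_between "Rep K" "Rep L" "Rep_fun F" using is_fun_Rep[OF F] by
      (rule is_fun_between)
    interpret QT: trans_between "QV_lower K" "QV_lower L" "QV_fun F" "QV_fun G" "QV_trans \<xi>"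
      using is_trans_QV by (rule is_trans_between)
    have "avtrans_vert QG.comparison_trans (avtrans_horz (Rep_trans \<xi>) (avtrans_id ?p)) =
        avtrans_vert (avtrans_horz (avtrans_id ?p') (QV_trans \<xi>)) QF.comparison_trans"
      using t1 t2
    proof (rule is_trans_eqI)
      fix A assume "A \<in> Ob (QV_lower K)"
      then have A: "A \<in> Ob K" by simp
      show "tob (avtrans_vert QG.comparison_trans (avtrans_horz (Rep_trans \<xi>) (avtrans_id ?p))) A =
        tob (avtrans_vert (avtrans_horz (avtrans_id ?p') (QV_trans \<xi>)) QF.comparison_trans) A"
        using A by (simp add: QG.comparison_trans_def QF.comparison_trans_def avtrans_id_def)
    next
      fix j assume jj: "j \<in> Hor (QV_lower K)"
      then have h: "has_companion K j" and j: "j \<in> Ver K" by auto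
      note jc = QK.counit_cell[OF h]
      have r: "QK.ch j \<in> Hor (Rep K)" using jc QK.chosen_representable[OF h] by simp
      have hi: "hidc K (QK.ch j) \<in> Cell (Rep K)"
        using F.src.Rep_avdc r aug_virt_dbl_cat.hidc_in[of "Rep K" "QK.ch j"] by simp
      have xx: "ccomp L (thor \<xi> (QK.ch j)) [hidc L (hmap F (QK.ch j))] = thor \<xi> (QK.ch j)"
        using F.tgt.is_cell_ccomp_hidc[OF is_cell_thor[OF jc(3)]] .
      have hG: "has_companion L (vmap G j)" "vmap G j \<in> Ver L" using G.has_companion_map[OF h] j
        by auto
      have sc: "sq j \<in> Cell (QV_lower L)" using is_cell_sq[OF h] by (simp add: is_cell_def)
      have st: "ccomp L (hidc L (QL.ch (vmap G j))) [QL.star (sq j)] = QL.star (sq j)"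
        using QL.star_cell(1)[OF is_cell_sq[OF h]] F.tgt.hidc_is_cell_ccomp by simp
      show "thor (avtrans_vert QG.comparison_trans (avtrans_horz (Rep_trans \<xi>) (avtrans_id ?p))) j =
        thor (avtrans_vert (avtrans_horz (avtrans_id ?p') (QV_trans \<xi>)) QF.comparison_trans) j"
        using j h r hi jc xx hG sc st comparison_natural[OF h]
        by (simp add: QG.comparison_trans_def QF.comparison_trans_def avtrans_id_def)
    qed
    then show "vert AugVirtDblCat (lower_structure \<epsilon> G) (horz AugVirtDblCat (T2 Rep_two_fun \<xi>) (cid
      AugVirtDblCat ?p)) =
        vert AugVirtDblCat (horz AugVirtDblCat (cid AugVirtDblCat ?p') (T2 QV_lower_two_fun \<xi>))
          (lower_structure \<epsilon> F)"
      by (simp add: lower_structure_def)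
  next
    fix K :: "'a univ avdc" assume "K \<in> Obj AugVirtDblCat"
    then have K: "aug_virt_dbl_cat K" by simp
    interpret quintet_functor K K "avfun_id K" "\<epsilon> K" "\<epsilon> K" using qf[OF is_fun_id[OF K]] .
    let ?p = "lower_star K (\<epsilon> K)"
    have "Rep_fun (avfun_id K) = avfun_id (Rep K)" "QV_fun (avfun_id K) = avfun_id (QV_lower K)"
      using strict_two_functor.T1_mid[OF Rep_strict_two_functor, of K]
        strict_two_functor.T1_mid[OF QV_lower_strict_two_functor, of K] K by auto
    then have e: "avfun_comp (Rep_fun (avfun_id K)) ?p = ?p" "avfun_comp ?p (QV_fun (avfun_id K))
      = ?p"
      using avfun_comp_id[OF QK.is_fun_lower_star] by auto
    have "comparison_trans = avtrans_id ?p"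
      using is_trans_comparison[unfolded e] is_trans_id[OF QK.is_fun_lower_star]
    proof (rule is_trans_eqI)
      fix j assume "j \<in> Hor (QV_lower K)"
      then have h: "has_companion K j" and j: "j \<in> Ver K" by auto
      note jc = QK.counit_cell[OF h]
      have "comparison j = hidc K (QK.ch j)"
        by (rule comparison_eqI[OF h])
          (use jc j src.is_cell_hidc[OF jc(3)] src.is_cell_ccomp_hidc[OF jc(1)] is_cellD(1)[OF
            jc(1)] in auto)
      then show "thor comparison_trans j = thor (avtrans_id ?p) j"
        using h j by (simp add: comparison_trans_def avtrans_id_def)
    qed (auto simp: comparison_trans_def avtrans_id_def)
    then show "lower_structure \<epsilon> (mid AugVirtDblCat K) = cid AugVirtDblCat ?p"
      by (simp add: lower_structure_def)
  next
    fix K L M :: "'a univ avdc" and F G assume "mor AugVirtDblCat K L F" "mor AugVirtDblCat L M G"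
    then have F: "is_fun K L F" and G: "is_fun L M G" by (auto simp: mor_AVDC)
    note GF = is_fun_comp[OF F G]
    interpret F: quintet_functor K L F "\<epsilon> K" "\<epsilon> L" using qf[OF F] .
    interpret G: quintet_functor L M G "\<epsilon> L" "\<epsilon> M" using qf[OF G] .
    interpret GF: quintet_functor K M "avfun_comp G F" "\<epsilon> K" "\<epsilon> M" using qf[OF GF] .
    let ?l = "avtrans_horz G.comparison_trans (avtrans_id (QV_fun F))"
    let ?r = "avtrans_horz (avtrans_id (Rep_fun G)) F.comparison_trans"
    have a: "avfun_comp (Rep_fun G) (avfun_comp (lower_star L (\<epsilon> L)) (QV_fun F)) =
        avfun_comp (avfun_comp (Rep_fun G) (lower_star L (\<epsilon> L))) (QV_fun F)"
      "avfun_comp (Rep_fun (avfun_comp G F)) (lower_star K (\<epsilon> K))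
        = avfun_comp (Rep_fun G) (avfun_comp (Rep_fun F) (lower_star K (\<epsilon> K)))"
      "avfun_comp (lower_star M (\<epsilon> M)) (QV_fun (avfun_comp G F))
        = avfun_comp (avfun_comp (lower_star M (\<epsilon> M)) (QV_fun G)) (QV_fun F)"
      using avfun_comp_assoc[OF F.is_fun_QV F.QL.is_fun_lower_star is_fun_Rep[OF G]]
        avfun_comp_assoc[OF F.QK.is_fun_lower_star is_fun_Rep[OF F] is_fun_Rep[OF G]]
        avfun_comp_assoc[OF F.is_fun_QV G.is_fun_QV G.QL.is_fun_lower_star] Rep_fun_comp[OF F G]
          QV_fun_comp[OF F G] by auto
    have r: "is_trans (QV_lower K) (Rep M) (avfun_comp (Rep_fun G) (avfun_comp (Rep_fun F)
      (lower_star K (\<epsilon> K))))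
        (avfun_comp (avfun_comp (Rep_fun G) (lower_star L (\<epsilon> L))) (QV_fun F)) ?r"
      unfolding a(1)[symmetric] by (rule is_trans_horz[OF F.is_trans_comparison is_trans_id[OF
        is_fun_Rep[OF G]]])
    have l: "is_trans (QV_lower K) (Rep M) (avfun_comp (avfun_comp (Rep_fun G) (lower_star L (\<epsilon> L)))
      (QV_fun F))
        (avfun_comp (avfun_comp (lower_star M (\<epsilon> M)) (QV_fun G)) (QV_fun F)) ?l"
      by (rule is_trans_horz[OF is_trans_id[OF F.is_fun_QV] G.is_trans_comparison])
    have "GF.comparison_trans = avtrans_vert ?l ?r"
      using GF.is_trans_comparison[unfolded a] is_trans_vert[OF r l]
    proof (rule is_trans_eqI)
      fix A assume "A \<in> Ob (QV_lower K)"
      then show "tob GF.comparison_trans A = tob (avtrans_vert ?l ?r) A"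
        by (simp add: GF.comparison_trans_def F.comparison_trans_def G.comparison_trans_def
          avtrans_id_def)
    next
      fix j assume "j \<in> Hor (QV_lower K)"
      then have h: "has_companion K j" and j: "j \<in> Ver K" by auto
      note jc = F.QK.counit_cell[OF h]
      have hF: "has_companion L (vmap F j)" "vmap F j \<in> Ver L" using F.has_companion_map[OF h] j
        by auto
      note jF = F.QL.counit_cell[OF hF(1)]
      have hGF: "has_companion M (vmap G (vmap F j))" using G.has_companion_map[OF hF(1)] .
      note s = F.comparison[OF h] and s' = G.comparison[OF hF(1)]
      note eM = G.QL.counit_cell[OF hGF]
      have Gs: "is_cell M (vid M (vdom M (vmap G (vmap F j)))) [hmap G (hmap F (F.QK.ch j))] [hmap G
        (F.QL.ch (vmap F j))]
          (vid M (vcod M (vmap G (vmap F j)))) (cmap G (F.comparison j))"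
        using G.is_cell_cmap[OF s(1)] j by simp
      have c: "composable L (\<epsilon> L (vmap F j)) [F.comparison j]"
        by (rule F.tgt.composable_1[OF jF(1) s(1)]) (use j in simp)
      have cmp: "is_cell M (vid M (vdom M (vmap G (vmap F j)))) [hmap G (hmap F (F.QK.ch j))]
        [G.QL.ch (vmap G (vmap F j))]
          (vid M (vcod M (vmap G (vmap F j)))) (ccomp M (G.comparison (vmap F j)) [cmap G
            (F.comparison j)])"
        using G.tgt.is_cell_ccomp_1[OF s'(1) Gs] j by simp
      have "ccomp M (\<epsilon> M (vmap G (vmap F j))) [ccomp M (G.comparison (vmap F j)) [cmap G
        (F.comparison j)]] =
         ccomp M (ccomp M (\<epsilon> M (vmap G (vmap F j))) [G.comparison (vmap F j)]) [cmap G (F.comparison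
           j)]"
        by (rule G.tgt.ccomp_assoc_11[OF eM(1) s'(1) Gs]) (use j in auto)
      also have "\<dots> = cmap G (cmap F (\<epsilon> K j))" using s'(2) G.cmap_ccomp[OF c] s(2) by simp
      finally have "GF.comparison j = ccomp M (G.comparison (vmap F j)) [cmap G (F.comparison j)]"
        using cmp j jc is_cellD(1)[OF jc(1)] by (intro GF.comparison_eqI[OF h]) auto
      \<comment> \<open>The whiskerings in the composition law contribute identity cells, which this
        and the following equations remove.\<close>
      moreover have "ccomp M (hidc M (hmap G (F.QL.ch (vmap F j)))) [cmap G (F.comparison j)]
        = cmap G (F.comparison j)"
        using G.tgt.hidc_is_cell_ccomp[OF Gs] .
      moreover have "cmap (avfun_comp (Rep_fun G) (lower_star L (\<epsilon> L))) (hidc (QV_lower L) (vmap F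
        j)) = hidc M (hmap G (F.QL.ch (vmap F j)))"
      proof -
        interpret B: functor_between "QV_lower L" "Rep M"
          "avfun_comp (Rep_fun G) (lower_star L (\<epsilon> L))"
          using is_fun_comp[OF F.QL.is_fun_lower_star is_fun_Rep[OF G]] by (rule is_fun_between)
        show ?thesis using B.functr.cmap_hidc[of
          "vmap F j"] hF F.QL.chosen_representable[OF hF(1)] jF by simp
      qed
      moreover have "ccomp M (G.comparison (vmap F j)) [hidc M (hmap G (F.QL.ch (vmap F j)))]
        = G.comparison (vmap F j)"
        using G.tgt.is_cell_ccomp_hidc[OF s'(1)] .
      moreover have "F.comparison j \<in> Cell (Rep L)"
        using F.is_trans_comparison trans_between.thor_in[OF is_trans_between, OF
          F.is_trans_comparison, of j] j h
        by (simp add: F.comparison_trans_def)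
      ultimately show "thor GF.comparison_trans j = thor (avtrans_vert ?l ?r) j"
        using h j hF jF F.QL.chosen_representable[OF hF(1)] jc F.QK.chosen_representable[OF h]
        by (simp add: GF.comparison_trans_def F.comparison_trans_def G.comparison_trans_def
          avtrans_id_def del: avfun_comp_simps(4))
    qed
    then show "lower_structure \<epsilon> (mcomp AugVirtDblCat G F) =
       vert AugVirtDblCat (horz AugVirtDblCat (lower_structure \<epsilon> G) (cid AugVirtDblCat (T1
         QV_lower_two_fun F)))
         (horz AugVirtDblCat (cid AugVirtDblCat (T1 Rep_two_fun G)) (lower_structure \<epsilon> F))"
      by (simp add: lower_structure_def)
  qed
qed


section \<open>Horizontal duality\<close>

lemma co_simps [simp]:
  "Ob (co K) = Ob K" "Ver (co K) = Ver K" "vdom (co K) = vdom K" "vcod (co K) = vcod K"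
  "vid (co K) = vid K" "vcomp (co K) = vcomp K" "Hor (co K) = Hor K" "hdom (co K) = hcod K"
  "hcod (co K) = hdom K" "Cell (co K) = Cell K" "hsrc (co K) = (\<lambda>\<phi>. rev (hsrc K \<phi>))" "htgt (co K)
    = htgt K"
  "vsrc (co K) = vtgt K" "vtgt (co K) = vsrc K" "ccomp (co K) = (\<lambda>\<psi> \<phi>s. ccomp K \<psi> (rev \<phi>s))"
  "hidc (co K) = hidc K" "vidc (co K) = vidc K"
  by (simp_all add: co_def)

lemma co_co [simp]: "co (co K) = K"
  by (simp add: co_def)

lemma co_fun_simps [simp]:
  "fdom (co_fun F) = co (fdom F)" "fcod (co_fun F) = co (fcod F)" "omap (co_fun F) = omap F"
  "vmap (co_fun F) = vmap F" "hmap (co_fun F) = hmap F" "cmap (co_fun F) = cmap F"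
  by (simp_all add: co_fun_def)

lemma co_fun_co_fun [simp]: "co_fun (co_fun F) = F"
  by (simp add: co_fun_def)

lemma co_trans_simps [simp]:
  "tsrc (co_trans \<xi>) = co_fun (tsrc \<xi>)" "ttgt (co_trans \<xi>) = co_fun (ttgt \<xi>)"
  "tob (co_trans \<xi>) = tob \<xi>" "thor (co_trans \<xi>) = thor \<xi>"
  by (simp_all add: co_trans_def)

lemma co_trans_co_trans [simp]: "co_trans (co_trans \<xi>) = \<xi>"
  by (simp add: co_trans_def)

lemma co_fun_id: "co_fun (avfun_id K) = avfun_id (co K)"
  by (simp add: co_fun_def avfun_id_def)

lemma co_fun_comp: "co_fun (avfun_comp G F) = avfun_comp (co_fun G) (co_fun F)"
  by (simp add: co_fun_def avfun_comp_def)

lemma co_trans_id: "co_trans (avtrans_id F) = avtrans_id (co_fun F)"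
  by (simp add: co_trans_def avtrans_id_def)

lemma co_trans_vert: "co_trans (avtrans_vert \<zeta> \<xi>) = avtrans_vert (co_trans \<zeta>) (co_trans \<xi>)"
  by (simp add: co_trans_def avtrans_vert_def)

lemma co_trans_horz: "co_trans (avtrans_horz \<zeta> \<xi>) = avtrans_horz (co_trans \<zeta>) (co_trans \<xi>)"
  by (simp add: co_trans_def avtrans_horz_def co_fun_comp)

text \<open>A non-empty list determines both ends of a path, and for an empty one the ends coincide;
  so either end determines the other. Duality needs this because \<open>composable\<close> compares
  only the objects at which paths start.\<close>

lemma hpath_ends_iff: "hpath K A Js B \<Longrightarrow> hpath K A' Js B' \<Longrightarrow> A = A' \<longleftrightarrow> B = B'"
proof (induction Js arbitrary: A A')
  case (Cons J Js)
  then show ?case using Cons.IH[of "hcod K J" "hcod K J"] by auto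
qed simp

lemma rev_short: "length xs \<le> 1 \<Longrightarrow> rev xs = xs"
  by (cases xs) auto

context aug_virt_dbl_cat
begin

lemma hpath_co: "hpath (co K) A Js B \<longleftrightarrow> hpath K B (rev Js) A"
proof (induction Js arbitrary: A)
  case (Cons J Js)
  then show ?case by (auto simp: hpath_append dest: hcod_in hdom_in)
qed auto

lemma cpath_co: "cpath (co K) f \<phi>s g \<longleftrightarrow> cpath K g (rev \<phi>s) f"
proof (induction \<phi>s arbitrary: f)
  case (Cons \<phi> \<phi>s)
  then show ?case by (auto simp: cpath_append dest: vsrc_in vtgt_in)
qed auto

lemma cpath_hpath_htgt:
  "cpath K f \<phi>s g \<Longrightarrow> hpath K (vcod K f) (concat (map (htgt K) \<phi>s)) (vcod K g)"
  by (induction \<phi>s arbitrary: f) (auto simp: hpath_append htgt_path, blast intro: htgt_path)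

text \<open>Reversal exchanges the two ends of a path, so the condition at the starting objects has
  to be recovered from the one at the other end. Horizontal targets are left alone by
  \<open>co\<close>, since a list of length at most one is its own reversal.\<close>

lemma composable_co:
  assumes "composable (co K) \<psi> \<phi>s"
  shows "composable K \<psi> (rev \<phi>s)"
proof -
  note D = assms[unfolded composable_def]
  have ps: "\<psi> \<in> Cell K" and ne: "rev \<phi>s \<noteq> []" using D by auto
  have cp: "cpath K (vsrc K (last \<phi>s)) (rev \<phi>s) (vtgt K (hd \<phi>s))" using D by (simp add: cpath_co)
  have "hsrc K \<psi> = concat (map (htgt K) (rev \<phi>s))"
  proof -
    have m: "map (\<lambda>x. rev (htgt K x)) (rev \<phi>s) = map (htgt K) (rev \<phi>s)"
      using cpath_Cell[OF cp] htgt_length by (auto simp: rev_short)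
    have "rev (hsrc K \<psi>) = concat (map (htgt K) \<phi>s)" using D by simp
    then have "hsrc K \<psi> = rev (concat (map (htgt K) \<phi>s))" by (metis rev_rev_ident)
    also have "\<dots> = concat (map (\<lambda>x. rev (htgt K x)) (rev \<phi>s))" by
      (simp add: rev_concat rev_map comp_def)
    finally show ?thesis using m by simp
  qed
  moreover have "vdom K (vsrc K \<psi>) = vcod K (vsrc K (last \<phi>s))"
    using hpath_ends_iff[OF hsrc_path[OF ps] cpath_hpath_htgt[OF cp, folded calculation]] D by simp
  ultimately show ?thesis by (intro composableI[OF ps ne cp])
qed

lemma co_avdc: "aug_virt_dbl_cat (co K)"
proof
  fix \<phi> assume p: "\<phi> \<in> Cell (co K)"
  then show "hpath (co K) (vdom (co K) (vsrc (co K) \<phi>)) (hsrc (co K) \<phi>) (vdom (co K) (vtgt (co K)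
    \<phi>))"
    using hsrc_path by (simp add: hpath_co)
  have "rev (htgt K \<phi>) = htgt K \<phi>" using p htgt_length by (simp add: rev_short)
  then show "hpath (co K) (vcod (co K) (vsrc (co K) \<phi>)) (htgt (co K) \<phi>) (vcod (co K) (vtgt (co K)
    \<phi>))"
    using p htgt_path by (simp add: hpath_co)
  show "length (htgt (co K) \<phi>) \<le> 1" using p htgt_length by simp
next
  fix \<psi> \<phi>s assume c: "composable (co K) \<psi> \<phi>s"
  note c' = composable_co[OF c]
  have ne: "\<phi>s \<noteq> []" using c by (simp add: composable_def)
  show "ccomp (co K) \<psi> \<phi>s \<in> Cell (co K)"
    "hsrc (co K) (ccomp (co K) \<psi> \<phi>s) = concat (map (hsrc (co K)) \<phi>s)"
    "htgt (co K) (ccomp (co K) \<psi> \<phi>s) = htgt (co K) \<psi>"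
    "vsrc (co K) (ccomp (co K) \<psi> \<phi>s) = vcomp (co K) (vsrc (co K) \<psi>) (vsrc (co K) (hd \<phi>s))"
    "vtgt (co K) (ccomp (co K) \<psi> \<phi>s) = vcomp (co K) (vtgt (co K) \<psi>) (vtgt (co K) (last \<phi>s))"
    using ccomp_in[OF c'] hsrc_ccomp[OF c'] htgt_ccomp[OF c'] vsrc_ccomp[OF c'] vtgt_ccomp[OF c'] ne
    by (auto simp: rev_concat rev_map comp_def hd_rev last_rev)
next
  fix \<psi>s \<phi>ss \<chi>
  assume l: "list_all2 (composable (co K)) \<psi>s \<phi>ss"
    and c: "composable (co K) \<chi> (map2 (ccomp (co K)) \<psi>s \<phi>ss)" "composable (co K) \<chi> \<psi>s"
      "composable (co K) (ccomp (co K) \<chi> \<psi>s) (concat \<phi>ss)"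
  have len: "length \<psi>s = length \<phi>ss" using l by (rule list_all2_lengthD)
  have l': "list_all2 (composable K) (rev \<psi>s) (map rev (rev \<phi>ss))"
    using l by (simp add: list_all2_map2) (auto elim: list_all2_mono composable_co)
  have m: "rev (map2 (ccomp (co K)) \<psi>s \<phi>ss) = map2 (ccomp K) (rev \<psi>s) (map rev (rev \<phi>ss))"
    using len by (simp add: rev_map zip_rev zip_map2 comp_def split_def)
  have cc: "rev (concat \<phi>ss) = concat (map rev (rev \<phi>ss))" by (simp add: rev_concat rev_map)
  show "ccomp (co K) \<chi> (map2 (ccomp (co K)) \<psi>s \<phi>ss) = ccomp (co K) (ccomp (co K) \<chi> \<psi>s) (concat \<phi>ss)"
    using ccomp_assoc[OF l', of \<chi>] c[THEN composable_co] m cc by simp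
next
  fix \<phi> assume "\<phi> \<in> Cell (co K)" "htgt (co K) \<phi> = []"
  then have p: "\<phi> \<in> Cell K" "htgt K \<phi> = []" by auto
  then have "vcod K (vtgt K \<phi>) = vcod K (vsrc K \<phi>)" using nullary_vcod by (auto simp: is_cell_def)
  then show "ccomp (co K) (vidc (co K) (vid (co K) (vcod (co K) (vsrc (co K) \<phi>)))) [\<phi>] = \<phi>"
    using vidc_ccomp p by simp
next
  fix \<phi> assume "\<phi> \<in> Cell (co K)" "hsrc (co K) \<phi> = []"
  then have p: "\<phi> \<in> Cell K" "hsrc K \<phi> = []" by auto
  then have "vdom K (vtgt K \<phi>) = vdom K (vsrc K \<phi>)" using hsrc_Nil_vdom by (auto simp: is_cell_def)
  then show "ccomp (co K) \<phi> [vidc (co K) (vid (co K) (vdom (co K) (vsrc (co K) \<phi>)))] = \<phi>"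
    using ccomp_vidc p by simp
next
  fix \<phi> assume "\<phi> \<in> Cell (co K)" "hsrc (co K) \<phi> \<noteq> []"
  then show "ccomp (co K) \<phi> (map (hidc (co K)) (hsrc (co K) \<phi>)) = \<phi>"
    using ccomp_hidc by (simp add: rev_map)
next
  fix \<psi> \<phi>s \<chi>s f\<^sub>0 f f\<^sub>n
  assume c: "composable (co K) \<psi> (\<phi>s @ \<chi>s)" and p: "cpath (co K) f\<^sub>0 \<phi>s f" "cpath (co K) f \<chi>s f\<^sub>n"
  have "composable K \<psi> (rev \<chi>s @ rev \<phi>s)" using composable_co[OF c] by simp
  from ccomp_insert_vidc[OF this] p
  show "ccomp (co K) \<psi> (\<phi>s @ [vidc (co K) f] @ \<chi>s) = ccomp (co K) \<psi> (\<phi>s @ \<chi>s)"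
    by (simp add: cpath_co)
qed (auto simp: vsrc_in vtgt_in hdom_in hcod_in hidc_in hsrc_hidc htgt_hidc vsrc_hidc vtgt_hidc
    vidc_in hsrc_vidc htgt_vidc vsrc_vidc vtgt_vidc vidc_vidc hidc_ccomp vcomp_assoc)

text \<open>Reversing the arguments of \<odot> is reversing the composition of 2-cells. Only
  composable pairs have to be compared, and for these the identity cell in \<odot> is taken at the
  same object on both sides.\<close>

lemma V_co: "V (co K) = co2 (V K)"
proof -
  have "hcomp (co K) \<alpha> \<beta> = hcomp K \<beta> \<alpha>"
    if "is_cell K (vsrc K \<alpha>) [] [] (vtgt K \<alpha>) \<alpha>" "is_cell K (vsrc K \<beta>) [] [] (vtgt K \<beta>) \<beta>" "vsrc K \<alpha>
      = vtgt K \<beta>" for \<alpha> \<beta>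
  proof -
    have "vcod K (vtgt K \<alpha>) = vcod K (vsrc K \<beta>)"
      using nullary_vcod[OF that(1)] nullary_vcod[OF that(2)] that(3) by simp
    then show ?thesis using that by (simp add: hcomp_def path_id_def is_cell_def)
  qed
  then show ?thesis by (auto simp: V_def co2_def Let_def is_cell_def fun_eq_iff)
qed

end

lemma is_fun_co:
  assumes "is_fun K L F"
  shows "is_fun (co K) (co L) (co_fun F)"
proof -
  interpret functor_between K L F using assms by (rule is_fun_between)
  have "avdc_functor (co_fun F)"
  proof (rule avdc_functor.intro)
    fix \<psi> \<phi>s assume "composable (fdom (co_fun F)) \<psi> \<phi>s"
    then have "composable K \<psi> (rev \<phi>s)" using src.composable_co by simp
    then show "cmap (co_fun F) (ccomp (fdom (co_fun F)) \<psi> \<phi>s)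
      = ccomp (fcod (co_fun F)) (cmap (co_fun F) \<psi>) (map (cmap (co_fun F)) \<phi>s)"
      using cmap_ccomp by (simp add: rev_map)
  qed (use src.co_avdc tgt.co_avdc functr.omap_in functr.vmap_in functr.hmap_in functr.cmap_in
    in \<open>auto simp: rev_map\<close>)
  then show ?thesis by (simp add: is_fun_def)
qed

lemma is_trans_co:
  assumes "is_trans K L F G \<xi>"
  shows "is_trans (co K) (co L) (co_fun F) (co_fun G) (co_trans \<xi>)"
proof -
  interpret trans_between K L F G \<xi> using assms by (rule is_trans_between)
  show ?thesis
  proof (rule is_transI[OF is_fun_co[OF F.F] is_fun_co[OF G.F]])
    show "tob (co_trans \<xi>) \<in> extensional (Ob (co K))" "thor (co_trans \<xi>) \<in> extensional (Hor (co K))"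
      using avdc_transformation.tob_in[OF trans] avdc_transformation.thor_in[OF trans] by
        (auto simp: PiE_iff)
  next
    fix f Js Ks g \<phi> assume p: "is_cell (co K) f Js Ks g \<phi>"
    then have p': "is_cell K g (rev Js) Ks f \<phi>" by (auto simp: is_cell_def)
    note D = is_cellD[OF p']
    have l: "length Ks \<le> 1" using D F.src.htgt_length by blast
    have "vdom K f = vdom K g" if "Js = []" using F.src.hsrc_Nil_vdom[of g Ks f \<phi>] p' that by simp
    then have J: "rev (tpath (co_trans \<xi>) (vdom K f) Js) = tpath \<xi> (vdom K g) (rev Js)"
      by (auto simp: tpath_def rev_map)
    have "vcod K f = vcod K g" if "Ks = []" using F.src.nullary_vcod[of g "rev Js" f \<phi>] p' that
      by simp
    then have Kt: "tpath (co_trans \<xi>) (vcod K f) Ks = tpath \<xi> (vcod K g) Ks"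
      by (auto simp: tpath_def)
    show "ccomp (co L) (cmap (co_fun G) \<phi>) (tpath (co_trans \<xi>) (vdom (co K) f) Js) =
        ccomp (co L) (hd (tpath (co_trans \<xi>) (vcod (co K) f) Ks)) [cmap (co_fun F) \<phi>]"
      using natural[OF p'] J Kt by simp
  qed (use tob_natural is_cell_thor in \<open>auto simp: is_cell_def\<close>)
qed

lemma invertible_co:
  assumes "invertible_two AugVirtDblCat F G \<xi>"
  shows "invertible_two AugVirtDblCat (co_fun F) (co_fun G) (co_trans \<xi>)"
proof -
  obtain \<zeta> where t: "two AugVirtDblCat F G \<xi>" "two AugVirtDblCat G F \<zeta>" and e: "avtrans_vert \<zeta> \<xi>
    = avtrans_id F" "avtrans_vert \<xi> \<zeta> = avtrans_id G"
    using assms by (auto simp: invertible_two_def)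
  have "two AugVirtDblCat (co_fun F) (co_fun G) (co_trans \<xi>)"
    "two AugVirtDblCat (co_fun G) (co_fun F) (co_trans \<zeta>)"
    using t is_trans_co by (auto simp: two_AVDC)
  moreover have "avtrans_vert (co_trans \<zeta>) (co_trans \<xi>) = avtrans_id (co_fun F)"
    "avtrans_vert (co_trans \<xi>) (co_trans \<zeta>) = avtrans_id (co_fun G)"
    using e by (simp_all add: co_trans_vert[symmetric] co_trans_id)
  ultimately show ?thesis unfolding invertible_two_def by auto
qed

lemma equivalence_co:
  assumes "equivalence_in AugVirtDblCat K L F"
  shows "equivalence_in AugVirtDblCat (co K) (co L) (co_fun F)"
proof -
  obtain G \<eta> \<epsilon> where F: "is_fun K L F" and G: "is_fun L K G"
    and h: "invertible_two AugVirtDblCat (avfun_id K) (avfun_comp G F) \<eta>"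
    and e: "invertible_two AugVirtDblCat (avfun_comp F G) (avfun_id L) \<epsilon>"
    using assms by (auto simp: equivalence_in_def mor_AVDC)
  show ?thesis
    using is_fun_co[OF F] is_fun_co[OF G] invertible_co[OF h] invertible_co[OF e]
    unfolding equivalence_in_def mor_AVDC by (auto simp: co_fun_id co_fun_comp)
qed

section \<open>Conjugation of 2-functors and of pseudonatural transformations by co\<close>

lemma strict_two_functor_is_fun:
  assumes "strict_two_functor AugVirtDblCat AugVirtDblCat T" "is_fun K L F"
  shows "is_fun (T0 T K) (T0 T L) (T1 T F)"
  using strict_two_functor.T1_mor[OF assms(1)] assms(2) by (simp add: mor_AVDC)

lemma strict_two_functor_is_trans:
  assumes T: "strict_two_functor AugVirtDblCat AugVirtDblCat T" and t: "is_trans K L F G \<xi>"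
  shows "is_trans (T0 T K) (T0 T L) (T1 T F) (T1 T G) (T2 T \<xi>)"
proof -
  have F: "is_fun K L F" using is_trans_funs[OF t] by simp
  then have "two AugVirtDblCat F G \<xi>" using t by (simp add: two_AVDC is_fun_def)
  from strict_two_functor.T2_two[OF T this] show ?thesis
    using strict_two_functor_is_fun[OF T F] by (simp add: two_AVDC is_fun_def)
qed

text \<open>T' agrees with co \<circ> T \<circ> co on the carriers. Equality beyond them is not
  asked for, because the comparison of V with duals is made for augmented virtual double
  categories.\<close>

locale dual_two_fun =
  fixes T T' :: "('u avdc, 'u avfun, 'u avtrans, 'u avdc, 'u avfun, 'u avtrans) two_fun"
  assumes strict: "strict_two_functor AugVirtDblCat AugVirtDblCat T"
    and T': "Tdom T' = AugVirtDblCat" "Tcod T' = AugVirtDblCat"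
    and T0': "aug_virt_dbl_cat K \<Longrightarrow> T0 T' K = co (T0 T (co K))"
    and T1': "is_fun K L F \<Longrightarrow> T1 T' F = co_fun (T1 T (co_fun F))"
    and T2': "is_trans K L F G \<xi> \<Longrightarrow> T2 T' \<xi> = co_trans (T2 T (co_trans \<xi>))"
begin

sublocale T: strict_two_functor AugVirtDblCat AugVirtDblCat T by (rule strict)

lemma dual_strict: "strict_two_functor AugVirtDblCat AugVirtDblCat T'"
proof (rule strict_two_functor_AVDC[OF T'])
  fix K :: "'u avdc" assume K: "aug_virt_dbl_cat K"
  then have "aug_virt_dbl_cat (co K)" by (rule aug_virt_dbl_cat.co_avdc)
  then show "aug_virt_dbl_cat (T0 T' K)"
    using T.T0_in[of "co K"] aug_virt_dbl_cat.co_avdc[of "T0 T (co K)"] T0'[OF K] by simp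
  show "T1 T' (avfun_id K) = avfun_id (T0 T' K)"
    using T1'[OF is_fun_id[OF K]] T0'[OF K] T.T1_mid[of "co K"] \<open>aug_virt_dbl_cat (co K)\<close> by
      (simp add: co_fun_id)
next
  fix K L :: "'u avdc" and F assume F: "is_fun K L F"
  then show "is_fun (T0 T' K) (T0 T' L) (T1 T' F)"
    using T0' T1'[OF F] is_fun_avdc[OF F] is_fun_co[OF strict_two_functor_is_fun[OF strict
      is_fun_co[OF F]]] by simp
  show "T2 T' (avtrans_id F) = avtrans_id (T1 T' F)"
    using T2'[OF is_trans_id[OF F]] T1'[OF F] T.T2_cid[of "co_fun F"] is_fun_co[OF F] by
      (simp add: co_trans_id is_fun_def)
next
  fix K L :: "'u avdc" and F G \<xi> assume t: "is_trans K L F G \<xi>"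
  have F: "is_fun K L F" "is_fun K L G" using is_trans_funs[OF t] by auto
  show "is_trans (T0 T' K) (T0 T' L) (T1 T' F) (T1 T' G) (T2 T' \<xi>)"
    using T0' T1'[OF F(1)] T1'[OF F(2)] T2'[OF t] is_fun_avdc[OF F(1)]
      is_trans_co[OF strict_two_functor_is_trans[OF strict is_trans_co[OF t]]] by simp
next
  fix K L M :: "'u avdc" and F G assume F: "is_fun K L F" and G: "is_fun L M G"
  show "T1 T' (avfun_comp G F) = avfun_comp (T1 T' G) (T1 T' F)"
    using T1'[OF F] T1'[OF G] T1'[OF is_fun_comp[OF F G]] T.T1_mcomp[of "co K" "co L" "co_fun F"
      "co M" "co_fun G"]
      is_fun_co[OF F] is_fun_co[OF G] by (simp add: co_fun_comp mor_AVDC)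
next
  fix K L :: "'u avdc" and F G H \<xi> \<zeta> assume x: "is_trans K L F G \<xi>" and z: "is_trans K L G H \<zeta>"
  have "two AugVirtDblCat (co_fun F) (co_fun G) (co_trans \<xi>)"
    "two AugVirtDblCat (co_fun G) (co_fun H) (co_trans \<zeta>)"
    using is_trans_co[OF x] is_trans_co[OF z] by (auto simp: two_AVDC is_trans_def)
  from T.T2_vert[OF this] show "T2 T' (avtrans_vert \<zeta> \<xi>) = avtrans_vert (T2 T' \<zeta>) (T2 T' \<xi>)"
    using T2'[OF x] T2'[OF z] T2'[OF is_trans_vert[OF x z]] by (simp add: co_trans_vert)
next
  fix K L M :: "'u avdc" and F G S R \<xi> \<zeta> assume x: "is_trans K L F G \<xi>" and z: "is_trans L M S R \<zeta>"
  have "two AugVirtDblCat (co_fun F) (co_fun G) (co_trans \<xi>)"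
    "two AugVirtDblCat (co_fun S) (co_fun R) (co_trans \<zeta>)"
    "mcod AugVirtDblCat (co_fun F) = mdom AugVirtDblCat (co_fun S)"
    using is_trans_co[OF x] is_trans_co[OF z] by (auto simp: two_AVDC is_trans_def)
  from T.T2_horz[OF this] show "T2 T' (avtrans_horz \<zeta> \<xi>) = avtrans_horz (T2 T' \<zeta>) (T2 T' \<xi>)"
    using T2'[OF x] T2'[OF z] T2'[OF is_trans_horz[OF x z]] by (simp add: co_trans_horz)
qed

end

text \<open>Dualizing preserves the direction of transformations and both of their compositions, so
  each axiom is the dual of the corresponding one at co K and at the dual functors.\<close>

lemma pseudonatural_dual:
  assumes S: "dual_two_fun S S'" and T: "dual_two_fun T T'"
    and P: "pseudonatural AugVirtDblCat AugVirtDblCat S T p \<sigma>"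
  shows "pseudonatural AugVirtDblCat AugVirtDblCat S' T' (\<lambda>K. co_fun (p (co K))) (\<lambda>F. co_trans (\<sigma>
    (co_fun F)))"
proof -
  interpret S: dual_two_fun S S' by fact
  interpret T: dual_two_fun T T' by fact
  interpret P: pseudonatural AugVirtDblCat AugVirtDblCat S T p \<sigma> by fact
  show ?thesis
  proof (rule pseudonatural.intro[OF S.dual_strict T.dual_strict], rule pseudonatural_axioms.intro)
    fix K :: "'a avdc" assume "K \<in> Obj AugVirtDblCat"
    then have K: "aug_virt_dbl_cat K" "aug_virt_dbl_cat (co K)" by
      (auto intro: aug_virt_dbl_cat.co_avdc)
    show "mor AugVirtDblCat (T0 S' K) (T0 T' K) (co_fun (p (co K)))"
      using P.component[of "co K"] K S.T0' T.T0' is_fun_co by (simp add: mor_AVDC)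
    show "co_trans (\<sigma> (co_fun (mid AugVirtDblCat K))) = cid AugVirtDblCat (co_fun (p (co K)))"
      using P.unit[of "co K"] K by (simp add: co_fun_id co_trans_id)
  next
    fix K L :: "'a avdc" and F assume "mor AugVirtDblCat K L F"
    then have F: "is_fun K L F" "is_fun (co K) (co L) (co_fun F)" using is_fun_co by
      (auto simp: mor_AVDC)
    show "invertible_two AugVirtDblCat (mcomp AugVirtDblCat (T1 T' F) (co_fun (p (co K))))
        (mcomp AugVirtDblCat (co_fun (p (co L))) (T1 S' F)) (co_trans (\<sigma> (co_fun F)))"
      using invertible_co[OF P.structure_cell[of "co K" "co L"
        "co_fun F"]] F T.T1'[OF F(1)] S.T1'[OF F(1)]
      by (simp add: mor_AVDC co_fun_comp)
  next
    fix K L :: "'a avdc" and F G \<xi>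
    assume "mor AugVirtDblCat K L F" "mor AugVirtDblCat K L G" "two AugVirtDblCat F G \<xi>"
    then have F: "is_fun K L F" and G: "is_fun K L G" and x: "is_trans K L F G \<xi>"
      by (auto simp: mor_AVDC two_AVDC is_fun_def)
    have "two AugVirtDblCat (co_fun F) (co_fun G) (co_trans \<xi>)"
      using is_trans_co[OF x] by (auto simp: two_AVDC is_trans_def)
    from arg_cong[OF P.natural[OF _ _ this, of "co K" "co L"], of co_trans]
    show "vert AugVirtDblCat (co_trans (\<sigma> (co_fun G))) (horz AugVirtDblCat (T2 T' \<xi>) (cid
      AugVirtDblCat (co_fun (p (co K))))) =
      vert AugVirtDblCat (horz AugVirtDblCat (cid AugVirtDblCat (co_fun (p (co L)))) (T2 S' \<xi>))
        (co_trans (\<sigma> (co_fun F)))"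
      using is_fun_co[OF F] is_fun_co[OF G] T.T2'[OF x] S.T2'[OF x]
      by (simp add: mor_AVDC co_trans_vert co_trans_horz co_trans_id)
  next
    fix K L M :: "'a avdc" and F G assume "mor AugVirtDblCat K L F" "mor AugVirtDblCat L M G"
    then have F: "is_fun K L F" and G: "is_fun L M G" by (auto simp: mor_AVDC)
    show "co_trans (\<sigma> (co_fun (mcomp AugVirtDblCat G F))) =
       vert AugVirtDblCat (horz AugVirtDblCat (co_trans (\<sigma> (co_fun G))) (cid AugVirtDblCat (T1 S'
         F)))
         (horz AugVirtDblCat (cid AugVirtDblCat (T1 T' G)) (co_trans (\<sigma> (co_fun F))))"
      using P.composition[of "co K" "co L" "co_fun F" "co M"
        "co_fun G"] is_fun_co[OF F] is_fun_co[OF G]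
        S.T1'[OF F] T.T1'[OF G]
      by (simp add: mor_AVDC co_fun_comp co_trans_vert co_trans_horz co_trans_id)
  qed
qed

text \<open>Duality exchanges the roles of h and k and fixes the horizontal source of \<psi>, which
  has length at most one. The converse implication is the same one for co K, as co is an
  involution.\<close>

lemma cartesian_co:
  fixes K :: "'u avdc"
  shows "cartesian (co K) \<psi> \<longleftrightarrow> cartesian K \<psi>"
proof -
  have "cartesian (co K) \<psi>" if c: "cartesian K \<psi>" for K :: "'u avdc"
    unfolding cartesian_def
  proof (intro conjI ballI impI)
    show "\<psi> \<in> Cell (co K)" "length (hsrc (co K) \<psi>) \<le> 1" using c by (auto simp: cartesian_def)
    have r: "rev (hsrc K \<psi>) = hsrc K \<psi>" using c by (intro rev_short) (simp add: cartesian_def)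
    fix \<chi> h k assume a: "\<chi> \<in> Cell (co K)" "h \<in> Ver (co K)" "k \<in> Ver (co K)" and
      b: "vcod (co K) h = vdom (co K) (vsrc (co K) \<psi>) \<and> vcod (co K) k
        = vdom (co K) (vtgt (co K) \<psi>) \<and>
        htgt (co K) \<chi> = htgt (co K) \<psi> \<and> vsrc (co K) \<chi> = vcomp (co K) (vsrc (co K) \<psi>) h \<and>
        vtgt (co K) \<chi> = vcomp (co K) (vtgt (co K) \<psi>) k"
    have "\<exists>!\<phi>. \<phi> \<in> Cell K \<and> hsrc K \<phi> = hsrc K \<chi> \<and> htgt K \<phi> = hsrc K \<psi> \<and>
              vsrc K \<phi> = k \<and> vtgt K \<phi> = h \<and> \<chi> = ccomp K \<psi> [\<phi>]"
      using c[unfolded cartesian_def, THEN conjunct2, THEN conjunct2, rule_format, of \<chi> k h] a b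
        by simp
    then show "\<exists>!\<phi>. \<phi> \<in> Cell (co K) \<and> hsrc (co K) \<phi> = hsrc (co K) \<chi> \<and> htgt (co K) \<phi>
      = hsrc (co K) \<psi> \<and>
        vsrc (co K) \<phi> = h \<and> vtgt (co K) \<phi> = k \<and> \<chi> = ccomp (co K) \<psi> [\<phi>]"
      using r by (simp add: conj_ac)
  qed
  from this[of K] this[of "co K"] show ?thesis by auto
qed

section \<open>Companions and conjoints under duality\<close>

lemma companion_cell_co: "companion_cell (co K) j \<epsilon> \<longleftrightarrow> conjoint_cell K j \<epsilon>"
  by (auto simp: companion_cell_def conjoint_cell_def cartesian_co)

lemma has_companion_co: "has_companion (co K) = has_conjoint K"
  by (simp add: fun_eq_iff has_companion_def has_conjoint_def companion_cell_co)

lemma companion_choice_co: "companion_choice (co K) \<epsilon> \<longleftrightarrow> conjoint_choice K \<epsilon>"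
  by (simp add: companion_choice_def conjoint_choice_def has_companion_co companion_cell_co)

lemma representable_co: "representable (co K) = oprepresentable K"
  by (auto simp: fun_eq_iff representable_def oprepresentable_def companion_cell_co)

lemma full_sub_co: "full_sub (co K) P = co (full_sub K P)"
  by (simp add: full_sub_def co_def)

lemma opRep_eq: "opRep K = co (Rep (co K))"
  by (simp add: opRep_def Rep_def full_sub_co representable_co)

text \<open>Full sub-structures commute with co, V of the horizontal dual is V with 2-cells
  reversed, and the conjoints of K are the companions of co K.\<close>

lemma coQV_upper_eq: "aug_virt_dbl_cat K \<Longrightarrow> coQV_upper K = co (QV_lower (co K))"
  by (simp add: coQV_upper_def QV_lower_def coQ_def full_sub_co aug_virt_dbl_cat.V_co
    has_companion_co)

lemma co_fun_restrict: "co_fun (avfun_restrict K L F) = avfun_restrict (co K) (co L) (co_fun F)"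
  by (simp add: co_fun_def avfun_restrict_def)

lemma co_trans_restrict: "co_trans (avtrans_restrict F G \<xi>)
  = avtrans_restrict (co_fun F) (co_fun G) (co_trans \<xi>)"
  by (simp add: co_trans_def avtrans_restrict_def)

lemma V_fun_co: "is_fun K L F \<Longrightarrow> V_fun (co_fun F) = co2_fun (V_fun F)"
  using is_fun_avdc[of K L F] by (auto simp: V_fun_def co2_fun_def aug_virt_dbl_cat.V_co is_fun_def)

lemma V_nat_co: "is_trans K L F G \<xi> \<Longrightarrow> V_nat (co_trans \<xi>) = co2_nat (V_nat \<xi>)"
  using is_trans_funs[of K L F G \<xi>] V_fun_co[of K L] by
    (auto simp: V_nat_def co2_nat_def is_trans_def)

lemma dual_opRep: "dual_two_fun Rep_two_fun opRep_two_fun"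
proof (rule dual_two_fun.intro[OF Rep_strict_two_functor])
  show "T1 opRep_two_fun F = co_fun (T1 Rep_two_fun (co_fun F))" for F :: "'a avfun"
    by (simp add: opRep_two_fun_def sub_two_fun_def Let_def Rep_fun_def opRep_eq co_fun_restrict)
  then show "T2 opRep_two_fun \<xi> = co_trans (T2 Rep_two_fun (co_trans \<xi>))" for \<xi> :: "'a avtrans"
    by (simp add: opRep_two_fun_def sub_two_fun_def Let_def Rep_trans_def co_trans_restrict)
qed (auto simp: opRep_two_fun_def sub_two_fun_def Let_def opRep_eq)

lemma dual_coQV_upper: "dual_two_fun QV_lower_two_fun coQV_upper_two_fun"
proof (rule dual_two_fun.intro[OF QV_lower_strict_two_functor])
  show 1: "T1 coQV_upper_two_fun F = co_fun (T1 QV_lower_two_fun (co_fun F))" if F: "is_fun K L F"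
    for K L and F :: "'a univ avfun"
    using is_fun_avdc[OF F] F
    by (simp add: coQV_upper_two_fun_def sub_two_fun_def Let_def QV_fun_def coQV_upper_eq
      co_fun_restrict
        coQ_fun_def V_fun_co[OF F] is_fun_def)
  show "T2 coQV_upper_two_fun \<xi> = co_trans (T2 QV_lower_two_fun (co_trans \<xi>))" if t:
    "is_trans K L F G \<xi>"
    for K L F G and \<xi> :: "'a univ avtrans"
    using 1[of K L F] 1[of K L G] is_trans_funs[OF t] t
    by (simp add: coQV_upper_two_fun_def sub_two_fun_def Let_def QV_trans_def co_trans_restrict
        coQ_trans_def V_nat_co[OF t] is_trans_def)
qed (auto simp: coQV_upper_two_fun_def sub_two_fun_def Let_def coQV_upper_eq)

theorem theorem6p5:
  shows
    "(\<forall>(K :: 'a univ avdc) \<epsilon>. aug_virt_dbl_cat K \<and> companion_choice K \<epsilon> \<longrightarrow>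
        (\<forall>\<phi>\<in>Cell (QV_lower K). \<exists>!\<phi>'. is_lower_star_cell K \<epsilon> \<phi> \<phi>') \<and>
        equivalence_in AugVirtDblCat (QV_lower K) (Rep K) (lower_star K \<epsilon>)) \<and>
     (\<forall>\<epsilon> :: 'a univ avdc \<Rightarrow> 'a univ \<Rightarrow> 'a univ.
        (\<forall>K. aug_virt_dbl_cat K \<longrightarrow> companion_choice K (\<epsilon> K)) \<longrightarrow>
        (\<exists>\<sigma>. pseudonatural AugVirtDblCat AugVirtDblCat QV_lower_two_fun Rep_two_fun
               (\<lambda>K. lower_star K (\<epsilon> K)) \<sigma>)) \<and>
     (\<forall>(K :: 'a univ avdc) \<epsilon>. aug_virt_dbl_cat K \<and> conjoint_choice K \<epsilon> \<longrightarrow>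
        equivalence_in AugVirtDblCat (coQV_upper K) (opRep K) (upper_star K \<epsilon>)) \<and>
     (\<forall>\<epsilon> :: 'a univ avdc \<Rightarrow> 'a univ \<Rightarrow> 'a univ.
        (\<forall>K. aug_virt_dbl_cat K \<longrightarrow> conjoint_choice K (\<epsilon> K)) \<longrightarrow>
        (\<exists>\<sigma>. pseudonatural AugVirtDblCat AugVirtDblCat coQV_upper_two_fun opRep_two_fun
               (\<lambda>K. upper_star K (\<epsilon> K)) \<sigma>))"
proof (intro conjI allI impI)
  fix K :: "'a univ avdc" and \<epsilon> assume "aug_virt_dbl_cat K \<and> companion_choice K \<epsilon>"
  then interpret quintet_companions K \<epsilon>
    by (simp add: quintet_companions_def chosen_companions_def chosen_companions_axioms_def)
  show "\<forall>\<phi>\<in>Cell (QV_lower K). \<exists>!\<phi>'. is_lower_star_cell K \<epsilon> \<phi> \<phi>'"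
    using ex1_lower_star_cell[OF QV_cellI] by blast
  show "equivalence_in AugVirtDblCat (QV_lower K) (Rep K) (lower_star K \<epsilon>)"
    by (rule equivalence_lower_star)
next
  fix \<epsilon> :: "'a univ avdc \<Rightarrow> 'a univ \<Rightarrow> 'a univ"
  assume "\<forall>K. aug_virt_dbl_cat K \<longrightarrow> companion_choice K (\<epsilon> K)"
  then show "\<exists>\<sigma>. pseudonatural AugVirtDblCat AugVirtDblCat QV_lower_two_fun Rep_two_fun (\<lambda>K.
    lower_star K (\<epsilon> K)) \<sigma>"
    using pseudonatural_lower_star by blast
next
  fix K :: "'a univ avdc" and \<epsilon> assume a: "aug_virt_dbl_cat K \<and> conjoint_choice K \<epsilon>"
  \<comment> \<open>A choice of conjoints in K is a choice of companions in co K.\<close>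
  then interpret quintet_companions "co K" \<epsilon>
    by (simp add: quintet_companions_def chosen_companions_def chosen_companions_axioms_def
        companion_choice_co aug_virt_dbl_cat.co_avdc)
  show "equivalence_in AugVirtDblCat (coQV_upper K) (opRep K) (upper_star K \<epsilon>)"
    using equivalence_co[OF equivalence_lower_star] a by
      (simp add: coQV_upper_eq opRep_eq upper_star_def)
next
  fix \<epsilon> :: "'a univ avdc \<Rightarrow> 'a univ \<Rightarrow> 'a univ"
  assume a: "\<forall>K. aug_virt_dbl_cat K \<longrightarrow> conjoint_choice K (\<epsilon> K)"
  \<comment> \<open>\<open>pseudonatural_dual\<close> evaluates a family of functors at co K, so the
    choice is composed with co beforehand and the two applications of co cancel.\<close>
  have "companion_choice K (\<epsilon> (co K))" if "aug_virt_dbl_cat K" for K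
    using a aug_virt_dbl_cat.co_avdc[OF that] companion_choice_co[of "co K"] by simp
  then have "pseudonatural AugVirtDblCat AugVirtDblCat QV_lower_two_fun Rep_two_fun
      (\<lambda>K. lower_star K (\<epsilon> (co K))) (lower_structure (\<lambda>K. \<epsilon> (co K)))"
    by (rule pseudonatural_lower_star)
  from pseudonatural_dual[OF dual_coQV_upper dual_opRep this]
  show "\<exists>\<sigma>. pseudonatural AugVirtDblCat AugVirtDblCat coQV_upper_two_fun opRep_two_fun (\<lambda>K.
    upper_star K (\<epsilon> K)) \<sigma>"
    by (auto simp: upper_star_def)
qed

end
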